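(* Let $d\ge1$. For every $M>1$, $l>0$ and $\delta>0$ there exist $0<\alpha_1<1$, $\tau_1>0$ and $\bar\eta>0$ such that the following holds: whenever $0\le\alpha<\alpha_1$, $0<\tau<\tau_1$, $L>l$, $E\subset\mathbb R^d$ is a $[0,L)^d$-periodic set of locally finite perimeter and $z\in[0,L)^d$ are such that $\bar F_{\alpha,\tau}(E,Q_l(z))<M$, then $D_\eta(E,Q_l(z))\le\delta$ for every $0<\eta<\bar\eta$. Moreover, $\bar\eta$ can be chosen independently of $\delta$ (and $\alpha_1,\tau_1,\bar\eta$ are independent of $L$).
   Context: Notation. $|z|_1=\sum_i|z_i|$; $e_1,\dots,e_d$ is the canonical basis of $\mathbb R^d$. For $x\in\mathbb R^d$, $x_i$ denotes the component along $e_i$ (identified either with the vector $\langle x,e_i\rangle e_i$ or with the number $\langle x,e_i\rangle$), and $x_i^\perp=x-x_i$ (identified with a point of $\mathbb R^{d-1}$). $Q_l(z)$ is the cube of side $l$ centred at $z$ with faces orthogonal to the coordinate axes, and $Q_l^\perp(z_i^\perp)\subset\mathbb R^{d-1}$ is the $(d-1)$-dimensional cube of side $l$ centred at $z_i^\perp$. For $\alpha<1$ put $p(\alpha)=d+2-\alpha$, $\beta(\alpha)=1-\alpha$ and for $\tau>0$ $$K_{\alpha,\tau}(\zeta)=\frac{1}{(|\zeta|_1+\tau^{1/\beta(\alpha)})^{p(\alpha)}},\qquad \widehat K_{\alpha,\tau}(\zeta_i)=\int_{\mathbb R^{d-1}}K_{\alpha,\tau}(\zeta_i+\zeta_i^\perp)\,d\zeta_i^\perp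 .$$ For $E\subset\mathbb R^d$ of locally finite perimeter, the slice in direction $e_i$ is $E_{t_i^\perp}=\{s\in\mathbb R: se_i+t_i^\perp\in E\}$; for a.e. $t_i^\perp$ it is a set of locally finite perimeter in $\mathbb R$, and $\partial E_{t_i^\perp}$ is its (locally finite) reduced boundary. For $s\in\partial E_{t_i^\perp}$, $s^+=\inf\{t'\in\partial E_{t_i^\perp}:t'>s\}$ and $s^-=\sup\{t'\in\partial E_{t_i^\perp}:t'<s\}$. Define $$r_{i,\alpha,\tau}(E,t_i^\perp,s)=-1+\int_{\mathbb R}|\zeta_i|\widehat K_{\alpha,\tau}(\zeta_i)d\zeta_i-\int_{s^-}^s\int_0^{+\infty}|\chi_{E_{t_i^\perp}}(u+\rho)-\chi_{E_{t_i^\perp}}(u)|\widehat K_{\alpha,\tau}(\rho)d\rho\,du-\int_s^{s^+}\int_{-\infty}^0|\chi_{E_{t_i^\perp}}(u+\rho)-\chi_{E_{t_i^\perp}}(u)|\widehat K_{\alpha,\tau}(\rho)d\rho\,du,$$ $$f_E(t_i^\perp,t_i,\zeta_i^\perp,\zeta_i)=|\chi_E(t_i+t_i^\perp+\zeta_i)-\chi_E(t_i+t_i^\perp)|\,|\chi_E(t_i+t_i^\perp+\zeta_i^\perp)-\chi_E(t_i+t_i^\perp)|,$$ $$v_{i,\alpha,\tau}(E,t_i^\perp,s)=\frac1{2d}\int_{s^-}^{s^+}\int_{\mathbb R^d}f_E(t_i^\perp,u,\zeta_i^\perp,\zeta_i)K_{\alpha,\tau}(\zeta)\,d\zeta\,du,\qquad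 w_{i,\alpha,\tau}(E,t_i^\perp,t_i)=\frac1d\int_{\mathbb R^d}f_E(t_i^\perp,t_i,\zeta_i^\perp,\zeta_i)K_{\alpha,\tau}(\zeta)\,d\zeta,$$ and $$\bar F_{i,\alpha,\tau}(E,Q_l(z))=\frac1{l^d}\Big[\int_{Q_l^\perp(z_i^\perp)}\sum_{\substack{s\in\partial E_{t_i^\perp}\\ t_i^\perp+se_i\in Q_l(z)}}\big(v_{i,\alpha,\tau}(E,t_i^\perp,s)+r_{i,\alpha,\tau}(E,t_i^\perp,s)\big)dt_i^\perp+\int_{Q_l(z)}w_{i,\alpha,\tau}(E,t_i^\perp,t_i)\,dt\Big],$$ $$\bar F_{\alpha,\tau}(E,Q_l(z))=\sum_{i=1}^d\bar F_{i,\alpha,\tau}(E,Q_l(z)).$$ Distance from stripes. For $\eta>0$, $\mathcal A^i_\eta$ is the family of sets $F\subset\mathbb R^d$ which, up to null sets, are unions of stripes with boundaries orthogonal to $e_i$, i.e. $F=\{x:\langle x,e_i\rangle\in\bar F\}$ with $\bar F\subset\mathbb R$ of locally finite perimeter, and such that distinct connected components of the boundary of $F$ (hyperplanes) are at distance at least $\eta$ from each other. For a cube $Q$, $$D^i_\eta(E,Q)=\inf\Big\{\frac1{|Q|}\int_Q|\chi_E-\chi_F|:F\in\mathcal A^i_\eta\Big\},\qquad D_\eta(E,Q)=\inf_{1\le i\le d}D^i_\eta(E,Q).$$ *)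

theory Defs
  imports "HOL-Analysis.Analysis"
begin

text \<open>
  The distributional gradient of the characteristic function of E is a Radon measure, given by its
  polar decomposition: mu is its total variation and nu its density, of unit length mu-almost
  everywhere. The test functions phi are real-valued, continuously differentiable (with gradient g)
  and compactly supported. The type is an arbitrary Euclidean space, so that the notion applies
  both to subsets of the whole space and to one-dimensional slices.
\<close>

definition gauss_green ::
    "'a::euclidean_space set \<Rightarrow> 'a measure \<Rightarrow> ('a \<Rightarrow> 'a) \<Rightarrow> bool" where
  "gauss_green E \<mu> \<nu> \<longleftrightarrow>
     E \<in> sets lebesgue \<and>
     sets \<mu> = sets borel \<and>
     (\<forall>K. compact K \<longrightarrow> emeasure \<mu> K < \<infinity>) \<and>
     \<nu> \<in> borel_measurable borel \<and>
     (AE x in \<mu>. norm (\<nu> x) = 1) \<and>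
     (\<forall>(\<phi> :: 'a \<Rightarrow> real) g.
        (\<forall>x. GDERIV \<phi> x :> g x) \<and> continuous_on UNIV g \<and> compact (closure {x. \<phi> x \<noteq> 0}) \<longrightarrow>
        (LINT x:E|lebesgue. g x) = - (LINT x|\<mu>. \<phi> x *\<^sub>R \<nu> x))"

definition locally_finite_perimeter :: "'a::euclidean_space set \<Rightarrow> bool" where
  "locally_finite_perimeter E \<longleftrightarrow> (\<exists>\<mu> \<nu>. gauss_green E \<mu> \<nu>)"

text \<open>
  De Giorgi's reduced boundary. The measure mu is unique and nu is unique up to mu-null sets, so the
  existential quantifier over them involves no choice. The reduced boundary is empty if E does not
  have locally finite perimeter.
\<close>

definition reduced_boundary :: "'a::euclidean_space set \<Rightarrow> 'a set" where
  "reduced_boundary E =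
     {x. \<exists>\<mu> \<nu>. gauss_green E \<mu> \<nu> \<and>
           (\<forall>r>0. measure \<mu> (ball x r) > 0) \<and>
           (\<exists>n. norm n = 1 \<and>
              ((\<lambda>r. (LINT y:ball x r|\<mu>. \<nu> y) /\<^sub>R measure \<mu> (ball x r)) \<longlongrightarrow> n) (at_right 0))}"

text \<open>
  Points of the (d-1)-dimensional space orthogonal to the i-th axis are families of reals indexed by
  the axes other than i (for d = 1 there is exactly one such point, of mass one). The completion is
  taken because E is only Lebesgue measurable.
\<close>

definition perp_lebesgue :: "'n::finite \<Rightarrow> ('n \<Rightarrow> real) measure" where
  "perp_lebesgue i = completion (Pi\<^sub>M (UNIV - {i}) (\<lambda>_. lborel))"

definition glue :: "'n::finite \<Rightarrow> ('n \<Rightarrow> real) \<Rightarrow> real \<Rightarrow> real ^ 'n" where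
  "glue i t s = (\<chi> j. if j = i then s else t j)"

definition slice :: "'n::finite \<Rightarrow> (real ^ 'n) set \<Rightarrow> ('n \<Rightarrow> real) \<Rightarrow> real set" where
  "slice i E t = {s. glue i t s \<in> E}"

definition cube :: "(real ^ 'n::finite) \<Rightarrow> real \<Rightarrow> (real ^ 'n) set" where
  "cube z l = {x. \<forall>j. \<bar>x $ j - z $ j\<bar> \<le> l / 2}"

definition perp_cube :: "'n::finite \<Rightarrow> (real ^ 'n) \<Rightarrow> real \<Rightarrow> ('n \<Rightarrow> real) set" where
  "perp_cube i z l = {t \<in> space (perp_lebesgue i). \<forall>j. j \<noteq> i \<longrightarrow> \<bar>t j - z $ j\<bar> \<le> l / 2}"

definition cube_periodic :: "real \<Rightarrow> (real ^ 'n::finite) set \<Rightarrow> bool" where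
  "cube_periodic L E \<longleftrightarrow> (\<forall>x j. x + axis j L \<in> E \<longleftrightarrow> x \<in> E)"

text \<open>
  The neighbouring boundary points of s in a one-dimensional set S; the value is infinite if there is
  no boundary point on that side.
\<close>

definition next_boundary :: "real set \<Rightarrow> real \<Rightarrow> ereal" where
  "next_boundary S s = Inf (ereal ` {t \<in> reduced_boundary S. t > s})"

definition prev_boundary :: "real set \<Rightarrow> real \<Rightarrow> ereal" where
  "prev_boundary S s = Sup (ereal ` {t \<in> reduced_boundary S. t < s})"

definition kernel :: "real \<Rightarrow> real \<Rightarrow> real ^ 'n::finite \<Rightarrow> real" where
  "kernel \<alpha> \<tau> \<zeta> =
     1 / ((\<Sum>j\<in>UNIV. \<bar>\<zeta> $ j\<bar>) + \<tau> powr (1 / (1 - \<alpha>))) powr (real CARD('n) + 2 - \<alpha>)"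

definition kernel_hat :: "'n::finite \<Rightarrow> real \<Rightarrow> real \<Rightarrow> real \<Rightarrow> real" where
  "kernel_hat i \<alpha> \<tau> \<rho> = (LINT y|perp_lebesgue i. kernel \<alpha> \<tau> (glue i y \<rho>))"

definition r_term ::
    "'n::finite \<Rightarrow> real \<Rightarrow> real \<Rightarrow> (real ^ 'n) set \<Rightarrow> ('n \<Rightarrow> real) \<Rightarrow> real \<Rightarrow> real" where
  "r_term i \<alpha> \<tau> E t s =
     (let S = slice i E t in
      - 1 + (LINT \<rho>|lebesgue. \<bar>\<rho>\<bar> * kernel_hat i \<alpha> \<tau> \<rho>)
      - (LINT u:einterval (prev_boundary S s) (ereal s)|lebesgue.
           (LINT \<rho>:{0..}|lebesgue.
              \<bar>indicat_real S (u + \<rho>) - indicat_real S u\<bar> * kernel_hat i \<alpha> \<tau> \<rho>))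
      - (LINT u:einterval (ereal s) (next_boundary S s)|lebesgue.
           (LINT \<rho>:{..0}|lebesgue.
              \<bar>indicat_real S (u + \<rho>) - indicat_real S u\<bar> * kernel_hat i \<alpha> \<tau> \<rho>)))"

text \<open>
  The functions f and w depend on the base point only through its sum of components, so they are
  given the full point x instead of its two parts.
\<close>

definition f_cross ::
    "'n::finite \<Rightarrow> (real ^ 'n) set \<Rightarrow> real ^ 'n \<Rightarrow> real ^ 'n \<Rightarrow> real" where
  "f_cross i E x \<zeta> =
     \<bar>indicat_real E (x + axis i (\<zeta> $ i)) - indicat_real E x\<bar> *
     \<bar>indicat_real E (x + (\<zeta> - axis i (\<zeta> $ i))) - indicat_real E x\<bar>"

definition v_term ::
    "'n::finite \<Rightarrow> real \<Rightarrow> real \<Rightarrow> (real ^ 'n) set \<Rightarrow> ('n \<Rightarrow> real) \<Rightarrow> real \<Rightarrow> real" where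
  "v_term i \<alpha> \<tau> E t s =
     1 / (2 * real CARD('n)) *
     (LINT u:einterval (prev_boundary (slice i E t) s) (next_boundary (slice i E t) s)|lebesgue.
        (LINT \<zeta>|lebesgue. f_cross i E (glue i t u) \<zeta> * kernel \<alpha> \<tau> \<zeta>))"

definition w_term ::
    "'n::finite \<Rightarrow> real \<Rightarrow> real \<Rightarrow> (real ^ 'n) set \<Rightarrow> real ^ 'n \<Rightarrow> real" where
  "w_term i \<alpha> \<tau> E x =
     1 / real CARD('n) * (LINT \<zeta>|lebesgue. f_cross i E x \<zeta> * kernel \<alpha> \<tau> \<zeta>)"

definition Fbar_dir ::
    "'n::finite \<Rightarrow> real \<Rightarrow> real \<Rightarrow> (real ^ 'n) set \<Rightarrow> real ^ 'n \<Rightarrow> real \<Rightarrow> real" where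
  "Fbar_dir i \<alpha> \<tau> E z l =
     1 / l ^ CARD('n) *
     ((LINT t:perp_cube i z l|perp_lebesgue i.
         (\<Sum>s\<in>{s \<in> reduced_boundary (slice i E t). glue i t s \<in> cube z l}.
            v_term i \<alpha> \<tau> E t s + r_term i \<alpha> \<tau> E t s))
      + (LINT x:cube z l|lebesgue. w_term i \<alpha> \<tau> E x))"

definition Fbar :: "real \<Rightarrow> real \<Rightarrow> (real ^ 'n::finite) set \<Rightarrow> real ^ 'n \<Rightarrow> real \<Rightarrow> real" where
  "Fbar \<alpha> \<tau> E z l = (\<Sum>i\<in>UNIV. Fbar_dir i \<alpha> \<tau> E z l)"

text \<open>
  The boundary of a union of stripes is understood up to null sets, as is the union itself: it
  consists of the hyperplanes over the reduced boundary of the one-dimensional profile G.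
\<close>

definition stripes :: "'n::finite \<Rightarrow> real \<Rightarrow> (real ^ 'n) set set" where
  "stripes i \<eta> =
     {F. \<exists>G :: real set. locally_finite_perimeter G \<and>
           (AE x in lebesgue. x \<in> F \<longleftrightarrow> x $ i \<in> G) \<and>
           (\<forall>C \<in> components {x. x $ i \<in> reduced_boundary G}.
            \<forall>C' \<in> components {x. x $ i \<in> reduced_boundary G}.
              C \<noteq> C' \<longrightarrow> \<eta> \<le> setdist C C')}"

definition stripe_dist_dir ::
    "'n::finite \<Rightarrow> real \<Rightarrow> (real ^ 'n) set \<Rightarrow> (real ^ 'n) set \<Rightarrow> real" where
  "stripe_dist_dir i \<eta> E Q =
     (INF F\<in>stripes i \<eta>.
        1 / measure lebesgue Q * (LINT x:Q|lebesgue. \<bar>indicat_real E x - indicat_real F x\<bar>))"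

definition stripe_dist :: "real \<Rightarrow> (real ^ 'n::finite) set \<Rightarrow> (real ^ 'n) set \<Rightarrow> real" where
  "stripe_dist \<eta> E Q = (INF i. stripe_dist_dir i \<eta> E Q)"

end

theory Submission
  imports Defs
begin

text \<open>
  On almost every slice the measure-theoretic boundary is locally finite; this is obtained by testing
  the Gauss-Green formula with mollifiers, which bounds the variation of the mollified slices. On such
  a slice the term \<open>r\<close> is at least \<open>-1\<close> plus a negative power of the neighbouring gaps, so the energy
  of a slice is bounded below by a constant, and it is large as soon as two boundary points in the
  cube are close. Since all other contributions are bounded below, the bound on the energy controls
  the cross terms, that is, the integral of \<open>f\<^sub>E(x, \<zeta>) K(\<zeta>)\<close> over the cube, for each direction.

  Let \<open>m(x, \<zeta>)\<close> be the absolute second difference of the indicator of \<open>E\<close> over the rectangle with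
  corners \<open>x\<close>, \<open>x + \<zeta>\<^sub>i\<close>, \<open>x + \<zeta>\<^sub>i\<^sup>\<bottom>\<close>, \<open>x + \<zeta>\<close>. It is bounded by the sum of \<open>f\<^sub>E\<close> over the corners
  and it is subadditive under halving the rectangle. Hence, up to constants, every dyadic scale
  between \<open>\<tau> powr (1 / (1 - \<alpha>))\<close> and \<open>l\<close> contributes at least as much to the cross terms as the
  scale \<open>l\<close> does, and with \<open>N\<close> scales available the mean of \<open>m\<close> over the cube is \<open>O(1/N)\<close>. An indicator function whose
  second differences are this small in every direction is \<open>L\<^sup>1\<close>-close to a function of one coordinate
  \<open>x\<^sub>i\<close>. By pigeonhole there is a slice in direction \<open>e\<^sub>i\<close> of bounded energy that represents the
  whole set; extended by constants outside the cube, it defines the stripes.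
\<close>

section \<open>Slices and the Lebesgue measure\<close>

text \<open>The range of \<open>\<alpha>\<close> is dictated by scaling. Passing to rectangles
  smaller by \<open>2 ^ k\<close> costs \<open>2 ^ (k * (d + 2))\<close>, Jacobian times number of
  pieces, while the kernel returns only the exponent \<open>d + 2 - \<alpha>\<close>. The loss
  \<open>2 powr (k * \<alpha>)\<close> stays bounded over \<open>N\<close> scales only if
  \<open>\<alpha>\<close> is of order \<open>1 / N\<close>. One-dimensionality comes from
  integrality: a set whose second differences in direction \<open>e_i\<close> vanish has an
  indicator of the form \<open>f x_i + g x'\<close>, \<open>x'\<close> being the other coordinates,
  and with values 0 and 1 one of the two summands must be constant. The proof is a quantitative form
  of this. The parameter \<open>\<delta>\<close> enters only through \<open>N\<close>; the distance
  between boundary points is governed by the energy bound alone. The technical obstacle is that the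
  definitions use integrals over completed measures, which are 0 when the integrand is not
  integrable, and that \<open>E\<close> is merely Lebesgue measurable. A lower bound on slices
  therefore says something about the energy only after integrability in the slice is known. Hence
  the Borel copy \<open>B\<close> of \<open>E\<close>, and the rewriting of all slice quantities in
  terms that ignore null sets.\<close>

lemma (in complete_measure) borel_measurable_AE:
  assumes g: "g \<in> borel_measurable M" and ae: "AE x in M. g x = f x"
  shows "f \<in> borel_measurable M"
proof (rule measurableI)
  fix A :: "'b set" assume A: "A \<in> sets borel"
  show "f -` A \<inter> space M \<in> sets M"
    by (rule in_sets_AE[of "g -` A \<inter> space M"])
       (use ae measurable_sets[OF g A] in \<open>auto elim: eventually_mono\<close>)
qed simp

text \<open>Completeness makes every function that agrees almost everywhere with a measurable one
  measurable. Integrals over completed measures thus become Borel integrals, for which Fubini is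
  available, even if \<open>f\<close> involves a set that is only Lebesgue measurable.\<close>

lemma
  fixes f g :: "'a \<Rightarrow> real"
  assumes g: "g \<in> borel_measurable M" and ae: "AE x in M. f x = g x"
  shows integral_completion_AE: "integral\<^sup>L (completion M) f = integral\<^sup>L M g"
    and integrable_completion_AE: "integrable (completion M) f \<longleftrightarrow> integrable M g"
proof -
  have gm: "g \<in> borel_measurable (completion M)"
    using g by (rule measurable_completion)
  have "AE x in completion M. g x = f x"
    using AE_completion[OF ae] by auto
  then have f: "f \<in> borel_measurable (completion M)"
    by (rule completion.borel_measurable_AE[OF gm])
  show "integral\<^sup>L (completion M) f = integral\<^sup>L M g"
    using integral_cong_AE[OF f gm AE_completion[OF ae]] integral_completion[OF g] by simp
  show "integrable (completion M) f \<longleftrightarrow> integrable M g"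
    using integrable_cong_AE[OF f gm AE_completion[OF ae]] integrable_completion[OF g] by simp
qed

abbreviation perp_borel :: "'n::finite \<Rightarrow> ('n \<Rightarrow> real) measure" where
  "perp_borel i \<equiv> Pi\<^sub>M (UNIV - {i}) (\<lambda>_. lborel)"

lemma sigma_finite_perp_borel: "sigma_finite_measure (perp_borel (i::'n::finite))"
proof -
  interpret finite_product_sigma_finite "\<lambda>_::'n. lborel :: real measure" "UNIV - {i}"
    by standard auto
  show ?thesis by unfold_locales
qed

lemma pair_sigma_finite_perp: "pair_sigma_finite (perp_borel i) (lborel :: 'b::euclidean_space measure)"
  using sigma_finite_perp_borel sigma_finite_lborel by (rule pair_sigma_finite.intro)

lemma Basis_vec_eq: "(Basis :: (real^'n) set) = range (\<lambda>j. axis j 1)"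
  by (auto simp: Basis_vec_def)

lemma borel_measurable_vecI:
  fixes f :: "'a \<Rightarrow> real^'n"
  assumes "\<And>j. (\<lambda>x. f x $ j) \<in> borel_measurable M"
  shows "f \<in> borel_measurable M"
  by (subst borel_measurable_euclidean_space) (use assms in \<open>simp add: Basis_vec_eq inner_axis\<close>)

lemma measurable_glue[measurable]:
  "(\<lambda>p. glue i (fst p) (snd p)) \<in> perp_borel i \<Otimes>\<^sub>M lborel \<rightarrow>\<^sub>M borel"
proof (rule borel_measurable_vecI)
  fix j
  show "(\<lambda>p. glue i (fst p) (snd p) $ j) \<in> perp_borel i \<Otimes>\<^sub>M lborel \<rightarrow>\<^sub>M borel"
  proof (cases "j = i")
    case True
    then show ?thesis
      unfolding glue_def by simp
  next
    case False
    then have "j \<in> UNIV - {i}" by simp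
    then have [measurable]: "(\<lambda>t. t j) \<in> perp_borel i \<rightarrow>\<^sub>M lborel"
      by (rule measurable_component_singleton)
    have "(\<lambda>p. fst p j) \<in> perp_borel i \<Otimes>\<^sub>M lborel \<rightarrow>\<^sub>M borel"
      using measurable_compose[OF measurable_fst \<open>(\<lambda>t. t j) \<in> _\<close>] by simp
    with False show ?thesis by (simp add: glue_def)
  qed
qed

lemma box_vec_eq: "box l u = {x::real^'n. \<forall>j. l $ j < x $ j \<and> x $ j < u $ j}"
  by (auto simp: box_def Basis_vec_def inner_axis)

lemma cbox_vec_eq: "cbox l u = {x::real^'n. \<forall>j. l $ j \<le> x $ j \<and> x $ j \<le> u $ j}"
  by (auto simp: cbox_def Basis_vec_def inner_axis)

lemma prod_Basis_vec: "(\<Prod>b\<in>Basis. x \<bullet> b) = (\<Prod>j\<in>UNIV. (x::real^'n) $ j)"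
proof -
  have "inj (\<lambda>j. axis j 1 :: real^'n)"
    by (auto simp: inj_on_def axis_eq_axis)
  from prod.reindex[OF this, of "\<lambda>b. x \<bullet> b"] show ?thesis
    by (simp add: Basis_vec_eq inner_axis)
qed

text \<open>Lebesgue measure is determined by boxes, and the preimage of a box under gluing is a
  product of intervals. The slicing lemmas below rest on this identity.\<close>

lemma distr_glue: "distr (perp_borel i \<Otimes>\<^sub>M lborel) borel (\<lambda>p. glue i (fst p) (snd p)) = lborel"
proof (rule lborel_eqI[symmetric])
  fix l u :: "real^'a"
  assume le: "\<And>b. b \<in> Basis \<Longrightarrow> l \<bullet> b \<le> u \<bullet> b"
  have le: "l $ j \<le> u $ j" for j
    using le[of "axis j 1"] by (simp add: inner_axis)
  interpret finite_product_sigma_finite "\<lambda>_::'a. lborel :: real measure" "UNIV - {i}"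
    by standard auto
  have eq: "(\<lambda>p. glue i (fst p) (snd p)) -` box l u \<inter> space (perp_borel i \<Otimes>\<^sub>M lborel) =
      Pi\<^sub>E (UNIV - {i}) (\<lambda>j. {l $ j <..< u $ j}) \<times> {l $ i <..< u $ i}" (is "?L = ?R")
  proof (rule set_eqI, rule iffI)
    fix p assume p: "p \<in> ?L"
    then have *: "l $ j < glue i (fst p) (snd p) $ j \<and> glue i (fst p) (snd p) $ j < u $ j" for j
      by (simp add: box_vec_eq)
    have "fst p j \<in> {l $ j <..< u $ j}" if "j \<in> UNIV - {i}" for j
      using *[of j] that by (simp add: glue_def)
    moreover have "snd p \<in> {l $ i <..< u $ i}"
      using *[of i] by (simp add: glue_def)
    moreover have "fst p \<in> extensional (UNIV - {i})"
      using p by (simp add: space_pair_measure space_PiM PiE_iff mem_Times_iff)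
    ultimately show "p \<in> ?R"
      by (simp add: PiE_iff mem_Times_iff)
  next
    fix p assume p: "p \<in> ?R"
    then have "fst p \<in> extensional (UNIV - {i})"
      by (simp add: PiE_iff mem_Times_iff)
    moreover have "l $ j < glue i (fst p) (snd p) $ j \<and> glue i (fst p) (snd p) $ j < u $ j" for j
    proof (cases "j = i")
      case True
      then show ?thesis using p by (simp add: glue_def mem_Times_iff)
    next
      case False
      then show ?thesis using p by (simp add: glue_def mem_Times_iff PiE_iff)
    qed
    ultimately show "p \<in> ?L"
      by (simp add: box_vec_eq space_pair_measure space_PiM PiE_iff mem_Times_iff)
  qed
  have "emeasure (distr (perp_borel i \<Otimes>\<^sub>M lborel) borel (\<lambda>p. glue i (fst p) (snd p))) (box l u) =
      emeasure (perp_borel i \<Otimes>\<^sub>M lborel) ?R"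
    by (subst emeasure_distr) (simp_all add: eq[symmetric])
  also have "\<dots> = emeasure (perp_borel i) (Pi\<^sub>E (UNIV - {i}) (\<lambda>j. {l $ j <..< u $ j})) *
      emeasure lborel {l $ i <..< u $ i}"
    by (intro sigma_finite_measure.emeasure_pair_measure_Times sigma_finite_lborel sets_PiM_I_finite) auto
  also have "\<dots> = (\<Prod>j\<in>UNIV - {i}. ennreal (u $ j - l $ j)) * ennreal (u $ i - l $ i)"
    using le by (subst measure_times) simp_all
  also have "\<dots> = (\<Prod>j\<in>UNIV. ennreal (u $ j - l $ j))"
    by (subst prod.remove[of UNIV i]) (simp_all add: mult.commute)
  also have "\<dots> = ennreal (\<Prod>j\<in>UNIV. (u - l) $ j)"
    using le by (simp add: prod_ennreal)
  finally show "emeasure (distr (perp_borel i \<Otimes>\<^sub>M lborel) borel (\<lambda>p. glue i (fst p) (snd p))) (box l u) =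
      ennreal (\<Prod>b\<in>Basis. (u - l) \<bullet> b)"
    by (simp only: prod_Basis_vec)
qed simp

lemma nn_integral_glue:
  assumes [measurable]: "f \<in> borel_measurable borel"
  shows "(\<integral>\<^sup>+x. f x \<partial>lborel) = (\<integral>\<^sup>+t. \<integral>\<^sup>+s. f (glue i t s) \<partial>lborel \<partial>perp_borel i)"
proof -
  interpret lborel: sigma_finite_measure "lborel :: real measure" by (rule sigma_finite_lborel)
  have "(\<integral>\<^sup>+x. f x \<partial>lborel) = (\<integral>\<^sup>+p. f (glue i (fst p) (snd p)) \<partial>(perp_borel i \<Otimes>\<^sub>M lborel))"
    by (subst distr_glue[of i, symmetric], subst nn_integral_distr) auto
  also have "\<dots> = (\<integral>\<^sup>+t. \<integral>\<^sup>+s. f (glue i t s) \<partial>lborel \<partial>perp_borel i)"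
    by (subst lborel.nn_integral_fst[symmetric]) auto
  finally show ?thesis .
qed

lemma nn_integral_glue':
  assumes [measurable]: "f \<in> borel_measurable borel"
  shows "(\<integral>\<^sup>+x. f x \<partial>lborel) = (\<integral>\<^sup>+s. \<integral>\<^sup>+t. f (glue i t s) \<partial>perp_borel i \<partial>lborel)"
proof -
  interpret pair_sigma_finite "perp_borel i" "lborel :: real measure"
    by (rule pair_sigma_finite_perp)
  show ?thesis
    by (subst nn_integral_glue[of f i], simp, subst Fubini'[symmetric]) auto
qed

lemma AE_glue_pair:
  assumes "AE x in lborel. P x"
  shows "AE p in perp_borel i \<Otimes>\<^sub>M lborel. P (glue i (fst p) (snd p))"
proof -
  obtain N where N: "N \<in> null_sets lborel" "\<And>x. x \<notin> N \<Longrightarrow> P x"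
    using AE_E3[OF assms] by auto
  then have [measurable]: "N \<in> sets borel" by auto
  have "AE x in distr (perp_borel i \<Otimes>\<^sub>M lborel) borel (\<lambda>p. glue i (fst p) (snd p)). x \<notin> N"
    unfolding distr_glue using N(1) by (rule AE_not_in)
  then have "AE p in perp_borel i \<Otimes>\<^sub>M lborel. glue i (fst p) (snd p) \<notin> N"
    by (subst (asm) AE_distr_iff) auto
  then show ?thesis
    by (rule AE_mp) (use N(2) in auto)
qed

lemma AE_glue:
  assumes "AE x in lborel. P x"
  shows "AE t in perp_borel i. AE s in lborel. P (glue i t s)"
proof -
  interpret pair_sigma_finite "perp_borel i" "lborel :: real measure"
    by (rule pair_sigma_finite_perp)
  show ?thesis
    using AE_pair[OF AE_glue_pair[OF assms]] by simp
qed

section \<open>Sets of locally finite perimeter on the line\<close>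

text \<open>This is the support of the distributional derivative of the indicator. It does not
  change when the set is modified on a null set, so it may be computed from any Borel
  representative.\<close>

definition ess_boundary :: "real set \<Rightarrow> real set" where
  "ess_boundary S = {x. \<forall>a b. a < x \<and> x < b \<longrightarrow>
     \<not> (AE y in lborel. a < y \<and> y < b \<longrightarrow> y \<in> S) \<and> \<not> (AE y in lborel. a < y \<and> y < b \<longrightarrow> y \<notin> S)}"

text \<open>The one-sided trace of the indicator, as a truth value. Where the boundary is locally
  finite it is the constant value of the set on that side; in general its failure does not mean that
  the complement is full there.\<close>

definition left_full :: "real set \<Rightarrow> real \<Rightarrow> bool" where
  "left_full S x \<longleftrightarrow> (\<exists>a<x. AE y in lborel. a < y \<and> y < x \<longrightarrow> y \<in> S)"

definition right_full :: "real set \<Rightarrow> real \<Rightarrow> bool" where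
  "right_full S x \<longleftrightarrow> (\<exists>b>x. AE y in lborel. x < y \<and> y < b \<longrightarrow> y \<in> S)"

definition jump :: "real set \<Rightarrow> real \<Rightarrow> real" where
  "jump S x = of_bool (right_full S x) - of_bool (left_full S x)"

definition locally_finite_boundary :: "real set \<Rightarrow> bool" where
  "locally_finite_boundary S \<longleftrightarrow> (\<forall>a b. finite (ess_boundary S \<inter> {a<..<b}))"

lemma not_AE_interval:
  assumes "a < (b::real)" shows "\<not> (AE y in lborel. \<not> (a < y \<and> y < b))"
proof
  assume "AE y in lborel. \<not> (a < y \<and> y < b)"
  then have "emeasure lborel {a<..<b} = 0"
    by (subst (asm) AE_iff_measurable[where N="{a<..<b}"]) auto
  with assms show False by simp
qed

lemma AE_interval_contradiction:
  assumes "a < (b::real)" "AE y in lborel. a < y \<and> y < b \<longrightarrow> y \<in> S" "AE y in lborel. a < y \<and> y < b \<longrightarrow> y \<notin> S"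
  shows False
proof -
  have "AE y in lborel. \<not> (a < y \<and> y < b)"
    using assms(2,3) by eventually_elim auto
  with not_AE_interval[OF assms(1)] show False by simp
qed

lemma AE_interval_mono:
  assumes "AE y in lborel. a < y \<and> y < (b::real) \<longrightarrow> P y" "a \<le> a'" "b' \<le> b"
  shows "AE y in lborel. a' < y \<and> y < b' \<longrightarrow> P y"
  using assms(1) by eventually_elim (use assms(2,3) in auto)

text \<open>Near each point of the interval the set is null or of full measure. The alternative is
  locally constant, hence constant by connectedness: bisection leads from points to compact
  subintervals, a countable exhaustion from these to the open interval.\<close>

lemma AE_constant_off_ess_boundary:
  assumes disj: "ess_boundary S \<inter> {a<..<b} = {}"
  shows "(AE y in lborel. a < y \<and> y < b \<longrightarrow> y \<in> S) \<or> (AE y in lborel. a < y \<and> y < b \<longrightarrow> y \<notin> S)"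
proof (cases "a < b")
  case False
  then show ?thesis by (intro disjI1 AE_I2) auto
next
  case True
  define k where "k x \<longleftrightarrow> (\<exists>c d. c < x \<and> x < d \<and> (AE y in lborel. c < y \<and> y < d \<longrightarrow> y \<in> S))" for x
  define P where "P c d \<longleftrightarrow> k c = k d \<and> (AE y in lborel. c < y \<and> y < d \<longrightarrow> (y \<in> S \<longleftrightarrow> k c))" for c d
  have loc: "\<exists>c d. c < x \<and> x < d \<and> (\<forall>y. c < y \<and> y < d \<longrightarrow> k y = k x) \<and>
      (AE y in lborel. c < y \<and> y < d \<longrightarrow> (y \<in> S \<longleftrightarrow> k x))" if x: "x \<in> {a<..<b}" for x
  proof -
    from x disj have "x \<notin> ess_boundary S" by auto
    then obtain c d where cd: "c < x" "x < d"
      and or: "(AE y in lborel. c < y \<and> y < d \<longrightarrow> y \<in> S) \<or> (AE y in lborel. c < y \<and> y < d \<longrightarrow> y \<notin> S)"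
      by (auto simp: ess_boundary_def)
    from or show ?thesis
    proof
      assume A: "AE y in lborel. c < y \<and> y < d \<longrightarrow> y \<in> S"
      then have K: "k y" if "c < y" "y < d" for y using that by (auto simp: k_def)
      with A cd show ?thesis by (intro exI[of _ c] exI[of _ d]) auto
    next
      assume A: "AE y in lborel. c < y \<and> y < d \<longrightarrow> y \<notin> S"
      have K: "\<not> k y" if "c < y" "y < d" for y
      proof
        assume "k y"
        then obtain c' d' where "c' < y" "y < d'" "AE y in lborel. c' < y \<and> y < d' \<longrightarrow> y \<in> S"
          by (auto simp: k_def)
        then show False
          using that AE_interval_mono[OF A, of "max c c'" "min d d'"]
            AE_interval_mono[of c' d' "\<lambda>y. y \<in> S" "max c c'" "min d d'"]
          by (intro AE_interval_contradiction[of "max c c'" "min d d'" S]) auto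
      qed
      with A cd show ?thesis by (intro exI[of _ c] exI[of _ d]) auto
    qed
  qed
  \<comment> \<open>\<open>P\<close> records, besides equality almost everywhere, that
    \<open>k\<close> agrees at the two ends; this is what lets it pass to a concatenation of
    intervals.\<close>
  have P: "P c d" if "a < c" "c \<le> d" "d < b" for c d
    using that(2)
  proof (induction rule: Bolzano)
    case (trans u v w)
    have 1: "AE y in lborel. u < y \<and> y < v \<longrightarrow> (y \<in> S \<longleftrightarrow> k u)"
      "AE y in lborel. v < y \<and> y < w \<longrightarrow> (y \<in> S \<longleftrightarrow> k v)" and k: "k u = k v" "k v = k w"
      using trans by (auto simp: P_def)
    have "AE y in lborel. y \<noteq> v" by (rule AE_lborel_singleton)
    with 1 have "AE y in lborel. u < y \<and> y < w \<longrightarrow> (y \<in> S \<longleftrightarrow> k u)"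
      by eventually_elim (use k in auto)
    with k show ?case by (simp add: P_def)
  next
    case (local x)
    then have "x \<in> {a<..<b}" using that by auto
    from loc[OF this] obtain p q where pq: "p < x" "x < q" "\<And>y. p < y \<Longrightarrow> y < q \<Longrightarrow> k y = k x"
      "AE y in lborel. p < y \<and> y < q \<longrightarrow> (y \<in> S \<longleftrightarrow> k x)" by blast
    show ?case
    proof (intro exI[of _ "min (x - p) (q - x)"] conjI allI impI)
      fix u v assume uv: "u \<le> x \<and> x \<le> v \<and> v - u < min (x - p) (q - x)"
      then have "k u = k x" "k v = k x" using pq(1,2) by (auto intro!: pq(3))
      moreover have "AE y in lborel. u < y \<and> y < v \<longrightarrow> (y \<in> S \<longleftrightarrow> k x)"
        using pq(4) by (rule AE_interval_mono) (use uv pq(1,2) in auto)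
      ultimately show "P u v" by (simp add: P_def)
    qed (use pq(1,2) in simp)
  qed
  define m where "m = (a + b) / 2"
  have m: "a < m" "m < b" using True by (auto simp: m_def)
  \<comment> \<open>\<open>P\<close> is available on compact subintervals only. Their ends approach
    \<open>a\<close> and \<open>b\<close> like \<open>1 / Suc n\<close>, and all of them contain
    \<open>m\<close>, so they share the value \<open>k m\<close>.\<close>
  have "AE y in lborel. \<forall>n. (let c = a + (m - a) / real (Suc n); d = b - (b - m) / real (Suc n) in
      c < y \<and> y < d \<longrightarrow> (y \<in> S \<longleftrightarrow> k m))"
  proof (subst AE_all_countable, intro allI)
    fix n
    define c where "c = a + (m - a) / real (Suc n)"
    define d where "d = b - (b - m) / real (Suc n)"
    have "(m - a) / real (Suc n) \<le> (m - a) / 1" "(b - m) / real (Suc n) \<le> (b - m) / 1"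
      using m by (intro divide_left_mono; simp)+
    moreover have "0 < (m - a) / real (Suc n)" "0 < (b - m) / real (Suc n)"
      using m by simp_all
    ultimately have "a < c" "c \<le> m" "m \<le> d" "d < b"
      unfolding c_def d_def using m by simp_all
    then have "P c d" "P c m" using P m by simp_all
    then have "k c = k m" "AE y in lborel. c < y \<and> y < d \<longrightarrow> (y \<in> S \<longleftrightarrow> k c)"
      unfolding P_def by blast+
    then have "AE y in lborel. c < y \<and> y < d \<longrightarrow> (y \<in> S \<longleftrightarrow> k m)"
      by (simp only:)
    then show "AE y in lborel. let c = a + (m - a) / real (Suc n); d = b - (b - m) / real (Suc n) in
      c < y \<and> y < d \<longrightarrow> (y \<in> S \<longleftrightarrow> k m)"
      by (simp only: c_def d_def Let_def)
  qed
  then have "AE y in lborel. a < y \<and> y < b \<longrightarrow> (y \<in> S \<longleftrightarrow> k m)"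
  proof eventually_elim
    case (elim y)
    show ?case
    proof
      assume y: "a < y \<and> y < b"
      have "(\<lambda>n. a + (m - a) * inverse (real (Suc n))) \<longlonglongrightarrow> a + (m - a) * 0"
        by (intro tendsto_intros LIMSEQ_inverse_real_of_nat)
      then have "\<forall>\<^sub>F n in sequentially. a + (m - a) * inverse (real (Suc n)) < y"
        using y by (auto intro: order_tendstoD)
      moreover have "(\<lambda>n. b - (b - m) * inverse (real (Suc n))) \<longlonglongrightarrow> b - (b - m) * 0"
        by (intro tendsto_intros LIMSEQ_inverse_real_of_nat)
      then have "\<forall>\<^sub>F n in sequentially. y < b - (b - m) * inverse (real (Suc n))"
        using y by (auto intro: order_tendstoD)
      ultimately have "\<forall>\<^sub>F n in sequentially. a + (m - a) * inverse (real (Suc n)) < y \<and> y < b - (b - m) * inverse (real (Suc n))"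
        by eventually_elim auto
      then obtain n where "a + (m - a) * inverse (real (Suc n)) < y \<and> y < b - (b - m) * inverse (real (Suc n))"
        by (auto simp: eventually_sequentially)
      with elim[THEN spec, of n] show "y \<in> S \<longleftrightarrow> k m" by (simp add: Let_def divide_inverse)
    qed
  qed
  then show ?thesis by (cases "k m") auto
qed

lemma ess_boundary_Int_iff:
  assumes "a < b"
  shows "ess_boundary S \<inter> {a<..<b} = {} \<longleftrightarrow>
    (AE y in lborel. a < y \<and> y < b \<longrightarrow> y \<in> S) \<or> (AE y in lborel. a < y \<and> y < b \<longrightarrow> y \<notin> S)"
proof
  show "ess_boundary S \<inter> {a<..<b} = {}"
    if "(AE y in lborel. a < y \<and> y < b \<longrightarrow> y \<in> S) \<or> (AE y in lborel. a < y \<and> y < b \<longrightarrow> y \<notin> S)"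
    using that by (auto simp: ess_boundary_def)
qed (rule AE_constant_off_ess_boundary)

lemma ess_boundary_cong_AE:
  assumes "AE y in lborel. y \<in> S \<longleftrightarrow> y \<in> T"
  shows "ess_boundary S = ess_boundary T"
proof -
  have "(AE y in lborel. a < y \<and> y < b \<longrightarrow> y \<in> S) \<longleftrightarrow> (AE y in lborel. a < y \<and> y < b \<longrightarrow> y \<in> T)"
    "(AE y in lborel. a < y \<and> y < b \<longrightarrow> y \<notin> S) \<longleftrightarrow> (AE y in lborel. a < y \<and> y < b \<longrightarrow> y \<notin> T)" for a b
    using assms by (auto elim: eventually_elim2)
  then show ?thesis by (simp add: ess_boundary_def)
qed

lemma locally_finite_isolated:
  assumes "locally_finite_boundary S"
  obtains e where "e > 0" "ess_boundary S \<inter> {x - e<..<x + e} \<subseteq> {x}"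
proof -
  have "finite (ess_boundary S \<inter> {x - 1<..<x + 1})"
    using assms by (auto simp: locally_finite_boundary_def)
  then obtain d where d: "d > 0" "\<forall>y\<in>ess_boundary S \<inter> {x - 1<..<x + 1}. y \<noteq> x \<longrightarrow> d \<le> dist x y"
    using finite_set_avoid by blast
  have "y = x" if "y \<in> ess_boundary S \<inter> {x - min d 1<..<x + min d 1}" for y
    using bspec[OF d(2), of y] that by (cases "y = x") (auto simp: dist_real_def min_def split: if_splits)
  then show thesis
    using d(1) by (intro that[of "min d 1"]) auto
qed

lemma trace_nhds:
  assumes "locally_finite_boundary S"
  obtains e where "e > 0" "ess_boundary S \<inter> {x - e<..<x + e} \<subseteq> {x}"
    "AE y in lborel. x - e < y \<and> y < x \<longrightarrow> (y \<in> S \<longleftrightarrow> left_full S x)"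
    "AE y in lborel. x < y \<and> y < x + e \<longrightarrow> (y \<in> S \<longleftrightarrow> right_full S x)"
proof -
  obtain e where e: "e > 0" "ess_boundary S \<inter> {x - e<..<x + e} \<subseteq> {x}"
    using locally_finite_isolated[OF assms] by blast
  have "ess_boundary S \<inter> {x - e<..<x} = {}" "ess_boundary S \<inter> {x<..<x + e} = {}" using e by force+
  then have or: "(AE y in lborel. x - e < y \<and> y < x \<longrightarrow> y \<in> S) \<or> (AE y in lborel. x - e < y \<and> y < x \<longrightarrow> y \<notin> S)"
     "(AE y in lborel. x < y \<and> y < x + e \<longrightarrow> y \<in> S) \<or> (AE y in lborel. x < y \<and> y < x + e \<longrightarrow> y \<notin> S)"
    using AE_constant_off_ess_boundary by blast+
  have L: "\<not> left_full S x" if A: "AE y in lborel. x - e < y \<and> y < x \<longrightarrow> y \<notin> S"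
  proof
    assume "left_full S x"
    then obtain a where "a < x" "AE y in lborel. a < y \<and> y < x \<longrightarrow> y \<in> S" by (auto simp: left_full_def)
    then show False
      using e AE_interval_mono[OF A, of "max a (x - e)" x] AE_interval_mono[of a x "\<lambda>y. y \<in> S" "max a (x - e)" x]
      by (intro AE_interval_contradiction[of "max a (x - e)" x S]) auto
  qed
  have R: "\<not> right_full S x" if A: "AE y in lborel. x < y \<and> y < x + e \<longrightarrow> y \<notin> S"
  proof
    assume "right_full S x"
    then obtain b where "x < b" "AE y in lborel. x < y \<and> y < b \<longrightarrow> y \<in> S" by (auto simp: right_full_def)
    then show False
      using e AE_interval_mono[OF A, of x "min b (x + e)"] AE_interval_mono[of x b "\<lambda>y. y \<in> S" x "min b (x + e)"]
      by (intro AE_interval_contradiction[of x "min b (x + e)" S]) auto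
  qed
  show thesis
  proof (rule that[OF e])
    show "AE y in lborel. x - e < y \<and> y < x \<longrightarrow> (y \<in> S \<longleftrightarrow> left_full S x)"
      using or(1)
    proof
      assume A: "AE y in lborel. x - e < y \<and> y < x \<longrightarrow> y \<in> S"
      then have "left_full S x" using e unfolding left_full_def by (intro exI[of _ "x - e"]) auto
      with A show ?thesis by auto
    qed (use L in auto)
    show "AE y in lborel. x < y \<and> y < x + e \<longrightarrow> (y \<in> S \<longleftrightarrow> right_full S x)"
      using or(2)
    proof
      assume A: "AE y in lborel. x < y \<and> y < x + e \<longrightarrow> y \<in> S"
      then have "right_full S x" using e unfolding right_full_def by (intro exI[of _ "x + e"]) auto
      with A show ?thesis by auto
    qed (use R in auto)
  qed
qed

lemma left_full_eqI:
  assumes "a < x" "AE y in lborel. a < y \<and> y < x \<longrightarrow> (y \<in> S \<longleftrightarrow> c)"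
  shows "left_full S x = c"
proof (cases c)
  case True
  with assms show ?thesis by (auto simp: left_full_def)
next
  case False
  have "\<not> left_full S x"
  proof
    assume "left_full S x"
    then obtain a' where "a' < x" "AE y in lborel. a' < y \<and> y < x \<longrightarrow> y \<in> S" by (auto simp: left_full_def)
    then show False
      using assms False AE_interval_mono[of a x "\<lambda>y. y \<notin> S" "max a a'" x] AE_interval_mono[of a' x "\<lambda>y. y \<in> S" "max a a'" x]
      by (intro AE_interval_contradiction[of "max a a'" x S]) auto
  qed
  with False show ?thesis by simp
qed

text \<open>If the traces agree, the set is constant almost everywhere on a two-sided neighbourhood,
  a single point being null; if they differ, neither alternative survives on any neighbourhood. So
  the jump is 1 or -1 at boundary points and 0 elsewhere.\<close>

lemma ess_boundary_iff_traces:
  assumes "locally_finite_boundary S"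
  shows "x \<in> ess_boundary S \<longleftrightarrow> left_full S x \<noteq> right_full S x"
proof -
  obtain e where e: "e > 0" "AE y in lborel. x - e < y \<and> y < x \<longrightarrow> (y \<in> S \<longleftrightarrow> left_full S x)"
    "AE y in lborel. x < y \<and> y < x + e \<longrightarrow> (y \<in> S \<longleftrightarrow> right_full S x)"
    using trace_nhds[OF assms, of x] by blast
  show ?thesis
  proof
    assume x: "x \<in> ess_boundary S"
    show "left_full S x \<noteq> right_full S x"
    proof
      assume eq: "left_full S x = right_full S x"
      have "AE y in lborel. y \<noteq> x" by (rule AE_lborel_singleton)
      with e(2,3) have "AE y in lborel. x - e < y \<and> y < x + e \<longrightarrow> (y \<in> S \<longleftrightarrow> left_full S x)"
        by eventually_elim (use eq in \<open>auto simp: not_less less_le\<close>)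
      then have "(AE y in lborel. x - e < y \<and> y < x + e \<longrightarrow> y \<in> S) \<or> (AE y in lborel. x - e < y \<and> y < x + e \<longrightarrow> y \<notin> S)"
        by (cases "left_full S x") auto
      with x e(1) show False unfolding ess_boundary_def by force
    qed
  next
    assume ne: "left_full S x \<noteq> right_full S x"
    show "x \<in> ess_boundary S"
      unfolding ess_boundary_def
    proof (intro CollectI allI impI conjI notI)
      fix a b assume ab: "a < x \<and> x < b" and A: "AE y in lborel. a < y \<and> y < b \<longrightarrow> y \<in> S"
      have "left_full S x" "right_full S x"
        unfolding left_full_def right_full_def
        using ab AE_interval_mono[OF A, of a x] AE_interval_mono[OF A, of x b] by (auto intro: exI[of _ a] exI[of _ b])
      with ne show False by simp
    next
      fix a b assume ab: "a < x \<and> x < b" and A: "AE y in lborel. a < y \<and> y < b \<longrightarrow> y \<notin> S"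
      have "\<not> left_full S x"
        using ab AE_interval_mono[OF A, of a x] left_full_eqI[of a x S False] by auto
      moreover have "\<not> right_full S x"
      proof
        assume "right_full S x"
        then obtain b' where "x < b'" "AE y in lborel. x < y \<and> y < b' \<longrightarrow> y \<in> S" by (auto simp: right_full_def)
        then show False
          using ab AE_interval_mono[OF A, of x "min b b'"] AE_interval_mono[of x b' "\<lambda>y. y \<in> S" x "min b b'"]
          by (intro AE_interval_contradiction[of x "min b b'" S]) auto
      qed
      ultimately show False using ne by simp
    qed
  qed
qed

section \<open>Integration by parts against a locally finite boundary\<close>

lemma left_full_cong:
  assumes "a < x" "x < b" "AE y in lborel. a < y \<and> y < b \<longrightarrow> (y \<in> S \<longleftrightarrow> c)"
  shows "left_full S x = c"
  using assms(1) AE_interval_mono[OF assms(3), of a x] assms(2) by (intro left_full_eqI[of a]) auto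

lemma set_integral_constant_on_interval:
  fixes \<phi> g :: "real \<Rightarrow> real"
  assumes "a \<le> b" "AE y in lborel. a < y \<and> y < b \<longrightarrow> (y \<in> S \<longleftrightarrow> c)"
    and \<phi>: "\<And>x. (\<phi> has_real_derivative g x) (at x)" and g: "continuous_on UNIV g" and S: "S \<in> sets lebesgue"
  shows "(LINT x:S \<inter> {a<..b}|lebesgue. g x) = of_bool c * (\<phi> b - \<phi> a)"
proof -
  have gm: "g \<in> borel_measurable borel" using g by (rule borel_measurable_continuous_onI)
  have "AE y in lborel. y \<noteq> a \<and> y \<noteq> b" using AE_lborel_singleton[of a] AE_lborel_singleton[of b] by eventually_elim auto
  then have ae: "AE y in lborel. indicator (S \<inter> {a<..b}) y *\<^sub>R g y = of_bool c * (indicator {a..b} y *\<^sub>R g y)"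
    using assms(2) by eventually_elim (auto simp: indicator_def)
  have "(LINT x:S \<inter> {a<..b}|lebesgue. g x) = (LINT y|lborel. of_bool c * (indicator {a..b} y *\<^sub>R g y))"
    unfolding set_lebesgue_integral_def
    by (rule integral_completion_AE) (use gm ae in auto)
  also have "\<dots> = of_bool c * (LINT y|lborel. indicator {a..b} y *\<^sub>R g y)"
    by simp
  also have "(LINT y|lborel. indicator {a..b} y *\<^sub>R g y) = \<phi> b - \<phi> a"
    using assms(1) by (intro integral_FTC_Icc[of a b \<phi> g])
      (use \<phi> g in \<open>auto simp: has_real_derivative_iff_has_vector_derivative[symmetric] intro: has_field_derivative_at_within continuous_on_subset\<close>)
  finally show ?thesis .
qed

lemma set_integrable_interval:
  fixes g :: "real \<Rightarrow> real"
  assumes g: "continuous_on UNIV g" and S: "S \<in> sets lebesgue"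
  shows "set_integrable lebesgue (S \<inter> {a<..b}) g"
proof -
  have "set_integrable lborel {a..b} g"
    unfolding set_integrable_def by (rule borel_integrable_compact) (use g in \<open>auto intro: continuous_on_subset\<close>)
  then have "set_integrable lebesgue {a..b} g"
    unfolding set_integrable_def
    using integrable_completion[of "\<lambda>x. indicator {a..b} x *\<^sub>R g x" lborel]
      borel_measurable_continuous_onI[OF g] by auto
  then show ?thesis
    by (rule set_integrable_subset) (use S in auto)
qed

text \<open>Left traces at both ends and jumps over the half-open interval \<open>{a..<b}\<close>
  make the right-hand side additive: the jump at a common end point is counted once. Bisection then
  reduces the claim to intervals around a point \<open>x\<close> that contain no boundary point
  except possibly \<open>x\<close>.\<close>

lemma integral_by_parts_interval:
  fixes \<phi> g :: "real \<Rightarrow> real"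
  assumes S: "S \<in> sets lebesgue" and lf: "locally_finite_boundary S"
    and \<phi>: "\<And>x. (\<phi> has_real_derivative g x) (at x)" and g: "continuous_on UNIV g" and "a \<le> b"
  shows "(LINT x:S \<inter> {a<..b}|lebesgue. g x) =
    of_bool (left_full S b) * \<phi> b - of_bool (left_full S a) * \<phi> a - (\<Sum>s\<in>ess_boundary S \<inter> {a..<b}. jump S s * \<phi> s)"
  using \<open>a \<le> b\<close>
proof (induction rule: Bolzano)
  case (trans a b c)
  have I: "set_integrable lebesgue (S \<inter> {a<..b}) g" "set_integrable lebesgue (S \<inter> {b<..c}) g"
    using set_integrable_interval[OF g S] by auto
  have "S \<inter> {a<..c} = (S \<inter> {a<..b}) \<union> (S \<inter> {b<..c})" using trans by auto
  then have 1: "(LINT x:S \<inter> {a<..c}|lebesgue. g x) = (LINT x:S \<inter> {a<..b}|lebesgue. g x) + (LINT x:S \<inter> {b<..c}|lebesgue. g x)"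
    using set_integral_Un[OF _ I] by fastforce
  have "ess_boundary S \<inter> {a..<c} = (ess_boundary S \<inter> {a..<b}) \<union> (ess_boundary S \<inter> {b..<c})" using trans by auto
  moreover have fin: "finite (ess_boundary S \<inter> {a'..<b'})" for a' b'
    by (rule finite_subset[of _ "ess_boundary S \<inter> {a' - 1<..<b'}"]) (use lf in \<open>auto simp: locally_finite_boundary_def\<close>)
  ultimately have "(\<Sum>s\<in>ess_boundary S \<inter> {a..<c}. jump S s * \<phi> s) =
    (\<Sum>s\<in>ess_boundary S \<inter> {a..<b}. jump S s * \<phi> s) + (\<Sum>s\<in>ess_boundary S \<inter> {b..<c}. jump S s * \<phi> s)"
    by (auto intro!: sum.union_disjoint)
  with 1 trans show ?case by simp
next
  case (local x)
  obtain e where e: "e > 0" "ess_boundary S \<inter> {x - e<..<x + e} \<subseteq> {x}"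
    "AE y in lborel. x - e < y \<and> y < x \<longrightarrow> (y \<in> S \<longleftrightarrow> left_full S x)"
    "AE y in lborel. x < y \<and> y < x + e \<longrightarrow> (y \<in> S \<longleftrightarrow> right_full S x)"
    using trace_nhds[OF lf, of x] by blast
  show ?case
  proof (intro exI[of _ e] conjI allI impI)
    fix a b assume ab: "a \<le> x \<and> x \<le> b \<and> b - a < e"
    have la: "left_full S a = left_full S x"
    proof (cases "a = x")
      case False
      with ab show ?thesis by (intro left_full_cong[of "x - e" a x, OF _ _ e(3)]) auto
    qed simp
    have lb: "left_full S b = right_full S x" if "x < b"
      using that ab by (intro left_full_cong[of x b "x + e", OF _ _ e(4)]) auto
    have 1: "(LINT x:S \<inter> {a<..x}|lebesgue. g x) = of_bool (left_full S x) * (\<phi> x - \<phi> a)"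
      by (rule set_integral_constant_on_interval[OF _ AE_interval_mono[OF e(3)] \<phi> g S]) (use ab in auto)
    have 2: "(LINT x:S \<inter> {x<..b}|lebesgue. g x) = of_bool (right_full S x) * (\<phi> b - \<phi> x)"
      by (rule set_integral_constant_on_interval[OF _ AE_interval_mono[OF e(4)] \<phi> g S]) (use ab in auto)
    have "S \<inter> {a<..b} = (S \<inter> {a<..x}) \<union> (S \<inter> {x<..b})" using ab by auto
    then have 3: "(LINT x:S \<inter> {a<..b}|lebesgue. g x) = (LINT x:S \<inter> {a<..x}|lebesgue. g x) + (LINT x:S \<inter> {x<..b}|lebesgue. g x)"
      using set_integral_Un[OF _ set_integrable_interval[OF g S, of a x] set_integrable_interval[OF g S, of x b]] by fastforce
    have sub: "ess_boundary S \<inter> {a..<b} \<subseteq> {x}" using e(2) ab by auto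
    have 4: "(\<Sum>s\<in>ess_boundary S \<inter> {a..<b}. jump S s * \<phi> s) = (if x < b then jump S x * \<phi> x else 0)"
    proof (cases "x < b \<and> x \<in> ess_boundary S")
      case True
      then have "ess_boundary S \<inter> {a..<b} = {x}" using sub ab by auto
      with True show ?thesis by simp
    next
      case False
      then have "ess_boundary S \<inter> {a..<b} = {}" using sub by auto
      moreover have "jump S x = 0" if "x < b"
        using False that ess_boundary_iff_traces[OF lf, of x] by (auto simp: jump_def)
      ultimately show ?thesis by simp
    qed
    show "(LINT x:S \<inter> {a<..b}|lebesgue. g x) =
      of_bool (left_full S b) * \<phi> b - of_bool (left_full S a) * \<phi> a - (\<Sum>s\<in>ess_boundary S \<inter> {a..<b}. jump S s * \<phi> s)"
    proof (cases "x < b")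
      case True
      then show ?thesis unfolding 3 1 2 4 la lb[OF True] by (simp add: jump_def algebra_simps)
    next
      case False
      then have "b = x" using ab by auto
      then show ?thesis unfolding 3 1 2 4 la by (simp add: algebra_simps)
    qed
  qed (use e in auto)
qed

lemma integral_by_parts_compact_support:
  fixes \<phi> g :: "real \<Rightarrow> real"
  assumes S: "S \<in> sets lebesgue" and lf: "locally_finite_boundary S"
    and \<phi>: "\<And>x. (\<phi> has_real_derivative g x) (at x)" and g: "continuous_on UNIV g"
    and z: "\<And>x. x \<notin> {c<..<d} \<Longrightarrow> \<phi> x = 0"
  shows "(LINT x:S|lebesgue. g x) = - (\<Sum>s\<in>ess_boundary S \<inter> {c<..<d}. jump S s * \<phi> s)"
proof -
  \<comment> \<open>The order of \<open>c\<close> and \<open>d\<close> is not fixed, hence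
    \<open>max c d\<close>. Because of the margins every point outside \<open>{a<..b}\<close> has a
    neighbourhood on which \<open>\<phi>\<close>, and so its derivative, vanishes.\<close>
  define a where "a = c - 1" define b where "b = max c d + 1"
  have ab: "a \<le> b" "a < c" "d < b" "c < b" by (auto simp: a_def b_def)
  have g0: "g x = 0" if "x \<notin> {a<..b}" for x
  proof -
    have "\<forall>\<^sub>F y in nhds x. y \<in> - {c..max c d}"
      using that ab by (intro eventually_nhds_in_open) (auto simp: b_def)
    then have "\<forall>\<^sub>F y in nhds x. \<phi> y = 0"
    proof eventually_elim
      case (elim y)
      then have "y \<notin> {c<..<d}" by auto
      then show ?case by (rule z)
    qed
    then have "((\<lambda>_. 0) has_real_derivative g x) (at x)"
      using \<phi>[of x] by (subst (asm) DERIV_cong_ev) auto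
    then show ?thesis using DERIV_const DERIV_unique by blast
  qed
  have "(LINT x:S|lebesgue. g x) = (LINT x:S \<inter> {a<..b}|lebesgue. g x)"
    unfolding set_lebesgue_integral_def by (rule Bochner_Integration.integral_cong) (use g0 in \<open>auto simp: indicator_def\<close>)
  also have "\<dots> = - (\<Sum>s\<in>ess_boundary S \<inter> {a..<b}. jump S s * \<phi> s)"
    using integral_by_parts_interval[OF S lf \<phi> g ab(1)] z[of a] z[of b] ab by auto
  also have "(\<Sum>s\<in>ess_boundary S \<inter> {a..<b}. jump S s * \<phi> s) = (\<Sum>s\<in>ess_boundary S \<inter> {c<..<d}. jump S s * \<phi> s)"
  proof (rule sum.mono_neutral_right)
    show "finite (ess_boundary S \<inter> {a..<b})"
      by (rule finite_subset[of _ "ess_boundary S \<inter> {a - 1<..<b}"]) (use lf in \<open>auto simp: locally_finite_boundary_def\<close>)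
  qed (use ab z in auto)
  finally show ?thesis .
qed

section \<open>Perimeter measure and reduced boundary on the line\<close>

lemma countable_ess_boundary:
  assumes "locally_finite_boundary S" shows "countable (ess_boundary S)"
proof -
  have "ess_boundary S = (\<Union>n. ess_boundary S \<inter> {- real n<..<real n})"
  proof (intro set_eqI iffI)
    fix x assume "x \<in> ess_boundary S"
    moreover obtain n where "\<bar>x\<bar> < real n" using reals_Archimedean2 by blast
    ultimately show "x \<in> (\<Union>n. ess_boundary S \<inter> {- real n<..<real n})" by (auto intro!: exI[of _ n])
  qed auto
  moreover have "countable \<dots>"
    by (rule countable_UN) (use assms in \<open>auto simp: locally_finite_boundary_def intro: countable_finite\<close>)
  ultimately show ?thesis by simp
qed

text \<open>Pushing forward by the identity only replaces the sigma-algebra of all subsets by the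
  Borel one that \<open>gauss_green\<close> asks for.\<close>

definition boundary_measure :: "real set \<Rightarrow> real measure" where
  "boundary_measure S = distr (count_space (ess_boundary S)) borel (\<lambda>x. x)"

text \<open>The value -1 off the boundary is a default of unit length, so that the norm is 1 at
  every point.\<close>

definition boundary_normal :: "real set \<Rightarrow> real \<Rightarrow> real" where
  "boundary_normal S x = (if x \<in> ess_boundary S \<and> right_full S x then 1 else -1)"

lemma boundary_normal_eq_jump:
  assumes "locally_finite_boundary S" "x \<in> ess_boundary S" shows "boundary_normal S x = jump S x"
  using assms(2) ess_boundary_iff_traces[OF assms(1), of x]
  by (cases "left_full S x"; cases "right_full S x") (simp_all add: boundary_normal_def jump_def)

lemma emeasure_boundary_measure:
  "A \<in> sets borel \<Longrightarrow> emeasure (boundary_measure S) A = emeasure (count_space (ess_boundary S)) (ess_boundary S \<inter> A)"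
  unfolding boundary_measure_def by (subst emeasure_distr) (simp_all add: Int_commute)

lemma sets_boundary_measure[simp]: "sets (boundary_measure S) = sets borel"
  by (simp add: boundary_measure_def)

lemma borel_measurable_boundary_normal:
  assumes "locally_finite_boundary S" shows "boundary_normal S \<in> borel_measurable borel"
proof -
  have "countable (ess_boundary S \<inter> {x. right_full S x})"
    using countable_ess_boundary[OF assms] by (rule countable_subset[rotated]) auto
  then have m: "ess_boundary S \<inter> {x. right_full S x} \<in> sets borel"
    by (rule sets.countable[rotated]) simp
  have "boundary_normal S = (\<lambda>x. if x \<in> ess_boundary S \<inter> {x. right_full S x} then 1 else -1)"
    unfolding boundary_normal_def by (rule ext) simp
  also have "\<dots> \<in> borel_measurable borel"
    by (rule measurable_If_set) (use m in simp_all)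
  finally show ?thesis .
qed

lemma integral_boundary_measure:
  fixes f :: "real \<Rightarrow> real"
  assumes f: "f \<in> borel_measurable borel" and fin: "finite (ess_boundary S \<inter> A)"
    and z: "\<And>x. x \<notin> A \<Longrightarrow> f x = 0"
  shows "(LINT x|boundary_measure S. f x) = (\<Sum>s\<in>ess_boundary S \<inter> A. f s)"
proof -
  have sub: "{x \<in> ess_boundary S. f x \<noteq> 0} \<subseteq> ess_boundary S \<inter> A" using z by auto
  have "(LINT x|boundary_measure S. f x) = (LINT x|count_space (ess_boundary S). f x)"
    unfolding boundary_measure_def by (subst integral_distr) (use f in auto)
  also have "\<dots> = (\<Sum>s | s \<in> ess_boundary S \<and> f s \<noteq> 0. f s)"
    by (rule lebesgue_integral_count_space_finite_support) (rule finite_subset[OF sub fin])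
  also have "\<dots> = (\<Sum>s\<in>ess_boundary S \<inter> A. f s)"
    by (rule sum.mono_neutral_left) (use fin z in auto)
  finally show ?thesis .
qed

text \<open>Integration by parts exhibits the counting measure on the boundary as the perimeter
  measure. It gives one half of the identification of the reduced boundary, and it provides the
  locally finite perimeter of the profile from which the stripes are built.\<close>

lemma gauss_green_boundary_measure:
  assumes S: "S \<in> sets lebesgue" and lf: "locally_finite_boundary S"
  shows "gauss_green S (boundary_measure S) (boundary_normal S)"
  unfolding gauss_green_def
proof (intro conjI allI impI)
  fix K :: "real set" assume K: "compact K"
  then have "bounded K" by (rule compact_imp_bounded)
  then obtain B where B: "\<And>x. x \<in> K \<Longrightarrow> norm x \<le> B" unfolding bounded_iff by blast
  have "finite (ess_boundary S \<inter> K)"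
    by (rule finite_subset[of _ "ess_boundary S \<inter> {- B - 1<..<B + 1}"])
      (use lf B in \<open>force simp: locally_finite_boundary_def\<close>)+
  then show "emeasure (boundary_measure S) K < \<infinity>"
    using K by (simp add: emeasure_boundary_measure compact_imp_closed emeasure_count_space_finite less_top[symmetric])
next
  fix \<phi> :: "real \<Rightarrow> real" and g
  assume *: "(\<forall>x. GDERIV \<phi> x :> g x) \<and> continuous_on UNIV g \<and> compact (closure {x. \<phi> x \<noteq> 0})"
  then have \<phi>: "(\<phi> has_real_derivative g x) (at x)" for x by auto
  from * have "bounded {x. \<phi> x \<noteq> 0}" by (meson bounded_closure_image bounded_subset closure_subset compact_imp_bounded)
  then obtain B where B: "\<And>x. \<phi> x \<noteq> 0 \<Longrightarrow> norm x \<le> B" unfolding bounded_iff by blast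
  have z: "\<phi> x = 0" if "x \<notin> {- B - 1<..<B + 1}" for x
    using B[of x] that by (cases "\<phi> x = 0") auto
  have fin: "finite (ess_boundary S \<inter> {- B - 1<..<B + 1})" using lf by (auto simp: locally_finite_boundary_def)
  have m: "\<phi> \<in> borel_measurable borel"
    by (rule borel_measurable_continuous_onI)
      (use \<phi> in \<open>auto intro!: DERIV_isCont simp: continuous_on_eq_continuous_at\<close>)
  have "(LINT x:S|lebesgue. g x) = - (\<Sum>s\<in>ess_boundary S \<inter> {- B - 1<..<B + 1}. jump S s * \<phi> s)"
    by (rule integral_by_parts_compact_support[OF S lf \<phi> _ z]) (use * in auto)
  also have "(\<Sum>s\<in>ess_boundary S \<inter> {- B - 1<..<B + 1}. jump S s * \<phi> s) =
      (\<Sum>s\<in>ess_boundary S \<inter> {- B - 1<..<B + 1}. \<phi> s *\<^sub>R boundary_normal S s)"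
    by (rule sum.cong) (auto simp: boundary_normal_eq_jump[OF lf])
  also have "\<dots> = (LINT x|boundary_measure S. \<phi> x *\<^sub>R boundary_normal S x)"
    by (rule integral_boundary_measure[symmetric]) (use m borel_measurable_boundary_normal[OF lf] fin z in auto)
  finally show "(LINT x:S|lebesgue. g x) = - (LINT x|boundary_measure S. \<phi> x *\<^sub>R boundary_normal S x)" .
qed (use S borel_measurable_boundary_normal[OF lf] in \<open>auto simp: boundary_normal_def\<close>)

text \<open>Squares of positive parts are the building blocks for test functions that are
  continuously differentiable and compactly supported.\<close>

lemma DERIV_pos_part_power2: "((\<lambda>s. (max 0 s)\<^sup>2) has_real_derivative 2 * max 0 s) (at (s::real))"
proof -
  consider "s > 0" | "s < 0" | "s = 0" by linarith
  then show ?thesis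
  proof cases
    case 1
    then have "\<forall>\<^sub>F y in nhds s. y \<in> {0<..}" by (intro eventually_nhds_in_open) auto
    then have ev: "\<forall>\<^sub>F y in nhds s. (max 0 y)\<^sup>2 = y\<^sup>2" by eventually_elim simp
    have "((\<lambda>y. y\<^sup>2) has_real_derivative 2 * max 0 s) (at s)"
      using 1 by (auto intro!: derivative_eq_intros)
    then show ?thesis by (subst DERIV_cong_ev[OF refl ev refl])
  next
    case 2
    then have "\<forall>\<^sub>F y in nhds s. y \<in> {..<0}" by (intro eventually_nhds_in_open) auto
    then have ev: "\<forall>\<^sub>F y in nhds s. (max 0 y)\<^sup>2 = 0" by eventually_elim simp
    have "((\<lambda>y. 0) has_real_derivative 2 * max 0 s) (at s)" using 2 by simp
    then show ?thesis by (subst DERIV_cong_ev[OF refl ev refl])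
  next
    case 3
    have "(\<lambda>y. ((max 0 y)\<^sup>2 - (max 0 s)\<^sup>2) / (y - s)) = (\<lambda>y. max 0 y)"
      using 3 by (auto simp: fun_eq_iff power2_eq_square max_def)
    moreover have "((\<lambda>y. max 0 y) \<longlongrightarrow> max 0 s) (at s)" by (intro tendsto_intros)
    ultimately show ?thesis using 3 by (simp add: has_field_derivative_iff)
  qed
qed

lemma interval_test_functions:
  fixes c d :: real
  assumes "c < d"
  obtains \<phi> g :: "nat \<Rightarrow> real \<Rightarrow> real" where
    "\<And>k x. (\<phi> k has_real_derivative g k x) (at x)" "\<And>k. continuous_on UNIV (g k)"
    "\<And>k x. x \<notin> {c<..<d} \<Longrightarrow> \<phi> k x = 0" "\<And>k x. 0 \<le> \<phi> k x \<and> \<phi> k x \<le> 1"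
    "\<And>x. (\<lambda>k. \<phi> k x) \<longlonglongrightarrow> indicator {c<..<d} x"
proof -
  define P where "P x = (max 0 ((x - c) * (d - x)))\<^sup>2" for x
  define P' where "P' x = 2 * max 0 ((x - c) * (d - x)) * ((d - x) - (x - c))" for x
  have P: "(P has_real_derivative P' x) (at x)" for x
    unfolding P_def P'_def
    by (rule DERIV_chain2[OF DERIV_pos_part_power2]) (auto intro!: derivative_eq_intros)
  have P0: "0 \<le> P x" for x by (simp add: P_def)
  have P'c: "continuous_on UNIV P'"
    unfolding P'_def by (intro continuous_intros)
  have sgn: "0 < (x - c) * (d - x) \<longleftrightarrow> x \<in> {c<..<d}" for x
    using assms by (auto simp: zero_less_mult_iff)
  have Ppos: "0 < P x" if "x \<in> {c<..<d}" for x
    using sgn[of x] that by (simp add: P_def)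
  have Pz: "P x = 0" if "x \<notin> {c<..<d}" for x
  proof -
    have "(x - c) * (d - x) \<le> 0" using sgn[of x] that by linarith
    then show ?thesis by (simp add: P_def max_def)
  qed
  \<comment> \<open>\<open>P\<close> is positive exactly on the interval, so these functions are 0
    outside and tend to 1 inside; the denominator is at least 1, which keeps the derivative
    continuous.\<close>
  define \<phi> where "\<phi> k x = 1 - 1 / (1 + real k * P x)" for k :: nat and x
  define g where "g k x = real k * P' x / (1 + real k * P x)^2" for k :: nat and x
  have pos: "0 < 1 + real k * P x" for k x using P0[of x] by (simp add: add_pos_nonneg)
  show thesis
  proof (rule that[of \<phi> g])
    show "(\<phi> k has_real_derivative g k x) (at x)" for k x
      unfolding \<phi>_def g_def using pos[of k x] P[of x]
      by (auto intro!: derivative_eq_intros simp: power2_eq_square)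
    have "continuous_on UNIV P" using P by (auto intro!: DERIV_isCont simp: continuous_on_eq_continuous_at)
    then show "continuous_on UNIV (g k)" for k
      unfolding g_def using P'c pos[of k] by (intro continuous_intros) (auto simp: less_le)
    show "\<phi> k x = 0" if "x \<notin> {c<..<d}" for k x using Pz[OF that] by (simp add: \<phi>_def)
    show "0 \<le> \<phi> k x \<and> \<phi> k x \<le> 1" for k x
      using pos[of k x] P0[of x] by (auto simp: \<phi>_def divide_simps)
    show "(\<lambda>k. \<phi> k x) \<longlonglongrightarrow> indicator {c<..<d} x" for x
    proof (cases "x \<in> {c<..<d}")
      case True
      then have "P x > 0" by (rule Ppos)
      then have "filterlim (\<lambda>k. 1 + real k * P x) at_top sequentially"
        by (intro filterlim_tendsto_add_at_top[OF tendsto_const] filterlim_at_top_mult_tendsto_pos[OF tendsto_const] filterlim_real_sequentially)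
      then have "(\<lambda>k. 1 - 1 / (1 + real k * P x)) \<longlonglongrightarrow> 1 - 0"
        by (intro tendsto_intros tendsto_divide_0[OF tendsto_const] filterlim_at_top_imp_at_infinity)
      then show ?thesis using True by (simp add: \<phi>_def)
    qed (simp add: \<phi>_def Pz)
  qed
qed

text \<open>The reduced boundary quantifies over all Gauss-Green pairs, so the pair is arbitrary
  here. Test functions converging to the indicator of the interval determine the mass of the normal
  on it, without an appeal to uniqueness of the measure.\<close>

lemma integral_normal_interval:
  assumes gg: "gauss_green S \<mu> \<nu>" and lf: "locally_finite_boundary S" and "c < (d::real)"
  shows "(LINT y:{c<..<d}|\<mu>. \<nu> y) = (\<Sum>s\<in>ess_boundary S \<inter> {c<..<d}. jump S s)"
proof -
  obtain \<phi> g where \<phi>: "\<And>k x. (\<phi> k has_real_derivative g k x) (at x)" "\<And>k::nat. continuous_on UNIV (g k)"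
    "\<And>k x. x \<notin> {c<..<d} \<Longrightarrow> \<phi> k x = 0" "\<And>k x. 0 \<le> \<phi> k x \<and> \<phi> k x \<le> 1"
    "\<And>x. (\<lambda>k. \<phi> k x) \<longlonglongrightarrow> indicator {c<..<d} x"
    using interval_test_functions[OF \<open>c < d\<close>] by metis
  have S: "S \<in> sets lebesgue" and [measurable_cong]: "sets \<mu> = sets borel" and [measurable]: "\<nu> \<in> borel_measurable borel"
    and nu: "AE x in \<mu>. norm (\<nu> x) = 1" and fin: "emeasure \<mu> {c..d} < \<infinity>"
    and ibp: "\<And>\<phi> g. (\<forall>x. GDERIV \<phi> x :> g x) \<and> continuous_on UNIV g \<and> compact (closure {x. \<phi> x \<noteq> 0}) \<Longrightarrow>
        (LINT x:S|lebesgue. g x) = - (LINT x|\<mu>. \<phi> x *\<^sub>R \<nu> x)"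
    using gg by (auto simp: gauss_green_def)
  have [measurable]: "\<phi> k \<in> borel_measurable borel" for k
    by (rule borel_measurable_continuous_onI)
      (use \<phi>(1) in \<open>auto intro!: DERIV_isCont simp: continuous_on_eq_continuous_at\<close>)
  have eq: "(LINT x|\<mu>. \<phi> k x *\<^sub>R \<nu> x) = (\<Sum>s\<in>ess_boundary S \<inter> {c<..<d}. jump S s * \<phi> k s)" for k
  proof -
    have "compact (closure {x. \<phi> k x \<noteq> 0})"
      by (rule compact_closure[THEN iffD2], rule bounded_subset[of "{c<..<d}"]) (use \<phi>(3)[of _ k] in \<open>auto simp del: greaterThanLessThan_iff\<close>)
    then have "(LINT x:S|lebesgue. g k x) = - (LINT x|\<mu>. \<phi> k x *\<^sub>R \<nu> x)"
      using \<phi>(1,2) by (intro ibp) auto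
    moreover have "(LINT x:S|lebesgue. g k x) = - (\<Sum>s\<in>ess_boundary S \<inter> {c<..<d}. jump S s * \<phi> k s)"
      by (rule integral_by_parts_compact_support[OF S lf \<phi>(1,2,3)])
    ultimately show ?thesis by simp
  qed
  have "(\<lambda>k. LINT x|\<mu>. \<phi> k x *\<^sub>R \<nu> x) \<longlonglongrightarrow> (LINT x|\<mu>. indicator {c<..<d} x *\<^sub>R \<nu> x)"
  proof (rule integral_dominated_convergence[where w="indicator {c..d}"])
    show "integrable \<mu> (indicat_real {c..d})"
      using fin by (simp add: integrable_indicator_iff \<open>sets \<mu> = sets borel\<close> sets_eq_imp_space_eq[OF \<open>sets \<mu> = sets borel\<close>])
    show "AE x in \<mu>. norm (\<phi> k x *\<^sub>R \<nu> x) \<le> indicat_real {c..d} x" for k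
      using nu
    proof eventually_elim
      case (elim x)
      then show ?case using \<phi>(3)[of x k] \<phi>(4)[of k x] by (auto simp: abs_mult indicator_def split: if_splits)
    qed
    show "AE x in \<mu>. (\<lambda>k. \<phi> k x *\<^sub>R \<nu> x) \<longlonglongrightarrow> indicator {c<..<d} x *\<^sub>R \<nu> x"
      using \<phi>(5) by (intro AE_I2 tendsto_intros) auto
  qed measurable
  moreover have "(\<lambda>k. \<Sum>s\<in>ess_boundary S \<inter> {c<..<d}. jump S s * \<phi> k s) \<longlonglongrightarrow>
      (\<Sum>s\<in>ess_boundary S \<inter> {c<..<d}. jump S s * indicator {c<..<d} s)"
    by (intro tendsto_sum tendsto_mult tendsto_const \<phi>(5))
  ultimately have "(LINT x|\<mu>. indicator {c<..<d} x *\<^sub>R \<nu> x) = (\<Sum>s\<in>ess_boundary S \<inter> {c<..<d}. jump S s * indicator {c<..<d} s)"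
    unfolding eq by (rule LIMSEQ_unique)
  also have "\<dots> = (\<Sum>s\<in>ess_boundary S \<inter> {c<..<d}. jump S s)" by (rule sum.cong) auto
  finally show ?thesis by (simp add: set_lebesgue_integral_def)
qed

lemma ball_real_eq: "ball (x::real) r = {x - r<..<x + r}"
  by (auto simp: dist_real_def)

text \<open>Off the essential boundary the averages of the normal vanish on small balls and cannot
  tend to a unit vector. At a boundary point, which is isolated, the explicit counting measure has
  the constant average \<open>boundary_normal S x\<close> on small balls.\<close>

lemma reduced_boundary_eq_ess_boundary:
  assumes S: "S \<in> sets lebesgue" and lf: "locally_finite_boundary S"
  shows "reduced_boundary S = ess_boundary S"
proof (intro set_eqI iffI)
  fix x assume "x \<in> reduced_boundary S"
  then obtain \<mu> \<nu> n where gg: "gauss_green S \<mu> \<nu>" and n: "norm n = 1"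
    and lim: "((\<lambda>r. (LINT y:ball x r|\<mu>. \<nu> y) /\<^sub>R measure \<mu> (ball x r)) \<longlongrightarrow> n) (at_right 0)"
    by (auto simp: reduced_boundary_def)
  show "x \<in> ess_boundary S"
  proof (rule ccontr)
    assume x: "x \<notin> ess_boundary S"
    obtain e where e: "e > 0" "ess_boundary S \<inter> {x - e<..<x + e} \<subseteq> {x}"
      using locally_finite_isolated[OF lf] by blast
    have "\<forall>\<^sub>F r in at_right 0. 0 < r \<and> r < e"
      using e(1) by (auto simp: eventually_at_right_field)
    then have "\<forall>\<^sub>F r in at_right 0. (LINT y:ball x r|\<mu>. \<nu> y) /\<^sub>R measure \<mu> (ball x r) = 0"
    proof eventually_elim
      case (elim r)
      then have "ess_boundary S \<inter> {x - r<..<x + r} = {}" using e(2) x by force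
      with elim show ?case
        unfolding ball_real_eq by (subst integral_normal_interval[OF gg lf]) auto
    qed
    then have "((\<lambda>r. (LINT y:ball x r|\<mu>. \<nu> y) /\<^sub>R measure \<mu> (ball x r)) \<longlongrightarrow> 0) (at_right 0)"
      by (rule tendsto_eventually)
    from tendsto_unique[OF _ lim this] n show False by simp
  qed
next
  fix x assume x: "x \<in> ess_boundary S"
  obtain e where e: "e > 0" "ess_boundary S \<inter> {x - e<..<x + e} \<subseteq> {x}"
    using locally_finite_isolated[OF lf] by blast
  let ?\<mu> = "boundary_measure S" and ?\<nu> = "boundary_normal S"
  have m1: "measure ?\<mu> (ball x r) = 1" if "0 < r" "r \<le> e" for r
  proof -
    have "ess_boundary S \<inter> ball x r = {x}" using e x that unfolding ball_real_eq by force
    then show ?thesis using x by (simp add: measure_def emeasure_boundary_measure)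
  qed
  have "measure ?\<mu> (ball x r) > 0" if "r > 0" for r
  proof -
    have fin: "finite (ess_boundary S \<inter> ball x r)" using lf unfolding ball_real_eq locally_finite_boundary_def by blast
    then have "emeasure ?\<mu> (ball x r) = card (ess_boundary S \<inter> ball x r)"
      by (simp add: emeasure_boundary_measure emeasure_count_space_finite)
    moreover have "card (ess_boundary S \<inter> ball x r) > 0" using fin x that by (auto simp: card_gt_0_iff)
    ultimately show ?thesis by (simp add: measure_def)
  qed
  moreover have "((\<lambda>r. (LINT y:ball x r|?\<mu>. ?\<nu> y) /\<^sub>R measure ?\<mu> (ball x r)) \<longlongrightarrow> ?\<nu> x) (at_right 0)"
  proof (rule tendsto_eventually)
    have "\<forall>\<^sub>F r in at_right 0. 0 < r \<and> r < e"
      using e(1) by (auto simp: eventually_at_right_field)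
    then show "\<forall>\<^sub>F r in at_right 0. (LINT y:ball x r|?\<mu>. ?\<nu> y) /\<^sub>R measure ?\<mu> (ball x r) = ?\<nu> x"
    proof eventually_elim
      case (elim r)
      have eqs: "ess_boundary S \<inter> ball x r = {x}" using e x elim unfolding ball_real_eq by force
      have "(LINT y:ball x r|?\<mu>. ?\<nu> y) = (\<Sum>s\<in>ess_boundary S \<inter> ball x r. indicator (ball x r) s *\<^sub>R ?\<nu> s)"
        unfolding set_lebesgue_integral_def
        by (rule integral_boundary_measure)
          (use borel_measurable_boundary_normal[OF lf] eqs in \<open>auto intro!: borel_measurable_times borel_measurable_indicator\<close>)
      with m1[of r] elim eqs show ?case by simp
    qed
  qed
  moreover have "norm (?\<nu> x) = 1" by (simp add: boundary_normal_def)
  ultimately show "x \<in> reduced_boundary S"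
    unfolding reduced_boundary_def using gauss_green_boundary_measure[OF S lf] by blast
qed

section \<open>Slices of sets of locally finite perimeter\<close>

definition bump :: "real \<Rightarrow> real" where
  "bump s = (max 0 s)\<^sup>2 * (max 0 (1 - s))\<^sup>2"

definition bump_deriv :: "real \<Rightarrow> real" where
  "bump_deriv s = 2 * max 0 s * (max 0 (1 - s))\<^sup>2 - (max 0 s)\<^sup>2 * (2 * max 0 (1 - s))"

lemma DERIV_bump: "(bump has_real_derivative bump_deriv s) (at s)"
proof -
  have "((\<lambda>s. (max 0 (1 - s))\<^sup>2) has_real_derivative 2 * max 0 (1 - s) * (-1)) (at s)"
    by (rule DERIV_chain2[OF DERIV_pos_part_power2]) (auto intro!: derivative_eq_intros)
  from DERIV_mult[OF DERIV_pos_part_power2[of s] this] show ?thesis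
    unfolding bump_def bump_deriv_def by (simp add: mult.commute)
qed

lemma continuous_bump: "continuous_on UNIV bump"
  unfolding bump_def by (intro continuous_intros)

lemma continuous_bump_deriv: "continuous_on UNIV bump_deriv"
  unfolding bump_deriv_def by (intro continuous_intros)

lemma bump_nonneg: "0 \<le> bump s" by (simp add: bump_def)

lemma bump_zero: "s \<notin> {0<..<1} \<Longrightarrow> bump s = 0"
  by (auto simp: bump_def max_def)

lemma bump_le_1: "bump s \<le> 1"
proof (cases "s \<in> {0<..<1}")
  case True
  then have "s\<^sup>2 \<le> 1" "(1 - s)\<^sup>2 \<le> 1" by (auto simp: power_le_one)
  with True show ?thesis by (simp add: bump_def mult_le_one)
qed (simp add: bump_zero)

lemma bump_pos: "s \<in> {0<..<1} \<Longrightarrow> 0 < bump s"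
  by (simp add: bump_def)

lemma ex_bump_primitive: "\<exists>P. \<forall>s. (P has_real_derivative bump s) (at s)"
proof -
  have "\<And>x. isCont bump x" using continuous_bump by (simp add: continuous_on_eq_continuous_at)
  then show ?thesis
    using einterval_antiderivative[of "-\<infinity>" "\<infinity>" bump]
    by (auto simp: has_real_derivative_iff_has_vector_derivative)
qed

text \<open>Any antiderivative will do: it is constant on either side of the unit interval, and only
  differences of its values enter.\<close>

definition bump_primitive :: "real \<Rightarrow> real" where
  "bump_primitive = (SOME P. \<forall>s. (P has_real_derivative bump s) (at s))"

lemma DERIV_bump_primitive: "(bump_primitive has_real_derivative bump s) (at s)"
  using someI_ex[OF ex_bump_primitive] unfolding bump_primitive_def by blast

lemma bump_primitive_mono: "s \<le> t \<Longrightarrow> bump_primitive s \<le> bump_primitive t"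
  by (rule DERIV_nonneg_imp_nondecreasing) (use DERIV_bump_primitive bump_nonneg in blast)+

lemma bump_primitive_neg: "s \<le> 0 \<Longrightarrow> bump_primitive s = bump_primitive 0"
proof (cases "s = 0")
  case False
  assume "s \<le> 0"
  with False have s: "s < 0" by simp
  show ?thesis
  proof (rule DERIV_isconst2[of s 0, symmetric])
    show "continuous_on {s..0} bump_primitive"
      using DERIV_bump_primitive DERIV_isCont by (blast intro: continuous_at_imp_continuous_on)
    show "(bump_primitive has_real_derivative 0) (at x)" if "s < x" "x < 0" for x
      using DERIV_bump_primitive[of x] that by (simp add: bump_zero)
  qed (use s in auto)
qed simp

lemma bump_primitive_ge: "1 \<le> s \<Longrightarrow> bump_primitive s = bump_primitive 1"
proof (cases "s = 1")
  case False
  assume "1 \<le> s"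
  with False have s: "1 < s" by simp
  show ?thesis
  proof (rule DERIV_isconst2[of 1 s])
    show "continuous_on {1..s} bump_primitive"
      using DERIV_bump_primitive DERIV_isCont by (blast intro: continuous_at_imp_continuous_on)
    show "(bump_primitive has_real_derivative 0) (at x)" if "1 < x" "x < s" for x
      using DERIV_bump_primitive[of x] that by (simp add: bump_zero)
  qed (use s in auto)
qed simp

section \<open>Mollifiers and the variation of mollified slices\<close>

lemma GDERIV_prod_vec:
  fixes F F' :: "'n::finite \<Rightarrow> real \<Rightarrow> real" and y :: "real^'n"
  assumes "\<And>j. (F j has_real_derivative F' j (y $ j)) (at (y $ j))"
  shows "GDERIV (\<lambda>y. \<Prod>j\<in>UNIV. F j (y $ j)) y :> (\<chi> j. F' j (y $ j) * (\<Prod>k\<in>UNIV - {j}. F k (y $ k)))"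
proof -
  have "((\<lambda>y. F j (y $ j)) has_derivative (\<lambda>h. F' j (y $ j) * h $ j)) (at y)" for j
  proof -
    have "((\<lambda>y. y $ j) has_derivative (\<lambda>h. h $ j)) (at y)"
      by (rule bounded_linear_imp_has_derivative[OF bounded_linear_vec_nth])
    from has_derivative_compose[OF this assms[of j, unfolded has_field_derivative_def]]
    show ?thesis by simp
  qed
  then have "((\<lambda>y. \<Prod>j\<in>UNIV. F j (y $ j)) has_derivative
      (\<lambda>h. \<Sum>j\<in>UNIV. (F' j (y $ j) * h $ j) * (\<Prod>k\<in>UNIV - {j}. F k (y $ k)))) (at y)"
    by (intro has_derivative_prod)
  moreover have "(\<lambda>h. \<Sum>j\<in>UNIV. (F' j (y $ j) * h $ j) * (\<Prod>k\<in>UNIV - {j}. F k (y $ k))) =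
      (\<lambda>h. h \<bullet> (\<chi> j. F' j (y $ j) * (\<Prod>k\<in>UNIV - {j}. F k (y $ k))))"
    by (simp add: fun_eq_iff inner_vec_def mult_ac)
  ultimately show ?thesis by (simp add: gderiv_def)
qed

lemma One_nth: "(\<Sum>b\<in>Basis. (b::real^'n) $ j) = 1"
proof -
  have "(\<Sum>b\<in>Basis. (1::real) *\<^sub>R b) \<bullet> (axis j 1 :: real^'n) = 1"
    by (rule inner_sum_left_Basis) simp
  then show ?thesis by (simp add: inner_axis)
qed

text \<open>Neither centred nor normalised. It lives on the cube of side \<open>h\<close> with
  lowest corner \<open>x\<close>, the shape for which the differentiation theorem is applied below;
  the normalisation \<open>h ^ d\<close> is written out where it occurs.\<close>

definition mollifier :: "real \<Rightarrow> real^'n::finite \<Rightarrow> real^'n \<Rightarrow> real" where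
  "mollifier h x y = (\<Prod>j\<in>UNIV. bump ((y $ j - x $ j) / h))"

lemma mollifier_nonneg: "0 \<le> mollifier h x y"
  by (simp add: mollifier_def prod_nonneg bump_nonneg)

lemma mollifier_le_1: "mollifier h x y \<le> 1"
  by (simp add: mollifier_def prod_le_1 bump_nonneg bump_le_1)

lemma mollifier_zero:
  assumes "h > 0" "y \<notin> box x (x + h *\<^sub>R One)" shows "mollifier h x y = 0"
proof -
  obtain j where "\<not> (x $ j < y $ j \<and> y $ j < x $ j + h)"
    using assms(2) by (auto simp: box_vec_eq One_nth)
  then have "bump ((y $ j - x $ j) / h) = 0"
    using assms(1) by (intro bump_zero) (auto simp: field_simps)
  then show ?thesis by (auto simp: mollifier_def)
qed

lemma borel_measurable_bump[measurable]: "bump \<in> borel_measurable borel"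
  by (rule borel_measurable_continuous_onI[OF continuous_bump])

lemma borel_measurable_vec_nth[measurable]: "(\<lambda>x::real^'n. x $ j) \<in> borel_measurable borel"
  by (intro borel_measurable_continuous_onI continuous_intros)

lemma borel_measurable_mollifier[measurable (raw)]:
  assumes [measurable]: "f \<in> borel_measurable M" "g \<in> borel_measurable M"
  shows "(\<lambda>p. mollifier h (f p) (g p)) \<in> borel_measurable M"
  unfolding mollifier_def by measurable

text \<open>The normalising constant. Its value is never computed; it matters that it is positive
  and finite.\<close>

definition mollifier_mass :: "'n::finite itself \<Rightarrow> ennreal" where
  "mollifier_mass _ = (\<integral>\<^sup>+w. ennreal (mollifier 1 (0::real^'n) w) \<partial>lborel)"

lemma nn_integral_lborel_affine:
  fixes f :: "'a::euclidean_space \<Rightarrow> ennreal"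
  assumes [measurable]: "f \<in> borel_measurable borel" and c: "c \<noteq> 0"
  shows "(\<integral>\<^sup>+x. f x \<partial>lborel) = ennreal (\<bar>c\<bar> ^ DIM('a)) * (\<integral>\<^sup>+x. f (t + c *\<^sub>R x) \<partial>lborel)"
  by (subst lborel_affine[OF c, of t])
     (simp add: nn_integral_density nn_integral_distr nn_integral_cmult)

lemma nn_integral_mollifier_right:
  fixes x :: "real^'n::finite"
  assumes "h > 0"
  shows "(\<integral>\<^sup>+y. ennreal (mollifier h x y) \<partial>lborel) = ennreal (h ^ CARD('n)) * mollifier_mass TYPE('n)"
  unfolding mollifier_mass_def
  using assms by (subst nn_integral_lborel_affine[of _ h x]) (simp_all add: mollifier_def)

lemma nn_integral_mollifier_left:
  fixes y :: "real^'n::finite"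
  assumes "h > 0"
  shows "(\<integral>\<^sup>+x. ennreal (mollifier h x y) \<partial>lborel) = ennreal (h ^ CARD('n)) * mollifier_mass TYPE('n)"
  unfolding mollifier_mass_def
  using assms by (subst nn_integral_lborel_affine[of _ "-h" y]) (simp_all add: mollifier_def)

lemma mollifier_mass_finite: "mollifier_mass TYPE('n::finite) < \<infinity>"
proof -
  have "mollifier_mass TYPE('n) \<le> (\<integral>\<^sup>+w. indicator (box (0::real^'n) One) w \<partial>lborel)"
    unfolding mollifier_mass_def
    by (intro nn_integral_mono)
      (use mollifier_zero[of 1 _ "0::real^'n"] in \<open>auto simp: indicator_def mollifier_le_1\<close>)
  also have "\<dots> < \<infinity>"
    using emeasure_lborel_box_finite[of "0::real^'n" One] by (simp add: less_top[symmetric])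
  finally show ?thesis .
qed

lemma mollifier_mass_pos: "0 < mollifier_mass TYPE('n::finite)"
proof (rule ccontr)
  assume "\<not> ?thesis"
  then have "AE w in lborel. ennreal (mollifier 1 (0::real^'n) w) = 0"
    by (subst (asm) not_gr_zero) (simp add: mollifier_mass_def nn_integral_0_iff_AE)
  then have "AE w in lborel. w \<notin> box (0::real^'n) One"
  proof eventually_elim
    case (elim w)
    have "0 < mollifier 1 (0::real^'n) w" if "w \<in> box 0 One"
      using that unfolding mollifier_def by (intro prod_pos) (auto simp: box_vec_eq One_nth intro!: bump_pos)
    with elim show ?case by force
  qed
  then have "emeasure lborel (box (0::real^'n) One) = 0"
    by (subst (asm) AE_iff_measurable[where N="box (0::real^'n) One"]) simp_all
  then show False by (simp add: emeasure_lborel_box_eq)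
qed

lemma ennreal_norm_integral_le:
  fixes f :: "'a \<Rightarrow> 'b::{banach, second_countable_topology}"
  shows "ennreal (norm (integral\<^sup>L M f)) \<le> (\<integral>\<^sup>+x. ennreal (norm (f x)) \<partial>M)"
  by (cases "integrable M f") (simp_all add: integral_norm_bound_ennreal not_integrable_integral_eq)

lemma sigma_finite_radon:
  fixes \<mu> :: "'a::euclidean_space measure"
  assumes s: "sets \<mu> = sets borel" and c: "\<And>K. compact K \<Longrightarrow> emeasure \<mu> K < \<infinity>"
  shows "sigma_finite_measure \<mu>"
proof (rule sigma_finite_measure.intro, intro exI conjI ballI)
  let ?A = "range (\<lambda>n. cball (0::'a) (real n))"
  show "countable ?A" by simp
  show "?A \<subseteq> sets \<mu>" by (auto simp: s)
  have "x \<in> \<Union>?A" for x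
    using real_arch_simple[of "norm x"] by auto
  then show "\<Union>?A = space \<mu>" using sets_eq_imp_space_eq[OF s] by auto
  show "emeasure \<mu> a \<noteq> \<infinity>" if "a \<in> ?A" for a
    using that c[of a] by (auto simp: less_top)
qed

lemma bump_deriv_zero: "s \<notin> {0<..<1} \<Longrightarrow> bump_deriv s = 0"
  by (auto simp: bump_deriv_def max_def)

lemma prod_eq_0I:
  fixes f :: "'b \<Rightarrow> 'c::comm_semiring_1"
  shows "finite A \<Longrightarrow> a \<in> A \<Longrightarrow> f a = 0 \<Longrightarrow> prod f A = 0"
  by (metis prod_zero)

lemma mollifier_glue:
  "mollifier h (glue i t s) y = bump ((y $ i - s) / h) * (\<Prod>k\<in>UNIV - {i}. bump ((y $ k - t k) / h))"
  unfolding mollifier_def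
  by (subst prod.remove[of UNIV i]) (auto simp: glue_def intro!: prod.cong)

text \<open>Up to the factor \<open>h\<close>, the difference of the two mollified values is the
  integral over \<open>E\<close> of a partial derivative. In direction \<open>e_i\<close> the bump
  is replaced by a difference of its primitives, a plateau whose derivative is the difference of two
  bumps. Gauss-Green bounds the integral by that of the test function against \<open>\<mu>\<close>,
  and up to scaling the plateau is the integral of the bump over base points in
  \<open>{p..q}\<close>.\<close>

lemma slice_variation:
  fixes E :: "(real^'n::finite) set"
  assumes gg: "gauss_green E \<mu> \<nu>" and h: "h > 0" and pq: "p \<le> q"
  shows "ennreal \<bar>(LINT y:E|lebesgue. mollifier h (glue i t q) y) - (LINT y:E|lebesgue. mollifier h (glue i t p) y)\<bar> \<le>
    (\<integral>\<^sup>+y. (\<integral>\<^sup>+s\<in>{p..q}. ennreal (mollifier h (glue i t s) y) \<partial>lborel) \<partial>\<mu>)"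
proof -
  have E: "E \<in> sets lebesgue" and s\<mu>[measurable_cong]: "sets \<mu> = sets borel" and [measurable]: "\<nu> \<in> borel_measurable borel"
    and nu: "AE x in \<mu>. norm (\<nu> x) = 1"
    and ibp: "\<And>\<phi> g. (\<forall>x. GDERIV \<phi> x :> g x) \<and> continuous_on UNIV g \<and> compact (closure {x. \<phi> x \<noteq> 0}) \<Longrightarrow>
        (LINT x:E|lebesgue. g x) = - (LINT x|\<mu>. \<phi> x *\<^sub>R \<nu> x)"
    using gg unfolding gauss_green_def by blast+
  define F where "F j s = (if j = i then bump_primitive ((s - p) / h) - bump_primitive ((s - q) / h) else bump ((s - t j) / h))" for j s
  define F' where "F' j s = (if j = i then (bump ((s - p) / h) - bump ((s - q) / h)) / h else bump_deriv ((s - t j) / h) / h)" for j s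
  define \<phi> where "\<phi> y = (\<Prod>j\<in>UNIV. F j (y $ j))" for y :: "real^'n"
  define G where "G y = (\<chi> j. F' j (y $ j) * (\<Prod>k\<in>UNIV - {j}. F k (y $ k)))" for y :: "real^'n"
  have DF: "(F j has_real_derivative F' j s) (at s)" for j s
  proof -
    have D: "((\<lambda>s. (s - c) / h) has_real_derivative 1 / h) (at s)" for c
      using h by (auto intro!: derivative_eq_intros)
    show ?thesis
    proof (cases "j = i")
      case True
      then show ?thesis
        using DERIV_diff[OF DERIV_chain2[OF DERIV_bump_primitive D[of p]] DERIV_chain2[OF DERIV_bump_primitive D[of q]]]
        by (simp add: F_def[abs_def] F'_def diff_divide_distrib)
    next
      case False
      then show ?thesis
        using DERIV_chain2[OF DERIV_bump D[of "t j"]] by (simp add: F_def[abs_def] F'_def)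
    qed
  qed
  have grad: "GDERIV \<phi> y :> G y" for y
    unfolding \<phi>_def G_def by (rule GDERIV_prod_vec) (rule DF)
  have Fc: "continuous_on UNIV (F j)" for j
    using DF DERIV_isCont by (blast intro: continuous_at_imp_continuous_on)
  have F'c: "continuous_on UNIV (F' j)" for j
  proof -
    have "continuous_on UNIV (\<lambda>s. bump_deriv ((s - c) / h) / h)" for c
      using h by (intro continuous_intros continuous_on_compose2[OF continuous_bump_deriv]) auto
    moreover have "continuous_on UNIV (\<lambda>s. (bump ((s - p) / h) - bump ((s - q) / h)) / h)"
      using h by (intro continuous_intros continuous_on_compose2[OF continuous_bump]) auto
    ultimately show ?thesis by (cases "j = i") (simp_all add: F'_def[abs_def])
  qed
  have Gc: "continuous_on UNIV G"
    unfolding G_def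
    by (intro continuous_on_vec_lambda continuous_on_mult continuous_on_prod
        continuous_on_compose2[OF Fc] continuous_on_compose2[OF F'c] continuous_on_component continuous_on_id) auto
  \<comment> \<open>A bump based at \<open>c\<close> is supported in \<open>{c..c + h}\<close>,
    hence the asymmetric margins of the box outside which \<open>\<phi>\<close> and \<open>G\<close>
    vanish.\<close>
  define lo where "lo = (\<chi> j. if j = i then p else t j)"
  define hi where "hi = (\<chi> j. if j = i then q + h else t j + h)"
  have Fz: "F j s = 0 \<and> F' j s = 0" if "s < lo $ j \<or> hi $ j < s" for j s
  proof (cases "j = i")
    case True
    from that consider "s < p" | "q + h < s" using True by (auto simp: lo_def hi_def)
    then show ?thesis
    proof cases
      case 1
      then have "(s - p) / h \<le> 0" "(s - q) / h \<le> 0" using h pq by (auto simp: divide_le_0_iff)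
      with True show ?thesis
        by (simp add: F_def F'_def bump_primitive_neg[of "(s - p) / h"] bump_primitive_neg[of "(s - q) / h"] bump_zero)
    next
      case 2
      then have "(s - p) / h \<ge> 1" "(s - q) / h \<ge> 1" using h pq by (auto simp: field_simps)
      with True show ?thesis
        by (simp add: F_def F'_def bump_primitive_ge[of "(s - p) / h"] bump_primitive_ge[of "(s - q) / h"] bump_zero)
    qed
  next
    case False
    then have "(s - t j) / h \<notin> {0<..<1}" using that h by (auto simp: lo_def hi_def field_simps)
    with False show ?thesis by (simp add: F_def F'_def bump_zero bump_deriv_zero)
  qed
  have out: "\<phi> y = 0 \<and> G y = 0" if "y \<notin> cbox lo hi" for y
  proof -
    have "\<exists>j0. y $ j0 < lo $ j0 \<or> hi $ j0 < y $ j0"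
    proof (rule ccontr)
      assume "\<nexists>j0. y $ j0 < lo $ j0 \<or> hi $ j0 < y $ j0"
      then have "y \<in> cbox lo hi" by (simp add: cbox_vec_eq not_less)
      with that show False by simp
    qed
    then obtain j0 where "y $ j0 < lo $ j0 \<or> hi $ j0 < y $ j0" by blast
    from Fz[OF this] have z: "F j0 (y $ j0) = 0" "F' j0 (y $ j0) = 0" by auto
    have "\<phi> y = 0" unfolding \<phi>_def by (rule prod_eq_0I[of _ j0]) (use z in auto)
    moreover have "G y $ j = 0" for j
    proof (cases "j = j0")
      case False
      then have "(\<Prod>k\<in>UNIV - {j}. F k (y $ k)) = 0" by (intro prod_eq_0I[of _ j0]) (use z in auto)
      then show ?thesis by (simp add: G_def)
    qed (simp add: G_def z)
    ultimately show ?thesis by (simp add: vec_eq_iff)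
  qed
  have "{x. \<phi> x \<noteq> 0} \<subseteq> cbox lo hi" using out by blast
  then have "compact (closure {x. \<phi> x \<noteq> 0})"
    by (meson bounded_cbox bounded_subset compact_closure)
  with grad Gc have eq: "(LINT x:E|lebesgue. G x) = - (LINT x|\<mu>. \<phi> x *\<^sub>R \<nu> x)" by (intro ibp) auto
  have "integrable lborel (\<lambda>y. indicator (cbox lo hi) y *\<^sub>R G y)"
    by (rule borel_integrable_compact) (use Gc in \<open>auto intro: continuous_on_subset\<close>)
  also have "(\<lambda>y. indicator (cbox lo hi) y *\<^sub>R G y) = G"
    using out by (auto simp: fun_eq_iff indicator_def)
  finally have "integrable lebesgue G"
    using borel_measurable_continuous_onI[OF Gc] by (simp add: integrable_completion)
  then have intG: "integrable lebesgue (\<lambda>y. indicator E y *\<^sub>R G y)"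
    using E by (rule integrable_mult_indicator[rotated])
  have Gi: "G y $ i = (mollifier h (glue i t p) y - mollifier h (glue i t q) y) / h" for y
  proof -
    have "(\<Prod>k\<in>UNIV - {i}. F k (y $ k)) = (\<Prod>k\<in>UNIV - {i}. bump ((y $ k - t k) / h))"
      by (rule prod.cong) (auto simp: F_def)
    then show ?thesis by (simp add: G_def F'_def mollifier_glue algebra_simps diff_divide_distrib)
  qed
  have intm: "integrable lebesgue (\<lambda>y. indicator E y * mollifier h x y)" for x :: "real^'n"
  proof -
    have "integrable lborel (\<lambda>y. mollifier h x y)"
      using nn_integral_mollifier_right[OF h, of x] mollifier_mass_finite
      by (intro integrableI_nonneg) (auto simp: mollifier_nonneg ennreal_mult_less_top)
    then have "integrable lebesgue (\<lambda>y. mollifier h x y)" by (simp add: integrable_completion)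
    then show ?thesis using integrable_mult_indicator[OF E, of "mollifier h x"] by simp
  qed
  let ?U = "\<lambda>s. LINT y:E|lebesgue. mollifier h (glue i t s) y"
  have "(LINT x:E|lebesgue. G x) $ i = (LINT y|lebesgue. (indicator E y *\<^sub>R G y) $ i)"
    unfolding set_lebesgue_integral_def
    by (rule integral_bounded_linear[OF bounded_linear_vec_nth intG, symmetric])
  also have "\<dots> = (LINT y|lebesgue. (indicator E y * mollifier h (glue i t p) y - indicator E y * mollifier h (glue i t q) y) / h)"
    by (rule Bochner_Integration.integral_cong) (simp_all add: Gi algebra_simps)
  also have "\<dots> = (?U p - ?U q) / h"
    using intm by (simp add: set_lebesgue_integral_def)
  finally have Ui: "(LINT x:E|lebesgue. G x) $ i = (?U p - ?U q) / h" .
  have "\<bar>?U q - ?U p\<bar> = h * \<bar>(LINT x:E|lebesgue. G x) $ i\<bar>"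
    unfolding Ui using h by (simp add: abs_minus_commute)
  also have "\<dots> \<le> h * norm (LINT x|\<mu>. \<phi> x *\<^sub>R \<nu> x)"
    using h component_le_norm_cart[of "LINT x:E|lebesgue. G x" i] by (simp add: eq)
  finally have "ennreal \<bar>?U q - ?U p\<bar> \<le> ennreal h * ennreal (norm (LINT x|\<mu>. \<phi> x *\<^sub>R \<nu> x))"
    using h by (simp add: ennreal_mult[symmetric] ennreal_leI)
  also have "\<dots> \<le> ennreal h * (\<integral>\<^sup>+x. ennreal (norm (\<phi> x *\<^sub>R \<nu> x)) \<partial>\<mu>)"
    by (intro mult_left_mono ennreal_norm_integral_le) simp
  also have "\<dots> = (\<integral>\<^sup>+x. ennreal h * ennreal (norm (\<phi> x *\<^sub>R \<nu> x)) \<partial>\<mu>)"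
  proof (rule nn_integral_cmult[symmetric])
    have "continuous_on UNIV \<phi>"
      unfolding \<phi>_def by (intro continuous_on_prod continuous_on_compose2[OF Fc] continuous_on_component continuous_on_id) auto
    then have [measurable]: "\<phi> \<in> borel_measurable borel" by (rule borel_measurable_continuous_onI)
    show "(\<lambda>x. ennreal (norm (\<phi> x *\<^sub>R \<nu> x))) \<in> borel_measurable \<mu>" by measurable
  qed
  also have "\<dots> = (\<integral>\<^sup>+y. (\<integral>\<^sup>+s\<in>{p..q}. ennreal (mollifier h (glue i t s) y) \<partial>lborel) \<partial>\<mu>)"
  proof (rule nn_integral_cong_AE)
    show "AE y in \<mu>. ennreal h * ennreal (norm (\<phi> y *\<^sub>R \<nu> y)) =
        (\<integral>\<^sup>+s\<in>{p..q}. ennreal (mollifier h (glue i t s) y) \<partial>lborel)"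
      using nu
    proof eventually_elim
    case (elim y)
    let ?P = "\<Prod>k\<in>UNIV - {i}. bump ((y $ k - t k) / h)"
    have P0: "0 \<le> ?P" by (simp add: prod_nonneg bump_nonneg)
    have "\<phi> y = F i (y $ i) * (\<Prod>k\<in>UNIV - {i}. F k (y $ k))"
      unfolding \<phi>_def by (rule prod.remove) auto
    also have "(\<Prod>k\<in>UNIV - {i}. F k (y $ k)) = ?P"
      by (rule prod.cong) (auto simp: F_def)
    finally have \<phi>y: "\<phi> y = (bump_primitive ((y $ i - p) / h) - bump_primitive ((y $ i - q) / h)) * ?P"
      by (simp add: F_def)
    have mono: "bump_primitive ((y $ i - q) / h) \<le> bump_primitive ((y $ i - p) / h)"
      using pq h by (intro bump_primitive_mono divide_right_mono) auto
    have "(\<integral>\<^sup>+s\<in>{p..q}. ennreal (mollifier h (glue i t s) y) \<partial>lborel) =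
        (\<integral>\<^sup>+s. ennreal (h * ?P) * (ennreal (bump ((y $ i - s) / h) / h) * indicator {p..q} s) \<partial>lborel)"
      using h P0 bump_nonneg
      by (intro nn_integral_cong) (auto simp: mollifier_glue ennreal_mult[symmetric] indicator_def mult_ac)
    also have "\<dots> = ennreal (h * ?P) * (\<integral>\<^sup>+s. ennreal (bump ((y $ i - s) / h) / h) * indicator {p..q} s \<partial>lborel)"
      by (rule nn_integral_cmult) measurable
    \<comment> \<open>The integration runs over the base point \<open>s\<close>, which enters with a
      minus sign; the antiderivative in \<open>s\<close> is therefore minus the primitive of the
      bump.\<close>
    also have "(\<integral>\<^sup>+s. ennreal (bump ((y $ i - s) / h) / h) * indicator {p..q} s \<partial>lborel) =
        ennreal (- bump_primitive ((y $ i - q) / h) - (- bump_primitive ((y $ i - p) / h)))"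
    proof (rule nn_integral_FTC_Icc[OF _ _ _ pq])
      fix s
      have "((\<lambda>s. (y $ i - s) / h) has_real_derivative - (1 / h)) (at s)"
        using h by (auto intro!: derivative_eq_intros)
      from DERIV_minus[OF DERIV_chain2[OF DERIV_bump_primitive this]]
      show "((\<lambda>s. - bump_primitive ((y $ i - s) / h)) has_real_derivative bump ((y $ i - s) / h) / h) (at s)"
        by simp
      show "0 \<le> bump ((y $ i - s) / h) / h" using h by (simp add: bump_nonneg)
    qed measurable
    finally have 1: "(\<integral>\<^sup>+s\<in>{p..q}. ennreal (mollifier h (glue i t s) y) \<partial>lborel) = ennreal (h * \<phi> y)"
      using mono P0 h by (simp add: \<phi>y ennreal_mult[symmetric] mult_ac)
    have "0 \<le> \<phi> y" using mono P0 by (simp add: \<phi>y)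
    then show ?case
      using h elim unfolding 1 by (simp add: ennreal_mult)
    qed
  qed
  finally show ?thesis .
qed

text \<open>At almost every \<open>x\<close> the fraction of the small cube above \<open>x\<close>
  filled by \<open>E\<close> tends to 0 or 1. The mollifier is at most 1 and supported in this cube,
  so its deviation from the limit is at most the measure of the part of the cube in the wrong
  phase.\<close>

lemma mollification_converges_AE:
  fixes E :: "(real^'n::finite) set"
  assumes E: "E \<in> sets lebesgue"
  shows "AE x in lborel. (\<lambda>n. real (Suc n) ^ CARD('n) * (LINT y:E|lebesgue. mollifier (1 / real (Suc n)) x y))
     \<longlonglongrightarrow> indicator E x * enn2real (mollifier_mass TYPE('n))"
proof -
  let ?D = "CARD('n)" and ?c = "enn2real (mollifier_mass TYPE('n))"
  have lm: "E \<inter> cbox a b \<in> lmeasurable" for a b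
    using E by (intro bounded_set_imp_lmeasurable) auto
  have "indicat_real E integrable_on cbox a b" for a b
    using lm[of a b] by (simp add: lmeasurable_iff_integrable_on integrable_on_indicator)
  from integrable_ccontinuous_explicit[OF this] obtain N where N: "negligible N"
    and lim: "\<And>x e. \<lbrakk>x \<notin> N; 0 < e\<rbrakk> \<Longrightarrow> \<exists>d>0. \<forall>h. 0 < h \<and> h < d \<longrightarrow>
        norm (integral (cbox x (x + h *\<^sub>R One)) (indicat_real E) /\<^sub>R h ^ DIM(real^'n) - indicat_real E x) < e"
    by blast
  have bound: "\<bar>(LINT y:E|lebesgue. mollifier h x y) / h ^ ?D - indicator E x * ?c\<bar> \<le>
      norm (integral (cbox x (x + h *\<^sub>R One)) (indicat_real E) /\<^sub>R h ^ DIM(real^'n) - indicat_real E x)"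
    if h: "h > 0" for h and x :: "real^'n"
  proof -
    let ?B = "cbox x (x + h *\<^sub>R One)"
    let ?m = "measure lebesgue (E \<inter> ?B)"
    have int: "integral ?B (indicat_real E) = ?m" using lm by (rule integral_indicator)
    have im: "integrable lebesgue (\<lambda>y. mollifier h x y)"
    proof -
      have "integrable lborel (\<lambda>y. mollifier h x y)"
        using nn_integral_mollifier_right[OF h, of x] mollifier_mass_finite
        by (intro integrableI_nonneg) (auto simp: mollifier_nonneg ennreal_mult_less_top)
      then show ?thesis by (simp add: integrable_completion)
    qed
    have tot: "(LINT y|lebesgue. mollifier h x y) = h ^ ?D * ?c"
    proof -
      have "(LINT y|lebesgue. mollifier h x y) = (LINT y|lborel. mollifier h x y)"
        by (rule integral_completion) measurable
      also have "\<dots> = enn2real (\<integral>\<^sup>+y. ennreal (mollifier h x y) \<partial>lborel)"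
        by (rule integral_eq_nn_integral) (auto simp: mollifier_nonneg)
      also have "\<dots> = h ^ ?D * ?c"
        using h by (simp add: nn_integral_mollifier_right[OF h] enn2real_mult)
      finally show ?thesis .
    qed
    have part: "0 \<le> (LINT y:A|lebesgue. mollifier h x y) \<and> (LINT y:A|lebesgue. mollifier h x y) \<le> measure lebesgue (A \<inter> ?B)"
      if A: "A \<in> sets lebesgue" for A
    proof
      have lmA: "A \<inter> ?B \<in> lmeasurable" using A by (intro bounded_set_imp_lmeasurable) auto
      show "0 \<le> (LINT y:A|lebesgue. mollifier h x y)"
        unfolding set_lebesgue_integral_def by (intro integral_nonneg_AE AE_I2) (simp add: mollifier_nonneg)
      have "(LINT y:A|lebesgue. mollifier h x y) \<le> (LINT y|lebesgue. indicat_real (A \<inter> ?B) y)"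
        unfolding set_lebesgue_integral_def
      proof (rule integral_mono)
        show "integrable lebesgue (\<lambda>y. indicat_real A y *\<^sub>R mollifier h x y)"
          by (rule integrable_mult_indicator[OF A im])
        show "integrable lebesgue (indicat_real (A \<inter> ?B))"
          using lmA by (simp add: lmeasurable_iff_integrable)
        show "indicat_real A y *\<^sub>R mollifier h x y \<le> indicat_real (A \<inter> ?B) y" for y
          using mollifier_zero[OF h, of y x] mollifier_le_1[of h x y] subsetD[OF box_subset_cbox, of y x "x + h *\<^sub>R One"]
          by (cases "y \<in> box x (x + h *\<^sub>R One)") (auto simp: indicator_def)
      qed
      then show "(LINT y:A|lebesgue. mollifier h x y) \<le> measure lebesgue (A \<inter> ?B)" by simp
    qed
    have "x \<in> ?B" using h by (simp add: cbox_vec_eq One_nth)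
    then have "?B \<noteq> {}" by blast
    then have mB: "measure lebesgue ?B = h ^ ?D"
      using h by (simp add: content_cbox_cart One_nth)
    have E': "- E \<in> sets lebesgue" using E by (metis Compl_in_sets_lebesgue)
    \<comment> \<open>For \<open>x\<close> in \<open>E\<close> the estimate is applied to the
      complement, whose share is the total mass minus that of \<open>E\<close>.\<close>
    have split: "(LINT y:E|lebesgue. mollifier h x y) + (LINT y:-E|lebesgue. mollifier h x y) = h ^ ?D * ?c"
    proof -
      have "(LINT y:E \<union> - E|lebesgue. mollifier h x y) = (LINT y:E|lebesgue. mollifier h x y) + (LINT y:-E|lebesgue. mollifier h x y)"
        by (rule set_integral_Un) (use integrable_mult_indicator[OF E im] integrable_mult_indicator[OF E' im] in \<open>auto simp: set_integrable_def\<close>)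
      then show ?thesis using tot by (simp add: set_lebesgue_integral_def)
    qed
    have msplit: "measure lebesgue (- E \<inter> ?B) = h ^ ?D - ?m"
    proof -
      have "- E \<inter> ?B = ?B - (E \<inter> ?B)" by auto
      then show ?thesis using lm[of x "x + h *\<^sub>R One"] mB
        by (simp add: measurable_measure_Diff fmeasurableD)
    qed
    have hD: "h ^ ?D > 0" using h by simp
    show ?thesis
    proof (cases "x \<in> E")
      case True
      have "\<bar>(LINT y:E|lebesgue. mollifier h x y) - h ^ ?D * ?c\<bar> \<le> \<bar>?m - h ^ ?D\<bar>"
        using split part[OF E'] msplit by linarith
      then have "\<bar>(LINT y:E|lebesgue. mollifier h x y) - h ^ ?D * ?c\<bar> / h ^ ?D \<le> \<bar>?m - h ^ ?D * 1\<bar> / h ^ ?D"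
        using hD by (simp add: divide_right_mono)
      moreover have "\<bar>u - h ^ ?D * v\<bar> / h ^ ?D = \<bar>u / h ^ ?D - v\<bar>" for u v
      proof -
        have "u / h ^ ?D - v = (u - h ^ ?D * v) / h ^ ?D" using h by (simp add: diff_divide_distrib)
        then show ?thesis using hD by (simp add: abs_divide)
      qed
      ultimately have "\<bar>(LINT y:E|lebesgue. mollifier h x y) / h ^ ?D - ?c\<bar> \<le> \<bar>?m / h ^ ?D - 1\<bar>" by (simp only:)
      then show ?thesis using True unfolding int by (simp add: divide_inverse mult.commute)
    next
      case False
      have "\<bar>(LINT y:E|lebesgue. mollifier h x y)\<bar> / h ^ ?D \<le> \<bar>?m\<bar> / h ^ ?D"
        using part[OF E] hD by (intro divide_right_mono) auto
      then show ?thesis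
        using False hD unfolding int by (simp add: divide_inverse abs_mult mult_ac)
    qed
  qed
  have "AE x in lborel. x \<notin> N"
    using AE_not_in[OF N[unfolded negligible_iff_null_sets]] by (simp only: AE_completion_iff)
  then show ?thesis
  proof eventually_elim
    case (elim x)
    show ?case
    proof (rule LIMSEQ_I)
      fix e :: real assume "e > 0"
      from lim[OF elim this] obtain d where d: "d > 0" "\<And>h. 0 < h \<and> h < d \<Longrightarrow>
        norm (integral (cbox x (x + h *\<^sub>R One)) (indicat_real E) /\<^sub>R h ^ DIM(real^'n) - indicat_real E x) < e" by blast
      from reals_Archimedean[OF d(1)] obtain n0 where n0: "inverse (real (Suc n0)) < d" by blast
      show "\<exists>no. \<forall>n\<ge>no. norm (real (Suc n) ^ ?D * (LINT y:E|lebesgue. mollifier (1 / real (Suc n)) x y) - indicat_real E x * ?c) < e"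
      proof (intro exI allI impI)
        fix n assume "n0 \<le> n"
        then have "inverse (real (Suc n)) \<le> inverse (real (Suc n0))" by (intro le_imp_inverse_le) auto
        with n0 have "1 / real (Suc n) < d" by (simp only: inverse_eq_divide)
        then have h: "0 < 1 / real (Suc n)" "1 / real (Suc n) < d" by simp_all
        have "real (Suc n) ^ ?D * (LINT y:E|lebesgue. mollifier (1 / real (Suc n)) x y) =
            (LINT y:E|lebesgue. mollifier (1 / real (Suc n)) x y) / (1 / real (Suc n)) ^ ?D"
          by (simp add: power_divide)
        with bound[OF h(1), of x] d(2)[of "1 / real (Suc n)"] h
        show "norm (real (Suc n) ^ ?D * (LINT y:E|lebesgue. mollifier (1 / real (Suc n)) x y) - indicat_real E x * ?c) < e"
          by simp
      qed
    qed
  qed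
qed

lemma measurable_glue_fst[measurable]: "(\<lambda>t. glue i t s) \<in> perp_borel i \<rightarrow>\<^sub>M borel"
  using measurable_compose[OF measurable_Pair2'[of s lborel "perp_borel i"] measurable_glue] by simp

lemma measurable_glue_snd[measurable]: "(\<lambda>s. glue i t s) \<in> borel \<rightarrow>\<^sub>M borel"
proof (rule borel_measurable_vecI)
  show "(\<lambda>s. glue i t s $ j) \<in> borel_measurable borel" for j
    by (cases "j = i") (simp_all add: glue_def)
qed

text \<open>Near a boundary point neither the set nor its complement is null, so each contains a
  point with any property that holds almost everywhere; the property will be convergence of the
  mollifications.\<close>

lemma ess_boundary_good_points:
  assumes s: "s \<in> ess_boundary S" and r: "r > 0" and good: "AE y in lborel. P y"
  obtains p q where "s - r < p" "p < s + r" "s - r < q" "q < s + r" "p \<in> S" "q \<notin> S" "P p" "P q"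
proof -
  have "s - r < s" "s < s + r" using r by auto
  with s have n: "\<not> (AE y in lborel. s - r < y \<and> y < s + r \<longrightarrow> y \<in> S)" "\<not> (AE y in lborel. s - r < y \<and> y < s + r \<longrightarrow> y \<notin> S)"
    unfolding ess_boundary_def by blast+
  have "\<exists>p. P p \<and> s - r < p \<and> p < s + r \<and> p \<in> S"
  proof (rule ccontr)
    assume *: "\<nexists>p. P p \<and> s - r < p \<and> p < s + r \<and> p \<in> S"
    have "AE y in lborel. s - r < y \<and> y < s + r \<longrightarrow> y \<notin> S"
      using good by eventually_elim (use * in blast)
    with n show False by simp
  qed
  moreover have "\<exists>p. P p \<and> s - r < p \<and> p < s + r \<and> p \<notin> S"
  proof (rule ccontr)
    assume *: "\<nexists>p. P p \<and> s - r < p \<and> p < s + r \<and> p \<notin> S"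
    have "AE y in lborel. s - r < y \<and> y < s + r \<longrightarrow> y \<in> S"
      using good by eventually_elim (use * in blast)
    with n show False by simp
  qed
  ultimately show thesis using that by blast
qed

lemma finite_separation:
  fixes F :: "real set"
  assumes "finite F" "F \<subseteq> {a<..<b}"
  obtains r where "r > 0" "\<And>s. s \<in> F \<Longrightarrow> a \<le> s - r \<and> s + r \<le> b"
    "\<And>s s'. s \<in> F \<Longrightarrow> s' \<in> F \<Longrightarrow> s \<noteq> s' \<Longrightarrow> {s - r<..<s + r} \<inter> {s' - r<..<s' + r} = {}"
proof -
  have "\<exists>d>0. \<forall>x\<in>F. \<forall>y\<in>F. x \<noteq> y \<longrightarrow> d \<le> dist x y"
    using assms(1)
  proof induction
    case (insert u F)
    then obtain d where d: "d > 0" "\<forall>x\<in>F. \<forall>y\<in>F. x \<noteq> y \<longrightarrow> d \<le> dist x y" by blast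
    obtain d' where d': "d' > 0" "\<forall>x\<in>F. x \<noteq> u \<longrightarrow> d' \<le> dist u x"
      using finite_set_avoid[OF insert(1), of u] by blast
    have "\<forall>x\<in>insert u F. \<forall>y\<in>insert u F. x \<noteq> y \<longrightarrow> min d d' \<le> dist x y"
      using d(2) d'(2) by (auto simp: min_le_iff_disj dist_commute)
    with d(1) d'(1) show ?case by (intro exI[of _ "min d d'"]) auto
  qed (auto intro: exI[of _ 1])
  then obtain d where d: "d > 0" "\<And>x y. x \<in> F \<Longrightarrow> y \<in> F \<Longrightarrow> x \<noteq> y \<Longrightarrow> d \<le> dist x y" by blast
  obtain da where da: "da > 0" "\<forall>x\<in>F. x \<noteq> a \<longrightarrow> da \<le> dist a x" using finite_set_avoid[OF assms(1), of a] by blast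
  obtain db where db: "db > 0" "\<forall>x\<in>F. x \<noteq> b \<longrightarrow> db \<le> dist b x" using finite_set_avoid[OF assms(1), of b] by blast
  define r where "r = min (d / 2) (min da db)"
  show thesis
  proof (rule that[of r])
    show "r > 0" using d da db by (simp add: r_def)
    show "a \<le> s - r \<and> s + r \<le> b" if "s \<in> F" for s
    proof -
      have "a < s" "s < b" using that assms(2) by auto
      with da(2) db(2) that have "da \<le> s - a" "db \<le> b - s" by (force simp: dist_real_def)+
      then show ?thesis by (auto simp: r_def min_def)
    qed
    show "{s - r<..<s + r} \<inter> {s' - r<..<s' + r} = {}" if "s \<in> F" "s' \<in> F" "s \<noteq> s'" for s s'
    proof -
      have "d \<le> \<bar>s - s'\<bar>" using d(2)[OF that] by (simp add: dist_real_def)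
      moreover have "2 * r \<le> d" by (auto simp: r_def)
      ultimately show ?thesis by auto
    qed
  qed
qed

text \<open>Each boundary point of a slice forces the mollified slices to vary by almost
  \<open>c\<close> over a small interval, and disjoint intervals add up. Integrated over the slices,
  the variation is at most \<open>c\<close> times the perimeter of a slightly larger cube, and Fatou
  passes to the limit. The bound is for finite subsets of the boundary and not for its cardinality,
  which would be 0 for an infinite set.\<close>

theorem finite_perimeter_slices:
  fixes E :: "(real^'n::finite) set" and i :: 'n
  assumes lfp: "locally_finite_perimeter E" and R: "R > 0"
  obtains g where "g \<in> borel_measurable (perp_borel i)"
    "(\<integral>\<^sup>+t\<in>{t. \<forall>j. j \<noteq> i \<longrightarrow> \<bar>t j\<bar> \<le> R}. g t \<partial>perp_borel i) < \<infinity>"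
    "AE t in perp_borel i. (\<forall>j. j \<noteq> i \<longrightarrow> \<bar>t j\<bar> \<le> R) \<longrightarrow>
       (\<forall>F. finite F \<longrightarrow> F \<subseteq> ess_boundary (slice i E t) \<inter> {-R<..<R} \<longrightarrow> of_nat (card F) \<le> g t)"
proof -
  obtain \<mu> \<nu> where gg: "gauss_green E \<mu> \<nu>" using lfp by (auto simp: locally_finite_perimeter_def)
  then have E: "E \<in> sets lebesgue" and s\<mu>[measurable_cong]: "sets \<mu> = sets borel"
    and fin: "\<And>K. compact K \<Longrightarrow> emeasure \<mu> K < \<infinity>"
    unfolding gauss_green_def by blast+
  interpret \<mu>: sigma_finite_measure \<mu> by (rule sigma_finite_radon[OF s\<mu> fin])
  interpret pair: pair_sigma_finite \<mu> "lborel :: real measure"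
    by (rule pair_sigma_finite.intro[OF \<mu>.sigma_finite_measure_axioms sigma_finite_lborel])
  interpret pairn: pair_sigma_finite \<mu> "lborel :: (real^'n) measure"
    by (rule pair_sigma_finite.intro[OF \<mu>.sigma_finite_measure_axioms sigma_finite_lborel])
  let ?D = "CARD('n)"
  define c where "c = enn2real (mollifier_mass TYPE('n))"
  have c: "mollifier_mass TYPE('n) = ennreal c" "c > 0"
    using mollifier_mass_finite[where 'n='n] mollifier_mass_pos[where 'n='n]
    by (auto simp: c_def enn2real_positive_iff)
  define h where "h n = 1 / real (Suc n)" for n
  have h: "h n > 0" for n by (simp add: h_def)
  have h1: "h n \<le> 1" for n by (simp add: h_def)
  \<comment> \<open>The prefactor gives the mollifier the mass \<open>c\<close> for every scale.
    \<open>V n t\<close> bounds the variation of the \<open>n\<close>-th mollified slice over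
    \<open>{-R..R}\<close>.\<close>
  define W where "W n x = ennreal (real (Suc n) ^ ?D) * (\<integral>\<^sup>+y. ennreal (mollifier (h n) x y) \<partial>\<mu>)" for n x
  define V where "V n t = (\<integral>\<^sup>+s. W n (glue i t s) * indicator {-R..R} s \<partial>lborel)" for n t
  define K where "K = cbox ((\<chi> j. -R) :: real^'n) (\<chi> j. R)"
  define K1 where "K1 = cbox ((\<chi> j. -R - 1) :: real^'n) (\<chi> j. R + 1)"
  have Wm[measurable]: "W n \<in> borel_measurable borel" for n
  proof -
    have "(\<lambda>x. \<integral>\<^sup>+y. ennreal (mollifier (h n) x y) \<partial>\<mu>) \<in> borel_measurable borel"
      by (rule \<mu>.borel_measurable_nn_integral) measurable
    then show ?thesis unfolding W_def by measurable
  qed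
  have Vm[measurable]: "V n \<in> borel_measurable (perp_borel i)" for n
    unfolding V_def by measurable
  define g where "g t = liminf (\<lambda>n. V n t) / ennreal c" for t
  let ?T = "{t. \<forall>j. j \<noteq> i \<longrightarrow> \<bar>t j\<bar> \<le> R}"
  have indK: "indicator {t. \<forall>j. j \<noteq> i \<longrightarrow> \<bar>t j\<bar> \<le> R} t * indicator {-R..R} s = (indicator K (glue i t s) :: ennreal)" for t s
    using R by (auto simp: indicator_def K_def cbox_vec_eq glue_def abs_le_iff)
      (metis minus_le_iff abs_le_iff)+
  have Tm: "(\<lambda>t. indicator ?T t :: ennreal) \<in> borel_measurable (perp_borel i)"
  proof -
    have "(\<lambda>t. indicator K (glue i t 0) :: ennreal) \<in> borel_measurable (perp_borel i)"
      by (rule measurable_compose[OF measurable_glue_fst]) (simp add: K_def)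
    then show ?thesis using R unfolding indK[symmetric] by (simp add: indicator_def)
  qed
  \<comment> \<open>Integrating in \<open>x\<close> first leaves the mass \<open>c\<close> for each
    \<open>y\<close>, and only \<open>y\<close> at distance at most 1 from \<open>K\<close> in each
    coordinate contribute because \<open>h n \<le> 1\<close>; hence the larger cube
    \<open>K1\<close>.\<close>
  have bound: "(\<integral>\<^sup>+t. V n t * indicator ?T t \<partial>perp_borel i) \<le> ennreal c * emeasure \<mu> K1" for n
  proof -
    have "(\<integral>\<^sup>+t. V n t * indicator ?T t \<partial>perp_borel i) =
        (\<integral>\<^sup>+t. \<integral>\<^sup>+s. W n (glue i t s) * indicator K (glue i t s) \<partial>lborel \<partial>perp_borel i)"
      unfolding V_def
      by (intro nn_integral_cong, subst nn_integral_multc[symmetric], measurable)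
         (auto intro!: nn_integral_cong simp: indK[symmetric] mult_ac)
    also have "\<dots> = (\<integral>\<^sup>+x. W n x * indicator K x \<partial>lborel)"
      by (rule nn_integral_glue[symmetric]) (simp add: K_def)
    also have "\<dots> = (\<integral>\<^sup>+x. \<integral>\<^sup>+y. ennreal (real (Suc n) ^ ?D) * (ennreal (mollifier (h n) x y) * indicator K x) \<partial>\<mu> \<partial>lborel)"
      unfolding W_def
      by (intro nn_integral_cong) (simp add: nn_integral_cmult nn_integral_multc mult.assoc)
    also have "\<dots> = (\<integral>\<^sup>+y. \<integral>\<^sup>+x. ennreal (real (Suc n) ^ ?D) * (ennreal (mollifier (h n) x y) * indicator K x) \<partial>lborel \<partial>\<mu>)"
      by (rule pairn.Fubini') (simp add: K_def split_beta')
    also have "\<dots> \<le> (\<integral>\<^sup>+y. ennreal c * indicator K1 y \<partial>\<mu>)"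
    proof (rule nn_integral_mono)
      fix y :: "real^'n"
      have "(\<integral>\<^sup>+x. ennreal (real (Suc n) ^ ?D) * (ennreal (mollifier (h n) x y) * indicator K x) \<partial>lborel) \<le>
          (\<integral>\<^sup>+x. ennreal (real (Suc n) ^ ?D) * (ennreal (mollifier (h n) x y) * indicator K1 y) \<partial>lborel)"
      proof (rule nn_integral_mono, rule mult_left_mono)
        fix x
        show "ennreal (mollifier (h n) x y) * indicator K x \<le> ennreal (mollifier (h n) x y) * indicator K1 y"
        proof (cases "y \<in> box x (x + h n *\<^sub>R One)")
          case True
          have "y \<in> K1" if "x \<in> K"
            unfolding K1_def cbox_vec_eq
          proof (intro CollectI allI)
            fix j
            have "x $ j < y $ j \<and> y $ j < x $ j + h n" using True by (simp add: box_vec_eq One_nth)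
            moreover have "- R \<le> x $ j \<and> x $ j \<le> R" using that by (simp add: K_def cbox_vec_eq)
            ultimately show "(\<chi> j. - R - 1) $ j \<le> y $ j \<and> y $ j \<le> (\<chi> j. R + 1) $ j" using h1[of n] by simp
          qed
          then show ?thesis by (auto simp: indicator_def)
        qed (simp add: mollifier_zero[OF h])
      qed simp
      also have "\<dots> = ennreal (real (Suc n) ^ ?D) * ((ennreal (h n ^ ?D) * ennreal c) * indicator K1 y)"
        by (simp add: nn_integral_cmult nn_integral_multc nn_integral_mollifier_left[OF h] c(1))
      also have "\<dots> = ennreal c * indicator K1 y"
      proof -
        have "real (Suc n) ^ ?D * h n ^ ?D = 1" by (simp add: h_def power_divide)
        then have "ennreal (real (Suc n) ^ ?D) * ennreal (h n ^ ?D) = 1"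
          using h[of n] by (simp add: ennreal_mult[symmetric] del: of_nat_Suc)
        then show ?thesis by (simp add: mult.assoc[symmetric])
      qed
      finally show "(\<integral>\<^sup>+x. ennreal (real (Suc n) ^ ?D) * (ennreal (mollifier (h n) x y) * indicator K x) \<partial>lborel) \<le>
        ennreal c * indicator K1 y" .
    qed
    also have "\<dots> = ennreal c * emeasure \<mu> K1"
      by (simp add: nn_integral_cmult_indicator K1_def s\<mu>)
    finally show ?thesis .
  qed
  show thesis
  proof (rule that[of g])
    show gm: "g \<in> borel_measurable (perp_borel i)" unfolding g_def by measurable
    have "(\<integral>\<^sup>+t. g t * indicator ?T t \<partial>perp_borel i) =
        (\<integral>\<^sup>+t. liminf (\<lambda>n. V n t * indicator ?T t) / ennreal c \<partial>perp_borel i)"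
      by (rule nn_integral_cong) (simp add: g_def indicator_def Liminf_const)
    also have "\<dots> = (\<integral>\<^sup>+t. liminf (\<lambda>n. V n t * indicator ?T t) \<partial>perp_borel i) / ennreal c"
      by (rule nn_integral_divide) (use Tm in measurable)
    also have "(\<integral>\<^sup>+t. liminf (\<lambda>n. V n t * indicator ?T t) \<partial>perp_borel i) \<le>
        liminf (\<lambda>n. \<integral>\<^sup>+t. V n t * indicator ?T t \<partial>perp_borel i)"
      by (rule nn_integral_liminf) (use Tm in measurable)
    also have "\<dots> \<le> ennreal c * emeasure \<mu> K1"
      by (rule order_trans[OF Liminf_mono Liminf_const[THEN eq_refl]]) (use bound in auto)
    finally have "(\<integral>\<^sup>+t. g t * indicator ?T t \<partial>perp_borel i) \<le> (ennreal c * emeasure \<mu> K1) / ennreal c"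
      by (simp add: divide_right_mono_ennreal)
    also have "\<dots> < \<infinity>"
      using c(2) fin[of K1] by (simp add: K1_def ennreal_mult_less_top ennreal_divide_eq_top_iff less_top[symmetric] ennreal_mult_eq_top_iff)
    finally show "(\<integral>\<^sup>+t\<in>?T. g t \<partial>perp_borel i) < \<infinity>" .
    define U where "U n x = real (Suc n) ^ ?D * (LINT y:E|lebesgue. mollifier (h n) x y)" for n x
    have conv: "AE x in lborel. (\<lambda>n. U n x) \<longlonglongrightarrow> indicator E x * c"
      using mollification_converges_AE[OF E] unfolding U_def h_def c_def .
    show "AE t in perp_borel i. (\<forall>j. j \<noteq> i \<longrightarrow> \<bar>t j\<bar> \<le> R) \<longrightarrow>
       (\<forall>F. finite F \<longrightarrow> F \<subseteq> ess_boundary (slice i E t) \<inter> {-R<..<R} \<longrightarrow> of_nat (card F) \<le> g t)"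
      using AE_glue[OF conv, of i]
    proof eventually_elim
      case (elim t)
      show ?case
      proof (intro impI allI)
        fix F assume F: "finite F" "F \<subseteq> ess_boundary (slice i E t) \<inter> {-R<..<R}"
        then have "F \<subseteq> {-R<..<R}" by auto
        from finite_separation[OF F(1) this] obtain r where r: "r > 0" "\<And>s. s \<in> F \<Longrightarrow> -R \<le> s - r \<and> s + r \<le> R"
          "\<And>s s'. s \<in> F \<Longrightarrow> s' \<in> F \<Longrightarrow> s \<noteq> s' \<Longrightarrow> {s - r<..<s + r} \<inter> {s' - r<..<s' + r} = {}"
          by blast
        have "\<exists>p q. s - r < p \<and> p < s + r \<and> s - r < q \<and> q < s + r \<and> p \<in> slice i E t \<and> q \<notin> slice i E t \<and>
            (\<lambda>n. U n (glue i t p)) \<longlonglongrightarrow> indicator E (glue i t p) * c \<and> (\<lambda>n. U n (glue i t q)) \<longlonglongrightarrow> indicator E (glue i t q) * c"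
          if "s \<in> F" for s
          using ess_boundary_good_points[of s "slice i E t" r, OF _ r(1) elim] F(2) that by blast
        then obtain p q where pq: "\<And>s. s \<in> F \<Longrightarrow> s - r < p s \<and> p s < s + r \<and> s - r < q s \<and> q s < s + r \<and> p s \<in> slice i E t \<and> q s \<notin> slice i E t \<and>
            (\<lambda>n. U n (glue i t (p s))) \<longlonglongrightarrow> indicator E (glue i t (p s)) * c \<and> (\<lambda>n. U n (glue i t (q s))) \<longlonglongrightarrow> indicator E (glue i t (q s)) * c"
          by metis
        have var: "ennreal \<bar>U n (glue i t b) - U n (glue i t a)\<bar> \<le> (\<integral>\<^sup>+s. W n (glue i t s) * indicator {a..b} s \<partial>lborel)"
          if "a \<le> b" for n a b
        proof -
          have "ennreal \<bar>U n (glue i t b) - U n (glue i t a)\<bar> = ennreal (real (Suc n) ^ ?D) *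
              ennreal \<bar>(LINT y:E|lebesgue. mollifier (h n) (glue i t b) y) - (LINT y:E|lebesgue. mollifier (h n) (glue i t a) y)\<bar>"
            by (simp add: U_def ennreal_mult[symmetric] abs_mult right_diff_distrib[symmetric] del: of_nat_Suc)
          also have "\<dots> \<le> ennreal (real (Suc n) ^ ?D) * (\<integral>\<^sup>+y. (\<integral>\<^sup>+s\<in>{a..b}. ennreal (mollifier (h n) (glue i t s) y) \<partial>lborel) \<partial>\<mu>)"
            by (intro mult_left_mono slice_variation[OF gg h that]) simp
          also have "(\<integral>\<^sup>+y. (\<integral>\<^sup>+s\<in>{a..b}. ennreal (mollifier (h n) (glue i t s) y) \<partial>lborel) \<partial>\<mu>) =
              (\<integral>\<^sup>+s. (\<integral>\<^sup>+y. ennreal (mollifier (h n) (glue i t s) y) * indicator {a..b} s \<partial>\<mu>) \<partial>lborel)"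
            by (rule pair.Fubini'[symmetric]) (simp add: split_beta' mollifier_glue)
          also have "ennreal (real (Suc n) ^ ?D) * \<dots> = (\<integral>\<^sup>+s. W n (glue i t s) * indicator {a..b} s \<partial>lborel)"
            unfolding W_def
            by (subst nn_integral_cmult[symmetric])
              (simp_all add: nn_integral_multc mult.assoc mollifier_glue)
          finally show ?thesis .
        qed
        have le: "ennreal (\<Sum>s\<in>F. \<bar>U n (glue i t (p s)) - U n (glue i t (q s))\<bar>) \<le> V n t" for n
        proof -
          define a b where "a s = min (p s) (q s)" and "b s = max (p s) (q s)" for s
          have ab: "s - r < a s" "a s \<le> b s" "b s < s + r" if "s \<in> F" for s using pq[OF that] by (auto simp: a_def b_def)
          have "ennreal (\<Sum>s\<in>F. \<bar>U n (glue i t (p s)) - U n (glue i t (q s))\<bar>) =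
              (\<Sum>s\<in>F. ennreal \<bar>U n (glue i t (b s)) - U n (glue i t (a s))\<bar>)"
            by (subst sum_ennreal) (auto intro!: sum.cong simp: a_def b_def min_def max_def abs_minus_commute)
          also have "\<dots> \<le> (\<Sum>s\<in>F. \<integral>\<^sup>+u. W n (glue i t u) * indicator {a s..b s} u \<partial>lborel)"
            by (intro sum_mono var ab)
          also have "\<dots> = (\<integral>\<^sup>+u. (\<Sum>s\<in>F. W n (glue i t u) * indicator {a s..b s} u) \<partial>lborel)"
            by (rule nn_integral_sum[symmetric]) (simp add: W_def mollifier_glue)
          also have "\<dots> \<le> (\<integral>\<^sup>+u. W n (glue i t u) * indicator {-R..R} u \<partial>lborel)"
          proof (rule nn_integral_mono)
            fix u
            have "(\<Sum>s\<in>F. indicator {a s..b s} u :: ennreal) = indicator (\<Union>s\<in>F. {a s..b s}) u"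
            proof (rule indicator_UN_disjoint[symmetric, OF F(1)])
              show "disjoint_family_on (\<lambda>s. {a s..b s}) F"
                unfolding disjoint_family_on_def
              proof (intro ballI impI)
                fix s s' assume s: "s \<in> F" "s' \<in> F" "s \<noteq> s'"
                have "{a s..b s} \<subseteq> {s - r<..<s + r}" "{a s'..b s'} \<subseteq> {s' - r<..<s' + r}"
                  using ab[OF s(1)] ab[OF s(2)] by auto
                with r(3)[OF s] show "{a s..b s} \<inter> {a s'..b s'} = {}" by blast
              qed
            qed
            also have "\<dots> \<le> indicator {-R..R} u"
            proof -
              have "(\<Union>s\<in>F. {a s..b s}) \<subseteq> {-R..R}" using ab r(2) by fastforce
              then have "u \<in> {-R..R}" if "u \<in> (\<Union>s\<in>F. {a s..b s})" using that by (rule subsetD)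
              then show ?thesis by (cases "u \<in> (\<Union>s\<in>F. {a s..b s})") (simp_all del: UN_iff atLeastAtMost_iff)
            qed
            finally show "(\<Sum>s\<in>F. W n (glue i t u) * indicator {a s..b s} u) \<le> W n (glue i t u) * indicator {-R..R} u"
              by (simp add: sum_distrib_left[symmetric] mult_left_mono)
          qed
          finally show ?thesis unfolding V_def .
        qed
        \<comment> \<open>The limit is \<open>c\<close> at \<open>p s\<close>, a point of the slice,
          and 0 at \<open>q s\<close>, a point outside it, so every boundary point contributes
          exactly \<open>c\<close>.\<close>
        have "(\<lambda>n. \<Sum>s\<in>F. \<bar>U n (glue i t (p s)) - U n (glue i t (q s))\<bar>) \<longlonglongrightarrow>
            (\<Sum>s\<in>F. \<bar>indicator E (glue i t (p s)) * c - indicator E (glue i t (q s)) * c\<bar>)"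
          using pq by (intro tendsto_intros) auto
        also have "(\<Sum>s\<in>F. \<bar>indicator E (glue i t (p s)) * c - indicator E (glue i t (q s)) * c\<bar>) = (\<Sum>s\<in>F. c)"
          by (rule sum.cong) (use pq c(2) in \<open>auto simp: slice_def\<close>)
        finally have "(\<lambda>n. ennreal (\<Sum>s\<in>F. \<bar>U n (glue i t (p s)) - U n (glue i t (q s))\<bar>)) \<longlonglongrightarrow> ennreal (real (card F) * c)"
          by (simp add: tendsto_ennrealI)
        then have "liminf (\<lambda>n. ennreal (\<Sum>s\<in>F. \<bar>U n (glue i t (p s)) - U n (glue i t (q s))\<bar>)) = ennreal (real (card F) * c)"
          by (rule lim_imp_Liminf[rotated]) simp
        moreover have "liminf (\<lambda>n. ennreal (\<Sum>s\<in>F. \<bar>U n (glue i t (p s)) - U n (glue i t (q s))\<bar>)) \<le> liminf (\<lambda>n. V n t)"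
          by (intro Liminf_mono always_eventually allI le)
        ultimately have "ennreal (real (card F) * c) \<le> liminf (\<lambda>n. V n t)" by simp
        then have "ennreal (real (card F) * c) / ennreal c \<le> g t"
          unfolding g_def by (rule divide_right_mono_ennreal)
        then show "of_nat (card F) \<le> g t"
          using c(2) by (simp add: divide_ennreal ennreal_of_nat_eq_real_of_nat)
      qed
    qed
  qed
qed

section \<open>The kernel and its moments\<close>

lemma nn_integral_inverse_powr_finite:
  fixes \<epsilon> a :: real
  assumes e: "\<epsilon> > 0" and a: "a > 1"
  shows "(\<integral>\<^sup>+s. ennreal (1 / (\<bar>s\<bar> + \<epsilon>) powr a) \<partial>lborel) < \<infinity>"
proof -
  let ?f = "\<lambda>s. ennreal (1 / (\<bar>s\<bar> + \<epsilon>) powr a)"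
  have half: "(\<integral>\<^sup>+s. ?f s * indicator {0..} s \<partial>lborel) < \<infinity>"
  proof -
    have "(\<integral>\<^sup>+s. ennreal ((s + \<epsilon>) powr (- a)) * indicator {0..} s \<partial>lborel) = ennreal (0 - (- (1 / (a - 1)) * (0 + \<epsilon>) powr (1 - a)))"
    proof (rule nn_integral_FTC_atLeast)
      fix s :: real assume "0 \<le> s"
      show "((\<lambda>s. - (1 / (a - 1)) * (s + \<epsilon>) powr (1 - a)) has_real_derivative (s + \<epsilon>) powr (- a)) (at s)"
      proof -
        have "((\<lambda>s. (s + \<epsilon>) powr (1 - a)) has_real_derivative (1 - a) * (s + \<epsilon>) powr (1 - a - 1)) (at s)"
          using e \<open>0 \<le> s\<close> by (auto intro!: derivative_eq_intros)
        from DERIV_cmult[OF this, of "- (1 / (a - 1))"] show ?thesis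
        proof (rule DERIV_cong)
          have "- (1 / (a - 1)) * (1 - a) = 1" using a by (simp add: field_simps)
          then show "- (1 / (a - 1)) * ((1 - a) * (s + \<epsilon>) powr (1 - a - 1)) = (s + \<epsilon>) powr - a"
            by (simp only: mult.assoc[symmetric]) simp
        qed
      qed
    next
      have "filterlim (\<lambda>s. s + \<epsilon>) at_top at_top"
        using filterlim_tendsto_add_at_top[OF tendsto_const filterlim_ident, of \<epsilon>] by (simp add: add.commute)
      then have "((\<lambda>s. (s + \<epsilon>) powr (1 - a)) \<longlongrightarrow> 0) at_top"
        using a by (intro tendsto_neg_powr) auto
      from tendsto_mult[OF tendsto_const[of "- (1 / (a - 1))"] this]
      show "((\<lambda>s. - (1 / (a - 1)) * (s + \<epsilon>) powr (1 - a)) \<longlongrightarrow> 0) at_top" by simp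
    qed auto
    also have "(\<integral>\<^sup>+s. ennreal ((s + \<epsilon>) powr (- a)) * indicator {0..} s \<partial>lborel) = (\<integral>\<^sup>+s. ?f s * indicator {0..} s \<partial>lborel)"
      by (rule nn_integral_cong) (auto simp: indicator_def powr_minus_divide)
    finally show ?thesis by simp
  qed
  have "(\<integral>\<^sup>+s. ?f s * indicator {..0} s \<partial>lborel) = (\<integral>\<^sup>+s. ?f s * indicator {0..} s \<partial>lborel)"
    by (subst nn_integral_real_affine[where c="-1" and t=0]) (auto intro!: nn_integral_cong simp: indicator_def)
  with half have half': "(\<integral>\<^sup>+s. ?f s * indicator {..0} s \<partial>lborel) < \<infinity>" by simp
  have "(\<integral>\<^sup>+s. ?f s \<partial>lborel) \<le> (\<integral>\<^sup>+s. ?f s * indicator {0..} s + ?f s * indicator {..0} s \<partial>lborel)"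
    by (rule nn_integral_mono) (auto simp: indicator_def)
  also have "\<dots> = (\<integral>\<^sup>+s. ?f s * indicator {0..} s \<partial>lborel) + (\<integral>\<^sup>+s. ?f s * indicator {..0} s \<partial>lborel)"
    by (rule nn_integral_add) auto
  also have "\<dots> < \<infinity>" using half half' by simp
  finally show ?thesis .
qed

text \<open>Each of the \<open>d\<close> factors \<open>|x_j| + \<epsilon>\<close> is at most the
  full sum plus \<open>\<epsilon>\<close>, and the exponents \<open>q / d\<close> add up to
  \<open>q\<close>. This reduces integrability in \<open>d\<close> variables to one variable, where
  the exponent exceeds 1 as soon as \<open>q > d\<close>.\<close>

lemma inverse_powr_prod_bound:
  fixes x :: "'n::finite \<Rightarrow> real"
  assumes e: "\<epsilon> > 0" and q: "q \<ge> 0"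
  shows "1 / ((\<Sum>j\<in>UNIV. \<bar>x j\<bar>) + \<epsilon>) powr q \<le> (\<Prod>j\<in>UNIV. 1 / (\<bar>x j\<bar> + \<epsilon>) powr (q / CARD('n)))"
proof -
  let ?S = "(\<Sum>j\<in>UNIV. \<bar>x j\<bar>) + \<epsilon>"
  have S: "?S > 0" using e by (intro add_nonneg_pos sum_nonneg) auto
  have "(\<Prod>j\<in>(UNIV::'n set). (\<bar>x j\<bar> + \<epsilon>) powr (q / CARD('n))) \<le> (\<Prod>j\<in>(UNIV::'n set). ?S powr (q / CARD('n)))"
    using e q by (intro prod_mono conjI powr_mono2 add_right_mono member_le_sum) auto
  also have "\<dots> = ?S powr q"
    using S by (simp add: powr_realpow[symmetric] powr_powr)
  finally have "(\<Prod>j\<in>(UNIV::'n set). (\<bar>x j\<bar> + \<epsilon>) powr (q / CARD('n))) \<le> ?S powr q" .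
  moreover have "0 < (\<Prod>j\<in>(UNIV::'n set). (\<bar>x j\<bar> + \<epsilon>) powr (q / CARD('n)))"
    using e by (intro prod_pos) (auto simp: add_nonneg_pos)
  ultimately have "1 / ?S powr q \<le> 1 / (\<Prod>j\<in>(UNIV::'n set). (\<bar>x j\<bar> + \<epsilon>) powr (q / CARD('n)))"
    by (intro divide_left_mono) (auto intro!: mult_pos_pos S)
  then show ?thesis by (simp add: prod_dividef)
qed

lemma nn_integral_perp_prod:
  assumes [measurable]: "\<And>j. f j \<in> borel_measurable borel"
  shows "(\<integral>\<^sup>+t. (\<Prod>j\<in>UNIV - {i}. f j (t j)) \<partial>perp_borel i) = (\<Prod>j\<in>UNIV - {i}. \<integral>\<^sup>+s. f j s \<partial>lborel)"
proof -
  interpret product_sigma_finite "\<lambda>_. lborel :: real measure" by standard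
  show ?thesis by (rule product_nn_integral_prod) auto
qed

lemma powr_prod_bound_glue_finite:
  fixes \<epsilon> q :: real and i :: "'n::finite"
  assumes e: "\<epsilon> > 0" and q: "q > CARD('n)"
  shows "(\<integral>\<^sup>+t. ennreal (\<Prod>j\<in>UNIV - {i}. 1 / (\<bar>t j\<bar> + \<epsilon>) powr (q / CARD('n))) \<partial>perp_borel i) < \<infinity>"
proof -
  have "(\<integral>\<^sup>+t. ennreal (\<Prod>j\<in>UNIV - {i}. 1 / (\<bar>t j\<bar> + \<epsilon>) powr (q / CARD('n))) \<partial>perp_borel i) =
     (\<integral>\<^sup>+t. (\<Prod>j\<in>UNIV - {i}. ennreal (1 / (\<bar>t j\<bar> + \<epsilon>) powr (q / CARD('n)))) \<partial>perp_borel i)"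
    by (simp add: prod_ennreal)
  also have "\<dots> = (\<Prod>j\<in>UNIV - {i}. \<integral>\<^sup>+s. ennreal (1 / (\<bar>s\<bar> + \<epsilon>) powr (q / CARD('n))) \<partial>lborel)"
    by (rule nn_integral_perp_prod) measurable
  also have "\<dots> < \<infinity>"
    using nn_integral_inverse_powr_finite[OF e, of "q / CARD('n)"] q
    by (simp add: power_less_top_ennreal)
  finally show ?thesis .
qed

lemma nn_integral_inverse_powr_vec_finite:
  fixes \<epsilon> q :: real
  assumes e: "\<epsilon> > 0" and q: "q > CARD('n::finite)"
  shows "(\<integral>\<^sup>+x. ennreal (1 / ((\<Sum>j\<in>UNIV. \<bar>(x::real^'n) $ j\<bar>) + \<epsilon>) powr q) \<partial>lborel) < \<infinity>"
proof -
  define i :: 'n where "i = undefined"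
  let ?g = "\<lambda>s. 1 / (\<bar>s\<bar> + \<epsilon>) powr (q / CARD('n))"
  have "(\<integral>\<^sup>+x. ennreal (1 / ((\<Sum>j\<in>UNIV. \<bar>(x::real^'n) $ j\<bar>) + \<epsilon>) powr q) \<partial>lborel) \<le>
      (\<integral>\<^sup>+x. ennreal (\<Prod>j\<in>UNIV. ?g ((x::real^'n) $ j)) \<partial>lborel)"
    using inverse_powr_prod_bound[OF e, of q] q by (intro nn_integral_mono ennreal_leI) auto
  also have "\<dots> = (\<integral>\<^sup>+t. \<integral>\<^sup>+s. ennreal (\<Prod>j\<in>UNIV. ?g (glue i t s $ j)) \<partial>lborel \<partial>perp_borel i)"
    by (rule nn_integral_glue) measurable
  also have "\<dots> = (\<integral>\<^sup>+t. \<integral>\<^sup>+s. ennreal (\<Prod>j\<in>UNIV - {i}. ?g (t j)) * ennreal (?g s) \<partial>lborel \<partial>perp_borel i)"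
  proof (intro nn_integral_cong)
    fix t s
    have "(\<Prod>j\<in>UNIV. ?g (glue i t s $ j)) = ?g (glue i t s $ i) * (\<Prod>j\<in>UNIV - {i}. ?g (glue i t s $ j))"
      by (rule prod.remove) auto
    also have "(\<Prod>j\<in>UNIV - {i}. ?g (glue i t s $ j)) = (\<Prod>j\<in>UNIV - {i}. ?g (t j))"
      by (rule prod.cong) (auto simp: glue_def)
    finally show "ennreal (\<Prod>j\<in>UNIV. ?g (glue i t s $ j)) = ennreal (\<Prod>j\<in>UNIV - {i}. ?g (t j)) * ennreal (?g s)"
      by (simp add: glue_def ennreal_mult[symmetric] prod_nonneg mult.commute)
  qed
  also have "\<dots> = (\<integral>\<^sup>+t. ennreal (\<Prod>j\<in>UNIV - {i}. ?g (t j)) * (\<integral>\<^sup>+s. ennreal (?g s) \<partial>lborel) \<partial>perp_borel i)"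
    by (intro nn_integral_cong nn_integral_cmult) measurable
  also have "\<dots> = (\<integral>\<^sup>+t. ennreal (\<Prod>j\<in>UNIV - {i}. ?g (t j)) \<partial>perp_borel i) * (\<integral>\<^sup>+s. ennreal (?g s) \<partial>lborel)"
  proof (rule nn_integral_multc)
    show "(\<lambda>t. ennreal (\<Prod>j\<in>UNIV - {i}. ?g (t j))) \<in> borel_measurable (perp_borel i)"
      by measurable
  qed
  also have "\<dots> < \<infinity>"
    using powr_prod_bound_glue_finite[OF e q, of i] nn_integral_inverse_powr_finite[OF e, of "q / CARD('n)"] q
    by (simp add: ennreal_mult_less_top)
  finally show ?thesis .
qed

section \<open>Integrability, moments and tails of the kernel\<close>

lemma kernel_nonneg: "0 \<le> kernel \<alpha> \<tau> \<zeta>"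
  by (simp add: kernel_def)

lemma borel_measurable_kernel[measurable (raw)]:
  assumes [measurable]: "f \<in> borel_measurable M"
  shows "(\<lambda>x. kernel \<alpha> \<tau> (f x)) \<in> borel_measurable M"
  unfolding kernel_def by measurable

lemma kernel_integrable:
  assumes "\<alpha> < 1" "\<tau> > 0"
  shows "(\<integral>\<^sup>+\<zeta>. ennreal (kernel \<alpha> \<tau> (\<zeta>::real^'n::finite)) \<partial>lborel) < \<infinity>"
  unfolding kernel_def by (rule nn_integral_inverse_powr_vec_finite) (use assms in auto)

text \<open>The weight costs one power of the kernel, and the remaining exponent
  \<open>d + 1 - \<alpha>\<close> still exceeds \<open>d\<close> because
  \<open>\<alpha> < 1\<close>.\<close>

lemma kernel_moment_finite:
  assumes "\<alpha> < 1" "\<tau> > 0"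
  shows "(\<integral>\<^sup>+\<zeta>. ennreal (\<bar>\<zeta> $ i\<bar> * kernel \<alpha> \<tau> (\<zeta>::real^'n::finite)) \<partial>lborel) < \<infinity>"
proof -
  let ?e = "\<tau> powr (1 / (1 - \<alpha>))"
  have e: "?e > 0" using assms by simp
  have "\<bar>\<zeta> $ i\<bar> * kernel \<alpha> \<tau> \<zeta> \<le> 1 / ((\<Sum>j\<in>UNIV. \<bar>\<zeta> $ j\<bar>) + ?e) powr (real CARD('n) + 1 - \<alpha>)" for \<zeta> :: "real^'n"
  proof -
    let ?S = "(\<Sum>j\<in>UNIV. \<bar>\<zeta> $ j\<bar>) + ?e"
    have S: "?S > 0" using e by (intro add_nonneg_pos sum_nonneg) auto
    have "\<bar>\<zeta> $ i\<bar> \<le> (\<Sum>j\<in>UNIV. \<bar>\<zeta> $ j\<bar>)" by (rule member_le_sum) auto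
    then have "\<bar>\<zeta> $ i\<bar> \<le> ?S" using e by linarith
    then have "\<bar>\<zeta> $ i\<bar> * kernel \<alpha> \<tau> \<zeta> \<le> ?S * kernel \<alpha> \<tau> \<zeta>"
      by (rule mult_right_mono[OF _ kernel_nonneg])
    also have "\<dots> = ?S powr 1 * ?S powr (- (real CARD('n) + 2 - \<alpha>))"
      using S unfolding kernel_def powr_minus_divide by simp
    also have "\<dots> = ?S powr (- (real CARD('n) + 1 - \<alpha>))"
      by (subst powr_add[symmetric]) (rule arg_cong[where f="\<lambda>x. ?S powr x"], simp)
    also have "\<dots> = 1 / ?S powr (real CARD('n) + 1 - \<alpha>)" by (rule powr_minus_divide)
    finally show ?thesis .
  qed
  then have "(\<integral>\<^sup>+\<zeta>. ennreal (\<bar>\<zeta> $ i\<bar> * kernel \<alpha> \<tau> (\<zeta>::real^'n)) \<partial>lborel) \<le>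
      (\<integral>\<^sup>+\<zeta>. ennreal (1 / ((\<Sum>j\<in>UNIV. \<bar>\<zeta> $ j\<bar>) + ?e) powr (real CARD('n) + 1 - \<alpha>)) \<partial>(lborel :: (real^'n) measure))"
    by (intro nn_integral_mono ennreal_leI)
  also have "\<dots> < \<infinity>"
    by (rule nn_integral_inverse_powr_vec_finite) (use assms e in auto)
  finally show ?thesis .
qed

lemma nn_kernel_hat_finite:
  fixes i :: "'n::finite"
  assumes "\<alpha> < 1" "\<tau> > 0"
  shows "(\<integral>\<^sup>+y. ennreal (kernel \<alpha> \<tau> (glue i y \<rho>)) \<partial>perp_borel i) < \<infinity>"
proof -
  let ?e = "\<tau> powr (1 / (1 - \<alpha>))" and ?q = "real CARD('n) + 2 - \<alpha>"
  have e: "?e > 0" using assms by simp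
  let ?g = "\<lambda>s. 1 / (\<bar>s\<bar> + ?e) powr (?q / CARD('n))"
  have "kernel \<alpha> \<tau> (glue i y \<rho>) \<le> ?g \<rho> * (\<Prod>j\<in>UNIV - {i}. ?g (y j))" for y
  proof -
    have "kernel \<alpha> \<tau> (glue i y \<rho>) \<le> (\<Prod>j\<in>UNIV. ?g (glue i y \<rho> $ j))"
      unfolding kernel_def using assms by (intro inverse_powr_prod_bound e) auto
    also have "\<dots> = ?g (glue i y \<rho> $ i) * (\<Prod>j\<in>UNIV - {i}. ?g (glue i y \<rho> $ j))"
      by (rule prod.remove) auto
    also have "(\<Prod>j\<in>UNIV - {i}. ?g (glue i y \<rho> $ j)) = (\<Prod>j\<in>UNIV - {i}. ?g (y j))"
      by (rule prod.cong) (auto simp: glue_def)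
    finally show ?thesis by (simp add: glue_def)
  qed
  then have "(\<integral>\<^sup>+y. ennreal (kernel \<alpha> \<tau> (glue i y \<rho>)) \<partial>perp_borel i) \<le>
      (\<integral>\<^sup>+y. ennreal (?g \<rho>) * ennreal (\<Prod>j\<in>UNIV - {i}. ?g (y j)) \<partial>perp_borel i)"
    by (intro nn_integral_mono) (simp add: ennreal_mult[symmetric] prod_nonneg)
  also have "\<dots> = ennreal (?g \<rho>) * (\<integral>\<^sup>+y. ennreal (\<Prod>j\<in>UNIV - {i}. ?g (y j)) \<partial>perp_borel i)"
    by (rule nn_integral_cmult) measurable
  also have "\<dots> < \<infinity>"
    using powr_prod_bound_glue_finite[OF e, of ?q i] assms by (simp add: ennreal_mult_less_top)
  finally show ?thesis .
qed

lemma ennreal_kernel_hat: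
  fixes i :: "'n::finite"
  assumes "\<alpha> < 1" "\<tau> > 0"
  shows "ennreal (kernel_hat i \<alpha> \<tau> \<rho>) = (\<integral>\<^sup>+y. ennreal (kernel \<alpha> \<tau> (glue i y \<rho>)) \<partial>perp_borel i)"
proof -
  have m: "(\<lambda>y. kernel \<alpha> \<tau> (glue i y \<rho>)) \<in> borel_measurable (perp_borel i)" by measurable
  have "kernel_hat i \<alpha> \<tau> \<rho> = (LINT y|perp_borel i. kernel \<alpha> \<tau> (glue i y \<rho>))"
    unfolding kernel_hat_def perp_lebesgue_def by (rule integral_completion[OF m])
  also have "ennreal \<dots> = (\<integral>\<^sup>+y. ennreal (kernel \<alpha> \<tau> (glue i y \<rho>)) \<partial>perp_borel i)"
    using nn_kernel_hat_finite[OF assms, of i \<rho>] m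
    by (intro nn_integral_eq_integral[symmetric] integrableI_nonneg) (auto simp: kernel_nonneg)
  finally show ?thesis .
qed

lemma kernel_hat_nonneg: "0 \<le> kernel_hat i \<alpha> \<tau> \<rho>"
  unfolding kernel_hat_def by (intro integral_nonneg_AE AE_I2 kernel_nonneg)

lemma borel_measurable_kernel_hat[measurable]:
  assumes "\<alpha> < 1" "\<tau> > 0"
  shows "kernel_hat i \<alpha> \<tau> \<in> borel_measurable borel"
proof -
  interpret pair_sigma_finite "perp_borel i" "lborel :: real measure" by (rule pair_sigma_finite_perp)
  have m: "(\<lambda>(\<rho>, y). ennreal (kernel \<alpha> \<tau> (glue i y \<rho>))) \<in> borel_measurable (lborel \<Otimes>\<^sub>M perp_borel i)"
  proof -
    have "(\<lambda>p. glue i (snd p) (fst p)) \<in> lborel \<Otimes>\<^sub>M perp_borel i \<rightarrow>\<^sub>M borel"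
      using measurable_compose[OF measurable_pair_swap' measurable_glue[of i]] by (simp add: split_beta')
    then show ?thesis by (simp add: split_beta')
  qed
  have "(\<lambda>\<rho>. \<integral>\<^sup>+y. ennreal (kernel \<alpha> \<tau> (glue i y \<rho>)) \<partial>perp_borel i) \<in> borel_measurable lborel"
    by (rule sigma_finite_measure.borel_measurable_nn_integral[OF sigma_finite_perp_borel m])
  then have "(\<lambda>\<rho>. enn2real (ennreal (kernel_hat i \<alpha> \<tau> \<rho>))) \<in> borel_measurable borel"
    unfolding ennreal_kernel_hat[OF assms] by measurable
  then show ?thesis by (simp add: kernel_hat_nonneg)
qed

lemma kernel_hat_even: "kernel_hat i \<alpha> \<tau> (- \<rho>) = kernel_hat i \<alpha> \<tau> \<rho>"
proof -
  have "kernel \<alpha> \<tau> (glue i y (- \<rho>)) = kernel \<alpha> \<tau> (glue i y \<rho>)" for y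
  proof -
    have "\<bar>glue i y (- \<rho>) $ j\<bar> = \<bar>glue i y \<rho> $ j\<bar>" for j by (simp add: glue_def)
    then show ?thesis by (simp add: kernel_def)
  qed
  then show ?thesis by (simp add: kernel_hat_def)
qed

text \<open>By symmetry this is the first moment over a half-line. In \<open>r_term\<close> one such
  moment will be set against each of the two gaps next to a boundary point.\<close>

definition kernel_moment :: "'n::finite \<Rightarrow> real \<Rightarrow> real \<Rightarrow> real" where
  "kernel_moment i \<alpha> \<tau> = (LINT \<rho>|lebesgue. \<bar>\<rho>\<bar> * kernel_hat i \<alpha> \<tau> \<rho>) / 2"

definition kernel_tail :: "'n::finite \<Rightarrow> real \<Rightarrow> real \<Rightarrow> real \<Rightarrow> ennreal" where
  "kernel_tail i \<alpha> \<tau> u = (\<integral>\<^sup>+\<rho>\<in>{u..}. ennreal (kernel_hat i \<alpha> \<tau> \<rho>) \<partial>lborel)"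

text \<open>Layer cake: \<open>\<rho>\<close> is the length of \<open>{0..\<rho>}\<close>, and
  exchanging the integrals turns the first moment into an integral of tails. The tail at
  \<open>u\<close> is what a point at distance \<open>u\<close> from the end of its gap can pay at
  most, so this form is comparable with the costs.\<close>

lemma
  fixes i :: "'n::finite"
  assumes a: "\<alpha> < 1" "\<tau> > 0"
  shows kernel_moment_eq: "ennreal (kernel_moment i \<alpha> \<tau>) = (\<integral>\<^sup>+u\<in>{0..}. kernel_tail i \<alpha> \<tau> u \<partial>lborel)"
    and kernel_moment_nonneg: "0 \<le> kernel_moment i \<alpha> \<tau>"
proof -
  note [measurable] = borel_measurable_kernel_hat[OF a, of i]
  let ?k = "kernel_hat i \<alpha> \<tau>"
  have "(\<integral>\<^sup>+\<rho>. ennreal (\<bar>\<rho>\<bar> * ?k \<rho>) \<partial>lborel) = (\<integral>\<^sup>+\<rho>. \<integral>\<^sup>+y. ennreal \<bar>\<rho>\<bar> * ennreal (kernel \<alpha> \<tau> (glue i y \<rho>)) \<partial>perp_borel i \<partial>lborel)"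
    by (intro nn_integral_cong, subst nn_integral_cmult)
      (simp_all add: ennreal_mult kernel_hat_nonneg ennreal_kernel_hat[OF a])
  also have "\<dots> = (\<integral>\<^sup>+\<rho>. \<integral>\<^sup>+y. (\<lambda>\<zeta>. ennreal (\<bar>\<zeta> $ i\<bar> * kernel \<alpha> \<tau> \<zeta>)) (glue i y \<rho>) \<partial>perp_borel i \<partial>lborel)"
    by (intro nn_integral_cong) (simp add: ennreal_mult kernel_nonneg glue_def)
  also have "\<dots> = (\<integral>\<^sup>+\<zeta>. ennreal (\<bar>\<zeta> $ i\<bar> * kernel \<alpha> \<tau> (\<zeta>::real^'n)) \<partial>lborel)"
    by (rule nn_integral_glue'[symmetric]) measurable
  finally have fin: "(\<integral>\<^sup>+\<rho>. ennreal (\<bar>\<rho>\<bar> * ?k \<rho>) \<partial>lborel) < \<infinity>"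
    using kernel_moment_finite[OF a, of i] by simp
  have "2 * kernel_moment i \<alpha> \<tau> = (LINT \<rho>|lborel. \<bar>\<rho>\<bar> * ?k \<rho>)"
    unfolding kernel_moment_def by (simp add: integral_completion)
  also have "ennreal \<dots> = (\<integral>\<^sup>+\<rho>. ennreal (\<bar>\<rho>\<bar> * ?k \<rho>) \<partial>lborel)"
    by (intro nn_integral_eq_integral[symmetric] integrableI_nonneg fin) (auto simp: kernel_hat_nonneg)
  finally have 1: "ennreal (2 * kernel_moment i \<alpha> \<tau>) = (\<integral>\<^sup>+\<rho>. ennreal (\<bar>\<rho>\<bar> * ?k \<rho>) \<partial>lborel)" .
  show nn: "0 \<le> kernel_moment i \<alpha> \<tau>"
    unfolding kernel_moment_def by (simp add: integral_nonneg_AE kernel_hat_nonneg)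
  have "(\<integral>\<^sup>+\<rho>. ennreal (\<bar>\<rho>\<bar> * ?k \<rho>) \<partial>lborel) =
      (\<integral>\<^sup>+\<rho>. ennreal (\<bar>\<rho>\<bar> * ?k \<rho>) * indicator {0..} \<rho> + ennreal (\<bar>\<rho>\<bar> * ?k \<rho>) * indicator {..0} \<rho> \<partial>lborel)"
    by (rule nn_integral_cong) (auto simp: indicator_def)
  also have "\<dots> = (\<integral>\<^sup>+\<rho>. ennreal (\<bar>\<rho>\<bar> * ?k \<rho>) * indicator {0..} \<rho> \<partial>lborel) + (\<integral>\<^sup>+\<rho>. ennreal (\<bar>\<rho>\<bar> * ?k \<rho>) * indicator {..0} \<rho> \<partial>lborel)"
    by (rule nn_integral_add) measurable
  also have "(\<integral>\<^sup>+\<rho>. ennreal (\<bar>\<rho>\<bar> * ?k \<rho>) * indicator {..0} \<rho> \<partial>lborel) = (\<integral>\<^sup>+\<rho>. ennreal (\<bar>\<rho>\<bar> * ?k \<rho>) * indicator {0..} \<rho> \<partial>lborel)"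
    by (subst nn_integral_real_affine[where c="-1" and t=0])
      (auto intro!: nn_integral_cong simp: indicator_def kernel_hat_even)
  finally have 2: "(\<integral>\<^sup>+\<rho>. ennreal (\<bar>\<rho>\<bar> * ?k \<rho>) \<partial>lborel) =
      (\<integral>\<^sup>+\<rho>. ennreal (\<bar>\<rho>\<bar> * ?k \<rho>) * indicator {0..} \<rho> \<partial>lborel) + (\<integral>\<^sup>+\<rho>. ennreal (\<bar>\<rho>\<bar> * ?k \<rho>) * indicator {0..} \<rho> \<partial>lborel)" .
  have "ennreal (2 * kernel_moment i \<alpha> \<tau>) = 2 * (\<integral>\<^sup>+\<rho>. ennreal (\<bar>\<rho>\<bar> * ?k \<rho>) * indicator {0..} \<rho> \<partial>lborel)"
    unfolding 1 2 by (rule mult_2[symmetric])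
  moreover have "ennreal (2 * kernel_moment i \<alpha> \<tau>) = 2 * ennreal (kernel_moment i \<alpha> \<tau>)"
    using nn by (simp add: ennreal_mult)
  ultimately have "2 * ennreal (kernel_moment i \<alpha> \<tau>) = 2 * (\<integral>\<^sup>+\<rho>. ennreal (\<bar>\<rho>\<bar> * ?k \<rho>) * indicator {0..} \<rho> \<partial>lborel)"
    by (simp only:)
  then have "ennreal (kernel_moment i \<alpha> \<tau>) = (\<integral>\<^sup>+\<rho>. ennreal (\<bar>\<rho>\<bar> * ?k \<rho>) * indicator {0..} \<rho> \<partial>lborel)"
    by (subst (asm) ennreal_mult_cancel_left) simp
  also have "\<dots> = (\<integral>\<^sup>+\<rho>. \<integral>\<^sup>+u. ennreal (?k \<rho>) * indicator {p. 0 \<le> fst p \<and> fst p \<le> snd p} (u, \<rho>) \<partial>lborel \<partial>lborel)"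
  proof (rule nn_integral_cong)
    fix \<rho> :: real
    have "(\<integral>\<^sup>+u. ennreal (?k \<rho>) * indicator {p. 0 \<le> fst p \<and> fst p \<le> snd p} (u, \<rho>) \<partial>lborel) =
        (\<integral>\<^sup>+u. ennreal (?k \<rho>) * indicator {0..\<rho>} u \<partial>lborel)"
      by (intro nn_integral_cong) (auto simp: indicator_def)
    also have "\<dots> = ennreal (?k \<rho>) * emeasure lborel {0..\<rho>}" by (rule nn_integral_cmult_indicator) simp
    also have "\<dots> = ennreal (\<bar>\<rho>\<bar> * ?k \<rho>) * indicator {0..} \<rho>"
      by (auto simp: indicator_def ennreal_mult[symmetric] kernel_hat_nonneg mult.commute)
    finally show "ennreal (\<bar>\<rho>\<bar> * ?k \<rho>) * indicator {0..} \<rho> =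
      (\<integral>\<^sup>+u. ennreal (?k \<rho>) * indicator {p. 0 \<le> fst p \<and> fst p \<le> snd p} (u, \<rho>) \<partial>lborel)" by simp
  qed
  also have "\<dots> = (\<integral>\<^sup>+u. \<integral>\<^sup>+\<rho>. ennreal (?k \<rho>) * indicator {p. 0 \<le> fst p \<and> fst p \<le> snd p} (u, \<rho>) \<partial>lborel \<partial>lborel)"
  proof -
    have "{p::real\<times>real. 0 \<le> fst p \<and> fst p \<le> snd p} \<in> sets borel"
      by (intro borel_closed closed_Collect_conj closed_Collect_le continuous_intros)
    then have [measurable]: "{p::real\<times>real. 0 \<le> fst p \<and> fst p \<le> snd p} \<in> sets (lborel \<Otimes>\<^sub>M lborel)"
      unfolding lborel_prod by simp
    show ?thesis
      by (rule lborel_pair.Fubini') measurable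
  qed
  also have "\<dots> = (\<integral>\<^sup>+u. kernel_tail i \<alpha> \<tau> u * indicator {0..} u \<partial>lborel)"
    unfolding kernel_tail_def
    by (intro nn_integral_cong, subst nn_integral_multc[symmetric], measurable)
      (auto intro!: nn_integral_cong simp: indicator_def)
  finally show "ennreal (kernel_moment i \<alpha> \<tau>) = (\<integral>\<^sup>+u\<in>{0..}. kernel_tail i \<alpha> \<tau> u \<partial>lborel)" .
qed

text \<open>On a cube of side \<open>H\<close> in the other coordinates, \<open>H\<close> being the
  base of the power in the claim, the base of the kernel is at most \<open>d * H\<close>, while the
  cube has volume \<open>H ^ (d - 1)\<close>; this accounts for the exponent
  \<open>3 - \<alpha>\<close>. The power of \<open>d\<close> is rounded up so that the constant does
  not depend on \<open>\<alpha>\<close>.\<close>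

lemma kernel_hat_lower_bound:
  fixes i :: "'n::finite"
  assumes a: "0 \<le> \<alpha>" "\<alpha> < 1" "\<tau> > 0"
  shows "1 / real CARD('n) ^ (CARD('n) + 2) * (\<bar>\<rho>\<bar> + \<tau> powr (1 / (1 - \<alpha>))) powr (- (3 - \<alpha>)) \<le> kernel_hat i \<alpha> \<tau> \<rho>"
proof -
  let ?d = "CARD('n)"
  define H where "H = \<bar>\<rho>\<bar> + \<tau> powr (1 / (1 - \<alpha>))"
  have H: "H > 0" using a by (simp add: H_def add_nonneg_pos)
  let ?p = "real ?d + 2 - \<alpha>"
  interpret finite_product_sigma_finite "\<lambda>_::'n. lborel :: real measure" "UNIV - {i}"
    by standard auto
  have d: "real ?d \<ge> 1" by (simp add: Suc_leI)
  define B where "B = Pi\<^sub>E (UNIV - {i}) (\<lambda>j. {0..H})"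
  have Bm: "B \<in> sets (perp_borel i)" unfolding B_def by (rule sets_PiM_I_finite) auto
  have "ennreal (1 / (real ?d * H) powr ?p) * emeasure (perp_borel i) B = (\<integral>\<^sup>+y. ennreal (1 / (real ?d * H) powr ?p) * indicator B y \<partial>perp_borel i)"
    using Bm by (simp add: nn_integral_cmult_indicator)
  also have "\<dots> \<le> (\<integral>\<^sup>+y. ennreal (kernel \<alpha> \<tau> (glue i y \<rho>)) \<partial>perp_borel i)"
  proof (rule nn_integral_mono)
    fix y :: "'n \<Rightarrow> real"
    show "ennreal (1 / (real ?d * H) powr ?p) * indicator B y \<le> ennreal (kernel \<alpha> \<tau> (glue i y \<rho>))"
    proof (cases "y \<in> B")
      case True
      have "(\<Sum>j\<in>UNIV. \<bar>glue i y \<rho> $ j\<bar>) = \<bar>glue i y \<rho> $ i\<bar> + (\<Sum>j\<in>UNIV - {i}. \<bar>glue i y \<rho> $ j\<bar>)"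
        by (rule sum.remove) auto
      also have "(\<Sum>j\<in>UNIV - {i}. \<bar>glue i y \<rho> $ j\<bar>) \<le> (\<Sum>j\<in>UNIV - {i}. H)"
        using True by (intro sum_mono) (auto simp: B_def glue_def PiE_iff)
      also have "\<bar>glue i y \<rho> $ i\<bar> + (\<Sum>j\<in>UNIV - {i}. H) = \<bar>\<rho>\<bar> + (real ?d - 1) * H"
        using d by (simp add: glue_def card_Diff_singleton of_nat_diff)
      finally have le: "(\<Sum>j\<in>UNIV. \<bar>glue i y \<rho> $ j\<bar>) + \<tau> powr (1 / (1 - \<alpha>)) \<le> real ?d * H"
        by (simp add: H_def algebra_simps)
      have pos: "0 < (\<Sum>j\<in>UNIV. \<bar>glue i y \<rho> $ j\<bar>) + \<tau> powr (1 / (1 - \<alpha>))"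
        using a by (intro add_nonneg_pos sum_nonneg) auto
      have "1 / (real ?d * H) powr ?p \<le> kernel \<alpha> \<tau> (glue i y \<rho>)"
        unfolding kernel_def using le pos a H d
        by (intro divide_left_mono powr_mono2) (auto intro!: mult_pos_pos)
      then show ?thesis using True by (simp add: ennreal_leI)
    qed simp
  qed
  also have "\<dots> = ennreal (kernel_hat i \<alpha> \<tau> \<rho>)" by (rule ennreal_kernel_hat[OF a(2,3), symmetric])
  also have "emeasure (perp_borel i) B = ennreal (H ^ (?d - 1))"
    using H unfolding B_def by (subst measure_times) (auto simp: card_Diff_singleton ennreal_power)
  finally have "1 / (real ?d * H) powr ?p * H ^ (?d - 1) \<le> kernel_hat i \<alpha> \<tau> \<rho>"
    using H kernel_hat_nonneg[of i \<alpha> \<tau> \<rho>] by (simp add: ennreal_mult[symmetric] ennreal_le_iff)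
  moreover have "1 / real ?d ^ (?d + 2) * H powr (- (3 - \<alpha>)) \<le> 1 / (real ?d * H) powr ?p * H ^ (?d - 1)"
  proof -
    have "real ?d powr ?p \<le> real ?d powr real (?d + 2)" using d a by (intro powr_mono) auto
    also have "\<dots> = real ?d ^ (?d + 2)" using d by (intro powr_realpow) auto
    finally have 1: "1 / real ?d ^ (?d + 2) \<le> 1 / real ?d powr ?p" using d by (intro divide_left_mono) auto
    have "H ^ (?d - 1) = H powr (real ?d - 1)" using H d by (simp add: powr_realpow[symmetric] of_nat_diff)
    then have "1 / H powr ?p * H ^ (?d - 1) = H powr (- ?p) * H powr (real ?d - 1)"
      unfolding powr_minus_divide by simp
    also have "\<dots> = H powr (- (3 - \<alpha>))"
      by (subst powr_add[symmetric]) (rule arg_cong[where f="\<lambda>x. H powr x"], simp)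
    finally have 2: "H powr (- (3 - \<alpha>)) = 1 / H powr ?p * H ^ (?d - 1)" by simp
    have "1 / real ?d ^ (?d + 2) * H powr (- (3 - \<alpha>)) \<le> 1 / real ?d powr ?p * H powr (- (3 - \<alpha>))"
      by (rule mult_right_mono[OF 1]) simp
    also have "\<dots> = 1 / (real ?d * H) powr ?p * H ^ (?d - 1)"
      unfolding 2 using H d by (simp add: powr_mult)
    finally show ?thesis .
  qed
  ultimately show ?thesis unfolding H_def by linarith
qed

text \<open>Let \<open>H\<close> be the base of the power in the claim. It is enough to integrate
  over \<open>u\<close> in \<open>{h..h + H}\<close> and \<open>\<rho>\<close> in
  \<open>{2 * H..3 * H}\<close>, where the base of the lower bound for the kernel is at most
  \<open>4 * H\<close>. Each of the two integrations gains a factor \<open>H\<close>, which turns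
  the exponent \<open>3 - \<alpha>\<close> into \<open>1 - \<alpha>\<close>; 64 is the cube of
  4.\<close>

lemma kernel_tail_lower_bound:
  fixes i :: "'n::finite"
  assumes a: "0 \<le> \<alpha>" "\<alpha> < 1" "\<tau> > 0" and h: "h \<ge> 0"
  shows "ennreal (1 / (64 * real CARD('n) ^ (CARD('n) + 2)) * (h + \<tau> powr (1 / (1 - \<alpha>))) powr (- (1 - \<alpha>))) \<le>
    (\<integral>\<^sup>+u\<in>{h..}. kernel_tail i \<alpha> \<tau> u \<partial>lborel)"
proof -
  define c where "c = 1 / real CARD('n) ^ (CARD('n) + 2)"
  have c: "c > 0" by (simp add: c_def)
  define H where "H = h + \<tau> powr (1 / (1 - \<alpha>))"
  have H: "H > 0" "h \<le> H" using a h by (simp_all add: H_def add_nonneg_pos)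
  let ?m = "c * (4 * H) powr (- (3 - \<alpha>))"
  have khat: "?m \<le> kernel_hat i \<alpha> \<tau> \<rho>" if "2 * H \<le> \<rho>" "\<rho> \<le> 3 * H" for \<rho>
  proof -
    have "\<bar>\<rho>\<bar> + \<tau> powr (1 / (1 - \<alpha>)) \<le> 4 * H" using that H h by (simp add: H_def)
    moreover have "0 < \<bar>\<rho>\<bar> + \<tau> powr (1 / (1 - \<alpha>))" using a by (simp add: add_nonneg_pos)
    ultimately have "(4 * H) powr (- (3 - \<alpha>)) \<le> (\<bar>\<rho>\<bar> + \<tau> powr (1 / (1 - \<alpha>))) powr (- (3 - \<alpha>))"
      using a by (intro powr_mono2') auto
    then have "?m \<le> c * (\<bar>\<rho>\<bar> + \<tau> powr (1 / (1 - \<alpha>))) powr (- (3 - \<alpha>))"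
      using c by (intro mult_left_mono) auto
    also have "\<dots> \<le> kernel_hat i \<alpha> \<tau> \<rho>" unfolding c_def by (rule kernel_hat_lower_bound[OF a])
    finally show ?thesis .
  qed
  have m0: "0 \<le> ?m" using c by simp
  have tail: "ennreal (?m * H) \<le> kernel_tail i \<alpha> \<tau> u" if u: "u \<le> 2 * H" for u
  proof -
    have "ennreal (?m * H) = (\<integral>\<^sup>+\<rho>. ennreal ?m * indicator {2 * H..3 * H} \<rho> \<partial>lborel)"
      using m0 H by (simp add: nn_integral_cmult_indicator ennreal_mult[symmetric])
    also have "\<dots> \<le> (\<integral>\<^sup>+\<rho>. ennreal (kernel_hat i \<alpha> \<tau> \<rho>) * indicator {u..} \<rho> \<partial>lborel)"
      using khat u by (intro nn_integral_mono) (auto simp: indicator_def intro!: ennreal_leI)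
    finally show ?thesis unfolding kernel_tail_def .
  qed
  have "ennreal (?m * H * H) = (\<integral>\<^sup>+u. ennreal (?m * H) * indicator {h..h + H} u \<partial>lborel)"
    using m0 H by (simp add: nn_integral_cmult_indicator ennreal_mult[symmetric])
  also have "\<dots> \<le> (\<integral>\<^sup>+u. kernel_tail i \<alpha> \<tau> u * indicator {h..} u \<partial>lborel)"
    using tail H by (intro nn_integral_mono) (auto simp: indicator_def)
  finally have "ennreal (?m * H * H) \<le> (\<integral>\<^sup>+u. kernel_tail i \<alpha> \<tau> u * indicator {h..} u \<partial>lborel)" .
  moreover have "c / 64 * H powr (- (1 - \<alpha>)) \<le> ?m * H * H"
  proof -
    have "(4::real) powr (- 3) \<le> 4 powr (- (3 - \<alpha>))" using a by (intro powr_mono) auto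
    then have 4: "1 / 64 \<le> (4::real) powr (- (3 - \<alpha>))"
      by (simp add: powr_minus powr_numeral)
    have "H powr (- (3 - \<alpha>)) * H * H = H powr (- (3 - \<alpha>)) * H powr 1 * H powr 1" using H by simp
    also have "\<dots> = H powr (- (1 - \<alpha>))"
      by (simp only: powr_add[symmetric]) (rule arg_cong[where f="\<lambda>x. H powr x"], simp)
    finally have "?m * H * H = c * 4 powr (- (3 - \<alpha>)) * H powr (- (1 - \<alpha>))"
      using H by (simp add: powr_mult mult.assoc)
    moreover have "c / 64 * H powr (- (1 - \<alpha>)) \<le> c * 4 powr (- (3 - \<alpha>)) * H powr (- (1 - \<alpha>))"
      using mult_left_mono[OF 4, of c] c by (intro mult_right_mono) auto
    ultimately show ?thesis by (simp only:)
  qed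
  ultimately have "ennreal (c / 64 * H powr (- (1 - \<alpha>))) \<le> (\<integral>\<^sup>+u. kernel_tail i \<alpha> \<tau> u * indicator {h..} u \<partial>lborel)"
    by (meson ennreal_leI order_trans)
  moreover have "c / 64 = 1 / (64 * real CARD('n) ^ (CARD('n) + 2))" by (simp add: c_def)
  ultimately show ?thesis unfolding H_def by (simp only:)
qed

section \<open>Second differences of indicator functions\<close>

text \<open>The rectangle with opposite corners \<open>x\<close> and \<open>y\<close> has the two
  further corners \<open>mix {i} x y\<close>, where only the coordinate \<open>i\<close> has moved,
  and \<open>mix {i} y x\<close>, where only the others have. Describing it by end points instead of
  increments makes its symmetries visible.\<close>

definition mix :: "'n set \<Rightarrow> real^'n::finite \<Rightarrow> real^'n \<Rightarrow> real^'n" where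
  "mix A x y = (\<chi> j. if j \<in> A then y $ j else x $ j)"

lemma mix_nth [simp]: "mix A x y $ j = (if j \<in> A then y $ j else x $ j)"
  by (simp add: mix_def)

lemma mix_Compl: "mix (- A) x y = mix A y x"
  by (simp add: vec_eq_iff)

lemma borel_measurable_mix[measurable (raw)]:
  assumes [measurable]: "f \<in> borel_measurable M" "g \<in> borel_measurable M"
  shows "(\<lambda>p. mix A (f p) (g p)) \<in> borel_measurable M"
proof (rule borel_measurable_vecI)
  show "(\<lambda>p. mix A (f p) (g p) $ j) \<in> borel_measurable M" for j
    by (cases "j \<in> A") simp_all
qed

lemma box_Pair_Times: "box (a, c) (b, d) = box a b \<times> box c d"
  by (force simp: box_def Basis_prod_def)

lemma emeasure_lborel_box_vec:
  assumes "\<And>j. l $ j \<le> u $ j"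
  shows "emeasure lborel (box l u) = ennreal (\<Prod>j\<in>UNIV. (u - l) $ j :: real)"
proof -
  have "l \<bullet> b \<le> u \<bullet> b" if "b \<in> Basis" for b
    using that assms by (auto simp: Basis_vec_eq inner_axis)
  from emeasure_lborel_box[OF this] show ?thesis by (simp only: prod_Basis_vec)
qed

text \<open>The map exchanges coordinates between the two points, a permutation of the coordinates
  of the product space. Together with swapping the two points it carries any corner of a rectangle
  to any other.\<close>

lemma distr_mix:
  "distr lborel borel (\<lambda>p. (mix A (fst p) (snd p), mix A (snd p) (fst p))) = (lborel :: ((real^'n::finite) \<times> (real^'n)) measure)"
proof (rule lborel_eqI[symmetric])
  fix l u :: "(real^'n) \<times> (real^'n)"
  assume le: "\<And>b. b \<in> Basis \<Longrightarrow> l \<bullet> b \<le> u \<bullet> b"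
  obtain l1 l2 u1 u2 where lu: "l = (l1, l2)" "u = (u1, u2)" by (cases l; cases u)
  have le1: "l1 $ j \<le> u1 $ j" for j
    using le[of "(axis j 1, 0)"] by (simp add: lu Basis_prod_def inner_axis)
  have le2: "l2 $ j \<le> u2 $ j" for j
    using le[of "(0, axis j 1)"] by (simp add: lu Basis_prod_def inner_axis)
  let ?T = "\<lambda>p::(real^'n) \<times> (real^'n). (mix A (fst p) (snd p), mix A (snd p) (fst p))"
  have [measurable]: "?T \<in> borel \<rightarrow>\<^sub>M borel"
    unfolding borel_prod[symmetric] by measurable
  have vimage: "?T -` box l u = box (mix A l1 l2) (mix A u1 u2) \<times> box (mix A l2 l1) (mix A u2 u1)"
    unfolding lu box_Pair_Times
    by (auto simp: box_vec_eq) (metis (mono_tags))+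
  have "emeasure (distr lborel borel ?T) (box l u) = emeasure lborel (?T -` box l u)"
    by (subst emeasure_distr) auto
  also have "\<dots> = emeasure (lborel \<Otimes>\<^sub>M lborel) (box (mix A l1 l2) (mix A u1 u2) \<times> box (mix A l2 l1) (mix A u2 u1))"
    by (simp only: vimage lborel_prod)
  also have "\<dots> = emeasure lborel (box (mix A l1 l2) (mix A u1 u2)) * emeasure lborel (box (mix A l2 l1) (mix A u2 u1))"
    by (rule lborel.emeasure_pair_measure_Times) auto
  also have "\<dots> = ennreal ((\<Prod>j\<in>UNIV. (mix A u1 u2 - mix A l1 l2) $ j) * (\<Prod>j\<in>UNIV. (mix A u2 u1 - mix A l2 l1) $ j))"
    using le1 le2 by (subst (1 2) emeasure_lborel_box_vec) (auto simp: ennreal_mult prod_nonneg)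
  also have "(\<Prod>j\<in>UNIV. (mix A u1 u2 - mix A l1 l2) $ j) * (\<Prod>j\<in>UNIV. (mix A u2 u1 - mix A l2 l1) $ j) =
      (\<Prod>j\<in>UNIV. (u1 - l1) $ j) * (\<Prod>j\<in>UNIV. (u2 - l2) $ j)"
    by (simp only: prod.distrib[symmetric]) (auto intro!: prod.cong simp: mult.commute)
  also have "ennreal \<dots> = emeasure lborel (box l1 u1) * emeasure lborel (box l2 u2)"
    using le1 le2 by (simp add: emeasure_lborel_box_vec ennreal_mult prod_nonneg)
  also have "\<dots> = emeasure (lborel \<Otimes>\<^sub>M lborel) (box l1 u1 \<times> box l2 u2)"
    by (rule lborel.emeasure_pair_measure_Times[symmetric]) auto
  also have "\<dots> = emeasure lborel (box l u)"
    by (simp only: lu box_Pair_Times lborel_prod)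
  also have "\<dots> = ennreal (\<Prod>b\<in>Basis. (u - l) \<bullet> b)"
    using le by (simp add: emeasure_lborel_box)
  finally show "emeasure (distr lborel borel ?T) (box l u) = ennreal (\<Prod>b\<in>Basis. (u - l) \<bullet> b)" .
qed simp

lemma nn_integral_mix:
  fixes F :: "real^'n::finite \<Rightarrow> real^'n \<Rightarrow> ennreal"
  assumes F: "(\<lambda>p. F (fst p) (snd p)) \<in> borel_measurable (borel \<Otimes>\<^sub>M borel)"
  shows "(\<integral>\<^sup>+x. \<integral>\<^sup>+y. F (mix A x y) (mix A y x) \<partial>lborel \<partial>lborel) = (\<integral>\<^sup>+x. \<integral>\<^sup>+y. F x y \<partial>lborel \<partial>lborel)"
proof -
  let ?T = "\<lambda>p::(real^'n) \<times> (real^'n). (mix A (fst p) (snd p), mix A (snd p) (fst p))"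
  have T[measurable]: "?T \<in> borel \<rightarrow>\<^sub>M borel"
    unfolding borel_prod[symmetric] by measurable
  have F'[measurable]: "(\<lambda>p. F (fst p) (snd p)) \<in> borel_measurable borel"
    using F unfolding borel_prod .
  have FT: "(\<lambda>p. F (mix A (fst p) (snd p)) (mix A (snd p) (fst p))) \<in> borel_measurable (lborel \<Otimes>\<^sub>M lborel)"
    using measurable_compose[OF T F'] unfolding lborel_prod by simp
  have "(\<integral>\<^sup>+x. \<integral>\<^sup>+y. F x y \<partial>lborel \<partial>lborel) = (\<integral>\<^sup>+p. F (fst p) (snd p) \<partial>(lborel \<Otimes>\<^sub>M lborel))"
    using F by (subst lborel.nn_integral_fst[symmetric]) simp_all
  also have "\<dots> = (\<integral>\<^sup>+p. F (fst p) (snd p) \<partial>distr lborel borel ?T)"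
    by (simp only: lborel_prod distr_mix)
  also have "\<dots> = (\<integral>\<^sup>+p. F (mix A (fst p) (snd p)) (mix A (snd p) (fst p)) \<partial>(lborel \<Otimes>\<^sub>M lborel))"
    by (subst nn_integral_distr) (simp_all add: lborel_prod)
  also have "\<dots> = (\<integral>\<^sup>+x. \<integral>\<^sup>+y. F (mix A x y) (mix A y x) \<partial>lborel \<partial>lborel)"
    using FT by (subst lborel.nn_integral_fst[symmetric]) simp_all
  finally show ?thesis by simp
qed

lemma nn_integral_swap:
  fixes F :: "'a::euclidean_space \<Rightarrow> 'b::euclidean_space \<Rightarrow> ennreal"
  assumes F: "(\<lambda>p. F (fst p) (snd p)) \<in> borel_measurable (borel \<Otimes>\<^sub>M borel)"
  shows "(\<integral>\<^sup>+x. \<integral>\<^sup>+y. F x y \<partial>lborel \<partial>lborel) = (\<integral>\<^sup>+y. \<integral>\<^sup>+x. F x y \<partial>lborel \<partial>lborel)"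
  by (rule lborel_pair.Fubini'[symmetric]) (use F in \<open>simp add: split_beta'\<close>)

definition mixed_diff :: "'n::finite \<Rightarrow> (real^'n) set \<Rightarrow> real^'n \<Rightarrow> real^'n \<Rightarrow> real" where
  "mixed_diff i E x y = \<bar>indicat_real E x - indicat_real E (mix {i} x y) - indicat_real E (mix {i} y x) + indicat_real E y\<bar>"

lemma f_cross_mix:
  "f_cross i E x (y - x) = \<bar>indicat_real E (mix {i} x y) - indicat_real E x\<bar> * \<bar>indicat_real E (mix {i} y x) - indicat_real E x\<bar>"
proof -
  have "x + axis i ((y - x) $ i) = mix {i} x y" "x + (y - x - axis i ((y - x) $ i)) = mix {i} y x"
    by (simp_all add: vec_eq_iff axis_def)
  then show ?thesis by (simp add: f_cross_def)
qed

lemma f_cross_nonneg: "0 \<le> f_cross i E x \<zeta>"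
  by (simp add: f_cross_def)

lemma mix_mix: "mix A (mix A x y) (mix A y x) = x"
  by (simp add: vec_eq_iff)

text \<open>If an odd number of corners lies in \<open>E\<close>, the second difference is 1 and the
  odd corner out differs from both its neighbours. It is 2 only in a chessboard pattern, where all
  four corners differ from their neighbours.\<close>

lemma mixed_diff_le_corners:
  "mixed_diff i E x y \<le> f_cross i E x (y - x) + f_cross i E y (x - y)
     + f_cross i E (mix {i} x y) (mix {i} y x - mix {i} x y) + f_cross i E (mix {i} y x) (mix {i} x y - mix {i} y x)"
  unfolding f_cross_mix mix_mix mixed_diff_def
  by (cases "x \<in> E"; cases "y \<in> E"; cases "mix {i} x y \<in> E"; cases "mix {i} y x \<in> E") simp_all

lemma kernel_mix: "kernel \<alpha> \<tau> (mix A y x - mix A x y) = kernel \<alpha> \<tau> (y - x)"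
proof -
  have "\<bar>(mix A y x - mix A x y) $ j\<bar> = \<bar>(y - x) $ j\<bar>" for j
    by (cases "j \<in> A") (simp_all add: abs_minus_commute)
  then show ?thesis unfolding kernel_def by simp
qed

lemma kernel_minus: "kernel \<alpha> \<tau> (x - y) = kernel \<alpha> \<tau> (y - x)"
  using kernel_mix[of \<alpha> \<tau> UNIV y x] by (simp add: mix_def vec_lambda_eta)

lemma mix_in_cube: "x \<in> cube z l \<Longrightarrow> y \<in> cube z l \<Longrightarrow> mix A x y \<in> cube z l"
  by (simp add: cube_def)

lemma cube_eq_cbox: "cube z l = cbox (z - (\<chi> j. l / 2)) (z + (\<chi> j. l / 2))"
proof -
  have "\<bar>x $ j - z $ j\<bar> \<le> l / 2 \<longleftrightarrow> z $ j - l / 2 \<le> x $ j \<and> x $ j \<le> z $ j + l / 2" for x j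
    by (auto simp: abs_if)
  then show ?thesis by (simp add: cube_def cbox_vec_eq)
qed

lemma cube_in_borel[measurable]: "cube z l \<in> sets borel"
  by (simp add: cube_eq_cbox)

lemma borel_measurable_f_cross[measurable (raw)]:
  assumes [measurable]: "E \<in> sets borel" "f \<in> borel_measurable M" "g \<in> borel_measurable M"
  shows "(\<lambda>p. f_cross i E (f p) (g p)) \<in> borel_measurable M"
proof -
  have *: "f_cross i E x \<zeta> = \<bar>indicat_real E (mix {i} x (x + \<zeta>)) - indicat_real E x\<bar> * \<bar>indicat_real E (mix {i} (x + \<zeta>) x) - indicat_real E x\<bar>"
    for x \<zeta> using f_cross_mix[of i E x "x + \<zeta>"] by simp
  show ?thesis unfolding * by measurable
qed

lemma borel_measurable_mixed_diff[measurable (raw)]: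
  assumes [measurable]: "E \<in> sets borel" "f \<in> borel_measurable M" "g \<in> borel_measurable M"
  shows "(\<lambda>p. mixed_diff i E (f p) (g p)) \<in> borel_measurable M"
  unfolding mixed_diff_def by measurable

lemma nn_integral_translate:
  fixes f :: "'a::euclidean_space \<Rightarrow> ennreal"
  assumes "f \<in> borel_measurable borel"
  shows "(\<integral>\<^sup>+x. f (t + x) \<partial>lborel) = (\<integral>\<^sup>+x. f x \<partial>lborel)"
  using nn_integral_lborel_affine[OF assms, of 1 t] by simp

text \<open>The four corner terms have equal integrals, because exchanging coordinates and swapping
  the points preserve volume, cube and kernel. What remains is the cross term, enlarged by letting
  the second point leave the cube.\<close>

lemma mixed_diff_integral_le_cross:
  fixes E :: "(real^'n::finite) set"
  assumes [measurable]: "E \<in> sets borel"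
  shows "(\<integral>\<^sup>+x. \<integral>\<^sup>+y. ennreal (mixed_diff i E x y * kernel \<alpha> \<tau> (y - x)) * (indicator (cube z l) x * indicator (cube z l) y) \<partial>lborel \<partial>lborel)
     \<le> 4 * (\<integral>\<^sup>+x\<in>cube z l. (\<integral>\<^sup>+\<zeta>. ennreal (f_cross i E x \<zeta> * kernel \<alpha> \<tau> \<zeta>) \<partial>lborel) \<partial>lborel)"
proof -
  define F where "F x y = ennreal (f_cross i E x (y - x) * kernel \<alpha> \<tau> (y - x)) * (indicator (cube z l) x * indicator (cube z l) y)" for x y
  have Fm[measurable (raw)]: "(\<lambda>p. F (f p) (g p)) \<in> borel_measurable M"
    if [measurable]: "f \<in> borel_measurable M" "g \<in> borel_measurable M" for f g and M :: "'z measure"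
    unfolding F_def by measurable
  let ?I = "\<integral>\<^sup>+x. \<integral>\<^sup>+y. F x y \<partial>lborel \<partial>lborel"
  have le: "ennreal (mixed_diff i E x y * kernel \<alpha> \<tau> (y - x)) * (indicator (cube z l) x * indicator (cube z l) y) \<le>
      F x y + F y x + F (mix {i} x y) (mix {i} y x) + F (mix {i} y x) (mix {i} x y)" for x y
  proof (cases "x \<in> cube z l \<and> y \<in> cube z l")
    case True
    have "mixed_diff i E x y * kernel \<alpha> \<tau> (y - x) \<le>
        (f_cross i E x (y - x) + f_cross i E y (x - y)
     + f_cross i E (mix {i} x y) (mix {i} y x - mix {i} x y) + f_cross i E (mix {i} y x) (mix {i} x y - mix {i} y x)) * kernel \<alpha> \<tau> (y - x)"
      by (rule mult_right_mono[OF mixed_diff_le_corners kernel_nonneg])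
    then have "ennreal (mixed_diff i E x y * kernel \<alpha> \<tau> (y - x)) \<le> ennreal (f_cross i E x (y - x) * kernel \<alpha> \<tau> (y - x)
       + f_cross i E y (x - y) * kernel \<alpha> \<tau> (x - y)
       + f_cross i E (mix {i} x y) (mix {i} y x - mix {i} x y) * kernel \<alpha> \<tau> (mix {i} y x - mix {i} x y)
       + f_cross i E (mix {i} y x) (mix {i} x y - mix {i} y x) * kernel \<alpha> \<tau> (mix {i} x y - mix {i} y x))"
      by (intro ennreal_leI) (simp add: kernel_mix kernel_minus[of \<alpha> \<tau> x y] kernel_minus[of \<alpha> \<tau> "mix {i} x y" "mix {i} y x"] algebra_simps)
    then show ?thesis
      using True mix_in_cube[of x z l y "{i}"] mix_in_cube[of y z l x "{i}"]
      by (simp add: F_def f_cross_nonneg kernel_nonneg)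
  next
    case False
    then show ?thesis by (auto simp: indicator_def)
  qed
  have "(\<integral>\<^sup>+x. \<integral>\<^sup>+y. ennreal (mixed_diff i E x y * kernel \<alpha> \<tau> (y - x)) * (indicator (cube z l) x * indicator (cube z l) y) \<partial>lborel \<partial>lborel)
    \<le> (\<integral>\<^sup>+x. \<integral>\<^sup>+y. F x y + F y x + F (mix {i} x y) (mix {i} y x) + F (mix {i} y x) (mix {i} x y) \<partial>lborel \<partial>lborel)"
    by (intro nn_integral_mono le)
  also have "\<dots> = (\<integral>\<^sup>+x. \<integral>\<^sup>+y. F x y \<partial>lborel \<partial>lborel) + (\<integral>\<^sup>+x. \<integral>\<^sup>+y. F y x \<partial>lborel \<partial>lborel)
     + (\<integral>\<^sup>+x. \<integral>\<^sup>+y. F (mix {i} x y) (mix {i} y x) \<partial>lborel \<partial>lborel) + (\<integral>\<^sup>+x. \<integral>\<^sup>+y. F (mix {i} y x) (mix {i} x y) \<partial>lborel \<partial>lborel)"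
    by (simp add: nn_integral_add)
  also have "(\<integral>\<^sup>+x. \<integral>\<^sup>+y. F y x \<partial>lborel \<partial>lborel) = ?I"
    by (rule nn_integral_swap) measurable
  also have "(\<integral>\<^sup>+x. \<integral>\<^sup>+y. F (mix {i} x y) (mix {i} y x) \<partial>lborel \<partial>lborel) = ?I"
    by (rule nn_integral_mix) measurable
  also have "(\<integral>\<^sup>+x. \<integral>\<^sup>+y. F (mix {i} y x) (mix {i} x y) \<partial>lborel \<partial>lborel) = ?I"
  proof -
    have "(\<integral>\<^sup>+x. \<integral>\<^sup>+y. F (mix {i} y x) (mix {i} x y) \<partial>lborel \<partial>lborel) = (\<integral>\<^sup>+y. \<integral>\<^sup>+x. F (mix {i} y x) (mix {i} x y) \<partial>lborel \<partial>lborel)"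
      by (rule nn_integral_swap) measurable
    also have "\<dots> = ?I" by (rule nn_integral_mix) measurable
    finally show ?thesis .
  qed
  also have "?I + ?I + ?I + ?I = 4 * ?I"
  proof -
    have "4 * ?I = (2 + 2) * ?I" by simp
    also have "\<dots> = ?I + ?I + ?I + ?I" unfolding distrib_right mult_2 by (simp only: add.assoc)
    finally show ?thesis by simp
  qed
  also have "?I \<le> (\<integral>\<^sup>+x. \<integral>\<^sup>+y. ennreal (f_cross i E x (y - x) * kernel \<alpha> \<tau> (y - x)) * indicator (cube z l) x \<partial>lborel \<partial>lborel)"
    unfolding F_def by (intro nn_integral_mono mult_left_mono) (auto simp: indicator_def)
  also have "\<dots> = (\<integral>\<^sup>+x\<in>cube z l. (\<integral>\<^sup>+\<zeta>. ennreal (f_cross i E x \<zeta> * kernel \<alpha> \<tau> \<zeta>) \<partial>lborel) \<partial>lborel)"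
  proof (rule nn_integral_cong)
    fix x :: "real^'n"
    have "(\<integral>\<^sup>+y. ennreal (f_cross i E x (y - x) * kernel \<alpha> \<tau> (y - x)) * indicator (cube z l) x \<partial>lborel) =
        (\<integral>\<^sup>+y. ennreal (f_cross i E x (y - x) * kernel \<alpha> \<tau> (y - x)) \<partial>lborel) * indicator (cube z l) x"
      by (rule nn_integral_multc) measurable
    also have "(\<integral>\<^sup>+y. ennreal (f_cross i E x (y - x) * kernel \<alpha> \<tau> (y - x)) \<partial>lborel) =
        (\<integral>\<^sup>+\<zeta>. ennreal (f_cross i E x \<zeta> * kernel \<alpha> \<tau> \<zeta>) \<partial>lborel)"
      by (subst nn_integral_translate[symmetric, of _ x]) (simp_all del: f_cross_mix)
    finally show "(\<integral>\<^sup>+y. ennreal (f_cross i E x (y - x) * kernel \<alpha> \<tau> (y - x)) * indicator (cube z l) x \<partial>lborel) =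
      (\<integral>\<^sup>+\<zeta>. ennreal (f_cross i E x \<zeta> * kernel \<alpha> \<tau> \<zeta>) \<partial>lborel) * indicator (cube z l) x" .
  qed
  finally show ?thesis by (simp add: mult_left_mono)
qed

section \<open>Comparison of dyadic scales\<close>

definition shift_mixed :: "'n::finite \<Rightarrow> (real^'n) set \<Rightarrow> (real^'n) set \<Rightarrow> real^'n \<Rightarrow> ennreal" where
  "shift_mixed i E Q \<zeta> = (\<integral>\<^sup>+x. ennreal (mixed_diff i E x (x + \<zeta>)) * (indicator Q x * indicator Q (x + \<zeta>)) \<partial>lborel)"

text \<open>With \<open>a\<close> and \<open>b\<close> in 0, 1, 2 these displacements are the nine
  nodes of the subdivision into four of a rectangle with diagonal
  \<open>2 *\<^sub>R \<zeta>\<close>.\<close>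

definition lattice_pt :: "'n::finite \<Rightarrow> real^'n \<Rightarrow> real \<Rightarrow> real \<Rightarrow> real^'n" where
  "lattice_pt i \<zeta> a b = (\<chi> j. (if j = i then a else b) * \<zeta> $ j)"

lemma mix_lattice_pt:
  "mix {i} (x + lattice_pt i \<zeta> a b) (x + lattice_pt i \<zeta> c d) = x + lattice_pt i \<zeta> c b"
  by (simp add: vec_eq_iff lattice_pt_def)

lemma shift_mixed_lattice:
  assumes [measurable]: "E \<in> sets borel" "Q \<in> sets borel"
  shows "(\<integral>\<^sup>+x. ennreal (mixed_diff i E (x + lattice_pt i \<zeta> a b) (x + lattice_pt i \<zeta> (a + 1) (b + 1))) *
     (indicator Q (x + lattice_pt i \<zeta> a b) * indicator Q (x + lattice_pt i \<zeta> (a + 1) (b + 1))) \<partial>lborel) = shift_mixed i E Q \<zeta>"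
proof -
  have eq: "x + lattice_pt i \<zeta> (a + 1) (b + 1) = (lattice_pt i \<zeta> a b + x) + \<zeta>" for x
    by (simp add: vec_eq_iff lattice_pt_def algebra_simps)
  have eq': "x + lattice_pt i \<zeta> a b = lattice_pt i \<zeta> a b + x" for x by simp
  show ?thesis
    unfolding shift_mixed_def eq eq'
    by (rule nn_integral_translate[where t="lattice_pt i \<zeta> a b" and
      f="\<lambda>x. ennreal (mixed_diff i E x (x + \<zeta>)) * (indicator Q x * indicator Q (x + \<zeta>))"]) measurable
qed

text \<open>A cube is convex in each coordinate separately, so nodes with independent factors stay
  in it. The halved rectangles thus inherit the restriction to the cube.\<close>

lemma lattice_pt_in_cube:
  assumes "x \<in> cube z l" "x + 2 *\<^sub>R \<zeta> \<in> cube z l" "a \<in> {0..2}" "b \<in> {0..2}"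
  shows "x + lattice_pt i \<zeta> a b \<in> cube z l"
proof -
  have "\<bar>x $ j + c * \<zeta> $ j - z $ j\<bar> \<le> l / 2" if "c \<in> {0..2}" for j c
  proof -
    have 1: "\<bar>x $ j - z $ j\<bar> \<le> l / 2" "\<bar>x $ j + 2 * \<zeta> $ j - z $ j\<bar> \<le> l / 2"
      using assms(1,2) by (auto simp: cube_def)
    have "x $ j + c * \<zeta> $ j - z $ j = (1 - c / 2) * (x $ j - z $ j) + (c / 2) * (x $ j + 2 * \<zeta> $ j - z $ j)"
      by (simp add: field_simps)
    also have "\<bar>\<dots>\<bar> \<le> \<bar>(1 - c / 2) * (x $ j - z $ j)\<bar> + \<bar>(c / 2) * (x $ j + 2 * \<zeta> $ j - z $ j)\<bar>"
      by (rule abs_triangle_ineq)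
    also have "\<dots> = (1 - c / 2) * \<bar>x $ j - z $ j\<bar> + (c / 2) * \<bar>x $ j + 2 * \<zeta> $ j - z $ j\<bar>"
      using that by (simp add: abs_mult)
    also have "\<dots> \<le> (1 - c / 2) * (l / 2) + (c / 2) * (l / 2)"
      using that 1 by (intro add_mono mult_left_mono) auto
    finally show ?thesis by (simp add: field_simps)
  qed
  then show ?thesis using assms(3,4) by (simp add: cube_def lattice_pt_def)
qed

text \<open>Splitting a rectangle into four halved ones is exact for second differences, whereas the
  products in \<^const>\<open>f_cross\<close> are not subadditive.\<close>

lemma shift_mixed_double:
  assumes [measurable]: "E \<in> sets borel"
  shows "shift_mixed i E (cube z l) (2 *\<^sub>R \<zeta>) \<le> 4 * shift_mixed i E (cube z l) \<zeta>"
proof -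
  let ?Q = "cube z l"
  define T where "T a b x = ennreal (mixed_diff i E (x + lattice_pt i \<zeta> a b) (x + lattice_pt i \<zeta> (a + 1) (b + 1))) *
     (indicator ?Q (x + lattice_pt i \<zeta> a b) * indicator ?Q (x + lattice_pt i \<zeta> (a + 1) (b + 1)))" for a b x
  have [measurable]: "T a b \<in> borel_measurable borel" for a b unfolding T_def by measurable
  have le: "ennreal (mixed_diff i E x (x + 2 *\<^sub>R \<zeta>)) * (indicator ?Q x * indicator ?Q (x + 2 *\<^sub>R \<zeta>)) \<le>
      T 0 0 x + T 1 0 x + T 0 1 x + T 1 1 x" for x
  proof (cases "x \<in> ?Q \<and> x + 2 *\<^sub>R \<zeta> \<in> ?Q")
    case True
    have inQ: "x + lattice_pt i \<zeta> a b \<in> ?Q" if "a \<in> {0..2}" "b \<in> {0..2}" for a b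
      using True that by (intro lattice_pt_in_cube) auto
    have l0: "x = x + lattice_pt i \<zeta> 0 0" "x + 2 *\<^sub>R \<zeta> = x + lattice_pt i \<zeta> 2 2"
      by (simp_all add: vec_eq_iff lattice_pt_def)
    let ?c = "\<lambda>a b. indicat_real E (x + lattice_pt i \<zeta> a b)"
    have md: "mixed_diff i E (x + lattice_pt i \<zeta> a b) (x + lattice_pt i \<zeta> c d) = \<bar>?c a b - ?c c b - ?c a d + ?c c d\<bar>" for a b c d
      unfolding mixed_diff_def mix_lattice_pt ..
    have "mixed_diff i E x (x + 2 *\<^sub>R \<zeta>) = \<bar>?c 0 0 - ?c 2 0 - ?c 0 2 + ?c 2 2\<bar>"
      by (subst l0(2), subst l0(1), rule md)
    also have "\<dots> \<le> \<bar>?c 0 0 - ?c 1 0 - ?c 0 1 + ?c 1 1\<bar> + \<bar>?c 1 0 - ?c 2 0 - ?c 1 1 + ?c 2 1\<bar>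
       + \<bar>?c 0 1 - ?c 1 1 - ?c 0 2 + ?c 1 2\<bar> + \<bar>?c 1 1 - ?c 2 1 - ?c 1 2 + ?c 2 2\<bar>"
      by linarith
    finally have "ennreal (mixed_diff i E x (x + 2 *\<^sub>R \<zeta>)) \<le> ennreal (\<bar>?c 0 0 - ?c 1 0 - ?c 0 1 + ?c 1 1\<bar> + \<bar>?c 1 0 - ?c 2 0 - ?c 1 1 + ?c 2 1\<bar>
       + \<bar>?c 0 1 - ?c 1 1 - ?c 0 2 + ?c 1 2\<bar> + \<bar>?c 1 1 - ?c 2 1 - ?c 1 2 + ?c 2 2\<bar>)"
      by (rule ennreal_leI)
    also have "\<dots> = T 0 0 x + T 1 0 x + T 0 1 x + T 1 1 x"
      unfolding T_def md by (simp add: inQ)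
    finally show ?thesis using True by simp
  next
    case False
    then show ?thesis by (auto simp: indicator_def)
  qed
  have "shift_mixed i E ?Q (2 *\<^sub>R \<zeta>) \<le> (\<integral>\<^sup>+x. T 0 0 x + T 1 0 x + T 0 1 x + T 1 1 x \<partial>lborel)"
    unfolding shift_mixed_def by (intro nn_integral_mono le)
  also have "\<dots> = (\<integral>\<^sup>+x. T 0 0 x \<partial>lborel) + (\<integral>\<^sup>+x. T 1 0 x \<partial>lborel) + (\<integral>\<^sup>+x. T 0 1 x \<partial>lborel) + (\<integral>\<^sup>+x. T 1 1 x \<partial>lborel)"
    by (simp add: nn_integral_add)
  also have "\<dots> = shift_mixed i E ?Q \<zeta> + shift_mixed i E ?Q \<zeta> + shift_mixed i E ?Q \<zeta> + shift_mixed i E ?Q \<zeta>"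
    unfolding T_def by (simp only: shift_mixed_lattice[OF assms cube_in_borel])
  also have "\<dots> = 4 * shift_mixed i E ?Q \<zeta>"
  proof -
    have "4 * shift_mixed i E ?Q \<zeta> = (2 + 2) * shift_mixed i E ?Q \<zeta>" by simp
    also have "\<dots> = shift_mixed i E ?Q \<zeta> + shift_mixed i E ?Q \<zeta> + shift_mixed i E ?Q \<zeta> + shift_mixed i E ?Q \<zeta>"
      unfolding distrib_right mult_2 by (simp only: add.assoc)
    finally show ?thesis by simp
  qed
  finally show ?thesis .
qed

lemma shift_mixed_pow2:
  assumes "E \<in> sets borel"
  shows "shift_mixed i E (cube z l) (2 ^ k *\<^sub>R \<zeta>) \<le> 4 ^ k * shift_mixed i E (cube z l) \<zeta>"
proof (induction k)
  case (Suc k)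
  have "shift_mixed i E (cube z l) (2 ^ Suc k *\<^sub>R \<zeta>) \<le> 4 * shift_mixed i E (cube z l) (2 ^ k *\<^sub>R \<zeta>)"
    using shift_mixed_double[OF assms, of i z l "2 ^ k *\<^sub>R \<zeta>"] by simp
  also have "\<dots> \<le> 4 * (4 ^ k * shift_mixed i E (cube z l) \<zeta>)"
    by (rule mult_left_mono[OF Suc]) simp
  finally show ?case by (simp add: mult.assoc)
qed simp

lemma borel_measurable_shift_mixed[measurable]:
  assumes [measurable]: "E \<in> sets borel" "Q \<in> sets borel"
  shows "shift_mixed i E Q \<in> borel_measurable borel"
  unfolding shift_mixed_def by measurable

lemma shift_mixed_eq_0:
  assumes "\<not> (\<forall>j. \<bar>\<zeta> $ j\<bar> \<le> l)"
  shows "shift_mixed i E (cube z l) \<zeta> = 0"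
proof -
  obtain j where j: "\<bar>\<zeta> $ j\<bar> > l" using assms by (auto simp: not_le)
  have "indicator (cube z l) x * indicator (cube z l) (x + \<zeta>) = (0::ennreal)" for x
  proof -
    have "\<not> (\<bar>x $ j - z $ j\<bar> \<le> l / 2 \<and> \<bar>x $ j + \<zeta> $ j - z $ j\<bar> \<le> l / 2)"
      using j by linarith
    then have "x \<notin> cube z l \<or> x + \<zeta> \<notin> cube z l" by (auto simp: cube_def)
    then show ?thesis by auto
  qed
  then have "shift_mixed i E (cube z l) \<zeta> = (\<integral>\<^sup>+x. ennreal (mixed_diff i E x (x + \<zeta>)) * 0 \<partial>lborel)"
    unfolding shift_mixed_def by (simp only:)
  then show ?thesis by simp
qed

definition mixed_total :: "'n::finite \<Rightarrow> (real^'n) set \<Rightarrow> (real^'n) set \<Rightarrow> ennreal" where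
  "mixed_total i E Q = (\<integral>\<^sup>+x. \<integral>\<^sup>+y. ennreal (mixed_diff i E x y) * (indicator Q x * indicator Q y) \<partial>lborel \<partial>lborel)"

lemma nn_integral_shift_mixed:
  fixes E :: "(real^'n::finite) set"
  assumes [measurable]: "E \<in> sets borel" "Q \<in> sets borel" "w \<in> borel_measurable borel"
  shows "(\<integral>\<^sup>+\<zeta>. shift_mixed i E Q \<zeta> * ennreal (w \<zeta>) \<partial>lborel) =
    (\<integral>\<^sup>+x. \<integral>\<^sup>+y. ennreal (mixed_diff i E x y) * ennreal (w (y - x)) * (indicator Q x * indicator Q y) \<partial>lborel \<partial>lborel)"
proof -
  let ?f = "\<lambda>x y. ennreal (mixed_diff i E x y) * ennreal (w (y - x)) * (indicator Q x * indicator Q y)"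
  have "(\<integral>\<^sup>+\<zeta>. shift_mixed i E Q \<zeta> * ennreal (w \<zeta>) \<partial>lborel) = (\<integral>\<^sup>+\<zeta>. \<integral>\<^sup>+x. ?f x (x + \<zeta>) \<partial>lborel \<partial>lborel)"
    unfolding shift_mixed_def
    by (intro nn_integral_cong, subst nn_integral_multc[symmetric], measurable)
      (auto intro!: nn_integral_cong simp: mult_ac)
  also have "\<dots> = (\<integral>\<^sup>+x. \<integral>\<^sup>+\<zeta>. ?f x (x + \<zeta>) \<partial>lborel \<partial>lborel)"
    by (rule nn_integral_swap) measurable
  also have "\<dots> = (\<integral>\<^sup>+x. \<integral>\<^sup>+y. ?f x y \<partial>lborel \<partial>lborel)"
    by (intro nn_integral_cong nn_integral_translate) measurable
  finally show ?thesis .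
qed

text \<open>Rescaling \<open>\<zeta>\<close> by \<open>2 ^ k\<close> gives the Jacobian
  \<open>2 ^ (k * d)\<close>, and \<open>k\<close> halvings give \<open>4 ^ k\<close>. Their product
  is how the kernel with \<open>\<alpha> = 0\<close> scales, the reason why all scales count
  equally. The restriction to short \<open>\<zeta>\<close> is automatic: two points of the cube
  differ by at most \<open>l\<close> in each coordinate.\<close>

lemma mixed_total_le_scale:
  fixes E :: "(real^'n::finite) set"
  assumes [measurable]: "E \<in> sets borel"
  shows "mixed_total i E (cube z l) \<le> ennreal (2 ^ (k * (CARD('n) + 2))) *
    (\<integral>\<^sup>+\<zeta>. shift_mixed i E (cube z l) \<zeta> * indicator {\<zeta>. \<forall>j. \<bar>\<zeta> $ j\<bar> \<le> l / 2 ^ k} \<zeta> \<partial>lborel)"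
proof -
  let ?g = "shift_mixed i E (cube z l)" and ?D = "CARD('n)"
  let ?B = "{\<zeta>::real^'n. \<forall>j. \<bar>\<zeta> $ j\<bar> \<le> l / 2 ^ k}"
  have "mixed_total i E (cube z l) = (\<integral>\<^sup>+\<zeta>. ?g \<zeta> \<partial>lborel)"
    using nn_integral_shift_mixed[OF assms cube_in_borel, of "\<lambda>_. 1" i z l] by (simp add: mixed_total_def)
  also have "\<dots> = ennreal (\<bar>2 ^ k\<bar> ^ DIM(real^'n)) * (\<integral>\<^sup>+\<zeta>. ?g (0 + 2 ^ k *\<^sub>R \<zeta>) \<partial>lborel)"
    by (rule nn_integral_lborel_affine) simp_all
  also have "\<dots> \<le> ennreal (\<bar>2 ^ k\<bar> ^ DIM(real^'n)) * (\<integral>\<^sup>+\<zeta>. 4 ^ k * (?g \<zeta> * indicator ?B \<zeta>) \<partial>lborel)"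
  proof (intro mult_left_mono nn_integral_mono)
    fix \<zeta> :: "real^'n"
    show "?g (0 + 2 ^ k *\<^sub>R \<zeta>) \<le> 4 ^ k * (?g \<zeta> * indicator ?B \<zeta>)"
    proof (cases "\<zeta> \<in> ?B")
      case True
      then show ?thesis using shift_mixed_pow2[OF assms, of i z l k \<zeta>] by simp
    next
      case False
      then obtain j where "\<bar>\<zeta> $ j\<bar> > l / 2 ^ k" by (auto simp: not_le)
      then have "\<bar>(2 ^ k *\<^sub>R \<zeta>) $ j\<bar> > l" by (simp add: abs_mult field_simps)
      then have "\<not> (\<forall>j. \<bar>(2 ^ k *\<^sub>R \<zeta>) $ j\<bar> \<le> l)" by (metis not_le)
      then show ?thesis by (simp add: shift_mixed_eq_0)
    qed
  qed simp
  also have "\<dots> = ennreal (\<bar>2 ^ k\<bar> ^ DIM(real^'n)) * (4 ^ k * (\<integral>\<^sup>+\<zeta>. ?g \<zeta> * indicator ?B \<zeta> \<partial>lborel))"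
    by (subst nn_integral_cmult) simp_all
  also have "\<dots> = ennreal (2 ^ (k * (?D + 2))) * (\<integral>\<^sup>+\<zeta>. ?g \<zeta> * indicator ?B \<zeta> \<partial>lborel)"
  proof -
    have "(4::ennreal) ^ k = ennreal (4 ^ k)" by (simp add: ennreal_power[symmetric])
    moreover have "(2::real) ^ (k * (?D + 2)) = (2 ^ k) ^ ?D * 4 ^ k"
      by (simp add: power_add power_mult power_mult_distrib[symmetric] power2_eq_square distrib_left mult.commute[of 2 k])
    ultimately show ?thesis by (simp add: ennreal_mult mult.assoc)
  qed
  finally show ?thesis .
qed

text \<open>The scales that see a given \<open>\<zeta>\<close> are at most some \<open>K\<close>,
  and the weights up to \<open>K\<close> form a geometric series bounded by twice its last term. At
  scale \<open>K\<close> the base of the kernel is at most \<open>(d + 1) * l / 2 ^ K\<close>, the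
  extra 1 accounting for \<open>\<tau> powr (1 / (1 - \<alpha>))\<close>, which lies below the
  finest scale.\<close>

lemma kernel_ge_dyadic_sum:
  fixes \<zeta> :: "real^'n::finite"
  assumes a: "0 \<le> \<alpha>" "\<alpha> < 1" "0 < \<tau>" and l: "0 < l" and eps: "\<tau> powr (1 / (1 - \<alpha>)) \<le> l / 2 ^ N"
  defines "p \<equiv> real CARD('n) + 2 - \<alpha>" and "A \<equiv> max 1 (real (CARD('n) + 1) * l)"
  shows "(\<Sum>k<N. 2 powr (real k * p) * indicat_real {\<zeta>. \<forall>j. \<bar>\<zeta> $ j\<bar> \<le> l / 2 ^ k} \<zeta>) \<le> 2 * A ^ (CARD('n) + 2) * kernel \<alpha> \<tau> \<zeta>"
proof -
  let ?S = "{k. k < N \<and> (\<forall>j. \<bar>\<zeta> $ j\<bar> \<le> l / 2 ^ k)}"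
  have p: "p \<ge> 1" "p \<le> real (CARD('n) + 2)" using a by (auto simp: p_def)
  have A1: "A \<ge> 1" "A \<ge> real (CARD('n) + 1) * l" by (auto simp: A_def)
  have "(\<Sum>k<N. 2 powr (real k * p) * indicat_real {\<zeta>. \<forall>j. \<bar>\<zeta> $ j\<bar> \<le> l / 2 ^ k} \<zeta>) = (\<Sum>k\<in>?S. 2 powr (real k * p))"
    by (rule sum.mono_neutral_cong_right) (auto simp: indicator_def)
  also have "\<dots> \<le> 2 * A ^ (CARD('n) + 2) * kernel \<alpha> \<tau> \<zeta>"
  proof (cases "?S = {}")
    case True
    then show ?thesis using A1 kernel_nonneg[of \<alpha> \<tau> \<zeta>] by (simp only: sum.empty) simp
  next
    case False
    define K where "K = Max ?S"
    have fin: "finite ?S" by simp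
    have K: "K \<in> ?S" using Max_in[OF fin False] by (simp add: K_def)
    have geo: "(\<Sum>k\<le>n. 2 powr (real k * p)) \<le> 2 * 2 powr (real n * p)" for n
    proof (induction n)
      case (Suc n)
      have "2 * 2 powr (real n * p) \<le> 2 powr p * 2 powr (real n * p)"
        using powr_mono[of 1 p 2] p by (intro mult_right_mono) auto
      also have "\<dots> = 2 powr (real (Suc n) * p)" by (simp add: powr_add[symmetric] algebra_simps)
      finally show ?case using Suc by simp
    qed simp
    have "(\<Sum>k\<in>?S. 2 powr (real k * p)) \<le> (\<Sum>k\<le>K. 2 powr (real k * p))"
      using fin Max_ge[OF fin] by (intro sum_mono2) (auto simp: K_def)
    also have "\<dots> \<le> 2 * 2 powr (real K * p)" by (rule geo)
    also have "2 powr (real K * p) \<le> A ^ (CARD('n) + 2) * kernel \<alpha> \<tau> \<zeta>"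
    proof -
      define r where "r = l / 2 ^ K"
      have r: "r > 0" using l by (simp add: r_def)
      have "(\<Sum>j\<in>UNIV. \<bar>\<zeta> $ j\<bar>) \<le> (\<Sum>j\<in>(UNIV::'n set). r)" using K by (intro sum_mono) (auto simp: r_def)
      moreover have "\<tau> powr (1 / (1 - \<alpha>)) \<le> r"
      proof -
        have "(2::real) ^ K \<le> 2 ^ N" using K by (intro power_increasing) auto
        then have "l / 2 ^ N \<le> r" unfolding r_def using l by (intro divide_left_mono) auto
        with eps show ?thesis by simp
      qed
      ultimately have le: "(\<Sum>j\<in>UNIV. \<bar>\<zeta> $ j\<bar>) + \<tau> powr (1 / (1 - \<alpha>)) \<le> real (CARD('n) + 1) * l / 2 ^ K"
        by (simp add: r_def algebra_simps add_divide_distrib)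
      let ?s = "(\<Sum>j\<in>UNIV. \<bar>\<zeta> $ j\<bar>) + \<tau> powr (1 / (1 - \<alpha>))"
      have pos: "?s > 0" using a by (intro add_nonneg_pos sum_nonneg) auto
      have "?s \<le> A / 2 ^ K"
        by (rule order_trans[OF le]) (use A1(2) in \<open>intro divide_right_mono\<close>, simp_all)
      then have "?s powr p \<le> (A / 2 ^ K) powr p" using pos p by (intro powr_mono2) auto
      also have "\<dots> = A powr p / 2 powr (real K * p)"
        using A1 by (simp add: powr_divide powr_powr powr_realpow[symmetric])
      \<comment> \<open>\<open>A\<close> is at least 1 by definition, which allows raising the
        exponent to an integer independent of \<open>\<alpha>\<close>.\<close>
      also have "A powr p \<le> A ^ (CARD('n) + 2)"
        proof -
          have "A powr p \<le> A powr real (CARD('n) + 2)" by (rule powr_mono[OF p(2) A1(1)])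
          also have "\<dots> = A ^ (CARD('n) + 2)" using A1(1) by (intro powr_realpow) simp
          finally show ?thesis .
        qed
      finally have "?s powr p \<le> A ^ (CARD('n) + 2) / 2 powr (real K * p)"
        by (simp add: divide_right_mono)
      then have "2 powr (real K * p) * ?s powr p \<le> A ^ (CARD('n) + 2)"
        by (simp add: field_simps)
      then show ?thesis
        using pos unfolding kernel_def p_def[symmetric] by (simp add: field_simps)
    qed
    finally show ?thesis by simp
  qed
  finally show ?thesis .
qed

text \<open>Every one of the \<open>N\<close> scales bounds the same quantity
  \<open>mixed_total\<close>, while the weights of all scales together are dominated by one kernel.
  Adding the bounds therefore gains the factor \<open>N\<close>. In the constant 16, a factor 2 pays
  for \<open>\<alpha>\<close>, 2 for the geometric series and 4 for the corners.\<close>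

theorem mixed_total_log_bound:
  fixes E :: "(real^'n::finite) set"
  assumes E[measurable]: "E \<in> sets borel"
    and a: "0 \<le> \<alpha>" "\<alpha> < 1" "0 < \<tau>" and l: "0 < l" and eps: "\<tau> powr (1 / (1 - \<alpha>)) \<le> l / 2 ^ N" and aN: "\<alpha> * real N \<le> 1"
  defines "A \<equiv> max 1 (real (CARD('n) + 1) * l)"
  shows "ennreal (real N) * mixed_total i E (cube z l) \<le> ennreal (16 * A ^ (CARD('n) + 2)) *
    (\<integral>\<^sup>+x\<in>cube z l. (\<integral>\<^sup>+\<zeta>. ennreal (f_cross i E x \<zeta> * kernel \<alpha> \<tau> \<zeta>) \<partial>lborel) \<partial>lborel)"
proof -
  let ?D = "CARD('n)" and ?g = "shift_mixed i E (cube z l)" and ?J = "mixed_total i E (cube z l)"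
  let ?B = "\<lambda>k. {\<zeta>::real^'n. \<forall>j. \<bar>\<zeta> $ j\<bar> \<le> l / 2 ^ k}"
  define p where "p = real ?D + 2 - \<alpha>"
  have A1: "A \<ge> 1" by (simp add: A_def)
  have step: "?J \<le> 2 * (\<integral>\<^sup>+\<zeta>. ?g \<zeta> * ennreal (2 powr (real k * p) * indicator (?B k) \<zeta>) \<partial>lborel)" if k: "k < N" for k
  proof -
    \<comment> \<open>The scale requires \<open>2 ^ (k * (d + 2))\<close> but the kernel provides
      \<open>2 powr (k * p)\<close>; the quotient \<open>2 powr (k * \<alpha>)\<close> is at most 2
      because \<open>\<alpha> * N \<le> 1\<close>.\<close>
    have "real k * \<alpha> \<le> real N * \<alpha>" using k a by (intro mult_right_mono) auto
    then have "real k * \<alpha> \<le> 1" using aN by (simp add: mult.commute)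
    then have "real (k * (?D + 2)) \<le> 1 + real k * p" by (simp add: p_def algebra_simps)
    then have "(2::real) powr real (k * (?D + 2)) \<le> 2 powr (1 + real k * p)" by (intro powr_mono) auto
    then have "(2::real) ^ (k * (?D + 2)) \<le> 2 * 2 powr (real k * p)"
      by (simp only: powr_realpow[symmetric, of 2] powr_add) simp
    then have "ennreal (2 ^ (k * (?D + 2))) \<le> 2 * ennreal (2 powr (real k * p))"
      by (subst ennreal_numeral[symmetric], subst ennreal_mult[symmetric]) (auto intro: ennreal_leI)
    then have "?J \<le> 2 * ennreal (2 powr (real k * p)) * (\<integral>\<^sup>+\<zeta>. ?g \<zeta> * indicator (?B k) \<zeta> \<partial>lborel)"
      using mixed_total_le_scale[OF E, of i z l k] by (meson mult_right_mono order_trans zero_le)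
    also have "\<dots> = 2 * (\<integral>\<^sup>+\<zeta>. ennreal (2 powr (real k * p)) * (?g \<zeta> * indicator (?B k) \<zeta>) \<partial>lborel)"
      by (simp add: nn_integral_cmult mult.assoc)
    also have "(\<integral>\<^sup>+\<zeta>. ennreal (2 powr (real k * p)) * (?g \<zeta> * indicator (?B k) \<zeta>) \<partial>lborel) =
        (\<integral>\<^sup>+\<zeta>. ?g \<zeta> * ennreal (2 powr (real k * p) * indicator (?B k) \<zeta>) \<partial>lborel)"
      by (intro nn_integral_cong) (auto simp: indicator_def mult_ac)
    finally show ?thesis .
  qed
  have "ennreal (real N) * ?J = (\<Sum>k<N. ?J)" by (simp add: ennreal_of_nat_eq_real_of_nat)
  also have "\<dots> \<le> (\<Sum>k<N. 2 * (\<integral>\<^sup>+\<zeta>. ?g \<zeta> * ennreal (2 powr (real k * p) * indicator (?B k) \<zeta>) \<partial>lborel))"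
    using step by (intro sum_mono) auto
  also have "\<dots> = 2 * (\<integral>\<^sup>+\<zeta>. (\<Sum>k<N. ?g \<zeta> * ennreal (2 powr (real k * p) * indicator (?B k) \<zeta>)) \<partial>lborel)"
    by (subst nn_integral_sum) (simp_all add: sum_distrib_left)
  also have "\<dots> \<le> 2 * (\<integral>\<^sup>+\<zeta>. ennreal (2 * A ^ (?D + 2)) * (?g \<zeta> * ennreal (kernel \<alpha> \<tau> \<zeta>)) \<partial>lborel)"
  proof (rule mult_left_mono[OF nn_integral_mono])
    fix \<zeta> :: "real^'n"
    have "(\<Sum>k<N. ennreal (2 powr (real k * p) * indicator (?B k) \<zeta>)) = ennreal (\<Sum>k<N. 2 powr (real k * p) * indicator (?B k) \<zeta>)"
      by (rule sum_ennreal) simp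
    also have "\<dots> \<le> ennreal (2 * A ^ (?D + 2) * kernel \<alpha> \<tau> \<zeta>)"
      unfolding p_def A_def by (intro ennreal_leI kernel_ge_dyadic_sum[OF a l eps])
    also have "\<dots> = ennreal (2 * A ^ (?D + 2)) * ennreal (kernel \<alpha> \<tau> \<zeta>)"
      using A1 by (intro ennreal_mult kernel_nonneg) auto
    finally have "?g \<zeta> * (\<Sum>k<N. ennreal (2 powr (real k * p) * indicator (?B k) \<zeta>)) \<le> ?g \<zeta> * (ennreal (2 * A ^ (?D + 2)) * ennreal (kernel \<alpha> \<tau> \<zeta>))"
      by (rule mult_left_mono) simp
    then show "(\<Sum>k<N. ?g \<zeta> * ennreal (2 powr (real k * p) * indicator (?B k) \<zeta>)) \<le> ennreal (2 * A ^ (?D + 2)) * (?g \<zeta> * ennreal (kernel \<alpha> \<tau> \<zeta>))"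
      by (simp only: sum_distrib_left[symmetric] mult.left_commute[of _ "?g \<zeta>"])
  qed simp
  also have "\<dots> = ennreal (4 * A ^ (?D + 2)) * (\<integral>\<^sup>+\<zeta>. ?g \<zeta> * ennreal (kernel \<alpha> \<tau> \<zeta>) \<partial>lborel)"
  proof -
    have "2 * ennreal (2 * A ^ (?D + 2)) = ennreal (4 * A ^ (?D + 2))"
      using A1 by (subst ennreal_numeral[symmetric], subst ennreal_mult[symmetric]) auto
    then show ?thesis
      by (subst nn_integral_cmult) (simp_all only: mult.assoc[symmetric], measurable)
  qed
  also have "(\<integral>\<^sup>+\<zeta>. ?g \<zeta> * ennreal (kernel \<alpha> \<tau> \<zeta>) \<partial>lborel) =
      (\<integral>\<^sup>+x. \<integral>\<^sup>+y. ennreal (mixed_diff i E x y) * ennreal (kernel \<alpha> \<tau> (y - x)) * (indicator (cube z l) x * indicator (cube z l) y) \<partial>lborel \<partial>lborel)"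
    by (rule nn_integral_shift_mixed) measurable
  also have "\<dots> = (\<integral>\<^sup>+x. \<integral>\<^sup>+y. ennreal (mixed_diff i E x y * kernel \<alpha> \<tau> (y - x)) * (indicator (cube z l) x * indicator (cube z l) y) \<partial>lborel \<partial>lborel)"
    by (intro nn_integral_cong) (simp add: ennreal_mult kernel_nonneg mixed_diff_def)
  also have "\<dots> \<le> 4 * (\<integral>\<^sup>+x\<in>cube z l. (\<integral>\<^sup>+\<zeta>. ennreal (f_cross i E x \<zeta> * kernel \<alpha> \<tau> \<zeta>) \<partial>lborel) \<partial>lborel)"
    by (rule mixed_diff_integral_le_cross[OF E])
  finally have "ennreal (real N) * ?J \<le> ennreal (4 * A ^ (?D + 2)) * (4 * (\<integral>\<^sup>+x\<in>cube z l. (\<integral>\<^sup>+\<zeta>. ennreal (f_cross i E x \<zeta> * kernel \<alpha> \<tau> \<zeta>) \<partial>lborel) \<partial>lborel))"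
    by (simp add: mult_left_mono)
  also have "\<dots> = ennreal (16 * A ^ (?D + 2)) * (\<integral>\<^sup>+x\<in>cube z l. (\<integral>\<^sup>+\<zeta>. ennreal (f_cross i E x \<zeta> * kernel \<alpha> \<tau> \<zeta>) \<partial>lborel) \<partial>lborel)"
  proof -
    have "ennreal (4 * A ^ (?D + 2)) * 4 = ennreal (16 * A ^ (?D + 2))"
      using A1 by (subst ennreal_numeral[symmetric], subst ennreal_mult[symmetric]) auto
    then show ?thesis by (simp only: mult.assoc[symmetric])
  qed
  finally show ?thesis .
qed

section \<open>Almost one-dimensional sets\<close>

text \<open>Up to normalisation, the probability that resampling the coordinates in \<open>A\<close>
  changes membership in \<open>E\<close>. It is small for \<open>A = - {i}\<close> if
  \<open>E\<close> is nearly a function of the coordinate \<open>i\<close>, and for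
  \<open>A = {i}\<close> if \<open>E\<close> nearly ignores that coordinate.\<close>

definition osc :: "'n::finite set \<Rightarrow> (real^'n) set \<Rightarrow> real^'n \<Rightarrow> real \<Rightarrow> ennreal" where
  "osc A E z l = (\<integral>\<^sup>+x. \<integral>\<^sup>+y. ennreal \<bar>indicat_real E x - indicat_real E (mix A x y)\<bar> *
     (indicator (cube z l) x * indicator (cube z l) y) \<partial>lborel \<partial>lborel)"

lemma emeasure_cube:
  assumes "l > 0" shows "emeasure lborel (cube z l :: (real^'n::finite) set) = ennreal (l ^ CARD('n))"
proof -
  have "emeasure lborel (cube z l) = emeasure lborel (cbox (z - (\<chi> j. l / 2)) (z + (\<chi> j. l / 2)))"
    by (simp only: cube_eq_cbox)
  also have "\<dots> = ennreal (\<Prod>b\<in>Basis. (z + (\<chi> j. l / 2) - (z - (\<chi> j. l / 2))) \<bullet> b)"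
    using assms by (intro emeasure_lborel_cbox) (auto simp: Basis_vec_eq inner_axis)
  also have "(\<Prod>b\<in>Basis. (z + (\<chi> j. l / 2) - (z - (\<chi> j. l / 2))) \<bullet> b) = l ^ CARD('n)"
    by (simp add: prod_Basis_vec)
  finally show ?thesis .
qed

lemma indicator_cube_mix:
  "indicator (cube z l) (mix A x y) * indicator (cube z l) (mix A y x) = (indicator (cube z l) x * indicator (cube z l) y :: ennreal)"
proof (cases "x \<in> cube z l \<and> y \<in> cube z l")
  case True
  then show ?thesis by (simp add: mix_in_cube)
next
  case False
  then have "\<not> (mix A x y \<in> cube z l \<and> mix A y x \<in> cube z l)"
    using mix_in_cube[of "mix A x y" z l "mix A y x" A] mix_in_cube[of "mix A y x" z l "mix A x y" A] mix_mix[of A x y] mix_mix[of A y x] by auto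
  with False show ?thesis by (auto simp: indicator_def)
qed

text \<open>Resampling some coordinates of a point uniform in the cube leaves its law unchanged, so
  the double integral collapses.\<close>

lemma nn_integral_mix_right:
  fixes G :: "real^'n::finite \<Rightarrow> ennreal"
  assumes [measurable]: "G \<in> borel_measurable borel"
  shows "(\<integral>\<^sup>+y. \<integral>\<^sup>+w. G (mix A y w) * (indicator (cube z l) y * indicator (cube z l) w) \<partial>lborel \<partial>lborel) =
     emeasure lborel (cube z l) * (\<integral>\<^sup>+y. G y * indicator (cube z l) y \<partial>lborel)"
proof -
  let ?F = "\<lambda>y w. G y * (indicator (cube z l) y * indicator (cube z l) w)"
  have "(\<integral>\<^sup>+y. \<integral>\<^sup>+w. G (mix A y w) * (indicator (cube z l) y * indicator (cube z l) w) \<partial>lborel \<partial>lborel) =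
      (\<integral>\<^sup>+y. \<integral>\<^sup>+w. ?F (mix A y w) (mix A w y) \<partial>lborel \<partial>lborel)"
    by (simp only: indicator_cube_mix)
  also have "\<dots> = (\<integral>\<^sup>+y. \<integral>\<^sup>+w. ?F y w \<partial>lborel \<partial>lborel)"
    by (rule nn_integral_mix) measurable
  also have "\<dots> = (\<integral>\<^sup>+y. emeasure lborel (cube z l) * (G y * indicator (cube z l) y) \<partial>lborel)"
  proof (rule nn_integral_cong)
    fix y
    have "(\<integral>\<^sup>+w. ?F y w \<partial>lborel) = (\<integral>\<^sup>+w. (G y * indicator (cube z l) y) * indicator (cube z l) w \<partial>lborel)"
      by (simp only: mult.assoc)
    also have "\<dots> = (G y * indicator (cube z l) y) * emeasure lborel (cube z l)"
      by (rule nn_integral_cmult_indicator) simp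
    finally show "(\<integral>\<^sup>+w. ?F y w \<partial>lborel) = emeasure lborel (cube z l) * (G y * indicator (cube z l) y)"
      by (simp only: mult.commute)
  qed
  also have "\<dots> = emeasure lborel (cube z l) * (\<integral>\<^sup>+y. G y * indicator (cube z l) y \<partial>lborel)"
    by (rule nn_integral_cmult) measurable
  finally show ?thesis .
qed

text \<open>Suppose that the three second differences vanish but the first factor does not. The
  first two then say that replacing the coordinates other than \<open>i\<close> of \<open>x\<close>
  by those of \<open>y\<close> changes the indicator by the same amount, 1 or -1, whether the
  coordinate \<open>i\<close> is that of \<open>x\<close>, \<open>x1\<close> or \<open>y1\<close>.
  For an indicator such a change determines both values. So, over the other coordinates of
  \<open>x\<close>, membership is the same at the coordinates \<open>i\<close> of \<open>x1\<close>
  and \<open>y1\<close>; the third difference transfers this to the other coordinates of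
  \<open>x1\<close>, and the second factor vanishes.\<close>

lemma osc_pointwise:
  "\<bar>indicat_real E x - indicat_real E (mix {i} y x)\<bar> * \<bar>indicat_real E x1 - indicat_real E (mix {i} x1 y1)\<bar> \<le>
   mixed_diff i E x (mix {i} y x1) + mixed_diff i E x (mix {i} y y1) + mixed_diff i E x1 (mix {i} x y1)"
proof -
  have e: "mix {i} x (mix {i} y x1) = mix {i} x x1" "mix {i} (mix {i} y x1) x = mix {i} y x"
    "mix {i} x (mix {i} y y1) = mix {i} x y1" "mix {i} (mix {i} y y1) x = mix {i} y x"
    "mix {i} x1 (mix {i} x y1) = mix {i} x1 y1" "mix {i} (mix {i} x y1) x1 = mix {i} x x1"
    by (simp_all add: vec_eq_iff)
  show ?thesis
    unfolding mixed_diff_def e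
    by (cases "x \<in> E"; cases "mix {i} y x \<in> E"; cases "x1 \<in> E"; cases "mix {i} x1 y1 \<in> E"; cases "mix {i} x x1 \<in> E";
      cases "mix {i} y x1 \<in> E"; cases "mix {i} x y1 \<in> E"; cases "mix {i} y y1 \<in> E") simp_all
qed

text \<open>The pointwise bound is integrated over four independent points. In each of its three
  terms the two points that occur are, after resampling, a uniform pair, which gives
  \<open>mixed_total\<close>; the remaining freedom contributes the squared volume.\<close>

lemma osc_product_le:
  fixes E :: "(real^'n::finite) set"
  assumes E[measurable]: "E \<in> sets borel"
  shows "osc (- {i}) E z l * osc {i} E z l \<le> 3 * (emeasure lborel (cube z l))\<^sup>2 * mixed_total i E (cube z l)"
proof -
  let ?Q = "cube z l"
  define V where "V = emeasure lborel ?Q"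
  define q :: "real^'n \<Rightarrow> ennreal" where "q = indicator ?Q"
  have [measurable]: "q \<in> borel_measurable borel" by (simp add: q_def)
  have Vq: "(\<integral>\<^sup>+x. c * q x \<partial>lborel) = c * V" for c
    unfolding q_def V_def by (rule nn_integral_cmult_indicator) simp
  define m where "m x y = ennreal (mixed_diff i E x y)" for x y
  have mm[measurable (raw)]: "(\<lambda>p. m (f p) (g p)) \<in> borel_measurable M"
    if [measurable]: "f \<in> borel_measurable M" "g \<in> borel_measurable M" for f g and M :: "'z measure"
    unfolding m_def by measurable
  define a where "a x y = ennreal \<bar>indicat_real E x - indicat_real E (mix {i} y x)\<bar>" for x y
  define b where "b x y = ennreal \<bar>indicat_real E x - indicat_real E (mix {i} x y)\<bar>" for x y
  have am[measurable (raw)]: "(\<lambda>p. a (f p) (g p)) \<in> borel_measurable M" "(\<lambda>p. b (f p) (g p)) \<in> borel_measurable M"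
    if [measurable]: "f \<in> borel_measurable M" "g \<in> borel_measurable M" for f g and M :: "'z measure"
    unfolding a_def b_def by measurable
  let ?X = "\<integral>\<^sup>+x. \<integral>\<^sup>+y. a x y * (q x * q y) \<partial>lborel \<partial>lborel"
  let ?Y = "\<integral>\<^sup>+x. \<integral>\<^sup>+y. b x y * (q x * q y) \<partial>lborel \<partial>lborel"
  let ?M = "\<integral>\<^sup>+x. \<integral>\<^sup>+y. m x y * (q x * q y) \<partial>lborel \<partial>lborel"
  have right: "(\<integral>\<^sup>+y. \<integral>\<^sup>+w. m x (mix {i} y w) * (q y * q w) \<partial>lborel \<partial>lborel) = V * (\<integral>\<^sup>+y. m x y * q y \<partial>lborel)" for x
    unfolding q_def V_def by (rule nn_integral_mix_right) measurable
  have M': "?M = (\<integral>\<^sup>+x. (\<integral>\<^sup>+y. m x y * q y \<partial>lborel) * q x \<partial>lborel)"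
    by (intro nn_integral_cong, subst nn_integral_multc[symmetric], measurable) (auto intro!: nn_integral_cong simp: mult_ac)
  have ab: "a x y * b x1 y1 \<le> m x (mix {i} y x1) + m x (mix {i} y y1) + m x1 (mix {i} x y1)" for x y x1 y1
  proof -
    have "a x y * b x1 y1 = ennreal (\<bar>indicat_real E x - indicat_real E (mix {i} y x)\<bar> * \<bar>indicat_real E x1 - indicat_real E (mix {i} x1 y1)\<bar>)"
      by (simp add: a_def b_def ennreal_mult)
    also have "\<dots> \<le> ennreal (mixed_diff i E x (mix {i} y x1) + mixed_diff i E x (mix {i} y y1) + mixed_diff i E x1 (mix {i} x y1))"
      by (rule ennreal_leI[OF osc_pointwise])
    also have "\<dots> = m x (mix {i} y x1) + m x (mix {i} y y1) + m x1 (mix {i} x y1)"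
      by (simp add: m_def mixed_diff_def)
    finally show ?thesis .
  qed
  \<comment> \<open>The product of the two double integrals is expanded one pair at a time, here
    over \<open>x1\<close> and \<open>y1\<close> with \<open>x\<close> and \<open>y\<close>
    fixed.\<close>
  have aY: "a x y * ?Y \<le> 2 * (V * (\<integral>\<^sup>+w. m x (mix {i} y w) * q w \<partial>lborel)) + (\<integral>\<^sup>+x1. \<integral>\<^sup>+y1. m x1 (mix {i} x y1) * (q x1 * q y1) \<partial>lborel \<partial>lborel)" for x y
  proof -
    have "a x y * ?Y = (\<integral>\<^sup>+x1. \<integral>\<^sup>+y1. (a x y * b x1 y1) * (q x1 * q y1) \<partial>lborel \<partial>lborel)"
      by (simp add: nn_integral_cmult[symmetric] mult.assoc)
    also have "\<dots> \<le> (\<integral>\<^sup>+x1. \<integral>\<^sup>+y1. (m x (mix {i} y x1) + m x (mix {i} y y1) + m x1 (mix {i} x y1)) * (q x1 * q y1) \<partial>lborel \<partial>lborel)"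
      by (intro nn_integral_mono mult_right_mono ab) simp
    also have "\<dots> = (\<integral>\<^sup>+x1. \<integral>\<^sup>+y1. (m x (mix {i} y x1) * q x1) * q y1 \<partial>lborel \<partial>lborel) + (\<integral>\<^sup>+x1. \<integral>\<^sup>+y1. q x1 * (m x (mix {i} y y1) * q y1) \<partial>lborel \<partial>lborel)
       + (\<integral>\<^sup>+x1. \<integral>\<^sup>+y1. m x1 (mix {i} x y1) * (q x1 * q y1) \<partial>lborel \<partial>lborel)"
    proof -
      have "(m x (mix {i} y x1) + m x (mix {i} y y1) + m x1 (mix {i} x y1)) * (q x1 * q y1) =
        (m x (mix {i} y x1) * q x1) * q y1 + q x1 * (m x (mix {i} y y1) * q y1) + m x1 (mix {i} x y1) * (q x1 * q y1)" for x1 y1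
        unfolding distrib_right by (simp only: mult_ac)
      then show ?thesis by (simp add: nn_integral_add)
    qed
    also have "(\<integral>\<^sup>+x1. \<integral>\<^sup>+y1. (m x (mix {i} y x1) * q x1) * q y1 \<partial>lborel \<partial>lborel) = (\<integral>\<^sup>+w. m x (mix {i} y w) * q w \<partial>lborel) * V"
      unfolding Vq by (rule nn_integral_multc) measurable
    also have "(\<integral>\<^sup>+x1. \<integral>\<^sup>+y1. q x1 * (m x (mix {i} y y1) * q y1) \<partial>lborel \<partial>lborel) = (\<integral>\<^sup>+w. m x (mix {i} y w) * q w \<partial>lborel) * V"
    proof -
      have "(\<integral>\<^sup>+x1. \<integral>\<^sup>+y1. q x1 * (m x (mix {i} y y1) * q y1) \<partial>lborel \<partial>lborel) = (\<integral>\<^sup>+x1. (\<integral>\<^sup>+w. m x (mix {i} y w) * q w \<partial>lborel) * q x1 \<partial>lborel)"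
        by (intro nn_integral_cong, subst nn_integral_cmult, measurable) (simp only: mult.commute)
      then show ?thesis unfolding Vq .
    qed
    finally show ?thesis by (simp add: mult_2 mult.commute)
  qed
  have "?X * ?Y = (\<integral>\<^sup>+x. \<integral>\<^sup>+y. (a x y * ?Y) * (q x * q y) \<partial>lborel \<partial>lborel)"
    by (simp add: nn_integral_multc[symmetric] mult_ac)
  also have "\<dots> \<le> (\<integral>\<^sup>+x. \<integral>\<^sup>+y. (2 * (V * (\<integral>\<^sup>+w. m x (mix {i} y w) * q w \<partial>lborel)) + (\<integral>\<^sup>+x1. \<integral>\<^sup>+y1. m x1 (mix {i} x y1) * (q x1 * q y1) \<partial>lborel \<partial>lborel)) * (q x * q y) \<partial>lborel \<partial>lborel)"
    by (intro nn_integral_mono mult_right_mono aY) simp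
  also have "\<dots> = (\<integral>\<^sup>+x. \<integral>\<^sup>+y. (2 * V * q x) * ((\<integral>\<^sup>+w. m x (mix {i} y w) * q w \<partial>lborel) * q y) \<partial>lborel \<partial>lborel) +
     (\<integral>\<^sup>+x. \<integral>\<^sup>+y. ((\<integral>\<^sup>+x1. \<integral>\<^sup>+y1. m x1 (mix {i} x y1) * (q x1 * q y1) \<partial>lborel \<partial>lborel) * q x) * q y \<partial>lborel \<partial>lborel)"
  proof -
    have "(2 * (V * H) + L) * (q x * q y) = (2 * V * q x) * (H * q y) + (L * q x) * q y" for H L x y
      unfolding distrib_right by (simp only: mult_ac)
    then show ?thesis by (simp add: nn_integral_add)
  qed
  also have "(\<integral>\<^sup>+x. \<integral>\<^sup>+y. (2 * V * q x) * ((\<integral>\<^sup>+w. m x (mix {i} y w) * q w \<partial>lborel) * q y) \<partial>lborel \<partial>lborel) = 2 * V * V * ?M"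
  proof -
    have "(\<integral>\<^sup>+y. (2 * V * q x) * ((\<integral>\<^sup>+w. m x (mix {i} y w) * q w \<partial>lborel) * q y) \<partial>lborel) = 2 * V * V * ((\<integral>\<^sup>+y. m x y * q y \<partial>lborel) * q x)" for x
    proof -
      have "(\<integral>\<^sup>+y. (2 * V * q x) * ((\<integral>\<^sup>+w. m x (mix {i} y w) * q w \<partial>lborel) * q y) \<partial>lborel) =
        (2 * V * q x) * (\<integral>\<^sup>+y. (\<integral>\<^sup>+w. m x (mix {i} y w) * q w \<partial>lborel) * q y \<partial>lborel)"
        by (rule nn_integral_cmult) measurable
      also have "(\<integral>\<^sup>+y. (\<integral>\<^sup>+w. m x (mix {i} y w) * q w \<partial>lborel) * q y \<partial>lborel) = (\<integral>\<^sup>+y. \<integral>\<^sup>+w. m x (mix {i} y w) * (q y * q w) \<partial>lborel \<partial>lborel)"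
        by (intro nn_integral_cong, subst nn_integral_multc[symmetric], measurable) (auto intro!: nn_integral_cong simp: mult_ac)
      finally show ?thesis unfolding right by (simp only: mult_ac)
    qed
    then show ?thesis unfolding M' by (simp add: nn_integral_cmult)
  qed
  also have "(\<integral>\<^sup>+x. \<integral>\<^sup>+y. ((\<integral>\<^sup>+x1. \<integral>\<^sup>+y1. m x1 (mix {i} x y1) * (q x1 * q y1) \<partial>lborel \<partial>lborel) * q x) * q y \<partial>lborel \<partial>lborel) = V * V * ?M"
  proof -
    have "(\<integral>\<^sup>+x. \<integral>\<^sup>+y. ((\<integral>\<^sup>+x1. \<integral>\<^sup>+y1. m x1 (mix {i} x y1) * (q x1 * q y1) \<partial>lborel \<partial>lborel) * q x) * q y \<partial>lborel \<partial>lborel) =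
      (\<integral>\<^sup>+x. (\<integral>\<^sup>+x1. \<integral>\<^sup>+y1. m x1 (mix {i} x y1) * (q x1 * q y1) \<partial>lborel \<partial>lborel) * q x \<partial>lborel) * V"
      unfolding Vq by (rule nn_integral_multc) measurable
    also have "(\<integral>\<^sup>+x. (\<integral>\<^sup>+x1. \<integral>\<^sup>+y1. m x1 (mix {i} x y1) * (q x1 * q y1) \<partial>lborel \<partial>lborel) * q x \<partial>lborel) =
        (\<integral>\<^sup>+x. \<integral>\<^sup>+x1. (\<integral>\<^sup>+y1. m x1 (mix {i} x y1) * (q x * q y1) \<partial>lborel) * q x1 \<partial>lborel \<partial>lborel)"
      by (intro nn_integral_cong, subst nn_integral_multc[symmetric], measurable, intro nn_integral_cong,
          subst (1 2) nn_integral_multc[symmetric], measurable) (auto intro!: nn_integral_cong simp: mult_ac)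
    also have "\<dots> = (\<integral>\<^sup>+x1. \<integral>\<^sup>+x. (\<integral>\<^sup>+y1. m x1 (mix {i} x y1) * (q x * q y1) \<partial>lborel) * q x1 \<partial>lborel \<partial>lborel)"
      by (rule nn_integral_swap) measurable
    also have "\<dots> = (\<integral>\<^sup>+x1. V * ((\<integral>\<^sup>+y. m x1 y * q y \<partial>lborel) * q x1) \<partial>lborel)"
      by (intro nn_integral_cong, subst nn_integral_multc, measurable) (simp only: right mult.assoc)
    also have "\<dots> = V * ?M" unfolding M' by (rule nn_integral_cmult) measurable
    finally show ?thesis by (simp only: mult_ac)
  qed
  also have "2 * V * V * ?M + V * V * ?M = 3 * V\<^sup>2 * ?M"
  proof -
    have "3 * V\<^sup>2 * ?M = (2 + 1) * (V\<^sup>2 * ?M)" by (simp add: mult.assoc)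
    then show ?thesis by (simp only: distrib_right power2_eq_square mult.assoc mult_1)
  qed
  finally show ?thesis
    unfolding osc_def mixed_total_def mix_Compl a_def b_def m_def q_def V_def .
qed

text \<open>First \<open>A\<close> is resampled, then \<open>j\<close>. After the first step the
  point is again uniform in the cube, so the second step contributes exactly
  \<open>osc {j}\<close>.\<close>

lemma osc_insert_le:
  fixes E :: "(real^'n::finite) set"
  assumes E[measurable]: "E \<in> sets borel" and j: "j \<notin> A"
  shows "osc (insert j A) E z l \<le> osc A E z l + osc {j} E z l"
proof -
  let ?q = "indicator (cube z l) :: real^'n \<Rightarrow> ennreal"
  define F where "F x y = ennreal \<bar>indicat_real E x - indicat_real E (mix {j} x y)\<bar> * (?q x * ?q y)" for x y
  have eq: "mix (insert j A) x y = mix {j} (mix A x y) (mix A y x)" for x y :: "real^'n"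
    using j by (auto simp: vec_eq_iff)
  have "osc (insert j A) E z l \<le> (\<integral>\<^sup>+x. \<integral>\<^sup>+y. ennreal \<bar>indicat_real E x - indicat_real E (mix A x y)\<bar> * (?q x * ?q y)
      + F (mix A x y) (mix A y x) \<partial>lborel \<partial>lborel)"
    unfolding osc_def
  proof (intro nn_integral_mono)
    fix x y :: "real^'n"
    have "ennreal \<bar>indicat_real E x - indicat_real E (mix (insert j A) x y)\<bar> \<le>
      ennreal (\<bar>indicat_real E x - indicat_real E (mix A x y)\<bar> + \<bar>indicat_real E (mix A x y) - indicat_real E (mix (insert j A) x y)\<bar>)"
      by (intro ennreal_leI) linarith
    then have "ennreal \<bar>indicat_real E x - indicat_real E (mix (insert j A) x y)\<bar> * (?q x * ?q y) \<le>
      (ennreal \<bar>indicat_real E x - indicat_real E (mix A x y)\<bar> + ennreal \<bar>indicat_real E (mix A x y) - indicat_real E (mix (insert j A) x y)\<bar>) * (?q x * ?q y)"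
      by (intro mult_right_mono) auto
    then show "ennreal \<bar>indicat_real E x - indicat_real E (mix (insert j A) x y)\<bar> * (?q x * ?q y) \<le>
      ennreal \<bar>indicat_real E x - indicat_real E (mix A x y)\<bar> * (?q x * ?q y) + F (mix A x y) (mix A y x)"
      unfolding F_def indicator_cube_mix eq by (simp only: distrib_right)
  qed
  also have "\<dots> = osc A E z l + (\<integral>\<^sup>+x. \<integral>\<^sup>+y. F (mix A x y) (mix A y x) \<partial>lborel \<partial>lborel)"
    unfolding osc_def F_def by (simp add: nn_integral_add)
  also have "(\<integral>\<^sup>+x. \<integral>\<^sup>+y. F (mix A x y) (mix A y x) \<partial>lborel \<partial>lborel) = osc {j} E z l"
    unfolding osc_def F_def[symmetric] by (rule nn_integral_mix) (unfold F_def, measurable)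
  finally show ?thesis .
qed

lemma osc_le_sum:
  fixes E :: "(real^'n::finite) set"
  assumes E: "E \<in> sets borel"
  shows "osc A E z l \<le> (\<Sum>j\<in>A. osc {j} E z l)"
proof (induction A rule: finite_induct[OF finite])
  case 1
  have "mix {} x y = x" for x y :: "real^'n" by (simp add: vec_eq_iff)
  then show ?case by (simp add: osc_def)
next
  case (2 j A)
  have "osc (insert j A) E z l \<le> osc A E z l + osc {j} E z l" by (rule osc_insert_le[OF E 2(2)])
  also have "\<dots> \<le> (\<Sum>j\<in>A. osc {j} E z l) + osc {j} E z l" by (rule add_right_mono[OF 2(3)])
  finally show ?case using 2(1,2) by (simp add: add.commute)
qed

lemma osc_finite:
  fixes E :: "(real^'n::finite) set"
  assumes "l > 0" shows "osc A E z l < \<infinity>"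
proof -
  let ?q = "indicator (cube z l) :: real^'n \<Rightarrow> ennreal"
  have "osc A E z l \<le> (\<integral>\<^sup>+x. \<integral>\<^sup>+y. ?q x * ?q y \<partial>lborel \<partial>lborel)"
    unfolding osc_def
    by (intro nn_integral_mono) (auto simp: indicator_def)
  also have "\<dots> = emeasure lborel (cube z l :: (real^'n) set) * emeasure lborel (cube z l :: (real^'n) set)"
    by (simp add: nn_integral_cmult nn_integral_multc)
  also have "\<dots> < \<infinity>" using assms by (simp add: emeasure_cube ennreal_mult_less_top)
  finally show ?thesis .
qed

text \<open>By the product bound, one of the two oscillations is small for every \<open>i\<close>.
  If it is never the one for \<open>- {i}\<close>, then \<open>E\<close> nearly ignores each single
  coordinate, hence is nearly constant, and every \<open>i\<close> will do; adding up the single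
  oscillations causes the factor \<open>d\<close>.\<close>

theorem almost_one_dimensional:
  fixes E :: "(real^'n::finite) set"
  assumes E: "E \<in> sets borel" and l: "l > 0" and \<sigma>: "0 \<le> \<sigma>" and le: "\<And>i. mixed_total i E (cube z l) \<le> ennreal \<sigma>"
  obtains i where "osc (- {i}) E z l \<le> ennreal (real CARD('n) * (sqrt (3 * \<sigma>) * l ^ CARD('n)))"
proof -
  \<comment> \<open>The square of \<open>m\<close> is the bound of \<open>osc_product_le\<close> for
    the product of the two oscillations.\<close>
  define m where "m = sqrt (3 * \<sigma>) * l ^ CARD('n)"
  have m0: "0 \<le> m" using l \<sigma> by (simp add: m_def)
  have either: "osc (- {i}) E z l \<le> ennreal m \<or> osc {i} E z l \<le> ennreal m" for i
  proof (rule ccontr)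
    assume n: "\<not> ?thesis"
    obtain a where a: "osc (- {i}) E z l = ennreal a" "0 \<le> a"
      using osc_finite[OF l, of "- {i}" E z] by (cases "osc (- {i}) E z l") auto
    obtain b where b: "osc {i} E z l = ennreal b" "0 \<le> b"
      using osc_finite[OF l, of "{i}" E z] by (cases "osc {i} E z l") auto
    have ab: "m < a" "m < b" using n a b m0 by (auto simp: not_le ennreal_less_iff)
    have "ennreal (a * b) \<le> 3 * (emeasure lborel (cube z l))\<^sup>2 * mixed_total i E (cube z l)"
      using osc_product_le[OF E, of i z l] a b by (simp add: ennreal_mult)
    also have "\<dots> \<le> 3 * (emeasure lborel (cube z l))\<^sup>2 * ennreal \<sigma>"
      by (intro mult_left_mono le) simp
    also have "\<dots> = ennreal (3 * (l ^ CARD('n))\<^sup>2 * \<sigma>)"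
      using l \<sigma> by (simp add: emeasure_cube ennreal_mult ennreal_power)
    also have "3 * (l ^ CARD('n))\<^sup>2 * \<sigma> = m * m"
      using \<sigma> by (simp add: m_def power2_eq_square real_sqrt_mult_self mult_ac)
    finally have "a * b \<le> m * m" using m0 by (simp add: ennreal_le_iff)
    moreover have "m * m < a * b" using ab m0 by (intro mult_strict_mono') auto
    ultimately show False by simp
  qed
  have d1: "real CARD('n) \<ge> 1" by (simp add: Suc_leI)
  show thesis
  proof (cases "\<exists>i. osc (- {i}) E z l \<le> ennreal m")
    case True
    then obtain i where "osc (- {i}) E z l \<le> ennreal m" by blast
    also have "\<dots> \<le> ennreal (real CARD('n) * m)" using d1 m0 mult_right_mono[of 1 "real CARD('n)" m] by (intro ennreal_leI) simp
    finally show ?thesis using that unfolding m_def by blast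
  next
    case False
    then have Y: "osc {j} E z l \<le> ennreal m" for j using either by blast
    fix i :: 'n
    have "osc (- {i}) E z l \<le> (\<Sum>j\<in>- {i}. osc {j} E z l)" by (rule osc_le_sum[OF E])
    also have "\<dots> \<le> (\<Sum>j\<in>- {i}. ennreal m)" by (intro sum_mono Y)
    also have "\<dots> = ennreal (real (card (- {i})) * m)"
      using m0 by (simp add: ennreal_mult ennreal_of_nat_eq_real_of_nat)
    also have "\<dots> \<le> ennreal (real CARD('n) * m)"
      using m0 by (intro ennreal_leI mult_right_mono) (auto intro: card_mono)
    finally show ?thesis using that unfolding m_def by blast
  qed
qed

text \<open>The \<open>L^1\<close> distance in the cube between \<open>E\<close> and the union of
  stripes whose profile is the slice at \<open>t\<close>.\<close>

definition slice_dist :: "'n::finite \<Rightarrow> (real^'n) set \<Rightarrow> real^'n \<Rightarrow> real \<Rightarrow> ('n \<Rightarrow> real) \<Rightarrow> ennreal" where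
  "slice_dist i E z l t = (\<integral>\<^sup>+x. ennreal \<bar>indicat_real E x - indicat_real E (glue i t (x $ i))\<bar> * indicator (cube z l) x \<partial>lborel)"

lemma borel_measurable_glue_vec[measurable (raw)]:
  assumes "f \<in> M \<rightarrow>\<^sub>M perp_borel i" "g \<in> borel_measurable M"
  shows "(\<lambda>p. glue i (f p) (g p)) \<in> borel_measurable M"
proof -
  have "(\<lambda>p. (f p, g p)) \<in> M \<rightarrow>\<^sub>M perp_borel i \<Otimes>\<^sub>M lborel" using assms by measurable
  from measurable_compose[OF this measurable_glue] show ?thesis by simp
qed

lemma borel_measurable_slice_dist[measurable]:
  assumes [measurable]: "E \<in> sets borel"
  shows "slice_dist i E z l \<in> borel_measurable (perp_borel i)"
  unfolding slice_dist_def by measurable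

lemma indicator_cube_glue:
  assumes "t \<in> space (perp_borel i)"
  shows "(indicator (cube z l) (glue i t s) :: ennreal) = indicator (perp_cube i z l) t * indicator {s. \<bar>s - z $ i\<bar> \<le> l / 2} s"
  using assms
  by (auto simp: indicator_def cube_def perp_cube_def perp_lebesgue_def glue_def split: if_splits)

lemma perp_cube_in_sets[measurable]: "l > 0 \<Longrightarrow> perp_cube i z l \<in> sets (perp_borel i)"
proof -
  assume "l > 0"
  have "perp_cube i z l = (\<lambda>t. glue i t (z $ i)) -` cube z l \<inter> space (perp_borel i)"
    using \<open>l > 0\<close> by (auto simp: cube_def perp_cube_def perp_lebesgue_def glue_def)
  also have "\<dots> \<in> sets (perp_borel i)" by measurable
  finally show ?thesis .
qed

text \<open>Replacing the coordinates other than \<open>i\<close> of \<open>x\<close> by those of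
  \<open>y\<close> forgets the coordinate \<open>i\<close> of \<open>y\<close>, whose integration
  gives the factor \<open>l\<close>. Small oscillation thus means that slices represent
  \<open>E\<close> well on average.\<close>

lemma osc_eq_slice_dist:
  fixes E :: "(real^'n::finite) set"
  assumes E[measurable]: "E \<in> sets borel" and l: "l > 0"
  shows "osc (- {i}) E z l = ennreal l * (\<integral>\<^sup>+t\<in>perp_cube i z l. slice_dist i E z l t \<partial>perp_borel i)"
proof -
  note [measurable] = perp_cube_in_sets[OF l, of i z]
  let ?q = "indicator (cube z l) :: real^'n \<Rightarrow> ennreal"
  let ?h = "\<lambda>y. (\<integral>\<^sup>+x. ennreal \<bar>indicat_real E x - indicat_real E (mix {i} y x)\<bar> * ?q x \<partial>lborel)"
  have "osc (- {i}) E z l = (\<integral>\<^sup>+y. \<integral>\<^sup>+x. ennreal \<bar>indicat_real E x - indicat_real E (mix {i} y x)\<bar> * (?q x * ?q y) \<partial>lborel \<partial>lborel)"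
    unfolding osc_def mix_Compl by (rule nn_integral_swap) measurable
  also have "\<dots> = (\<integral>\<^sup>+y. ?h y * ?q y \<partial>lborel)"
    by (intro nn_integral_cong, subst nn_integral_multc[symmetric], measurable) (simp only: mult.assoc)
  also have "\<dots> = (\<integral>\<^sup>+t. \<integral>\<^sup>+s. ?h (glue i t s) * ?q (glue i t s) \<partial>lborel \<partial>perp_borel i)"
    by (rule nn_integral_glue) measurable
  also have "\<dots> = (\<integral>\<^sup>+t. ennreal l * (slice_dist i E z l t * indicator (perp_cube i z l) t) \<partial>perp_borel i)"
  proof (rule nn_integral_cong)
    fix t assume t: "t \<in> space (perp_borel i)"
    have "mix {i} (glue i t s) x = glue i t (x $ i)" for s x by (simp add: vec_eq_iff glue_def)
    then have h: "?h (glue i t s) = slice_dist i E z l t" for s unfolding slice_dist_def by simp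
    have I: "{s. \<bar>s - z $ i\<bar> \<le> l / 2} = {z $ i - l / 2..z $ i + l / 2}"
      by (auto simp: abs_if split: if_splits)
    have "(\<integral>\<^sup>+s. ?h (glue i t s) * ?q (glue i t s) \<partial>lborel) =
      (\<integral>\<^sup>+s. (slice_dist i E z l t * indicator (perp_cube i z l) t) * indicator {z $ i - l / 2..z $ i + l / 2} s \<partial>lborel)"
      by (simp only: h indicator_cube_glue[OF t] I mult.assoc)
    also have "\<dots> = (slice_dist i E z l t * indicator (perp_cube i z l) t) * emeasure lborel {z $ i - l / 2..z $ i + l / 2}"
      by (rule nn_integral_cmult_indicator) simp
    also have "\<dots> = ennreal l * (slice_dist i E z l t * indicator (perp_cube i z l) t)"
      using l by (simp add: mult.commute)
    finally show "(\<integral>\<^sup>+s. ?h (glue i t s) * ?q (glue i t s) \<partial>lborel) = ennreal l * (slice_dist i E z l t * indicator (perp_cube i z l) t)" .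
  qed
  also have "\<dots> = ennreal l * (\<integral>\<^sup>+t\<in>perp_cube i z l. slice_dist i E z l t \<partial>perp_borel i)"
    by (rule nn_integral_cmult) measurable
  finally show ?thesis .
qed

section \<open>Gaps between boundary points\<close>

text \<open>Periodicity bounds the gaps: as soon as there is one boundary point, every point has a
  neighbouring boundary point on each side, at distance at most the period.\<close>

definition periodic_set :: "real \<Rightarrow> real set \<Rightarrow> bool" where
  "periodic_set L J \<longleftrightarrow> L > 0 \<and> (\<forall>x. x + L \<in> J \<longleftrightarrow> x \<in> J)"

lemma periodic_set_int:
  assumes "periodic_set L J" shows "x + of_int k * L \<in> J \<longleftrightarrow> x \<in> J"
proof (induction k rule: int_induct[where k=0])
  case (step1 k)
  have "x + of_int (k + 1) * L = (x + of_int k * L) + L" by (simp add: algebra_simps)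
  with step1 assms show ?case unfolding periodic_set_def by metis
next
  case (step2 k)
  have "x + of_int k * L = (x + of_int (k - 1) * L) + L" by (simp add: algebra_simps)
  with step2 assms show ?case unfolding periodic_set_def by metis
qed simp

lemma periodic_set_next:
  assumes p: "periodic_set L J" and ne: "s \<in> J"
  obtains n where "n \<in> J" "u < n" "n \<le> u + L"
proof -
  have L: "L > 0" using p by (simp add: periodic_set_def)
  define k where "k = \<lfloor>(u - s) / L\<rfloor>"
  have "of_int k \<le> (u - s) / L" "(u - s) / L < of_int k + 1" by (simp_all add: k_def)
  then have "of_int k * L \<le> u - s" "u - s < (of_int k + 1) * L" using L by (simp_all add: field_simps)
  then show thesis
    using periodic_set_int[OF p, of s "k + 1"] ne by (intro that[of "s + of_int (k + 1) * L"]) (auto simp: algebra_simps)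
qed

lemma periodic_set_prev:
  assumes p: "periodic_set L J" and ne: "s \<in> J"
  obtains n where "n \<in> J" "n < u" "u - L \<le> n"
proof -
  have L: "L > 0" using p by (simp add: periodic_set_def)
  define k where "k = \<lceil>(u - s) / L\<rceil>"
  have "(u - s) / L \<le> of_int k" "of_int k - 1 < (u - s) / L" unfolding k_def by linarith+
  then have "u - s \<le> of_int k * L" "(of_int k - 1) * L < u - s" using L by (simp_all add: field_simps)
  then show thesis
    using periodic_set_int[OF p, of s "k - 1"] ne by (intro that[of "s + of_int (k - 1) * L"]) (auto simp: algebra_simps)
qed

lemma next_boundary_obtain:
  assumes lf: "locally_finite_boundary S" and red: "reduced_boundary S = ess_boundary S"
    and p: "periodic_set L (ess_boundary S)" and ne: "s \<in> ess_boundary S"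
  obtains n where "next_boundary S u = ereal n" "n \<in> ess_boundary S" "u < n" "n \<le> u + L" "ess_boundary S \<inter> {u<..<n} = {}"
proof -
  let ?F = "ess_boundary S \<inter> {u<..<u + L + 1}"
  obtain n0 where n0: "n0 \<in> ess_boundary S" "u < n0" "n0 \<le> u + L" using periodic_set_next[OF p ne] .
  have fin: "finite ?F" and n0F: "n0 \<in> ?F" using lf n0 by (auto simp: locally_finite_boundary_def)
  define n where "n = Min ?F"
  have n: "n \<in> ?F" unfolding n_def using fin n0F by (intro Min_in) auto
  have nle: "n \<le> y" if "y \<in> ?F" for y unfolding n_def using fin that by (rule Min_le)
  have le: "n \<le> y" if "y \<in> ess_boundary S" "u < y" for y
    using that nle[of y] nle[OF n0F] n0 by (cases "y < u + L + 1") auto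
  have "next_boundary S u = ereal n"
    unfolding next_boundary_def red
    by (rule antisym; (intro Inf_lower Inf_greatest)?) (use n le in auto)
  then show thesis using n le nle[OF n0F] n0 by (intro that[of n]) force+
qed

lemma prev_boundary_obtain:
  assumes lf: "locally_finite_boundary S" and red: "reduced_boundary S = ess_boundary S"
    and p: "periodic_set L (ess_boundary S)" and ne: "s \<in> ess_boundary S"
  obtains n where "prev_boundary S u = ereal n" "n \<in> ess_boundary S" "n < u" "u - L \<le> n" "ess_boundary S \<inter> {n<..<u} = {}"
proof -
  let ?F = "ess_boundary S \<inter> {u - L - 1<..<u}"
  obtain n0 where n0: "n0 \<in> ess_boundary S" "n0 < u" "u - L \<le> n0" using periodic_set_prev[OF p ne] .
  have fin: "finite ?F" and n0F: "n0 \<in> ?F" using lf n0 by (auto simp: locally_finite_boundary_def)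
  define n where "n = Max ?F"
  have n: "n \<in> ?F" unfolding n_def using fin n0F by (intro Max_in) auto
  have nle: "y \<le> n" if "y \<in> ?F" for y unfolding n_def using fin that by (rule Max_ge)
  have le: "y \<le> n" if "y \<in> ess_boundary S" "y < u" for y
    using that nle[of y] nle[OF n0F] n0 by (cases "u - L - 1 < y") auto
  have "prev_boundary S u = ereal n"
    unfolding prev_boundary_def red
    by (rule antisym; (intro Sup_upper Sup_least)?) (use n le in auto)
  then show thesis using n le nle[OF n0F] n0 by (intro that[of n]) force+
qed

lemma AE_not_ess_boundary:
  assumes "locally_finite_boundary S" shows "AE u in lborel. u \<notin> ess_boundary S"
  using countable_ess_boundary[OF assms] by (intro AE_not_in countable_imp_null_set_lborel)

text \<open>Off the null set of boundary points, \<open>u\<close> lies in the gap to the left of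
  \<open>s\<close> exactly when \<open>s\<close> is the first boundary point after \<open>u\<close>.
  A sum over a set that varies with the slice is thereby traded for an integral over the
  line.\<close>

lemma sum_left_gaps:
  fixes f :: "real \<Rightarrow> ennreal"
  assumes lf: "locally_finite_boundary S" and red: "reduced_boundary S = ess_boundary S"
    and p: "periodic_set L (ess_boundary S)" and f[measurable]: "f \<in> borel_measurable borel"
    and J: "J = ess_boundary S \<inter> {a..b}"
  shows "(\<Sum>s\<in>J. \<integral>\<^sup>+u. f u * indicator (einterval (prev_boundary S s) (ereal s)) u \<partial>lborel) =
    (\<integral>\<^sup>+u. f u * indicator {u. ereal a \<le> next_boundary S u \<and> next_boundary S u \<le> ereal b} u \<partial>lborel)"
proof -
  have fin: "finite J" unfolding J
    by (rule finite_subset[of _ "ess_boundary S \<inter> {a - 1<..<b + 1}"]) (use lf in \<open>auto simp: locally_finite_boundary_def\<close>)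
  have "(\<Sum>s\<in>J. \<integral>\<^sup>+u. f u * indicator (einterval (prev_boundary S s) (ereal s)) u \<partial>lborel) =
      (\<integral>\<^sup>+u. (\<Sum>s\<in>J. f u * indicator (einterval (prev_boundary S s) (ereal s)) u) \<partial>lborel)"
    by (rule nn_integral_sum[symmetric]) measurable
  also have "\<dots> = (\<integral>\<^sup>+u. f u * indicator {u. ereal a \<le> next_boundary S u \<and> next_boundary S u \<le> ereal b} u \<partial>lborel)"
  proof (rule nn_integral_cong_AE)
    show "AE u in lborel. (\<Sum>s\<in>J. f u * indicator (einterval (prev_boundary S s) (ereal s)) u) =
        f u * indicator {u. ereal a \<le> next_boundary S u \<and> next_boundary S u \<le> ereal b} u"
      using AE_not_ess_boundary[OF lf]
    proof eventually_elim
      case (elim u)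
      show ?case
      \<comment> \<open>Without boundary points the next one is at infinity, outside every real
        interval, and both sides vanish.\<close>
      proof (cases "ess_boundary S = {}")
        case True
        have "next_boundary S u = \<infinity>" by (simp add: next_boundary_def red True top_ereal_def)
        then show ?thesis using True J by simp
      next
        case False
        then obtain s0 where s0: "s0 \<in> ess_boundary S" by blast
        obtain n where n: "next_boundary S u = ereal n" "n \<in> ess_boundary S" "u < n" "ess_boundary S \<inter> {u<..<n} = {}"
          using next_boundary_obtain[OF lf red p s0, of u] by blast
        have iff: "u \<in> einterval (prev_boundary S s) (ereal s) \<longleftrightarrow> s = n" if s: "s \<in> ess_boundary S" for s
        proof -
          obtain m where m: "prev_boundary S s = ereal m" "m \<in> ess_boundary S" "m < s" "ess_boundary S \<inter> {m<..<s} = {}"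
            using prev_boundary_obtain[OF lf red p s0, of s] by blast
          have "u \<in> einterval (prev_boundary S s) (ereal s) \<longleftrightarrow> m < u \<and> u < s" by (simp add: einterval_def m(1))
          also have "\<dots> \<longleftrightarrow> s = n"
          proof
            assume mu: "m < u \<and> u < s"
            then have "\<not> s < n" using n(4) s by auto
            moreover have "\<not> n < s" using m(4) n(2,3) mu by auto
            ultimately show "s = n" by simp
          next
            assume "s = n"
            then show "m < u \<and> u < s" using n m elim by (cases "m = u"; cases "u < m") auto
          qed
          finally show ?thesis .
        qed
        have "(\<Sum>s\<in>J. f u * indicator (einterval (prev_boundary S s) (ereal s)) u) = (\<Sum>s\<in>J. if s = n then f u else 0)"
          using iff J by (intro sum.cong) (auto simp: indicator_def)
        also have "\<dots> = (if n \<in> J then f u else 0)" using fin by simp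
        also have "\<dots> = f u * indicator {u. ereal a \<le> next_boundary S u \<and> next_boundary S u \<le> ereal b} u"
          using n J by (auto simp: indicator_def)
        finally show ?thesis .
      qed
    qed
  qed
  finally show ?thesis .
qed

lemma sum_right_gaps:
  fixes f :: "real \<Rightarrow> ennreal"
  assumes lf: "locally_finite_boundary S" and red: "reduced_boundary S = ess_boundary S"
    and p: "periodic_set L (ess_boundary S)" and f[measurable]: "f \<in> borel_measurable borel"
    and J: "J = ess_boundary S \<inter> {a..b}"
  shows "(\<Sum>s\<in>J. \<integral>\<^sup>+u. f u * indicator (einterval (ereal s) (next_boundary S s)) u \<partial>lborel) =
    (\<integral>\<^sup>+u. f u * indicator {u. ereal a \<le> prev_boundary S u \<and> prev_boundary S u \<le> ereal b} u \<partial>lborel)"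
proof -
  have fin: "finite J" unfolding J
    by (rule finite_subset[of _ "ess_boundary S \<inter> {a - 1<..<b + 1}"]) (use lf in \<open>auto simp: locally_finite_boundary_def\<close>)
  have "(\<Sum>s\<in>J. \<integral>\<^sup>+u. f u * indicator (einterval (ereal s) (next_boundary S s)) u \<partial>lborel) =
      (\<integral>\<^sup>+u. (\<Sum>s\<in>J. f u * indicator (einterval (ereal s) (next_boundary S s)) u) \<partial>lborel)"
    by (rule nn_integral_sum[symmetric]) measurable
  also have "\<dots> = (\<integral>\<^sup>+u. f u * indicator {u. ereal a \<le> prev_boundary S u \<and> prev_boundary S u \<le> ereal b} u \<partial>lborel)"
  proof (rule nn_integral_cong_AE)
    show "AE u in lborel. (\<Sum>s\<in>J. f u * indicator (einterval (ereal s) (next_boundary S s)) u) =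
        f u * indicator {u. ereal a \<le> prev_boundary S u \<and> prev_boundary S u \<le> ereal b} u"
      using AE_not_ess_boundary[OF lf]
    proof eventually_elim
      case (elim u)
      show ?case
      proof (cases "ess_boundary S = {}")
        case True
        have "prev_boundary S u = -\<infinity>" by (simp add: prev_boundary_def red True bot_ereal_def)
        then show ?thesis using True J by simp
      next
        case False
        then obtain s0 where s0: "s0 \<in> ess_boundary S" by blast
        obtain n where n: "prev_boundary S u = ereal n" "n \<in> ess_boundary S" "n < u" "ess_boundary S \<inter> {n<..<u} = {}"
          using prev_boundary_obtain[OF lf red p s0, of u] by blast
        have iff: "u \<in> einterval (ereal s) (next_boundary S s) \<longleftrightarrow> s = n" if s: "s \<in> ess_boundary S" for s
        proof -
          obtain m where m: "next_boundary S s = ereal m" "m \<in> ess_boundary S" "s < m" "ess_boundary S \<inter> {s<..<m} = {}"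
            using next_boundary_obtain[OF lf red p s0, of s] by blast
          have "u \<in> einterval (ereal s) (next_boundary S s) \<longleftrightarrow> s < u \<and> u < m" by (simp add: einterval_def m(1))
          also have "\<dots> \<longleftrightarrow> s = n"
          proof
            assume mu: "s < u \<and> u < m"
            then have "\<not> n < s" using n(4) s by auto
            moreover have "\<not> s < n" using m(4) n(2,3) mu by auto
            ultimately show "s = n" by simp
          next
            assume "s = n"
            then show "s < u \<and> u < m" using n m elim by (cases "m = u"; cases "m < u") auto
          qed
          finally show ?thesis .
        qed
        have "(\<Sum>s\<in>J. f u * indicator (einterval (ereal s) (next_boundary S s)) u) = (\<Sum>s\<in>J. if s = n then f u else 0)"
          using iff J by (intro sum.cong) (auto simp: indicator_def)
        also have "\<dots> = (if n \<in> J then f u else 0)" using fin by simp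
        also have "\<dots> = f u * indicator {u. ereal a \<le> prev_boundary S u \<and> prev_boundary S u \<le> ereal b} u"
          using n J by (auto simp: indicator_def)
        finally show ?thesis .
      qed
    qed
  qed
  finally show ?thesis .
qed

section \<open>The cost of a gap against the kernel moment\<close>

definition right_cost :: "'n::finite \<Rightarrow> real \<Rightarrow> real \<Rightarrow> real set \<Rightarrow> real \<Rightarrow> ennreal" where
  "right_cost i \<alpha> \<tau> S u = (\<integral>\<^sup>+\<rho>\<in>{0..}. ennreal (\<bar>indicat_real S (u + \<rho>) - indicat_real S u\<bar> * kernel_hat i \<alpha> \<tau> \<rho>) \<partial>lborel)"

definition left_cost :: "'n::finite \<Rightarrow> real \<Rightarrow> real \<Rightarrow> real set \<Rightarrow> real \<Rightarrow> ennreal" where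
  "left_cost i \<alpha> \<tau> S u = (\<integral>\<^sup>+\<rho>\<in>{..0}. ennreal (\<bar>indicat_real S (u + \<rho>) - indicat_real S u\<bar> * kernel_hat i \<alpha> \<tau> \<rho>) \<partial>lborel)"

lemma AE_lborel_translate:
  assumes "AE x in (lborel :: 'a::euclidean_space measure). P x"
  shows "AE x in lborel. P (t + x)"
proof -
  obtain N where N: "N \<in> null_sets lborel" "\<And>x. x \<notin> N \<Longrightarrow> P x" using AE_E3[OF assms] by auto
  have Nm: "N \<in> sets borel" using N(1) by (simp add: null_sets_def)
  have m: "(+) t \<in> lborel \<rightarrow>\<^sub>M borel" by measurable
  have "{x \<in> space borel. x \<notin> N} = - N" by auto
  then have c: "{x \<in> space borel. x \<notin> N} \<in> sets borel" using Nm by (simp only: borel_comp)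
  have "AE x in distr lborel borel ((+) t). x \<notin> N" using AE_not_in[OF N(1)] unfolding lborel_distr_plus .
  then have "AE x in lborel. t + x \<notin> N" unfolding AE_distr_iff[OF m c] .
  then show ?thesis by eventually_elim (rule N(2))
qed

text \<open>A point of a gap meets the opposite phase only beyond the end of the gap, at distance
  \<open>s - u\<close>.\<close>

lemma right_cost_le_tail:
  assumes c: "AE y in lborel. m < y \<and> y < s \<longrightarrow> (y \<in> S \<longleftrightarrow> c)" and u: "m < u" "u < s" "u \<in> S \<longleftrightarrow> c"
  shows "right_cost i \<alpha> \<tau> S u \<le> kernel_tail i \<alpha> \<tau> (s - u)"
  unfolding right_cost_def kernel_tail_def
proof (rule nn_integral_mono_AE)
  show "AE \<rho> in lborel. ennreal (\<bar>indicat_real S (u + \<rho>) - indicat_real S u\<bar> * kernel_hat i \<alpha> \<tau> \<rho>) * indicator {0..} \<rho> \<le>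
      ennreal (kernel_hat i \<alpha> \<tau> \<rho>) * indicator {s - u..} \<rho>"
    using AE_lborel_translate[OF c, of u]
  proof eventually_elim
    case (elim \<rho>)
    show ?case
    proof (cases "\<rho> \<ge> 0 \<and> \<rho> < s - u")
      case True
      then have "u + \<rho> \<in> S \<longleftrightarrow> u \<in> S" using elim u by auto
      then show ?thesis by (simp add: indicator_def)
    next
      case False
      then show ?thesis using kernel_hat_nonneg[of i \<alpha> \<tau> \<rho>] u
        by (auto simp: indicator_def not_less)
    qed
  qed
qed

lemma left_cost_le_tail:
  assumes c: "AE y in lborel. s < y \<and> y < m \<longrightarrow> (y \<in> S \<longleftrightarrow> c)" and u: "s < u" "u < m" "u \<in> S \<longleftrightarrow> c"
    and a: "\<alpha> < 1" "\<tau> > 0"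
  shows "left_cost i \<alpha> \<tau> S u \<le> kernel_tail i \<alpha> \<tau> (u - s)"
proof -
  note [measurable] = borel_measurable_kernel_hat[OF a, of i]
  have "left_cost i \<alpha> \<tau> S u \<le> (\<integral>\<^sup>+\<rho>. ennreal (kernel_hat i \<alpha> \<tau> \<rho>) * indicator {..s - u} \<rho> \<partial>lborel)"
    unfolding left_cost_def
  proof (rule nn_integral_mono_AE)
    show "AE \<rho> in lborel. ennreal (\<bar>indicat_real S (u + \<rho>) - indicat_real S u\<bar> * kernel_hat i \<alpha> \<tau> \<rho>) * indicator {..0} \<rho> \<le>
        ennreal (kernel_hat i \<alpha> \<tau> \<rho>) * indicator {..s - u} \<rho>"
      using AE_lborel_translate[OF c, of u]
    proof eventually_elim
      case (elim \<rho>)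
      show ?case
      proof (cases "\<rho> \<le> 0 \<and> s - u < \<rho>")
        case True
        then have "u + \<rho> \<in> S \<longleftrightarrow> u \<in> S" using elim u by auto
        then show ?thesis by (simp add: indicator_def)
      next
        case False
        then show ?thesis using kernel_hat_nonneg[of i \<alpha> \<tau> \<rho>] u
          by (auto simp: indicator_def not_less)
      qed
    qed
  qed
  also have "\<dots> = kernel_tail i \<alpha> \<tau> (u - s)"
    unfolding kernel_tail_def
    by (subst nn_integral_real_affine[where c="-1" and t=0])
      (auto intro!: nn_integral_cong simp: indicator_def kernel_hat_even)
  finally show ?thesis .
qed

lemma borel_measurable_kernel_tail[measurable]:
  assumes a: "\<alpha> < 1" "\<tau> > 0"
  shows "kernel_tail i \<alpha> \<tau> \<in> borel_measurable borel"
proof -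
  note [measurable] = borel_measurable_kernel_hat[OF a, of i]
  have [measurable]: "{p::real\<times>real. fst p \<le> snd p} \<in> sets (lborel \<Otimes>\<^sub>M lborel)"
    unfolding lborel_prod by (simp, intro borel_closed closed_Collect_le continuous_intros)
  have "(\<lambda>u. \<integral>\<^sup>+\<rho>. ennreal (kernel_hat i \<alpha> \<tau> \<rho>) * indicator {p. fst p \<le> snd p} (u, \<rho>) \<partial>lborel) \<in> borel_measurable lborel"
    by (rule lborel.borel_measurable_nn_integral) measurable
  also have "(\<lambda>u. \<integral>\<^sup>+\<rho>. ennreal (kernel_hat i \<alpha> \<tau> \<rho>) * indicator {p. fst p \<le> snd p} (u, \<rho>) \<partial>lborel) = kernel_tail i \<alpha> \<tau>"
    unfolding kernel_tail_def by (intro ext nn_integral_cong) (auto simp: indicator_def)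
  finally show ?thesis by simp
qed

lemma AE_constant_off_ess_boundaryE:
  assumes "ess_boundary S \<inter> {a<..<b} = {}"
  obtains c where "AE y in lborel. a < y \<and> y < b \<longrightarrow> (y \<in> S \<longleftrightarrow> c)"
  using AE_constant_off_ess_boundary[OF assms]
proof
  assume "AE y in lborel. a < y \<and> y < b \<longrightarrow> y \<in> S"
  then show thesis by (intro that[of True]) simp
next
  assume "AE y in lborel. a < y \<and> y < b \<longrightarrow> y \<notin> S"
  then show thesis by (intro that[of False]) simp
qed

lemma right_cost_gap_le:
  fixes i :: "'n::finite"
  assumes a: "\<alpha> < 1" "\<tau> > 0" and gap: "ess_boundary S \<inter> {m<..<s} = {}"
  shows "(\<integral>\<^sup>+u. right_cost i \<alpha> \<tau> S u * indicator {m<..<s} u \<partial>lborel) \<le> ennreal (kernel_moment i \<alpha> \<tau>)"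
proof -
  note [measurable] = borel_measurable_kernel_tail[OF a, of i]
  obtain c where c: "AE y in lborel. m < y \<and> y < s \<longrightarrow> (y \<in> S \<longleftrightarrow> c)"
    using AE_constant_off_ess_boundaryE[OF gap] by blast
  have "(\<integral>\<^sup>+u. right_cost i \<alpha> \<tau> S u * indicator {m<..<s} u \<partial>lborel) \<le> (\<integral>\<^sup>+u. kernel_tail i \<alpha> \<tau> (s - u) * indicator {..s} u \<partial>lborel)"
  proof (rule nn_integral_mono_AE)
    show "AE u in lborel. right_cost i \<alpha> \<tau> S u * indicator {m<..<s} u \<le> kernel_tail i \<alpha> \<tau> (s - u) * indicator {..s} u"
      using c by eventually_elim (auto simp: indicator_def intro: right_cost_le_tail[OF c])
  qed
  also have "\<dots> = (\<integral>\<^sup>+u\<in>{0..}. kernel_tail i \<alpha> \<tau> u \<partial>lborel)"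
    by (subst nn_integral_real_affine[where c="-1" and t=s]) (auto intro!: nn_integral_cong simp: indicator_def)
  finally show ?thesis by (simp only: kernel_moment_eq[OF a])
qed

text \<open>The distances \<open>u - s\<close> run only up to the length of the gap, so the integral
  of the tails beyond that length is left over from the full moment. It is bounded below by a
  negative power of the length, which is what penalises close boundary points. For the gap on the
  other side, \<open>right_cost_gap_le\<close> gives this remainder away.\<close>

lemma left_cost_gap_le:
  fixes i :: "'n::finite"
  assumes a: "0 \<le> \<alpha>" "\<alpha> < 1" "\<tau> > 0" and gap: "ess_boundary S \<inter> {s<..<m} = {}" and sm: "s < m"
  shows "(\<integral>\<^sup>+u. left_cost i \<alpha> \<tau> S u * indicator {s<..<m} u \<partial>lborel)
     + ennreal (1 / (64 * real CARD('n) ^ (CARD('n) + 2)) * (m - s + \<tau> powr (1 / (1 - \<alpha>))) powr (- (1 - \<alpha>)))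
     \<le> ennreal (kernel_moment i \<alpha> \<tau>)"
proof -
  note [measurable] = borel_measurable_kernel_tail[OF a(2,3), of i]
  obtain c where c: "AE y in lborel. s < y \<and> y < m \<longrightarrow> (y \<in> S \<longleftrightarrow> c)"
    using AE_constant_off_ess_boundaryE[OF gap] by blast
  have "(\<integral>\<^sup>+u. left_cost i \<alpha> \<tau> S u * indicator {s<..<m} u \<partial>lborel) \<le> (\<integral>\<^sup>+u. kernel_tail i \<alpha> \<tau> (u - s) * indicator {s..<m} u \<partial>lborel)"
  proof (rule nn_integral_mono_AE)
    show "AE u in lborel. left_cost i \<alpha> \<tau> S u * indicator {s<..<m} u \<le> kernel_tail i \<alpha> \<tau> (u - s) * indicator {s..<m} u"
      using c by eventually_elim (auto simp: indicator_def intro: left_cost_le_tail[OF c _ _ _ a(2,3)])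
  qed
  also have "\<dots> = (\<integral>\<^sup>+u. kernel_tail i \<alpha> \<tau> u * indicator {0..<m - s} u \<partial>lborel)"
    by (subst nn_integral_real_affine[where c="1" and t=s]) (auto intro!: nn_integral_cong simp: indicator_def)
  finally have "(\<integral>\<^sup>+u. left_cost i \<alpha> \<tau> S u * indicator {s<..<m} u \<partial>lborel)
     + ennreal (1 / (64 * real CARD('n) ^ (CARD('n) + 2)) * (m - s + \<tau> powr (1 / (1 - \<alpha>))) powr (- (1 - \<alpha>)))
     \<le> (\<integral>\<^sup>+u. kernel_tail i \<alpha> \<tau> u * indicator {0..<m - s} u \<partial>lborel) + (\<integral>\<^sup>+u\<in>{m - s..}. kernel_tail i \<alpha> \<tau> u \<partial>lborel)"
    by (rule add_mono) (rule kernel_tail_lower_bound, use a sm in auto)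
  also have "\<dots> = (\<integral>\<^sup>+u. kernel_tail i \<alpha> \<tau> u * indicator {0..<m - s} u + kernel_tail i \<alpha> \<tau> u * indicator {m - s..} u \<partial>lborel)"
    by (rule nn_integral_add[symmetric]) measurable
  also have "\<dots> = (\<integral>\<^sup>+u\<in>{0..}. kernel_tail i \<alpha> \<tau> u \<partial>lborel)"
    using sm by (intro nn_integral_cong) (auto simp: indicator_def)
  finally show ?thesis by (simp only: kernel_moment_eq[OF a(2,3)])
qed

text \<open>Both sides are 0 by convention when the integral is infinite, so it suffices that
  \<open>F\<close> is finite at each point.\<close>

lemma set_integral_eq_enn2real:
  fixes f :: "'a::euclidean_space \<Rightarrow> real"
  assumes ae: "AE u in lborel. f u = enn2real (F u)" and F[measurable]: "F \<in> borel_measurable borel"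
    and fin: "\<And>u. F u < \<infinity>" and I[measurable]: "I \<in> sets borel"
  shows "(LINT u:I|lebesgue. f u) = enn2real (\<integral>\<^sup>+u. F u * indicator I u \<partial>lborel)"
proof -
  have "(LINT u:I|lebesgue. f u) = (LINT u|lborel. indicator I u *\<^sub>R enn2real (F u))"
    unfolding set_lebesgue_integral_def
  proof (rule integral_completion_AE)
    show "AE x in lborel. indicat_real I x *\<^sub>R f x = indicat_real I x *\<^sub>R enn2real (F x)"
      using ae by eventually_elim simp
  qed measurable
  also have "\<dots> = enn2real (\<integral>\<^sup>+u. ennreal (indicator I u *\<^sub>R enn2real (F u)) \<partial>lborel)"
    by (rule integral_eq_nn_integral) (auto simp: indicator_def)
  also have "(\<integral>\<^sup>+u. ennreal (indicator I u *\<^sub>R enn2real (F u)) \<partial>lborel) = (\<integral>\<^sup>+u. F u * indicator I u \<partial>lborel)"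
    using fin by (intro nn_integral_cong) (auto simp: indicator_def)
  finally show ?thesis .
qed

lemma nn_integral_kernel_hat:
  fixes i :: "'n::finite"
  assumes a: "\<alpha> < 1" "\<tau> > 0"
  shows "(\<integral>\<^sup>+\<rho>. ennreal (kernel_hat i \<alpha> \<tau> \<rho>) \<partial>lborel) = (\<integral>\<^sup>+\<zeta>. ennreal (kernel \<alpha> \<tau> (\<zeta>::real^'n)) \<partial>lborel)"
  unfolding ennreal_kernel_hat[OF a] by (rule nn_integral_glue'[symmetric]) measurable

lemma
  fixes i :: "'n::finite"
  assumes a: "\<alpha> < 1" "\<tau> > 0"
  shows right_cost_finite: "right_cost i \<alpha> \<tau> S u < \<infinity>"
    and left_cost_finite: "left_cost i \<alpha> \<tau> S u < \<infinity>"
proof -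
  have "right_cost i \<alpha> \<tau> S u \<le> (\<integral>\<^sup>+\<rho>. ennreal (kernel_hat i \<alpha> \<tau> \<rho>) \<partial>lborel)"
    "left_cost i \<alpha> \<tau> S u \<le> (\<integral>\<^sup>+\<rho>. ennreal (kernel_hat i \<alpha> \<tau> \<rho>) \<partial>lborel)"
    unfolding right_cost_def left_cost_def
    by (intro nn_integral_mono; auto simp: indicator_def)+
  then show "right_cost i \<alpha> \<tau> S u < \<infinity>" "left_cost i \<alpha> \<tau> S u < \<infinity>"
    using kernel_integrable[OF a, where 'n='n] unfolding nn_integral_kernel_hat[OF a] by (meson le_less_trans)+
qed

text \<open>The integrand contains the value of the indicator at \<open>u\<close> itself, which is
  why agreement at this point is asked for besides agreement almost everywhere.\<close>

lemma
  fixes i :: "'n::finite"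
  assumes a: "\<alpha> < 1" "\<tau> > 0" and S': "S' \<in> sets borel" and eq: "AE y in lborel. y \<in> S \<longleftrightarrow> y \<in> S'" and u: "u \<in> S \<longleftrightarrow> u \<in> S'"
  shows integral_right_cost: "(LINT \<rho>:{0..}|lebesgue. \<bar>indicat_real S (u + \<rho>) - indicat_real S u\<bar> * kernel_hat i \<alpha> \<tau> \<rho>) = enn2real (right_cost i \<alpha> \<tau> S' u)"
    and integral_left_cost: "(LINT \<rho>:{..0}|lebesgue. \<bar>indicat_real S (u + \<rho>) - indicat_real S u\<bar> * kernel_hat i \<alpha> \<tau> \<rho>) = enn2real (left_cost i \<alpha> \<tau> S' u)"
proof -
  note [measurable] = borel_measurable_kernel_hat[OF a, of i] S'
  have ae: "AE \<rho> in lborel. \<bar>indicat_real S (u + \<rho>) - indicat_real S u\<bar> * kernel_hat i \<alpha> \<tau> \<rho> =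
      enn2real (ennreal (\<bar>indicat_real S' (u + \<rho>) - indicat_real S' u\<bar> * kernel_hat i \<alpha> \<tau> \<rho>))"
    using AE_lborel_translate[OF eq, of u]
    by eventually_elim (use u in \<open>auto simp: indicator_def kernel_hat_nonneg\<close>)
  show "(LINT \<rho>:{0..}|lebesgue. \<bar>indicat_real S (u + \<rho>) - indicat_real S u\<bar> * kernel_hat i \<alpha> \<tau> \<rho>) = enn2real (right_cost i \<alpha> \<tau> S' u)"
    unfolding right_cost_def by (rule set_integral_eq_enn2real[OF ae]) simp_all
  show "(LINT \<rho>:{..0}|lebesgue. \<bar>indicat_real S (u + \<rho>) - indicat_real S u\<bar> * kernel_hat i \<alpha> \<tau> \<rho>) = enn2real (left_cost i \<alpha> \<tau> S' u)"
    unfolding left_cost_def by (rule set_integral_eq_enn2real[OF ae]) simp_all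
qed

section \<open>Measurable dependence on the slice\<close>

definition ess_next :: "real set \<Rightarrow> real \<Rightarrow> ereal" where
  "ess_next S u = Inf (ereal ` {s \<in> ess_boundary S. s > u})"

text \<open>On almost every slice \<open>ess_next\<close> and \<open>ess_prev\<close> are the
  neighbours in the sense of the reduced boundary, but they ignore null sets, so the slices of a
  Borel representative may be used.\<close>

definition ess_prev :: "real set \<Rightarrow> real \<Rightarrow> ereal" where
  "ess_prev S u = Sup (ereal ` {s \<in> ess_boundary S. s < u})"

lemma indicator_slice: "indicator (slice i B t) s = indicator B (glue i t s)"
  by (simp add: slice_def indicator_def)

lemma slice_in_borel:
  assumes "B \<in> sets borel" shows "slice i B t \<in> sets borel"
  using measurable_sets[OF measurable_glue_snd assms] by (simp add: slice_def vimage_def)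

text \<open>The boundary meets an open interval exactly when the set and its complement both have
  positive measure in it. The two measures are integrals with a parameter, on which the ends of the
  interval may depend, and are measurable by Fubini.\<close>

lemma ess_boundary_meets_interval_measurable:
  assumes B[measurable]: "B \<in> sets borel" 
    and l: "l \<in> borel_measurable (perp_borel i \<Otimes>\<^sub>M lborel)" and r: "r \<in> borel_measurable (perp_borel i \<Otimes>\<^sub>M lborel)"
  shows "{p \<in> space (perp_borel i \<Otimes>\<^sub>M lborel). l p < r p \<and> ess_boundary (slice i B (fst p)) \<inter> {l p<..<r p} \<noteq> {}} \<in> sets (perp_borel i \<Otimes>\<^sub>M lborel)"
proof -
  note [measurable] = l r
  define f where "f p = (\<integral>\<^sup>+s. indicator B (glue i (fst p) s) * (indicator {l p<..} s * indicator {..<r p} s) \<partial>lborel)" for p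
  define g where "g p = (\<integral>\<^sup>+s. indicator (- B) (glue i (fst p) s) * (indicator {l p<..} s * indicator {..<r p} s) \<partial>lborel)" for p
  have ind: "(indicator {a<..} s :: ennreal) = (if a < s then 1 else 0)" "(indicator {..<a} s :: ennreal) = (if s < a then 1 else 0)" for a s :: real
    by (simp_all add: indicator_def)
  have glm[measurable]: "(\<lambda>q. glue i (fst (fst q)) (snd q)) \<in> borel_measurable ((perp_borel i \<Otimes>\<^sub>M lborel) \<Otimes>\<^sub>M lborel)"
    by (rule borel_measurable_glue_vec) measurable
  have [measurable]: "- B \<in> sets borel" using B by (rule borel_comp)
  have fm[measurable]: "f \<in> borel_measurable (perp_borel i \<Otimes>\<^sub>M lborel)"
    unfolding f_def ind
    by (rule lborel.borel_measurable_nn_integral) (simp add: split_beta')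
  have gm[measurable]: "g \<in> borel_measurable (perp_borel i \<Otimes>\<^sub>M lborel)"
    unfolding g_def ind
    by (rule lborel.borel_measurable_nn_integral) (simp add: split_beta')
  have "(l p < r p \<and> ess_boundary (slice i B (fst p)) \<inter> {l p<..<r p} \<noteq> {}) \<longleftrightarrow> (l p < r p \<and> f p \<noteq> 0 \<and> g p \<noteq> 0)" for p
  proof (cases "l p < r p")
    case True
    have Bt: "slice i B (fst p) \<in> sets borel" by (rule slice_in_borel[OF B])
    have m1: "(\<lambda>s. indicator B (glue i (fst p) s) * (indicator {l p<..} s * indicator {..<r p} s) :: ennreal) \<in> borel_measurable lborel"
      "(\<lambda>s. indicator (- B) (glue i (fst p) s) * (indicator {l p<..} s * indicator {..<r p} s) :: ennreal) \<in> borel_measurable lborel"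
      by measurable
    have "f p = 0 \<longleftrightarrow> (AE s in lborel. l p < s \<and> s < r p \<longrightarrow> s \<notin> slice i B (fst p))"
      unfolding f_def nn_integral_0_iff_AE[OF m1(1)] by (intro AE_cong) (auto simp: indicator_def slice_def)
    moreover have "g p = 0 \<longleftrightarrow> (AE s in lborel. l p < s \<and> s < r p \<longrightarrow> s \<in> slice i B (fst p))"
      unfolding g_def nn_integral_0_iff_AE[OF m1(2)] by (intro AE_cong) (auto simp: indicator_def slice_def)
    ultimately show ?thesis using ess_boundary_Int_iff[OF True, of "slice i B (fst p)"] True by blast
  qed simp
  then have "{p \<in> space (perp_borel i \<Otimes>\<^sub>M lborel). l p < r p \<and> ess_boundary (slice i B (fst p)) \<inter> {l p<..<r p} \<noteq> {}} =
     {p \<in> space (perp_borel i \<Otimes>\<^sub>M lborel). l p < r p \<and> f p \<noteq> 0 \<and> g p \<noteq> 0}" by simp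
  also have "\<dots> \<in> sets (perp_borel i \<Otimes>\<^sub>M lborel)" by measurable
  finally show ?thesis .
qed

lemma ess_next_less_iff: "ess_next S u < ereal a \<longleftrightarrow> u < a \<and> ess_boundary S \<inter> {u<..<a} \<noteq> {}"
proof -
  have "ess_next S u < ereal a \<longleftrightarrow> (\<exists>s\<in>ess_boundary S. u < s \<and> s < a)"
    unfolding ess_next_def Inf_less_iff by auto
  also have "\<dots> \<longleftrightarrow> u < a \<and> ess_boundary S \<inter> {u<..<a} \<noteq> {}" by force
  finally show ?thesis .
qed

lemma ess_prev_less_iff: "ereal a < ess_prev S u \<longleftrightarrow> a < u \<and> ess_boundary S \<inter> {a<..<u} \<noteq> {}"
proof -
  have "ereal a < ess_prev S u \<longleftrightarrow> (\<exists>s\<in>ess_boundary S. s < u \<and> a < s)"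
    unfolding ess_prev_def less_Sup_iff by auto
  also have "\<dots> \<longleftrightarrow> a < u \<and> ess_boundary S \<inter> {a<..<u} \<noteq> {}" by force
  finally show ?thesis .
qed

lemma borel_measurable_ereal_lessI:
  fixes f :: "'a \<Rightarrow> ereal"
  assumes "\<And>a. {x \<in> space M. f x < ereal a} \<in> sets M"
  shows "f \<in> borel_measurable M"
proof (rule borel_measurableI_less)
  fix y :: ereal
  show "{x \<in> space M. f x < y} \<in> sets M"
  proof (cases y)
    case (real a)
    then show ?thesis using assms by simp
  next
    case PInf
    have "f x < \<infinity> \<longleftrightarrow> (\<exists>n::nat. f x < ereal (real n))" for x
      using less_PInf_Ex_of_nat[of "f x"] by auto
    then have "{x \<in> space M. f x < y} = (\<Union>n::nat. {x \<in> space M. f x < ereal (real n)})" using PInf by auto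
    then show ?thesis using assms by simp
  next
    case MInf
    then have "{x \<in> space M. f x < y} = {}" by auto
    then show ?thesis by (simp only: sets.empty_sets)
  qed
qed

lemma
  assumes B: "B \<in> sets borel"
  shows borel_measurable_ess_next: "(\<lambda>p. ess_next (slice i B (fst p)) (snd p)) \<in> borel_measurable (perp_borel i \<Otimes>\<^sub>M lborel)"
    and borel_measurable_ess_prev: "(\<lambda>p. ess_prev (slice i B (fst p)) (snd p)) \<in> borel_measurable (perp_borel i \<Otimes>\<^sub>M lborel)"
proof -
  show "(\<lambda>p. ess_next (slice i B (fst p)) (snd p)) \<in> borel_measurable (perp_borel i \<Otimes>\<^sub>M lborel)"
  proof (rule borel_measurable_ereal_lessI)
    show "{x \<in> space (perp_borel i \<Otimes>\<^sub>M lborel). ess_next (slice i B (fst x)) (snd x) < ereal a} \<in> sets (perp_borel i \<Otimes>\<^sub>M lborel)" for a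
      unfolding ess_next_less_iff by (rule ess_boundary_meets_interval_measurable[OF B]) measurable
  qed
  have "(\<lambda>p. - ess_prev (slice i B (fst p)) (snd p)) \<in> borel_measurable (perp_borel i \<Otimes>\<^sub>M lborel)"
  proof (rule borel_measurable_ereal_lessI)
    fix a
    have "- ess_prev (slice i B (fst x)) (snd x) < ereal a \<longleftrightarrow> ereal (- a) < ess_prev (slice i B (fst x)) (snd x)" for x
      by (metis ereal_minus_less_minus ereal_uminus_uminus uminus_ereal.simps(1))
    then show "{x \<in> space (perp_borel i \<Otimes>\<^sub>M lborel). - ess_prev (slice i B (fst x)) (snd x) < ereal a} \<in> sets (perp_borel i \<Otimes>\<^sub>M lborel)"
      unfolding ess_prev_less_iff by (simp only:) (rule ess_boundary_meets_interval_measurable[OF B]; measurable)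
  qed
  then have "(\<lambda>p. - (- ess_prev (slice i B (fst p)) (snd p))) \<in> borel_measurable (perp_borel i \<Otimes>\<^sub>M lborel)"
    by (rule borel_measurable_uminus_ereal)
  then show "(\<lambda>p. ess_prev (slice i B (fst p)) (snd p)) \<in> borel_measurable (perp_borel i \<Otimes>\<^sub>M lborel)" by simp
qed

lemma
  fixes i :: "'n::finite"
  assumes a: "\<alpha> < 1" "\<tau> > 0" and B[measurable]: "B \<in> sets borel"
  shows borel_measurable_right_cost: "(\<lambda>p. right_cost i \<alpha> \<tau> (slice i B (fst p)) (snd p)) \<in> borel_measurable (perp_borel i \<Otimes>\<^sub>M lborel)"
    and borel_measurable_left_cost: "(\<lambda>p. left_cost i \<alpha> \<tau> (slice i B (fst p)) (snd p)) \<in> borel_measurable (perp_borel i \<Otimes>\<^sub>M lborel)"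
proof -
  note [measurable] = borel_measurable_kernel_hat[OF a, of i]
  have g1[measurable]: "(\<lambda>q. glue i (fst (fst q)) (snd (fst q) + snd q)) \<in> borel_measurable ((perp_borel i \<Otimes>\<^sub>M lborel) \<Otimes>\<^sub>M lborel)"
    by (rule borel_measurable_glue_vec) measurable
  have g2[measurable]: "(\<lambda>q. glue i (fst (fst q)) (snd (fst q))) \<in> borel_measurable ((perp_borel i \<Otimes>\<^sub>M lborel) \<Otimes>\<^sub>M lborel)"
    by (rule borel_measurable_glue_vec) measurable
  show "(\<lambda>p. right_cost i \<alpha> \<tau> (slice i B (fst p)) (snd p)) \<in> borel_measurable (perp_borel i \<Otimes>\<^sub>M lborel)"
    unfolding right_cost_def indicator_slice
    by (rule lborel.borel_measurable_nn_integral) (simp add: split_beta')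
  show "(\<lambda>p. left_cost i \<alpha> \<tau> (slice i B (fst p)) (snd p)) \<in> borel_measurable (perp_borel i \<Otimes>\<^sub>M lborel)"
    unfolding left_cost_def indicator_slice
    by (rule lborel.borel_measurable_nn_integral) (simp add: split_beta')
qed

definition cross_energy :: "'n::finite \<Rightarrow> real \<Rightarrow> real \<Rightarrow> (real^'n) set \<Rightarrow> real^'n \<Rightarrow> ennreal" where
  "cross_energy i \<alpha> \<tau> B x = (\<integral>\<^sup>+\<zeta>. ennreal (f_cross i B x \<zeta> * kernel \<alpha> \<tau> \<zeta>) \<partial>lborel)"

lemma borel_measurable_cross_energy[measurable]:
  assumes [measurable]: "B \<in> sets borel"
  shows "cross_energy i \<alpha> \<tau> B \<in> borel_measurable borel"
  unfolding cross_energy_def by measurable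

lemma cross_energy_le:
  fixes x :: "real^'n::finite"
  shows "cross_energy i \<alpha> \<tau> B x \<le> (\<integral>\<^sup>+\<zeta>. ennreal (kernel \<alpha> \<tau> (\<zeta>::real^'n)) \<partial>lborel)"
  unfolding cross_energy_def
proof (rule nn_integral_mono, rule ennreal_leI)
  fix \<zeta>
  have "f_cross i B x \<zeta> \<le> 1" by (auto simp: f_cross_def indicator_def)
  then show "f_cross i B x \<zeta> * kernel \<alpha> \<tau> \<zeta> \<le> kernel \<alpha> \<tau> \<zeta>"
    using kernel_nonneg[of \<alpha> \<tau> \<zeta>] mult_right_mono by fastforce
qed

text \<open>Exchanging coordinates between two points preserves volume, so a mixed corner almost
  surely avoids a null set. This is needed for the two mixed corners in the cross term.\<close>

lemma AE_mix:
  assumes "AE x in (lborel :: (real^'n::finite) measure). P x"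
  shows "AE x in lborel. AE y in lborel. P (mix A x y)"
proof -
  obtain N where N: "N \<in> null_sets lborel" "\<And>x. x \<notin> N \<Longrightarrow> P x" using AE_E3[OF assms] by auto
  have Nm[measurable]: "N \<in> sets borel" using N(1) by (simp add: null_sets_def)
  have "(\<integral>\<^sup>+x. \<integral>\<^sup>+y. indicator N (mix A x y) \<partial>lborel \<partial>lborel) = (\<integral>\<^sup>+x. \<integral>\<^sup>+y. indicator N x \<partial>(lborel :: (real^'n) measure) \<partial>lborel)"
    by (rule nn_integral_mix[of "\<lambda>x y. indicator N x"]) measurable
  also have "\<dots> = (\<integral>\<^sup>+x. 0 \<partial>(lborel :: (real^'n) measure))"
  proof (rule nn_integral_cong_AE)
    show "AE x in lborel. (\<integral>\<^sup>+y. indicator N x \<partial>(lborel :: (real^'n) measure)) = 0"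
      using AE_not_in[OF N(1)] by eventually_elim simp
  qed
  finally have "(\<integral>\<^sup>+x. \<integral>\<^sup>+y. indicator N (mix A x y) \<partial>lborel \<partial>lborel) = 0" by simp
  then have "AE x in lborel. (\<integral>\<^sup>+y. indicator N (mix A x y) \<partial>lborel) = 0"
    by (subst (asm) nn_integral_0_iff_AE) measurable
  then show ?thesis
  proof eventually_elim
    case (elim x)
    then have "AE y in lborel. indicator N (mix A x y) = (0::ennreal)"
      by (subst (asm) nn_integral_0_iff_AE) measurable
    then show ?case by eventually_elim (auto simp: indicator_def intro!: N(2) split: if_splits)
  qed
qed

lemma integral_cross_energy_AE:
  fixes E B :: "(real^'n::finite) set"
  assumes B[measurable]: "B \<in> sets borel" and eq: "AE x in lborel. x \<in> E \<longleftrightarrow> x \<in> B"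
  shows "AE x in lborel. (LINT \<zeta>|lebesgue. f_cross i E x \<zeta> * kernel \<alpha> \<tau> \<zeta>) = enn2real (cross_energy i \<alpha> \<tau> B x)"
  using eq AE_mix[OF eq, of "{i}"] AE_mix[OF eq, of "- {i}"]
proof eventually_elim
  case (elim x)
  have "AE \<zeta> in lborel. f_cross i E x \<zeta> * kernel \<alpha> \<tau> \<zeta> = f_cross i B x \<zeta> * kernel \<alpha> \<tau> \<zeta>"
    using AE_lborel_translate[OF elim(2), of x] AE_lborel_translate[OF elim(3), of x]
  proof eventually_elim
    case (elim \<zeta>)
    have "f_cross i E x (x + \<zeta> - x) = f_cross i B x (x + \<zeta> - x)"
      unfolding f_cross_mix using elim \<open>x \<in> E \<longleftrightarrow> x \<in> B\<close> by (simp add: mix_Compl indicator_def)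
    then show ?case by simp
  qed
  then have "(LINT \<zeta>|lebesgue. f_cross i E x \<zeta> * kernel \<alpha> \<tau> \<zeta>) = (LINT \<zeta>|lborel. f_cross i B x \<zeta> * kernel \<alpha> \<tau> \<zeta>)"
    by (intro integral_completion_AE) measurable
  also have "\<dots> = enn2real (cross_energy i \<alpha> \<tau> B x)"
    unfolding cross_energy_def by (rule integral_eq_nn_integral) (auto simp: f_cross_nonneg kernel_nonneg)
  finally show ?case .
qed

section \<open>The energy on a slice\<close>

lemma locally_finite_boundaryI:
  assumes "\<And>n::nat. finite (ess_boundary S \<inter> {- real (Suc n)<..<real (Suc n)})"
  shows "locally_finite_boundary S"
  unfolding locally_finite_boundary_def
proof (intro allI)
  fix a b :: real
  obtain n :: nat where n: "max \<bar>a\<bar> \<bar>b\<bar> < real n" using reals_Archimedean2 by blast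
  show "finite (ess_boundary S \<inter> {a<..<b})"
    by (rule finite_subset[OF _ assms[of n]]) (use n in auto)
qed

lemma finite_if_subset_card_bounded:
  assumes "\<And>F. finite F \<Longrightarrow> F \<subseteq> A \<Longrightarrow> of_nat (card F) \<le> (g::ennreal)" and "g < \<infinity>"
  shows "finite A"
proof (rule ccontr)
  assume inf: "infinite A"
  obtain r where r: "g = ennreal r" "0 \<le> r" using assms(2) by (cases g) auto
  obtain n :: nat where n: "r < real n" using reals_Archimedean2 by blast
  obtain F where F: "F \<subseteq> A" "finite F" "card F = n" using infinite_arbitrarily_large[OF inf] by blast
  have "ennreal (real n) \<le> ennreal r" using assms(1)[OF F(2,1)] F(3) r by (simp add: ennreal_of_nat_eq_real_of_nat)
  with r n show False by (simp add: ennreal_le_iff)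
qed

text \<open>The energy is defined through \<open>E\<close>, which is only Lebesgue measurable.
  \<open>B\<close> is a Borel copy through which the integrands are expressed; on almost every slice
  the two sets agree up to a null set.\<close>

locale perimeter_energy =
  fixes \<alpha> \<tau> L :: real and E B :: "(real^'n::finite) set"
  assumes \<alpha>0: "0 \<le> \<alpha>" and \<alpha>1: "\<alpha> < 1" and \<tau>0: "0 < \<tau>" and L0: "0 < L"
    and lfp: "locally_finite_perimeter E" and per: "cube_periodic L E"
    and B[measurable]: "B \<in> sets borel" and EB: "AE x in lborel. x \<in> E \<longleftrightarrow> x \<in> B"
begin

text \<open>Collects what holds on almost every slice, so that later statements about a slice have
  one hypothesis and only one null set is excluded.\<close>

definition good :: "'n \<Rightarrow> ('n \<Rightarrow> real) \<Rightarrow> bool" where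
  "good i t \<longleftrightarrow> (AE u in lborel. u \<in> slice i E t \<longleftrightarrow> u \<in> slice i B t) \<and> locally_finite_boundary (slice i E t) \<and>
     (AE u in lborel. (LINT \<zeta>|lebesgue. f_cross i E (glue i t u) \<zeta> * kernel \<alpha> \<tau> \<zeta>) = enn2real (cross_energy i \<alpha> \<tau> B (glue i t u)))"

text \<open>The number of boundary points in a bounded cube has an integrable bound, which is finite
  almost everywhere. Countably many cubes exhaust all slices and the whole line in each
  slice.\<close>

lemma AE_good: "AE t in perp_borel i. good i t"
proof -
  have "AE t in perp_borel i. finite (ess_boundary (slice i E t) \<inter> {- real (Suc n)<..<real (Suc n)}) \<or> \<not> (\<forall>j. j \<noteq> i \<longrightarrow> \<bar>t j\<bar> \<le> real (Suc n))" for n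
  proof -
    obtain g where g: "g \<in> borel_measurable (perp_borel i)"
      "(\<integral>\<^sup>+t\<in>{t. \<forall>j. j \<noteq> i \<longrightarrow> \<bar>t j\<bar> \<le> real (Suc n)}. g t \<partial>perp_borel i) < \<infinity>"
      "AE t in perp_borel i. (\<forall>j. j \<noteq> i \<longrightarrow> \<bar>t j\<bar> \<le> real (Suc n)) \<longrightarrow>
         (\<forall>F. finite F \<longrightarrow> F \<subseteq> ess_boundary (slice i E t) \<inter> {-real (Suc n)<..<real (Suc n)} \<longrightarrow> of_nat (card F) \<le> g t)"
      using finite_perimeter_slices[OF lfp, of "real (Suc n)" i] by auto
    let ?T = "{t. \<forall>j. j \<noteq> i \<longrightarrow> \<bar>t j\<bar> \<le> real (Suc n)}"
    have "?T \<inter> space (perp_borel i) = perp_cube i 0 (2 * real (Suc n))"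
      by (auto simp: perp_cube_def perp_lebesgue_def)
    then have "?T \<inter> space (perp_borel i) \<in> sets (perp_borel i)" by simp
    then have "(\<lambda>t. indicator ?T t :: ennreal) \<in> borel_measurable (perp_borel i)"
      by (simp add: borel_measurable_indicator_iff)
    then have "AE t in perp_borel i. g t * indicator ?T t \<noteq> \<infinity>"
      using g(1,2) by (intro nn_integral_PInf_AE) auto
    with g(3) show ?thesis
    proof eventually_elim
      case (elim t)
      show ?case
      proof (cases "\<forall>j. j \<noteq> i \<longrightarrow> \<bar>t j\<bar> \<le> real (Suc n)")
        case True
        then have "g t < \<infinity>" using elim(2) by (simp add: less_top)
        moreover have "of_nat (card F) \<le> g t" if "finite F" "F \<subseteq> ess_boundary (slice i E t) \<inter> {-real (Suc n)<..<real (Suc n)}" for F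
          using elim(1) True that by blast
        ultimately have "finite (ess_boundary (slice i E t) \<inter> {-real (Suc n)<..<real (Suc n)})"
          by (intro finite_if_subset_card_bounded)
        then show ?thesis ..
      qed simp
    qed
  qed
  then have "AE t in perp_borel i. \<forall>n. finite (ess_boundary (slice i E t) \<inter> {- real (Suc n)<..<real (Suc n)}) \<or> \<not> (\<forall>j. j \<noteq> i \<longrightarrow> \<bar>t j\<bar> \<le> real (Suc n))"
    by (subst AE_all_countable) blast
  with AE_glue[OF EB, of i] AE_glue[OF integral_cross_energy_AE[OF B EB, of i \<alpha> \<tau>], of i]
  show ?thesis
  proof eventually_elim
    case (elim t)
    have "locally_finite_boundary (slice i E t)"
    proof (rule locally_finite_boundaryI)
      fix n :: nat
      \<comment> \<open>The radius \<open>Suc (m + n)\<close> is large enough both for the slice at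
        \<open>t\<close> to meet the cube and for the interval up to \<open>Suc n\<close>.\<close>
      obtain m :: nat where m: "Max (insert 0 (range (\<lambda>j. \<bar>t j\<bar>))) < real m" using reals_Archimedean2 by blast
      have tj: "\<bar>t j\<bar> \<le> real m" for j
      proof -
        have "\<bar>t j\<bar> \<le> Max (insert 0 (range (\<lambda>j. \<bar>t j\<bar>)))" by (rule Max_ge) auto
        with m show ?thesis by linarith
      qed
      have "\<forall>j. j \<noteq> i \<longrightarrow> \<bar>t j\<bar> \<le> real (Suc (m + n))"
      proof (intro allI impI)
        show "\<bar>t j\<bar> \<le> real (Suc (m + n))" for j using tj[of j] by simp
      qed
      with elim(3) have "finite (ess_boundary (slice i E t) \<inter> {- real (Suc (m + n))<..<real (Suc (m + n))})" by blast
      then show "finite (ess_boundary (slice i E t) \<inter> {- real (Suc n)<..<real (Suc n)})"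
        by (rule finite_subset[rotated]) auto
    qed
    with elim(1,2) show ?case by (simp add: good_def slice_def)
  qed
qed

context
  fixes i :: 'n and t :: "'n \<Rightarrow> real"
  assumes good: "good i t"
begin

lemma slice_AE: "AE u in lborel. u \<in> slice i E t \<longleftrightarrow> u \<in> slice i B t"
  and slice_lf: "locally_finite_boundary (slice i E t)"
  and cross_AE: "AE u in lborel. (LINT \<zeta>|lebesgue. f_cross i E (glue i t u) \<zeta> * kernel \<alpha> \<tau> \<zeta>) = enn2real (cross_energy i \<alpha> \<tau> B (glue i t u))"
  using good by (simp_all add: good_def)

lemma slice_lebesgue: "slice i E t \<in> sets lebesgue"
proof (rule completion.in_sets_AE)
  show "AE x in lebesgue. (x \<in> slice i B t) = (x \<in> slice i E t)"
    using AE_completion[OF slice_AE] by eventually_elim simp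
  show "slice i B t \<in> sets lebesgue" using slice_in_borel[OF B, of i t] by simp
qed simp

lemma slice_reduced: "reduced_boundary (slice i E t) = ess_boundary (slice i E t)"
  by (rule reduced_boundary_eq_ess_boundary[OF slice_lebesgue slice_lf])

lemma slice_boundary_eq: "ess_boundary (slice i E t) = ess_boundary (slice i B t)"
  by (rule ess_boundary_cong_AE[OF slice_AE])

lemma slice_next: "next_boundary (slice i E t) u = ess_next (slice i B t) u"
  by (simp add: next_boundary_def ess_next_def slice_reduced slice_boundary_eq)

lemma slice_prev: "prev_boundary (slice i E t) u = ess_prev (slice i B t) u"
  by (simp add: prev_boundary_def ess_prev_def slice_reduced slice_boundary_eq)

text \<open>The essential boundary is defined by statements that hold almost everywhere on
  intervals, and these are invariant under translation by \<open>L\<close>.\<close>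

lemma slice_periodic: "periodic_set L (ess_boundary (slice i E t))"
proof -
  have sl: "s + L \<in> slice i E t \<longleftrightarrow> s \<in> slice i E t" for s
  proof -
    have "glue i t (s + L) = glue i t s + axis i L" by (simp add: vec_eq_iff glue_def axis_def)
    then show ?thesis using per by (simp add: slice_def cube_periodic_def)
  qed
  have shift: "(AE y in lborel. a + L < y \<and> y < b + L \<longrightarrow> (y \<in> slice i E t \<longleftrightarrow> c)) \<longleftrightarrow> (AE y in lborel. a < y \<and> y < b \<longrightarrow> (y \<in> slice i E t \<longleftrightarrow> c))" for a b c
  proof
    assume "AE y in lborel. a + L < y \<and> y < b + L \<longrightarrow> (y \<in> slice i E t \<longleftrightarrow> c)"
    from AE_lborel_translate[OF this, of L] show "AE y in lborel. a < y \<and> y < b \<longrightarrow> (y \<in> slice i E t \<longleftrightarrow> c)"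
      by eventually_elim (use sl in \<open>auto simp: add.commute\<close>)
  next
    assume "AE y in lborel. a < y \<and> y < b \<longrightarrow> (y \<in> slice i E t \<longleftrightarrow> c)"
    from AE_lborel_translate[OF this, of "- L"] show "AE y in lborel. a + L < y \<and> y < b + L \<longrightarrow> (y \<in> slice i E t \<longleftrightarrow> c)"
    proof eventually_elim
      case (elim y)
      then show ?case using sl[of "- L + y"] by auto
    qed
  qed
  have iff: "x \<notin> ess_boundary (slice i E t) \<longleftrightarrow> (\<exists>a b c. a < x \<and> x < b \<and> (AE y in lborel. a < y \<and> y < b \<longrightarrow> (y \<in> slice i E t \<longleftrightarrow> c)))" for x
  proof
    assume "x \<notin> ess_boundary (slice i E t)"
    then obtain a b where "a < x" "x < b" "(AE y in lborel. a < y \<and> y < b \<longrightarrow> y \<in> slice i E t) \<or> (AE y in lborel. a < y \<and> y < b \<longrightarrow> y \<notin> slice i E t)"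
      by (auto simp: ess_boundary_def)
    then show "\<exists>a b c. a < x \<and> x < b \<and> (AE y in lborel. a < y \<and> y < b \<longrightarrow> (y \<in> slice i E t \<longleftrightarrow> c))"
    proof (elim disjE)
      assume "a < x" "x < b" "AE y in lborel. a < y \<and> y < b \<longrightarrow> y \<in> slice i E t"
      then show ?thesis by (intro exI[of _ a] exI[of _ b] exI[of _ True]) simp
    next
      assume "a < x" "x < b" "AE y in lborel. a < y \<and> y < b \<longrightarrow> y \<notin> slice i E t"
      then show ?thesis by (intro exI[of _ a] exI[of _ b] exI[of _ False]) simp
    qed
  next
    assume "\<exists>a b c. a < x \<and> x < b \<and> (AE y in lborel. a < y \<and> y < b \<longrightarrow> (y \<in> slice i E t \<longleftrightarrow> c))"
    then obtain a b c where *: "a < x" "x < b" "AE y in lborel. a < y \<and> y < b \<longrightarrow> (y \<in> slice i E t \<longleftrightarrow> c)" by blast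
    then show "x \<notin> ess_boundary (slice i E t)" by (cases c) (auto simp: ess_boundary_def)
  qed
  have "x + L \<notin> ess_boundary (slice i E t) \<longleftrightarrow> x \<notin> ess_boundary (slice i E t)" for x
  proof
    assume "x + L \<notin> ess_boundary (slice i E t)"
    then obtain a b c where *: "a < x + L" "x + L < b" "AE y in lborel. a < y \<and> y < b \<longrightarrow> (y \<in> slice i E t \<longleftrightarrow> c)"
      unfolding iff by blast
    then have "AE y in lborel. a - L < y \<and> y < b - L \<longrightarrow> (y \<in> slice i E t \<longleftrightarrow> c)"
      using shift[of "a - L" "b - L" c] by simp
    then show "x \<notin> ess_boundary (slice i E t)" unfolding iff using *(1,2)
      by (intro exI[of _ "a - L"] exI[of _ "b - L"] exI[of _ c]) auto
  next
    assume "x \<notin> ess_boundary (slice i E t)"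
    then obtain a b c where *: "a < x" "x < b" "AE y in lborel. a < y \<and> y < b \<longrightarrow> (y \<in> slice i E t \<longleftrightarrow> c)"
      unfolding iff by blast
    then show "x + L \<notin> ess_boundary (slice i E t)" unfolding iff
      by (intro exI[of _ "a + L"] exI[of _ "b + L"] exI[of _ c]) (simp add: shift)
  qed
  then show ?thesis using L0 by (simp add: periodic_set_def)
qed

lemmas slice_next_obtain = next_boundary_obtain[OF slice_lf slice_reduced slice_periodic]
lemmas slice_prev_obtain = prev_boundary_obtain[OF slice_lf slice_reduced slice_periodic]

abbreviation "Rc \<equiv> right_cost i \<alpha> \<tau> (slice i B t)"
abbreviation "Lc \<equiv> left_cost i \<alpha> \<tau> (slice i B t)"
abbreviation "Ce \<equiv> \<lambda>u. cross_energy i \<alpha> \<tau> B (glue i t u)"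

lemma right_cost_slice_measurable[measurable]: "right_cost i \<alpha> \<tau> (slice i B t) \<in> borel_measurable borel"
  and left_cost_slice_measurable[measurable]: "left_cost i \<alpha> \<tau> (slice i B t) \<in> borel_measurable borel"
proof -
  note [measurable] = slice_in_borel[OF B, of i t] borel_measurable_kernel_hat[OF \<alpha>1 \<tau>0, of i]
  show "right_cost i \<alpha> \<tau> (slice i B t) \<in> borel_measurable borel" unfolding right_cost_def by measurable
  show "left_cost i \<alpha> \<tau> (slice i B t) \<in> borel_measurable borel" unfolding left_cost_def by measurable
qed

lemma r_term_eq:
  "r_term i \<alpha> \<tau> E t s = - 1 + 2 * kernel_moment i \<alpha> \<tau>
     - enn2real (\<integral>\<^sup>+u. right_cost i \<alpha> \<tau> (slice i B t) u * indicator (einterval (prev_boundary (slice i E t) s) (ereal s)) u \<partial>lborel)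
     - enn2real (\<integral>\<^sup>+u. left_cost i \<alpha> \<tau> (slice i B t) u * indicator (einterval (ereal s) (next_boundary (slice i E t) s)) u \<partial>lborel)"
proof -
  let ?S = "slice i E t"
  have 1: "AE u in lborel. (LINT \<rho>:{0..}|lebesgue. \<bar>indicat_real ?S (u + \<rho>) - indicat_real ?S u\<bar> * kernel_hat i \<alpha> \<tau> \<rho>) = enn2real (Rc u)"
    using slice_AE by eventually_elim (rule integral_right_cost[OF \<alpha>1 \<tau>0 slice_in_borel[OF B] slice_AE])
  have 2: "AE u in lborel. (LINT \<rho>:{..0}|lebesgue. \<bar>indicat_real ?S (u + \<rho>) - indicat_real ?S u\<bar> * kernel_hat i \<alpha> \<tau> \<rho>) = enn2real (Lc u)"
    using slice_AE by eventually_elim (rule integral_left_cost[OF \<alpha>1 \<tau>0 slice_in_borel[OF B] slice_AE])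
  show ?thesis
    unfolding r_term_def Let_def
    by (subst set_integral_eq_enn2real[OF 1 right_cost_slice_measurable right_cost_finite[OF \<alpha>1 \<tau>0] borel_einterval],
        subst set_integral_eq_enn2real[OF 2 left_cost_slice_measurable left_cost_finite[OF \<alpha>1 \<tau>0] borel_einterval])
      (simp add: kernel_moment_def)
qed

lemma v_term_eq:
  "v_term i \<alpha> \<tau> E t s = 1 / (2 * real CARD('n)) *
     enn2real (\<integral>\<^sup>+u. cross_energy i \<alpha> \<tau> B (glue i t u) * indicator (einterval (prev_boundary (slice i E t) s) (next_boundary (slice i E t) s)) u \<partial>lborel)"
proof -
  have fin: "Ce u < \<infinity>" for u
    using cross_energy_le[of i \<alpha> \<tau> B "glue i t u"] kernel_integrable[OF \<alpha>1 \<tau>0, where 'n='n] by (meson le_less_trans)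
  show ?thesis
    unfolding v_term_def
    by (subst set_integral_eq_enn2real[OF cross_AE _ fin borel_einterval]) simp_all
qed

lemma v_term_nonneg: "0 \<le> v_term i \<alpha> \<tau> E t s"
  unfolding v_term_eq by simp

lemma
  assumes s: "s \<in> ess_boundary (slice i E t)"
  shows right_cost_gap: "(\<integral>\<^sup>+u. right_cost i \<alpha> \<tau> (slice i B t) u * indicator (einterval (prev_boundary (slice i E t) s) (ereal s)) u \<partial>lborel) \<le> ennreal (kernel_moment i \<alpha> \<tau>)"
    and left_cost_gap: "\<And>n. next_boundary (slice i E t) s = ereal n \<Longrightarrow>
       (\<integral>\<^sup>+u. left_cost i \<alpha> \<tau> (slice i B t) u * indicator (einterval (ereal s) (next_boundary (slice i E t) s)) u \<partial>lborel)
       + ennreal (1 / (64 * real CARD('n) ^ (CARD('n) + 2)) * (n - s + \<tau> powr (1 / (1 - \<alpha>))) powr (- (1 - \<alpha>))) \<le> ennreal (kernel_moment i \<alpha> \<tau>)"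
proof -
  obtain m where m: "prev_boundary (slice i E t) s = ereal m" "m \<in> ess_boundary (slice i E t)" "m < s" "s - L \<le> m"
      "ess_boundary (slice i E t) \<inter> {m<..<s} = {}"
    by (rule slice_prev_obtain[OF s, of s])
  have "einterval (ereal m) (ereal s) = {m<..<s}" by (auto simp: einterval_def)
  with m show "(\<integral>\<^sup>+u. right_cost i \<alpha> \<tau> (slice i B t) u * indicator (einterval (prev_boundary (slice i E t) s) (ereal s)) u \<partial>lborel) \<le> ennreal (kernel_moment i \<alpha> \<tau>)"
    using right_cost_gap_le[OF \<alpha>1 \<tau>0, of "slice i B t" m s i] by (simp add: slice_boundary_eq)
  fix n assume n: "next_boundary (slice i E t) s = ereal n"
  obtain n' where n': "next_boundary (slice i E t) s = ereal n'" "n' \<in> ess_boundary (slice i E t)" "s < n'" "n' \<le> s + L"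
      "ess_boundary (slice i E t) \<inter> {s<..<n'} = {}"
    by (rule slice_next_obtain[OF s, of s])
  with n have nn: "n' = n" by simp
  have "einterval (ereal s) (ereal n) = {s<..<n}" by (auto simp: einterval_def)
  with n n' nn show "(\<integral>\<^sup>+u. left_cost i \<alpha> \<tau> (slice i B t) u * indicator (einterval (ereal s) (next_boundary (slice i E t) s)) u \<partial>lborel)
       + ennreal (1 / (64 * real CARD('n) ^ (CARD('n) + 2)) * (n - s + \<tau> powr (1 / (1 - \<alpha>))) powr (- (1 - \<alpha>))) \<le> ennreal (kernel_moment i \<alpha> \<tau>)"
    using left_cost_gap_le[OF \<alpha>0 \<alpha>1 \<tau>0, of "slice i B t" s n i] by (simp add: slice_boundary_eq)
qed

text \<open>One of the two moments in \<open>2 * kernel_moment\<close> is set against each adjacent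
  gap: the left gap costs at most a moment, the right gap at most a moment minus the power of its
  length. Hence \<open>r\<close> is at least -1, and large when the right gap is short.\<close>

lemma
  assumes s: "s \<in> ess_boundary (slice i E t)"
  shows r_term_lower: "\<And>n. next_boundary (slice i E t) s = ereal n \<Longrightarrow>
      - 1 + 1 / (64 * real CARD('n) ^ (CARD('n) + 2)) * (n - s + \<tau> powr (1 / (1 - \<alpha>))) powr (- (1 - \<alpha>)) \<le> r_term i \<alpha> \<tau> E t s"
    and r_term_ge: "- 1 \<le> r_term i \<alpha> \<tau> E t s"
    and r_term_le: "r_term i \<alpha> \<tau> E t s \<le> - 1 + 2 * kernel_moment i \<alpha> \<tau>"
    and right_cost_gap_finite: "(\<integral>\<^sup>+u. right_cost i \<alpha> \<tau> (slice i B t) u * indicator (einterval (prev_boundary (slice i E t) s) (ereal s)) u \<partial>lborel) < \<infinity>"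
    and left_cost_gap_finite: "(\<integral>\<^sup>+u. left_cost i \<alpha> \<tau> (slice i B t) u * indicator (einterval (ereal s) (next_boundary (slice i E t) s)) u \<partial>lborel) < \<infinity>"
proof -
  let ?k = "kernel_moment i \<alpha> \<tau>"
  have k0: "0 \<le> ?k" by (rule kernel_moment_nonneg[OF \<alpha>1 \<tau>0])
  let ?A = "\<integral>\<^sup>+u. right_cost i \<alpha> \<tau> (slice i B t) u * indicator (einterval (prev_boundary (slice i E t) s) (ereal s)) u \<partial>lborel"
  let ?B = "\<integral>\<^sup>+u. left_cost i \<alpha> \<tau> (slice i B t) u * indicator (einterval (ereal s) (next_boundary (slice i E t) s)) u \<partial>lborel"
  obtain n' where n': "next_boundary (slice i E t) s = ereal n'" "n' \<in> ess_boundary (slice i E t)" "s < n'" "n' \<le> s + L"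
      "ess_boundary (slice i E t) \<inter> {s<..<n'} = {}"
    by (rule slice_next_obtain[OF s, of s])
  obtain a where a: "?A = ennreal a" "0 \<le> a" "a \<le> ?k"
    using right_cost_gap[OF s] k0 by (cases ?A) (auto simp: ennreal_le_iff top_unique)
  define c where "c n = 1 / (64 * real CARD('n) ^ (CARD('n) + 2)) * (n - s + \<tau> powr (1 / (1 - \<alpha>))) powr (- (1 - \<alpha>))" for n
  have c0: "0 \<le> c n" for n by (simp add: c_def)
  have Bc: "?B + ennreal (c n') \<le> ennreal ?k" unfolding c_def by (rule left_cost_gap[OF s n'(1)])
  then have "?B \<le> ennreal ?k" by (rule order_trans[rotated]) simp
  then obtain b where b: "?B = ennreal b" "0 \<le> b"
    using k0 by (cases ?B) (auto simp: top_unique)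
  have bc: "b + c n' \<le> ?k" using Bc b c0[of n'] k0 by (simp add: ennreal_plus[symmetric] ennreal_le_iff del: ennreal_plus)
  have r: "r_term i \<alpha> \<tau> E t s = - 1 + 2 * ?k - a - b"
    unfolding r_term_eq using a b by simp
  show "- 1 + 1 / (64 * real CARD('n) ^ (CARD('n) + 2)) * (n - s + \<tau> powr (1 / (1 - \<alpha>))) powr (- (1 - \<alpha>)) \<le> r_term i \<alpha> \<tau> E t s"
    if "next_boundary (slice i E t) s = ereal n" for n
    using that n' bc a unfolding r c_def[symmetric] by simp
  show "- 1 \<le> r_term i \<alpha> \<tau> E t s" unfolding r using bc a c0[of n'] by linarith
  show "r_term i \<alpha> \<tau> E t s \<le> - 1 + 2 * ?k" unfolding r using a b by linarith
  show "?A < \<infinity>" "?B < \<infinity>" using a b by simp_all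
qed

end

end

text \<open>Rounding \<open>(x - a) / \<eta>\<close> down is injective on a set with spacing
  \<open>\<eta>\<close> and has values between 0 and the integer part of
  \<open>l / \<eta>\<close>.\<close>

lemma card_separated_le:
  fixes G :: "real set"
  assumes G: "G \<subseteq> {a..a + l}" and \<eta>: "\<eta> > 0" and l: "l \<ge> 0"
    and sep: "\<And>x y. x \<in> G \<Longrightarrow> y \<in> G \<Longrightarrow> x < y \<Longrightarrow> \<eta> \<le> y - x"
  shows "real (card G) \<le> l / \<eta> + 1"
proof -
  let ?f = "\<lambda>x. \<lfloor>(x - a) / \<eta>\<rfloor>"
  have ne: "?f x \<noteq> ?f y" if "x \<in> G" "y \<in> G" "x < y" for x y
  proof -
    have "(x - a) / \<eta> + 1 \<le> (y - a) / \<eta>" 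
    proof -
      have "(x - a) / \<eta> + 1 = (x - a + \<eta>) / \<eta>" using \<eta> by (simp add: add_divide_distrib)
      also have "\<dots> \<le> (y - a) / \<eta>" using sep[OF that] \<eta> by (intro divide_right_mono) auto
      finally show ?thesis .
    qed
    then have "?f x + 1 \<le> ?f y" by linarith
    then show ?thesis by simp
  qed
  have inj: "inj_on ?f G"
  proof (rule inj_onI, rule ccontr)
    fix x y assume "x \<in> G" "y \<in> G" "?f x = ?f y" "x \<noteq> y"
    then show False using ne[of x y] ne[of y x] by (cases "x < y") auto
  qed
  have "?f ` G \<subseteq> {0..\<lfloor>l / \<eta>\<rfloor>}"
  proof (rule image_subsetI)
    fix x assume "x \<in> G"
    then have "0 \<le> (x - a) / \<eta>" "(x - a) / \<eta> \<le> l / \<eta>" using G \<eta> by (auto intro!: divide_right_mono)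
    then show "?f x \<in> {0..\<lfloor>l / \<eta>\<rfloor>}" by (auto intro: floor_mono)
  qed
  then have "card G \<le> card {0..\<lfloor>l / \<eta>\<rfloor>}" using inj by (intro card_inj_on_le) auto
  also have "card {0..\<lfloor>l / \<eta>\<rfloor>} = nat (\<lfloor>l / \<eta>\<rfloor> + 1)" by simp
  finally have "real (card G) \<le> real (nat (\<lfloor>l / \<eta>\<rfloor> + 1))" by simp
  also have "\<dots> = of_int (\<lfloor>l / \<eta>\<rfloor> + 1)" using l \<eta> by (simp add: add_nonneg_pos)
  also have "\<dots> \<le> l / \<eta> + 1" by simp
  finally show ?thesis .
qed

section \<open>The sum over the crossings of one slice\<close>

context perimeter_energy
begin

definition slice_sum :: "'n \<Rightarrow> real^'n \<Rightarrow> real \<Rightarrow> ('n \<Rightarrow> real) \<Rightarrow> real" where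
  "slice_sum i z l t = (\<Sum>s\<in>{s \<in> reduced_boundary (slice i E t). glue i t s \<in> cube z l}. v_term i \<alpha> \<tau> E t s + r_term i \<alpha> \<tau> E t s)"

text \<open>Marks the points of the gaps to the left of crossings in the cube; such points may lie
  outside the cube themselves. Formulated with \<open>B\<close>, it is jointly measurable in
  \<open>t\<close> and \<open>u\<close>.\<close>

definition near_left :: "'n \<Rightarrow> real^'n \<Rightarrow> real \<Rightarrow> ('n \<Rightarrow> real) \<Rightarrow> real \<Rightarrow> ennreal" where
  "near_left i z l t u = indicator {e. ereal (z $ i - l / 2) \<le> e \<and> e \<le> ereal (z $ i + l / 2)} (ess_next (slice i B t) u)"

definition near_right :: "'n \<Rightarrow> real^'n \<Rightarrow> real \<Rightarrow> ('n \<Rightarrow> real) \<Rightarrow> real \<Rightarrow> ennreal" where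
  "near_right i z l t u = indicator {e. ereal (z $ i - l / 2) \<le> e \<and> e \<le> ereal (z $ i + l / 2)} (ess_prev (slice i B t) u)"

definition gap_density :: "'n \<Rightarrow> ('n \<Rightarrow> real) \<Rightarrow> real \<Rightarrow> ennreal" where
  "gap_density i t u = ennreal (1 / (real_of_ereal (ess_next (slice i B t) u) - real_of_ereal (ess_prev (slice i B t) u)))"

text \<open>An expression for \<^term>\<open>slice_sum\<close> by integrals over the line, whose measurability in the slice
  is plain: a sum over boundary points of integrals over adjacent gaps is an integral over the points
  with neighbouring boundary point in the cube, and the counting function arises from
  \<^term>\<open>gap_density\<close>, of integral one over each gap.\<close>

definition slice_sum_borel :: "'n \<Rightarrow> real^'n \<Rightarrow> real \<Rightarrow> ('n \<Rightarrow> real) \<Rightarrow> real" where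
  "slice_sum_borel i z l t =
     (- 1 + 2 * kernel_moment i \<alpha> \<tau>) * enn2real (\<integral>\<^sup>+u. gap_density i t u * near_left i z l t u \<partial>lborel)
     + 1 / (2 * real CARD('n)) * (enn2real (\<integral>\<^sup>+u. cross_energy i \<alpha> \<tau> B (glue i t u) * near_left i z l t u \<partial>lborel)
         + enn2real (\<integral>\<^sup>+u. cross_energy i \<alpha> \<tau> B (glue i t u) * near_right i z l t u \<partial>lborel))
     - enn2real (\<integral>\<^sup>+u. right_cost i \<alpha> \<tau> (slice i B t) u * near_left i z l t u \<partial>lborel)
     - enn2real (\<integral>\<^sup>+u. left_cost i \<alpha> \<tau> (slice i B t) u * near_right i z l t u \<partial>lborel)"

lemma borel_measurable_slice_sum_borel: "slice_sum_borel i z l \<in> borel_measurable (perp_borel i)"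
proof -
  note [measurable] = borel_measurable_ess_next[OF B, of i] borel_measurable_ess_prev[OF B, of i]
    borel_measurable_right_cost[OF \<alpha>1 \<tau>0 B, of i] borel_measurable_left_cost[OF \<alpha>1 \<tau>0 B, of i]
  have [measurable]: "{e. ereal (z $ i - l / 2) \<le> e \<and> e \<le> ereal (z $ i + l / 2)} \<in> sets borel"
  proof -
    have "{e. ereal (z $ i - l / 2) \<le> e \<and> e \<le> ereal (z $ i + l / 2)} = {ereal (z $ i - l / 2)..ereal (z $ i + l / 2)}" by auto
    then show ?thesis by simp
  qed
  have nl[measurable]: "(\<lambda>p. near_left i z l (fst p) (snd p)) \<in> borel_measurable (perp_borel i \<Otimes>\<^sub>M lborel)"
    unfolding near_left_def by measurable
  have nr[measurable]: "(\<lambda>p. near_right i z l (fst p) (snd p)) \<in> borel_measurable (perp_borel i \<Otimes>\<^sub>M lborel)"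
    unfolding near_right_def by measurable
  have gd[measurable]: "(\<lambda>p. gap_density i (fst p) (snd p)) \<in> borel_measurable (perp_borel i \<Otimes>\<^sub>M lborel)"
    unfolding gap_density_def by measurable
  have [measurable]: "(\<lambda>t. \<integral>\<^sup>+u. gap_density i t u * near_left i z l t u \<partial>lborel) \<in> borel_measurable (perp_borel i)"
    by (rule lborel.borel_measurable_nn_integral) (simp add: split_beta')
  have [measurable]: "(\<lambda>t. \<integral>\<^sup>+u. cross_energy i \<alpha> \<tau> B (glue i t u) * near_left i z l t u \<partial>lborel) \<in> borel_measurable (perp_borel i)"
    by (rule lborel.borel_measurable_nn_integral) (simp add: split_beta')
  have [measurable]: "(\<lambda>t. \<integral>\<^sup>+u. cross_energy i \<alpha> \<tau> B (glue i t u) * near_right i z l t u \<partial>lborel) \<in> borel_measurable (perp_borel i)"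
    by (rule lborel.borel_measurable_nn_integral) (simp add: split_beta')
  have [measurable]: "(\<lambda>t. \<integral>\<^sup>+u. right_cost i \<alpha> \<tau> (slice i B t) u * near_left i z l t u \<partial>lborel) \<in> borel_measurable (perp_borel i)"
    by (rule lborel.borel_measurable_nn_integral) (simp add: split_beta')
  have [measurable]: "(\<lambda>t. \<integral>\<^sup>+u. left_cost i \<alpha> \<tau> (slice i B t) u * near_right i z l t u \<partial>lborel) \<in> borel_measurable (perp_borel i)"
    by (rule lborel.borel_measurable_nn_integral) (simp add: split_beta')
  show ?thesis unfolding slice_sum_borel_def by measurable
qed

definition crossings :: "'n \<Rightarrow> real^'n \<Rightarrow> real \<Rightarrow> ('n \<Rightarrow> real) \<Rightarrow> real set" where
  "crossings i z l t = ess_boundary (slice i E t) \<inter> {z $ i - l / 2..z $ i + l / 2}"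

lemma kernel_mass_finite: "(\<integral>\<^sup>+\<zeta>. ennreal (kernel \<alpha> \<tau> (\<zeta>::real^'n)) \<partial>lborel) < \<infinity>"
  by (rule kernel_integrable[OF \<alpha>1 \<tau>0])

context
  fixes i :: 'n and t :: "'n \<Rightarrow> real" and z :: "real^'n" and l :: real
  assumes good: "good i t" and t: "t \<in> perp_cube i z l"
begin

lemma finite_crossings: "finite (crossings i z l t)"
  unfolding crossings_def
  by (rule finite_subset[of _ "ess_boundary (slice i E t) \<inter> {z $ i - l / 2 - 1<..<z $ i + l / 2 + 1}"])
    (use slice_lf[OF good] in \<open>auto simp: locally_finite_boundary_def\<close>)

lemma crossings_eq: "{s \<in> reduced_boundary (slice i E t). glue i t s \<in> cube z l} = crossings i z l t"
proof -
  have "glue i t s \<in> cube z l \<longleftrightarrow> \<bar>s - z $ i\<bar> \<le> l / 2" for s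
    using t by (auto simp: cube_def perp_cube_def glue_def)
  moreover have "\<bar>s - z $ i\<bar> \<le> l / 2 \<longleftrightarrow> s \<in> {z $ i - l / 2..z $ i + l / 2}" for s by (auto simp: abs_if)
  ultimately show ?thesis unfolding slice_reduced[OF good] crossings_def by auto
qed

lemma slice_sum_eq: "slice_sum i z l t = (\<Sum>s\<in>crossings i z l t. v_term i \<alpha> \<tau> E t s + r_term i \<alpha> \<tau> E t s)"
  by (simp add: slice_sum_def crossings_eq)

lemma sum_left:
  assumes "f \<in> borel_measurable borel"
  shows "(\<Sum>s\<in>crossings i z l t. \<integral>\<^sup>+u. f u * indicator (einterval (prev_boundary (slice i E t) s) (ereal s)) u \<partial>lborel) =
    (\<integral>\<^sup>+u. f u * near_left i z l t u \<partial>lborel)"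
  using sum_left_gaps[OF slice_lf[OF good] slice_reduced[OF good] slice_periodic[OF good] assms crossings_def]
  by (simp add: near_left_def slice_next[OF good] indicator_def)

lemma sum_right:
  assumes "f \<in> borel_measurable borel"
  shows "(\<Sum>s\<in>crossings i z l t. \<integral>\<^sup>+u. f u * indicator (einterval (ereal s) (next_boundary (slice i E t) s)) u \<partial>lborel) =
    (\<integral>\<^sup>+u. f u * near_right i z l t u \<partial>lborel)"
  using sum_right_gaps[OF slice_lf[OF good] slice_reduced[OF good] slice_periodic[OF good] assms crossings_def]
  by (simp add: near_right_def slice_prev[OF good] indicator_def)

lemma ess_next_const:
  assumes s: "s \<in> ess_boundary (slice i E t)" and u: "m < u" "u < s" and gap: "ess_boundary (slice i E t) \<inter> {m<..<s} = {}"
  shows "ess_next (slice i B t) u = ereal s"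
proof -
  obtain n where n: "next_boundary (slice i E t) u = ereal n" "n \<in> ess_boundary (slice i E t)" "u < n" "n \<le> u + L"
      "ess_boundary (slice i E t) \<inter> {u<..<n} = {}"
    by (rule slice_next_obtain[OF good s, of u])
  have "\<not> n < s" using gap n(2,3) u by auto
  moreover have "\<not> s < n" using n(5) s u by auto
  ultimately have "n = s" by simp
  with n show ?thesis by (simp add: slice_next[OF good])
qed

lemma ess_prev_const:
  assumes s: "s \<in> ess_boundary (slice i E t)" and u: "s < u" "u < m" and gap: "ess_boundary (slice i E t) \<inter> {s<..<m} = {}"
  shows "ess_prev (slice i B t) u = ereal s"
proof -
  obtain n where n: "prev_boundary (slice i E t) u = ereal n" "n \<in> ess_boundary (slice i E t)" "n < u" "u - L \<le> n"
      "ess_boundary (slice i E t) \<inter> {n<..<u} = {}"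
    by (rule slice_prev_obtain[OF good s, of u])
  have "\<not> s < n" using gap n(2,3) u by auto
  moreover have "\<not> n < s" using n(5) s u by auto
  ultimately have "n = s" by simp
  with n show ?thesis by (simp add: slice_prev[OF good])
qed

lemma gap_density_integral:
  assumes s: "s \<in> ess_boundary (slice i E t)"
  shows "(\<integral>\<^sup>+u. gap_density i t u * indicator (einterval (prev_boundary (slice i E t) s) (ereal s)) u \<partial>lborel) = 1"
proof -
  obtain m where m: "prev_boundary (slice i E t) s = ereal m" "m \<in> ess_boundary (slice i E t)" "m < s" "s - L \<le> m"
      "ess_boundary (slice i E t) \<inter> {m<..<s} = {}"
    by (rule slice_prev_obtain[OF good s, of s])
  have "(\<integral>\<^sup>+u. gap_density i t u * indicator (einterval (prev_boundary (slice i E t) s) (ereal s)) u \<partial>lborel) =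
      (\<integral>\<^sup>+u. ennreal (1 / (s - m)) * indicator {m<..<s} u \<partial>lborel)"
  proof (rule nn_integral_cong)
    fix u
    show "gap_density i t u * indicator (einterval (prev_boundary (slice i E t) s) (ereal s)) u = ennreal (1 / (s - m)) * indicator {m<..<s} u"
    proof (cases "m < u \<and> u < s")
      case True
      then show ?thesis
        using ess_next_const[OF s _ _ m(5), of u] ess_prev_const[OF m(2) _ _ m(5), of u]
        by (simp add: gap_density_def m(1) einterval_def)
    next
      case False
      then show ?thesis by (auto simp: m(1) einterval_def indicator_def)
    qed
  qed
  also have "\<dots> = ennreal (1 / (s - m)) * emeasure lborel {m<..<s}" by (rule nn_integral_cmult_indicator) simp
  also have "\<dots> = 1" using m(3) by (simp add: ennreal_mult[symmetric])
  finally show ?thesis .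
qed

lemma gap_density_measurable[measurable]: "gap_density i t \<in> borel_measurable borel"
  and cross_slice_measurable[measurable]: "(\<lambda>u. cross_energy i \<alpha> \<tau> B (glue i t u)) \<in> borel_measurable borel"
proof -
  have tsp: "t \<in> space (perp_borel i)" using t by (simp add: perp_cube_def perp_lebesgue_def)
  have "(\<lambda>u. (t, u)) \<in> lborel \<rightarrow>\<^sub>M perp_borel i \<Otimes>\<^sub>M lborel" using tsp by (rule measurable_Pair1')
  note m = measurable_compose[OF this]
  have "(\<lambda>u. ess_next (slice i B t) u) \<in> borel_measurable lborel" "(\<lambda>u. ess_prev (slice i B t) u) \<in> borel_measurable lborel"
    using m[OF borel_measurable_ess_next[OF B]] m[OF borel_measurable_ess_prev[OF B]] by simp_all
  then have [measurable]: "ess_next (slice i B t) \<in> borel_measurable borel" "ess_prev (slice i B t) \<in> borel_measurable borel" by simp_all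
  show "gap_density i t \<in> borel_measurable borel" unfolding gap_density_def by measurable
  show "(\<lambda>u. cross_energy i \<alpha> \<tau> B (glue i t u)) \<in> borel_measurable borel" by measurable
qed

lemma cross_gap_finite:
  "(\<integral>\<^sup>+u. cross_energy i \<alpha> \<tau> B (glue i t u) * indicator {a<..<b} u \<partial>lborel) \<le> (\<integral>\<^sup>+\<zeta>. ennreal (kernel \<alpha> \<tau> (\<zeta>::real^'n)) \<partial>lborel) * ennreal (max 0 (b - a))"
proof -
  have "(\<integral>\<^sup>+u. cross_energy i \<alpha> \<tau> B (glue i t u) * indicator {a<..<b} u \<partial>lborel) \<le>
      (\<integral>\<^sup>+u. (\<integral>\<^sup>+\<zeta>. ennreal (kernel \<alpha> \<tau> (\<zeta>::real^'n)) \<partial>lborel) * indicator {a<..<b} u \<partial>lborel)"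
    by (intro nn_integral_mono mult_right_mono cross_energy_le) simp
  also have "\<dots> = (\<integral>\<^sup>+\<zeta>. ennreal (kernel \<alpha> \<tau> (\<zeta>::real^'n)) \<partial>lborel) * emeasure lborel {a<..<b}"
    by (rule nn_integral_cmult_indicator) simp
  also have "emeasure lborel {a<..<b} = ennreal (max 0 (b - a))"
    by (cases "a \<le> b") (auto simp: max_def)
  finally show ?thesis .
qed

lemma v_term_split:
  assumes s: "s \<in> ess_boundary (slice i E t)"
  shows "v_term i \<alpha> \<tau> E t s = 1 / (2 * real CARD('n)) *
      (enn2real (\<integral>\<^sup>+u. cross_energy i \<alpha> \<tau> B (glue i t u) * indicator (einterval (prev_boundary (slice i E t) s) (ereal s)) u \<partial>lborel)
       + enn2real (\<integral>\<^sup>+u. cross_energy i \<alpha> \<tau> B (glue i t u) * indicator (einterval (ereal s) (next_boundary (slice i E t) s)) u \<partial>lborel))" (is ?split)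
    and "(\<integral>\<^sup>+u. cross_energy i \<alpha> \<tau> B (glue i t u) * indicator (einterval (prev_boundary (slice i E t) s) (ereal s)) u \<partial>lborel) < \<infinity>" (is ?f1)
    and "(\<integral>\<^sup>+u. cross_energy i \<alpha> \<tau> B (glue i t u) * indicator (einterval (ereal s) (next_boundary (slice i E t) s)) u \<partial>lborel) < \<infinity>" (is ?f2)
    and "v_term i \<alpha> \<tau> E t s \<le> enn2real (\<integral>\<^sup>+\<zeta>. ennreal (kernel \<alpha> \<tau> (\<zeta>::real^'n)) \<partial>lborel) * L" (is ?le)
proof -
  let ?K = "\<integral>\<^sup>+\<zeta>. ennreal (kernel \<alpha> \<tau> (\<zeta>::real^'n)) \<partial>lborel"
  obtain m where m: "prev_boundary (slice i E t) s = ereal m" "m \<in> ess_boundary (slice i E t)" "m < s" "s - L \<le> m"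
      "ess_boundary (slice i E t) \<inter> {m<..<s} = {}"
    by (rule slice_prev_obtain[OF good s, of s])
  obtain n where n: "next_boundary (slice i E t) s = ereal n" "n \<in> ess_boundary (slice i E t)" "s < n" "n \<le> s + L"
      "ess_boundary (slice i E t) \<inter> {s<..<n} = {}"
    by (rule slice_next_obtain[OF good s, of s])
  have ei: "einterval (ereal a) (ereal b) = {a<..<b}" for a b by (auto simp: einterval_def)
  let ?C = "\<lambda>u. cross_energy i \<alpha> \<tau> B (glue i t u)"
  have fin: "(\<integral>\<^sup>+u. ?C u * indicator {a<..<b} u \<partial>lborel) < \<infinity>" for a b
    by (rule le_less_trans[OF cross_gap_finite]) (use kernel_mass_finite in \<open>simp add: ennreal_mult_less_top\<close>)
  have "(\<integral>\<^sup>+u. ?C u * indicator {m<..<n} u \<partial>lborel) = (\<integral>\<^sup>+u. ?C u * indicator {m<..<s} u + ?C u * indicator {s<..<n} u \<partial>lborel)"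
  proof (rule nn_integral_cong_AE)
    have "AE u in lborel. u \<noteq> s" by (rule AE_lborel_singleton)
    then show "AE u in lborel. ?C u * indicator {m<..<n} u = ?C u * indicator {m<..<s} u + ?C u * indicator {s<..<n} u"
      by eventually_elim (use m n in \<open>auto simp: indicator_def\<close>)
  qed
  also have "\<dots> = (\<integral>\<^sup>+u. ?C u * indicator {m<..<s} u \<partial>lborel) + (\<integral>\<^sup>+u. ?C u * indicator {s<..<n} u \<partial>lborel)"
    by (rule nn_integral_add) measurable
  finally show ?split
    unfolding v_term_eq[OF good] m(1) n(1) ei using fin by (simp add: enn2real_plus)
  show ?f1 ?f2 unfolding m(1) n(1) ei by (rule fin)+
  have d: "real CARD('n) \<ge> 1" by (simp add: Suc_leI)
  have "enn2real (\<integral>\<^sup>+u. ?C u * indicator {m<..<n} u \<partial>lborel) \<le> enn2real (?K * ennreal (max 0 (n - m)))"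
    using cross_gap_finite[of m n] kernel_mass_finite by (intro enn2real_mono) (auto simp: ennreal_mult_less_top)
  also have "\<dots> = enn2real ?K * (n - m)" using m n by (simp add: enn2real_mult)
  \<comment> \<open>Each of the two gaps has length at most \<open>L\<close>; the factor 2 cancels
    against the prefactor of \<open>v_term\<close>.\<close>
  also have "\<dots> \<le> enn2real ?K * (2 * L)" using m n by (intro mult_left_mono) auto
  finally have "v_term i \<alpha> \<tau> E t s \<le> 1 / (2 * real CARD('n)) * (enn2real ?K * (2 * L))"
    unfolding v_term_eq[OF good] m(1) n(1) ei by (intro mult_left_mono) auto
  also have "\<dots> = (enn2real ?K * L) / real CARD('n)" by simp
  also have "\<dots> \<le> (enn2real ?K * L) / 1" using d L0 by (intro divide_left_mono) auto
  also have "\<dots> = enn2real ?K * L" by simp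
  finally show ?le .
qed

lemma slice_sum_eq_borel: "slice_sum i z l t = slice_sum_borel i z l t"
proof -
  let ?J = "crossings i z l t" and ?S = "slice i E t"
  have J: "s \<in> ess_boundary ?S" if "s \<in> ?J" for s using that by (simp add: crossings_def)
  define cl where "cl s = (\<integral>\<^sup>+u. cross_energy i \<alpha> \<tau> B (glue i t u) * indicator (einterval (prev_boundary ?S s) (ereal s)) u \<partial>lborel)" for s
  define cr where "cr s = (\<integral>\<^sup>+u. cross_energy i \<alpha> \<tau> B (glue i t u) * indicator (einterval (ereal s) (next_boundary ?S s)) u \<partial>lborel)" for s
  define rl where "rl s = (\<integral>\<^sup>+u. right_cost i \<alpha> \<tau> (slice i B t) u * indicator (einterval (prev_boundary ?S s) (ereal s)) u \<partial>lborel)" for s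
  define lr where "lr s = (\<integral>\<^sup>+u. left_cost i \<alpha> \<tau> (slice i B t) u * indicator (einterval (ereal s) (next_boundary ?S s)) u \<partial>lborel)" for s
  have fin: "cl s < \<infinity>" "cr s < \<infinity>" "rl s < \<infinity>" "lr s < \<infinity>" if "s \<in> ?J" for s
    unfolding cl_def cr_def rl_def lr_def
    using v_term_split(2,3)[OF J[OF that]] right_cost_gap_finite[OF good J[OF that]] left_cost_gap_finite[OF good J[OF that]] by auto
  have "slice_sum i z l t = (\<Sum>s\<in>?J. (- 1 + 2 * kernel_moment i \<alpha> \<tau>) * 1 + 1 / (2 * real CARD('n)) * (enn2real (cl s) + enn2real (cr s)) - enn2real (rl s) - enn2real (lr s))"
    unfolding slice_sum_eq
    by (intro sum.cong refl) (simp add: v_term_split(1)[OF J] r_term_eq[OF good] cl_def cr_def rl_def lr_def)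
  also have "\<dots> = (- 1 + 2 * kernel_moment i \<alpha> \<tau>) * (\<Sum>s\<in>?J. 1) + 1 / (2 * real CARD('n)) * ((\<Sum>s\<in>?J. enn2real (cl s)) + (\<Sum>s\<in>?J. enn2real (cr s)))
     - (\<Sum>s\<in>?J. enn2real (rl s)) - (\<Sum>s\<in>?J. enn2real (lr s))"
    by (simp only: sum_subtractf sum.distrib sum_distrib_left distrib_left)
  also have "(\<Sum>s\<in>?J. enn2real (cl s)) = enn2real (\<integral>\<^sup>+u. cross_energy i \<alpha> \<tau> B (glue i t u) * near_left i z l t u \<partial>lborel)"
    using fin(1) unfolding sum_left[OF cross_slice_measurable, symmetric] cl_def[symmetric] by (subst enn2real_sum) auto
  also have "(\<Sum>s\<in>?J. enn2real (cr s)) = enn2real (\<integral>\<^sup>+u. cross_energy i \<alpha> \<tau> B (glue i t u) * near_right i z l t u \<partial>lborel)"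
    using fin(2) unfolding sum_right[OF cross_slice_measurable, symmetric] cr_def[symmetric] by (subst enn2real_sum) auto
  also have "(\<Sum>s\<in>?J. enn2real (rl s)) = enn2real (\<integral>\<^sup>+u. right_cost i \<alpha> \<tau> (slice i B t) u * near_left i z l t u \<partial>lborel)"
    using fin(3) unfolding sum_left[OF right_cost_slice_measurable[OF good], symmetric] rl_def[symmetric] by (subst enn2real_sum) auto
  also have "(\<Sum>s\<in>?J. enn2real (lr s)) = enn2real (\<integral>\<^sup>+u. left_cost i \<alpha> \<tau> (slice i B t) u * near_right i z l t u \<partial>lborel)"
    using fin(4) unfolding sum_right[OF left_cost_slice_measurable[OF good], symmetric] lr_def[symmetric] by (subst enn2real_sum) auto
  also have "(\<Sum>s\<in>?J. 1) = enn2real (\<integral>\<^sup>+u. gap_density i t u * near_left i z l t u \<partial>lborel)"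
    using gap_density_integral[OF J] unfolding sum_left[OF gap_density_measurable, symmetric]
    by (simp add: sum.cong)
  finally show ?thesis unfolding slice_sum_borel_def .
qed

text \<open>A crude bound with a constant depending on \<open>L\<close>, \<open>\<alpha>\<close> and
  \<open>\<tau>\<close>. It serves integrability only, so this dependence does not reach the final
  constants.\<close>

lemma slice_sum_abs_le:
  "\<bar>slice_sum i z l t\<bar> \<le> (enn2real (\<integral>\<^sup>+\<zeta>. ennreal (kernel \<alpha> \<tau> (\<zeta>::real^'n)) \<partial>lborel) * L + 1 + 2 * kernel_moment i \<alpha> \<tau>) * real (card (crossings i z l t))"
proof -
  let ?K = "enn2real (\<integral>\<^sup>+\<zeta>. ennreal (kernel \<alpha> \<tau> (\<zeta>::real^'n)) \<partial>lborel) * L"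
  have k: "0 \<le> kernel_moment i \<alpha> \<tau>" by (rule kernel_moment_nonneg[OF \<alpha>1 \<tau>0])
  have "\<bar>slice_sum i z l t\<bar> \<le> (\<Sum>s\<in>crossings i z l t. \<bar>v_term i \<alpha> \<tau> E t s + r_term i \<alpha> \<tau> E t s\<bar>)"
    unfolding slice_sum_eq by (rule sum_abs)
  also have "\<dots> \<le> (\<Sum>s\<in>crossings i z l t. ?K + 1 + 2 * kernel_moment i \<alpha> \<tau>)"
  proof (rule sum_mono)
    fix s assume "s \<in> crossings i z l t"
    then have s: "s \<in> ess_boundary (slice i E t)" by (simp add: crossings_def)
    show "\<bar>v_term i \<alpha> \<tau> E t s + r_term i \<alpha> \<tau> E t s\<bar> \<le> ?K + 1 + 2 * kernel_moment i \<alpha> \<tau>"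
      using v_term_split(4)[OF s] v_term_nonneg[OF good, of s] r_term_ge[OF good s] r_term_le[OF good s] k by linarith
  qed
  finally show ?thesis by (simp add: mult.commute)
qed

text \<open>Since \<open>v\<close> is nonnegative, only \<open>r\<close> matters. It is nonnegative
  at a crossing whose right gap is shorter than \<open>\<eta>\<^sub>1\<close>; the other crossings
  have spacing at least \<open>\<eta>\<^sub>1\<close>, so there are at most
  \<open>l / \<eta>\<^sub>1 + 1\<close> of them, each worth at least -1. If two crossings are closer
  than \<open>\<eta>\<^sub>0\<close>, the left one adds \<open>K\<close> to this bound. The
  hypotheses range up to twice the threshold because the gap and
  \<open>\<tau> powr (1 / (1 - \<alpha>))\<close> are added.\<close>

lemma slice_sum_lower:
  fixes c \<eta>\<^sub>1 \<eta>\<^sub>0 K :: real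
  defines "c \<equiv> 1 / (64 * real CARD('n) ^ (CARD('n) + 2))"
  assumes l: "0 < l" and eta1: "0 < \<eta>\<^sub>1" and h1: "\<And>h. 0 < h \<Longrightarrow> h \<le> 2 * \<eta>\<^sub>1 \<Longrightarrow> 1 \<le> c * h powr (- (1 - \<alpha>))"
    and eps1: "\<tau> powr (1 / (1 - \<alpha>)) \<le> \<eta>\<^sub>1"
  shows "- (l / \<eta>\<^sub>1 + 1) \<le> slice_sum i z l t"
    and "\<lbrakk>0 \<le> K; \<And>h. 0 < h \<Longrightarrow> h \<le> 2 * \<eta>\<^sub>0 \<Longrightarrow> K + 1 \<le> c * h powr (- (1 - \<alpha>)); \<tau> powr (1 / (1 - \<alpha>)) \<le> \<eta>\<^sub>0;
       s \<in> crossings i z l t; s' \<in> crossings i z l t; s < s'; s' - s < \<eta>\<^sub>0\<rbrakk> \<Longrightarrow> K - (l / \<eta>\<^sub>1 + 1) \<le> slice_sum i z l t"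
proof -
  let ?J = "crossings i z l t" and ?S = "slice i E t"
  let ?e = "\<tau> powr (1 / (1 - \<alpha>))"
  have e0: "?e > 0" using \<tau>0 by simp
  have fin: "finite ?J" by (rule finite_crossings)
  have J: "s \<in> ess_boundary ?S" if "s \<in> ?J" for s using that by (simp add: crossings_def)
  define gap where "gap s = real_of_ereal (next_boundary ?S s) - s" for s
  have gap: "\<exists>n. next_boundary ?S s = ereal n \<and> gap s = n - s \<and> s < n \<and> ess_boundary ?S \<inter> {s<..<n} = {}" if s: "s \<in> ?J" for s
  proof -
    obtain n where n: "next_boundary ?S s = ereal n" "n \<in> ess_boundary ?S" "s < n" "n \<le> s + L"
        "ess_boundary ?S \<inter> {s<..<n} = {}"
      by (rule slice_next_obtain[OF good J[OF s], of s])
    then show ?thesis by (intro exI[of _ n]) (simp add: gap_def)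
  qed
  have rlow: "- 1 + c * (gap s + ?e) powr (- (1 - \<alpha>)) \<le> r_term i \<alpha> \<tau> E t s" if s: "s \<in> ?J" for s
    using gap[OF s] r_term_lower[OF good J[OF s]] unfolding c_def by auto
  let ?G = "{s \<in> ?J. \<eta>\<^sub>1 \<le> gap s}"
  have cG: "real (card ?G) \<le> l / \<eta>\<^sub>1 + 1"
  proof (rule card_separated_le[where a="z $ i - l / 2"])
    show "?G \<subseteq> {z $ i - l / 2..z $ i - l / 2 + l}" by (auto simp: crossings_def field_simps)
    show "\<eta>\<^sub>1 \<le> y - x" if "x \<in> ?G" "y \<in> ?G" "x < y" for x y
    proof -
      have "x \<in> ?J" using that by simp
      from gap[OF this] obtain n where n: "gap x = n - x" "ess_boundary ?S \<inter> {x<..<n} = {}" by blast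
      have "\<not> y < n" using n(2) that J[of y] by auto
      with n that show ?thesis by auto
    qed
  qed (use eta1 l in auto)
  have r0: "0 \<le> r_term i \<alpha> \<tau> E t s" if "s \<in> ?J" "gap s < \<eta>\<^sub>1" for s
  proof -
    have "0 < gap s" using gap[OF that(1)] by auto
    then have "1 \<le> c * (gap s + ?e) powr (- (1 - \<alpha>))" by (intro h1) (use that e0 eps1 in linarith)+
    with rlow[OF that(1)] show ?thesis by simp
  qed
  have rm1: "- 1 \<le> r_term i \<alpha> \<tau> E t s" if "s \<in> ?J" for s by (rule r_term_ge[OF good J[OF that]])
  have sumr: "(\<Sum>s\<in>?J. r_term i \<alpha> \<tau> E t s) \<le> slice_sum i z l t"
    unfolding slice_sum_eq by (intro sum_mono) (simp add: v_term_nonneg[OF good])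
  have split: "(\<Sum>s\<in>?J. r_term i \<alpha> \<tau> E t s) = (\<Sum>s\<in>?G. r_term i \<alpha> \<tau> E t s) + (\<Sum>s\<in>?J - ?G. r_term i \<alpha> \<tau> E t s)"
    using sum.subset_diff[of ?G ?J] fin by (simp add: add.commute)
  have "(\<Sum>s\<in>?G. - 1) \<le> (\<Sum>s\<in>?G. r_term i \<alpha> \<tau> E t s)" using rm1 by (intro sum_mono) auto
  then have G: "- (l / \<eta>\<^sub>1 + 1) \<le> (\<Sum>s\<in>?G. r_term i \<alpha> \<tau> E t s)" using cG by simp
  have "0 \<le> (\<Sum>s\<in>?J - ?G. r_term i \<alpha> \<tau> E t s)" using r0 by (intro sum_nonneg) auto
  then show "- (l / \<eta>\<^sub>1 + 1) \<le> slice_sum i z l t" using split G sumr by linarith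
  assume K: "0 \<le> K" and hK: "\<And>h. 0 < h \<Longrightarrow> h \<le> 2 * \<eta>\<^sub>0 \<Longrightarrow> K + 1 \<le> c * h powr (- (1 - \<alpha>))" and eps0: "?e \<le> \<eta>\<^sub>0"
    and s: "s \<in> ?J" "s' \<in> ?J" "s < s'" "s' - s < \<eta>\<^sub>0"
  obtain n where n: "gap s = n - s" "s < n" "ess_boundary ?S \<inter> {s<..<n} = {}" using gap[OF s(1)] by blast
  have "\<not> s' < n" using n s J[of s'] by auto
  then have gs: "0 < gap s" "gap s < \<eta>\<^sub>0" using n s by auto
  then have "K + 1 \<le> c * (gap s + ?e) powr (- (1 - \<alpha>))" by (intro hK) (use e0 eps0 in linarith)+
  then have rs: "K \<le> r_term i \<alpha> \<tau> E t s" using rlow[OF s(1)] by simp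
  \<comment> \<open>The large term at \<open>s\<close> is either among the nonnegative ones dropped
    before, or replaces one that was estimated by -1.\<close>
  show "K - (l / \<eta>\<^sub>1 + 1) \<le> slice_sum i z l t"
  proof (cases "gap s < \<eta>\<^sub>1")
    case True
    then have "s \<in> ?J - ?G" using s by auto
    then have "r_term i \<alpha> \<tau> E t s \<le> (\<Sum>s\<in>?J - ?G. r_term i \<alpha> \<tau> E t s)"
      using fin r0 by (intro member_le_sum) auto
    then show ?thesis using split G sumr rs by linarith
  next
    case False
    then have sG: "s \<in> ?G" using s by auto
    have "(\<Sum>s\<in>?G. r_term i \<alpha> \<tau> E t s) = r_term i \<alpha> \<tau> E t s + (\<Sum>s\<in>?G - {s}. r_term i \<alpha> \<tau> E t s)"
      using sG fin by (intro sum.remove) auto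
    moreover have "(\<Sum>s\<in>?G - {s}. - 1) \<le> (\<Sum>s\<in>?G - {s}. r_term i \<alpha> \<tau> E t s)" using rm1 by (intro sum_mono) auto
    moreover have "real (card (?G - {s})) \<le> real (card ?G)" using fin by (intro of_nat_mono card_mono) auto
    ultimately have "K - (l / \<eta>\<^sub>1 + 1) \<le> (\<Sum>s\<in>?G. r_term i \<alpha> \<tau> E t s)" using rs cG by simp
    moreover have "0 \<le> (\<Sum>s\<in>?J - ?G. r_term i \<alpha> \<tau> E t s)" using r0 by (intro sum_nonneg) auto
    ultimately show ?thesis using split sumr by linarith
  qed
qed

end

end

lemma emeasure_perp_cube:
  fixes i :: "'n::finite"
  assumes l: "l > 0"
  shows "emeasure (perp_borel i) (perp_cube i z l) = ennreal (l ^ (CARD('n) - 1))"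
proof -
  interpret finite_product_sigma_finite "\<lambda>_::'n. lborel :: real measure" "UNIV - {i}"
    by standard auto
  have "perp_cube i z l = Pi\<^sub>E (UNIV - {i}) (\<lambda>j. {z $ j - l / 2..z $ j + l / 2})"
  proof -
    have "\<bar>x - z $ j\<bar> \<le> l / 2 \<longleftrightarrow> x \<in> {z $ j - l / 2..z $ j + l / 2}" for x j by (auto simp: abs_if)
    then have "t \<in> perp_cube i z l \<longleftrightarrow> t \<in> Pi\<^sub>E (UNIV - {i}) (\<lambda>j. {z $ j - l / 2..z $ j + l / 2})" for t
      unfolding perp_cube_def perp_lebesgue_def space_completion space_PiM PiE_iff by simp blast
    then show ?thesis by (rule set_eqI)
  qed
  then have "emeasure (perp_borel i) (perp_cube i z l) = (\<Prod>j\<in>UNIV - {i}. emeasure lborel {z $ j - l / 2..z $ j + l / 2})"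
    by (simp add: measure_times)
  also have "\<dots> = (\<Prod>j\<in>UNIV - {i}. ennreal l)" using l by (intro prod.cong) auto
  also have "\<dots> = ennreal (l ^ (CARD('n) - 1))" using l by (simp add: ennreal_power card_Diff_singleton)
  finally show ?thesis .
qed

context perimeter_energy
begin

text \<open>The integral of a function that is not integrable is 0, and lower bounds on slices would
  then say nothing about the energy. The number of crossings is dominated by the function from
  \<open>finite_perimeter_slices\<close>, which has a finite integral over the slices meeting a
  larger cube.\<close>

lemma
  assumes l: "l > 0"
  shows integrable_slice_sum: "integrable (perp_borel i) (\<lambda>t. indicator (perp_cube i z l) t * slice_sum_borel i z l t)"
    and integral_slice_sum: "(LINT t:perp_cube i z l|perp_lebesgue i.
         (\<Sum>s\<in>{s \<in> reduced_boundary (slice i E t). glue i t s \<in> cube z l}. v_term i \<alpha> \<tau> E t s + r_term i \<alpha> \<tau> E t s)) =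
       (LINT t|perp_borel i. indicator (perp_cube i z l) t * slice_sum_borel i z l t)"
proof -
  note [measurable] = borel_measurable_slice_sum_borel[of i z l] perp_cube_in_sets[OF l, of i z]
  have m: "(\<lambda>t. indicator (perp_cube i z l) t * slice_sum_borel i z l t) \<in> borel_measurable (perp_borel i)" by measurable
  show "(LINT t:perp_cube i z l|perp_lebesgue i.
         (\<Sum>s\<in>{s \<in> reduced_boundary (slice i E t). glue i t s \<in> cube z l}. v_term i \<alpha> \<tau> E t s + r_term i \<alpha> \<tau> E t s)) =
       (LINT t|perp_borel i. indicator (perp_cube i z l) t * slice_sum_borel i z l t)"
    unfolding set_lebesgue_integral_def perp_lebesgue_def slice_sum_def[symmetric]
  proof (rule integral_completion_AE[OF m])
    show "AE t in perp_borel i. indicat_real (perp_cube i z l) t *\<^sub>R slice_sum i z l t = indicat_real (perp_cube i z l) t * slice_sum_borel i z l t"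
      using AE_good[of i]
    proof eventually_elim
      case (elim t)
      show ?case
        using slice_sum_eq_borel[OF elim, of z l] by (cases "t \<in> perp_cube i z l") simp_all
    qed
  qed
  \<comment> \<open>Strictly larger than every coordinate occurring in the closed cube, so that the
    crossings lie in the open interval \<open>{-R<..<R}\<close>.\<close>
  define R where "R = (\<Sum>j\<in>UNIV. \<bar>z $ j\<bar>) + l + 1"
  have zR: "\<bar>z $ j\<bar> + l / 2 < R" for j
  proof -
    have "\<bar>z $ j\<bar> \<le> (\<Sum>j\<in>UNIV. \<bar>z $ j\<bar>)" by (rule member_le_sum) auto
    then show ?thesis using l by (simp add: R_def)
  qed
  have R: "R > 0" using zR[of i] l by linarith
  obtain g where g: "g \<in> borel_measurable (perp_borel i)"
    "(\<integral>\<^sup>+t\<in>{t. \<forall>j. j \<noteq> i \<longrightarrow> \<bar>t j\<bar> \<le> R}. g t \<partial>perp_borel i) < \<infinity>"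
    "AE t in perp_borel i. (\<forall>j. j \<noteq> i \<longrightarrow> \<bar>t j\<bar> \<le> R) \<longrightarrow>
       (\<forall>F. finite F \<longrightarrow> F \<subseteq> ess_boundary (slice i E t) \<inter> {-R<..<R} \<longrightarrow> of_nat (card F) \<le> g t)"
    using finite_perimeter_slices[OF lfp R, of i] by blast
  let ?T = "{t. \<forall>j. j \<noteq> i \<longrightarrow> \<bar>t j\<bar> \<le> R}"
  define C where "C = enn2real (\<integral>\<^sup>+\<zeta>. ennreal (kernel \<alpha> \<tau> (\<zeta>::real^'n)) \<partial>lborel) * L + 1 + 2 * kernel_moment i \<alpha> \<tau>"
  have C: "C \<ge> 0" unfolding C_def using L0 kernel_moment_nonneg[OF \<alpha>1 \<tau>0, of i] by (intro add_nonneg_nonneg mult_nonneg_nonneg) auto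
  have Tm: "(\<lambda>t. indicator ?T t :: ennreal) \<in> borel_measurable (perp_borel i)"
  proof -
    have "?T \<inter> space (perp_borel i) = perp_cube i 0 (2 * R)"
      by (auto simp: perp_cube_def perp_lebesgue_def)
    then have "?T \<inter> space (perp_borel i) \<in> sets (perp_borel i)" using R by simp
    then show ?thesis by (simp add: borel_measurable_indicator_iff)
  qed
  have "(\<integral>\<^sup>+t. ennreal (norm (indicator (perp_cube i z l) t * slice_sum_borel i z l t)) \<partial>perp_borel i) \<le>
     (\<integral>\<^sup>+t. ennreal C * (g t * indicator ?T t) \<partial>perp_borel i)"
  proof (rule nn_integral_mono_AE)
    show "AE t in perp_borel i. ennreal (norm (indicator (perp_cube i z l) t * slice_sum_borel i z l t)) \<le> ennreal C * (g t * indicator ?T t)"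
      using AE_good[of i] g(3)
    proof eventually_elim
      case (elim t)
      show ?case
      proof (cases "t \<in> perp_cube i z l")
        case True
        have tT: "\<bar>t j\<bar> \<le> R" if "j \<noteq> i" for j
        proof -
          have "\<bar>t j - z $ j\<bar> \<le> l / 2" using True that by (simp add: perp_cube_def)
          then show ?thesis using zR[of j] by linarith
        qed
        have "crossings i z l t \<subseteq> ess_boundary (slice i E t) \<inter> {-R<..<R}"
          using zR[of i] by (auto simp: crossings_def)
        then have cg: "of_nat (card (crossings i z l t)) \<le> g t"
          using elim(2) tT finite_crossings[OF elim(1) True] by blast
        have "\<bar>slice_sum_borel i z l t\<bar> \<le> C * real (card (crossings i z l t))"
          using slice_sum_abs_le[OF elim(1) True] unfolding slice_sum_eq_borel[OF elim(1) True] C_def .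
        then have "ennreal \<bar>slice_sum_borel i z l t\<bar> \<le> ennreal C * ennreal (real (card (crossings i z l t)))"
          using C by (simp add: ennreal_mult[symmetric] ennreal_leI)
        also have "\<dots> \<le> ennreal C * g t"
          using cg by (intro mult_left_mono) (simp_all add: ennreal_of_nat_eq_real_of_nat)
        finally show ?thesis using True tT by simp
      qed simp
    qed
  qed
  also have "\<dots> = ennreal C * (\<integral>\<^sup>+t. g t * indicator ?T t \<partial>perp_borel i)"
    by (rule nn_integral_cmult) (use g(1) Tm in measurable)
  also have "\<dots> < \<infinity>" using g(2) by (simp add: ennreal_mult_less_top)
  finally show "integrable (perp_borel i) (\<lambda>t. indicator (perp_cube i z l) t * slice_sum_borel i z l t)"
    using m by (intro integrableI_bounded) auto
qed

lemma cross_total_finite: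
  assumes l: "l > 0"
  shows "(\<integral>\<^sup>+x\<in>cube z l. cross_energy i \<alpha> \<tau> B x \<partial>lborel) < \<infinity>"
proof -
  have "(\<integral>\<^sup>+x\<in>cube z l. cross_energy i \<alpha> \<tau> B x \<partial>lborel) \<le> (\<integral>\<^sup>+x. (\<integral>\<^sup>+\<zeta>. ennreal (kernel \<alpha> \<tau> (\<zeta>::real^'n)) \<partial>lborel) * indicator (cube z l) x \<partial>lborel)"
    by (intro nn_integral_mono mult_right_mono cross_energy_le) simp
  also have "\<dots> = (\<integral>\<^sup>+\<zeta>. ennreal (kernel \<alpha> \<tau> (\<zeta>::real^'n)) \<partial>lborel) * emeasure lborel (cube z l)"
    by (rule nn_integral_cmult_indicator) simp
  also have "\<dots> < \<infinity>" using kernel_mass_finite l by (simp add: emeasure_cube ennreal_mult_less_top)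
  finally show ?thesis .
qed

lemma integral_w_term:
  "(LINT x:cube z l|lebesgue. w_term i \<alpha> \<tau> E x) = 1 / real CARD('n) * enn2real (\<integral>\<^sup>+x\<in>cube z l. cross_energy i \<alpha> \<tau> B x \<partial>lborel)"
proof -
  have fin: "cross_energy i \<alpha> \<tau> B x < \<infinity>" for x
    by (rule le_less_trans[OF cross_energy_le kernel_mass_finite])
  have "(LINT x:cube z l|lebesgue. w_term i \<alpha> \<tau> E x) = 1 / real CARD('n) * (LINT x:cube z l|lebesgue. (LINT \<zeta>|lebesgue. f_cross i E x \<zeta> * kernel \<alpha> \<tau> \<zeta>))"
    unfolding w_term_def by (rule set_integral_mult_right)
  also have "(LINT x:cube z l|lebesgue. (LINT \<zeta>|lebesgue. f_cross i E x \<zeta> * kernel \<alpha> \<tau> \<zeta>)) = enn2real (\<integral>\<^sup>+x\<in>cube z l. cross_energy i \<alpha> \<tau> B x \<partial>lborel)"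
    by (rule set_integral_eq_enn2real[OF integral_cross_energy_AE[OF B EB] _ fin]) simp_all
  finally show ?thesis .
qed

end

section \<open>Comparison with stripes\<close>

text \<open>Beyond the ends of the interval the slice is continued by its traces, so that no
  boundary point arises there. Separation is known for crossings in the cube only, whereas stripes
  must be separated everywhere.\<close>

definition trimmed :: "real set \<Rightarrow> real \<Rightarrow> real \<Rightarrow> real set" where
  "trimmed S a b = (S \<inter> {a<..<b}) \<union> (if right_full S a then {..a} else {}) \<union> (if left_full S b then {b..} else {})"

lemma trimmed_iff: "a < b \<Longrightarrow> y \<in> trimmed S a b \<longleftrightarrow> (if y \<le> a then right_full S a else if b \<le> y then left_full S b else y \<in> S)"
  by (auto simp: trimmed_def)

lemma not_ess_boundaryI:
  assumes "p < x" "x < q" "AE y in lborel. p < y \<and> y < q \<longrightarrow> (y \<in> S \<longleftrightarrow> c)"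
  shows "x \<notin> ess_boundary S"
  using assms by (cases c) (auto simp: ess_boundary_def)

lemma not_ess_boundaryE:
  assumes "x \<notin> ess_boundary S"
  obtains p q c where "p < x" "x < q" "AE y in lborel. p < y \<and> y < q \<longrightarrow> (y \<in> S \<longleftrightarrow> c)"
proof -
  obtain p q where pq: "p < x" "x < q"
    and or: "(AE y in lborel. p < y \<and> y < q \<longrightarrow> y \<in> S) \<or> (AE y in lborel. p < y \<and> y < q \<longrightarrow> y \<notin> S)"
    using assms by (auto simp: ess_boundary_def)
  from or show thesis
  proof
    assume "AE y in lborel. p < y \<and> y < q \<longrightarrow> y \<in> S"
    then show thesis using pq by (intro that[of p q True]) simp_all
  next
    assume "AE y in lborel. p < y \<and> y < q \<longrightarrow> y \<notin> S"
    then show thesis using pq by (intro that[of p q False]) simp_all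
  qed
qed

lemma ess_boundary_trimmed:
  assumes lf: "locally_finite_boundary S" and ab: "a < b"
  shows "ess_boundary (trimmed S a b) \<subseteq> ess_boundary S \<inter> {a<..<b}"
proof
  fix x assume x: "x \<in> ess_boundary (trimmed S a b)"
  obtain e where e: "e > 0" "AE y in lborel. a < y \<and> y < a + e \<longrightarrow> (y \<in> S \<longleftrightarrow> right_full S a)"
    using trace_nhds[OF lf, of a] by metis
  obtain e' where e': "e' > 0" "AE y in lborel. b - e' < y \<and> y < b \<longrightarrow> (y \<in> S \<longleftrightarrow> left_full S b)"
    using trace_nhds[OF lf, of b] by metis
  have "a < x"
  proof (rule ccontr)
    assume "\<not> a < x"
    have "x \<notin> ess_boundary (trimmed S a b)"
    proof (rule not_ess_boundaryI)
      show "AE y in lborel. x - 1 < y \<and> y < min (a + e) b \<longrightarrow> (y \<in> trimmed S a b \<longleftrightarrow> right_full S a)"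
        using e(2) by eventually_elim (use ab in \<open>auto simp: trimmed_iff\<close>)
    qed (use \<open>\<not> a < x\<close> e(1) ab in auto)
    with x show False by simp
  qed
  moreover have "x < b"
  proof (rule ccontr)
    assume "\<not> x < b"
    have "x \<notin> ess_boundary (trimmed S a b)"
    proof (rule not_ess_boundaryI)
      show "AE y in lborel. max (b - e') a < y \<and> y < x + 1 \<longrightarrow> (y \<in> trimmed S a b \<longleftrightarrow> left_full S b)"
        using e'(2) by eventually_elim (use ab in \<open>auto simp: trimmed_iff\<close>)
    qed (use \<open>\<not> x < b\<close> e'(1) ab in auto)
    with x show False by simp
  qed
  moreover have "x \<in> ess_boundary S"
  proof (rule ccontr)
    assume "x \<notin> ess_boundary S"
    then obtain p q c where pq: "p < x" "x < q" "AE y in lborel. p < y \<and> y < q \<longrightarrow> (y \<in> S \<longleftrightarrow> c)"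
      by (rule not_ess_boundaryE)
    have "x \<notin> ess_boundary (trimmed S a b)"
    proof (rule not_ess_boundaryI)
      show "AE y in lborel. max p a < y \<and> y < min q b \<longrightarrow> (y \<in> trimmed S a b \<longleftrightarrow> c)"
        using pq(3) by eventually_elim (use ab in \<open>auto simp: trimmed_iff\<close>)
    qed (use pq \<open>a < x\<close> \<open>x < b\<close> in auto)
    with x show False by simp
  qed
  ultimately show "x \<in> ess_boundary S \<inter> {a<..<b}" by simp
qed

text \<open>The \<open>i\<close>-th coordinates of a connected set form an interval contained in
  \<open>J\<close>, and a set with spacing \<open>\<eta>\<close> contains no interval of positive
  length. So the components are single hyperplanes, at the distance of their coordinates.\<close>

lemma components_of_hyperplanes:
  fixes J :: "real set" and i :: "'n::finite"
  assumes \<eta>: "\<eta> > 0" and sep: "\<And>s s'. s \<in> J \<Longrightarrow> s' \<in> J \<Longrightarrow> s < s' \<Longrightarrow> \<eta> \<le> s' - s"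
    and C: "C \<in> components {x::real^'n. x $ i \<in> J}" and C': "C' \<in> components {x::real^'n. x $ i \<in> J}" and ne: "C \<noteq> C'"
  shows "\<eta> \<le> setdist C C'"
proof -
  let ?U = "{x::real^'n. x $ i \<in> J}"
  have hyper: "\<exists>s. s \<in> J \<and> C = {x. x $ i = s}" if C: "C \<in> components ?U" for C
  proof -
    have ne: "C \<noteq> {}" and sub: "C \<subseteq> ?U" and con: "connected C"
      using C by (auto simp: in_components_nonempty in_components_connected dest: in_components_subset)
    have coni: "connected ((\<lambda>x. x $ i) ` C)"
      using con by (intro connected_continuous_image continuous_on_component continuous_on_id)
    have const: "\<not> x $ i < y $ i" if "x \<in> C" "y \<in> C" for x y
    proof
      assume lt: "x $ i < y $ i"
      \<comment> \<open>A value strictly above \<open>x $ i\<close>, at most \<open>y $ i\<close>,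
        and too close to \<open>x $ i\<close> to belong to \<open>J\<close> as well.\<close>
      define w where "w = x $ i + min (\<eta> / 2) (y $ i - x $ i)"
      have "w \<in> (\<lambda>x. x $ i) ` C"
        by (rule connectedD_interval[OF coni, of "x $ i" "y $ i"]) (use that lt \<eta> in \<open>auto simp: w_def\<close>)
      then have "w \<in> J" using sub by auto
      moreover have "x $ i \<in> J" using sub that by auto
      ultimately have "\<eta> \<le> w - x $ i" using lt \<eta> by (intro sep) (auto simp: w_def)
      then show False using \<eta> by (auto simp: w_def)
    qed
    obtain x0 where x0: "x0 \<in> C" using ne by blast
    define s where "s = x0 $ i"
    have s: "s \<in> J" using x0 sub by (auto simp: s_def)
    have "C \<subseteq> {x. x $ i = s}" using const x0 by (auto simp: s_def not_less intro: antisym)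
    moreover have "{x. x $ i = s} \<subseteq> C"
    proof (rule components_maximal[OF C])
      show "connected {x::real^'n. x $ i = s}"
      proof (rule convex_connected, rule convexI)
        fix x y :: "real^'n" and u v :: real
        assume "x \<in> {x. x $ i = s}" "y \<in> {x. x $ i = s}" "u + v = 1"
        then show "u *\<^sub>R x + v *\<^sub>R y \<in> {x. x $ i = s}" by (simp add: distrib_right[symmetric])
      qed
    qed (use s x0 in \<open>auto simp: s_def\<close>)
    ultimately show ?thesis using s by blast
  qed
  obtain s s' where s: "s \<in> J" "C = {x. x $ i = s}" "s' \<in> J" "C' = {x. x $ i = s'}"
    using hyper[OF C] hyper[OF C'] by blast
  have "s \<noteq> s'" using ne s by auto
  then have ss: "\<eta> \<le> \<bar>s - s'\<bar>" using sep[of s s'] sep[of s' s] s by (cases "s < s'") auto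
  show ?thesis
  proof (rule le_setdistI)
    show "C \<noteq> {}" "C' \<noteq> {}" using in_components_nonempty[OF C] in_components_nonempty[OF C'] by auto
    fix x y assume xy: "x \<in> C" "y \<in> C'"
    have "\<bar>x $ i - y $ i\<bar> \<le> norm (x - y)" using component_le_norm_cart[of "x - y" i] by simp
    then show "\<eta> \<le> dist x y" using xy s ss by (simp add: dist_norm)
  qed
qed

lemma AE_coordinate:
  assumes "AE s in lborel. P s"
  shows "AE x in (lborel :: (real^'n::finite) measure). P (x $ i)"
proof -
  obtain N where N: "N \<in> null_sets lborel" "\<And>x. x \<notin> N \<Longrightarrow> P x" using AE_E3[OF assms] by auto
  have Nm[measurable]: "N \<in> sets borel" using N(1) by (simp add: null_sets_def)
  have "(\<integral>\<^sup>+x. indicator N (x $ i) \<partial>(lborel :: (real^'n) measure)) = (\<integral>\<^sup>+t. \<integral>\<^sup>+s. indicator N (glue i t s $ i) \<partial>lborel \<partial>perp_borel i)"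
    by (rule nn_integral_glue) measurable
  also have "\<dots> = (\<integral>\<^sup>+t. emeasure lborel N \<partial>perp_borel i)"
    by (simp add: glue_def)
  also have "\<dots> = 0" using N(1) by (simp add: null_sets_def)
  finally have "AE x in (lborel :: (real^'n) measure). indicator N (x $ i) = (0::ennreal)"
    by (subst (asm) nn_integral_0_iff_AE) measurable
  then show ?thesis by eventually_elim (auto simp: indicator_def intro!: N(2) split: if_splits)
qed

context perimeter_energy
begin

text \<open>The competitor has the trimmed slice as its profile. Inside the cube it coincides with
  the slice, the faces orthogonal to \<open>e_i\<close> being null, so its distance from
  \<open>E\<close> is the slice distance; its boundary points are crossings and hence
  separated.\<close>

lemma stripe_dist_le_slice_dist:
  assumes l: "0 < l" and \<eta>: "0 < \<eta>" and good: "good i t" and t: "t \<in> perp_cube i z l"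
    and sep: "\<And>s s'. s \<in> crossings i z l t \<Longrightarrow> s' \<in> crossings i z l t \<Longrightarrow> s < s' \<Longrightarrow> \<eta> \<le> s' - s"
  shows "stripe_dist \<eta> E (cube z l) \<le> enn2real (slice_dist i B z l t) / l ^ CARD('n)"
proof -
  let ?S = "slice i E t"
  define a b where "a = z $ i - l / 2" and "b = z $ i + l / 2"
  have ab: "a < b" using l by (simp add: a_def b_def)
  define G where "G = trimmed ?S a b"
  have sub: "ess_boundary G \<subseteq> ess_boundary ?S \<inter> {a<..<b}"
    unfolding G_def by (rule ess_boundary_trimmed[OF slice_lf[OF good] ab])
  have lfG: "locally_finite_boundary G"
    unfolding locally_finite_boundary_def
  proof (intro allI)
    fix c d
    show "finite (ess_boundary G \<inter> {c<..<d})"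
      by (rule finite_subset[of _ "ess_boundary ?S \<inter> {c<..<d}"])
        (use sub slice_lf[OF good] in \<open>auto simp: locally_finite_boundary_def\<close>)
  qed
  have GL: "G \<in> sets lebesgue"
  proof -
    have "{..a} \<in> sets lebesgue" "{b..} \<in> sets lebesgue" "{a<..<b} \<in> sets lebesgue" by auto
    then show ?thesis
      unfolding G_def trimmed_def using slice_lebesgue[OF good] by (intro sets.Un sets.Int) simp_all
  qed
  have redG: "reduced_boundary G = ess_boundary G" by (rule reduced_boundary_eq_ess_boundary[OF GL lfG])
  have lfpG: "locally_finite_perimeter G"
    using gauss_green_boundary_measure[OF GL lfG] by (auto simp: locally_finite_perimeter_def)
  define F where "F = {x::real^'n. x $ i \<in> G}"
  have F: "F \<in> stripes i \<eta>"
    unfolding stripes_def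
  proof (intro CollectI exI[of _ G] conjI ballI impI)
    show "AE x in lebesgue. (x \<in> F) = (x $ i \<in> G)" by (simp add: F_def)
    fix C C' assume C: "C \<in> components {x::real^'n. x $ i \<in> reduced_boundary G}" "C' \<in> components {x::real^'n. x $ i \<in> reduced_boundary G}" "C \<noteq> C'"
    show "\<eta> \<le> setdist C C'"
    proof (rule components_of_hyperplanes[OF \<eta> _ C])
      fix s s' assume s: "s \<in> reduced_boundary G" "s' \<in> reduced_boundary G" "s < s'"
      have "s \<in> crossings i z l t" "s' \<in> crossings i z l t"
        using s sub unfolding redG crossings_def a_def b_def by auto
      then show "\<eta> \<le> s' - s" using s(3) by (rule sep)
    qed
  qed (rule lfpG)
  define h where "h x = ennreal \<bar>indicat_real B x - indicat_real B (glue i t (x $ i))\<bar>" for x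
  have gm: "(\<lambda>x::real^'n. glue i t (x $ i)) \<in> borel_measurable borel"
    using measurable_compose[OF borel_measurable_vec_nth measurable_glue_snd] .
  have hm[measurable]: "h \<in> borel_measurable borel"
    unfolding h_def using gm by measurable
  have e1: "AE s in lborel. s \<noteq> a \<and> s \<noteq> b \<and> (s \<in> ?S \<longleftrightarrow> s \<in> slice i B t)"
    using AE_lborel_singleton[of a] AE_lborel_singleton[of b] slice_AE[OF good] by eventually_elim auto
  have ae: "AE x in lborel. indicat_real (cube z l) x * \<bar>indicat_real E x - indicat_real F x\<bar> = enn2real (h x * indicator (cube z l) x)"
    using EB AE_coordinate[OF e1, of i]
  proof eventually_elim
    case (elim x)
    show ?case
    proof (cases "x \<in> cube z l")
      case True
      then have "\<bar>x $ i - z $ i\<bar> \<le> l / 2" by (simp add: cube_def)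
      then have "a \<le> x $ i" "x $ i \<le> b" unfolding a_def b_def by linarith+
      with elim have "a < x $ i" "x $ i < b" by auto
      then have "x \<in> F \<longleftrightarrow> x $ i \<in> ?S" by (simp add: F_def G_def trimmed_iff[OF ab])
      then have "x \<in> F \<longleftrightarrow> glue i t (x $ i) \<in> B" using elim by (simp add: slice_def)
      with elim(1) True show ?thesis by (simp add: h_def indicator_def)
    qed simp
  qed
  have hfin: "h x * indicator (cube z l) x < \<infinity>" for x by (simp add: h_def ennreal_mult_less_top indicator_def)
  have "(LINT x:cube z l|lebesgue. \<bar>indicat_real E x - indicat_real F x\<bar>) =
      (LINT x:cube z l|lebesgue. indicat_real (cube z l) x * \<bar>indicat_real E x - indicat_real F x\<bar>)"
    unfolding set_lebesgue_integral_def by (rule Bochner_Integration.integral_cong) (auto simp: indicator_def)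
  also have "\<dots> = enn2real (\<integral>\<^sup>+x. (h x * indicator (cube z l) x) * indicator (cube z l) x \<partial>lborel)"
    by (rule set_integral_eq_enn2real[OF ae _ hfin]) measurable
  also have "(\<integral>\<^sup>+x. (h x * indicator (cube z l) x) * indicator (cube z l) x \<partial>lborel) = slice_dist i B z l t"
    unfolding slice_dist_def h_def by (intro nn_integral_cong) (simp add: indicator_def)
  finally have int: "(LINT x:cube z l|lebesgue. \<bar>indicat_real E x - indicat_real F x\<bar>) = enn2real (slice_dist i B z l t)" .
  have mQ: "measure lebesgue (cube z l) = l ^ CARD('n)"
    using emeasure_cube[OF l, of z] l by (simp add: measure_def)
  let ?f = "\<lambda>F. 1 / measure lebesgue (cube z l) * (LINT x:cube z l|lebesgue. \<bar>indicat_real E x - indicat_real F x\<bar>)"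
  have "stripe_dist \<eta> E (cube z l) \<le> stripe_dist_dir i \<eta> E (cube z l)"
    unfolding stripe_dist_def by (rule cINF_lower) auto
  also have "\<dots> \<le> ?f F"
    unfolding stripe_dist_dir_def
  proof (rule cINF_lower[OF _ F])
    show "bdd_below (?f ` stripes i \<eta>)"
      by (rule bdd_belowI[of _ 0]) (auto simp: set_lebesgue_integral_def intro!: mult_nonneg_nonneg divide_nonneg_nonneg integral_nonneg_AE)
  qed
  also have "\<dots> = enn2real (slice_dist i B z l t) / l ^ CARD('n)"
    unfolding int mQ by simp
  finally show ?thesis .
qed

end

text \<open>For \<open>\<alpha> \<le> 1 / 2\<close> and \<open>h \<le> 1\<close> the power is at
  least \<open>h powr (- (1 / 2))\<close>. The resulting threshold for \<open>h\<close> does not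
  depend on \<open>\<alpha>\<close>.\<close>

lemma powr_small_ge:
  fixes c X h \<alpha> :: real
  assumes c: "0 < c" and X: "0 < X" and h: "0 < h" "h \<le> min 1 ((c / X)\<^sup>2)" and a: "0 \<le> \<alpha>" "\<alpha> \<le> 1 / 2"
  shows "X \<le> c * h powr (- (1 - \<alpha>))"
proof -
  have "h powr (1 / 2) \<le> ((c / X)\<^sup>2) powr (1 / 2)" using h by (intro powr_mono2) auto
  also have "\<dots> = c / X" using c X by (simp add: powr_half_sqrt)
  finally have "X * h powr (1 / 2) \<le> c" using X by (simp add: field_simps)
  then have "X \<le> c * h powr (- (1 / 2))" using h by (simp add: powr_minus field_simps)
  also have "h powr (- (1 / 2)) \<le> h powr (- (1 - \<alpha>))" using h a by (intro powr_mono') auto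
  finally show ?thesis using c by simp
qed

section \<open>Selection of a slice, and the conclusion\<close>

context perimeter_energy
begin

text \<open>Markov's inequality twice: slices of large energy and slices far from \<open>E\<close>
  each make up at most a quarter, the constant \<open>C\<close> being added to make the energy
  nonnegative. If all slices were bad, the indicator of the cube would be bounded pointwise by the
  two quotients; integrating this bound avoids the question whether the bad sets are
  measurable.\<close>

lemma ex_good_slice:
  assumes l: "l > 0" and K: "K > 0" and \<theta>: "\<theta> > 0"
    and lower: "\<And>t. good i t \<Longrightarrow> t \<in> perp_cube i z l \<Longrightarrow> - C \<le> slice_sum i z l t"
    and T: "(LINT t|perp_borel i. indicator (perp_cube i z l) t * slice_sum_borel i z l t) + C * l ^ (CARD('n) - 1) \<le> K * l ^ (CARD('n) - 1) / 4"
    and D: "(\<integral>\<^sup>+t\<in>perp_cube i z l. slice_dist i B z l t \<partial>perp_borel i) \<le> ennreal (\<theta> * l ^ (CARD('n) - 1) / 4)"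
  obtains t where "good i t" "t \<in> perp_cube i z l" "slice_sum i z l t + C < K" "slice_dist i B z l t \<le> ennreal \<theta>"
proof (rule ccontr)
  assume contra: "\<not> thesis"
  let ?Q = "perp_cube i z l" and ?V = "l ^ (CARD('n) - 1)"
  note [measurable] = perp_cube_in_sets[OF l, of i z] borel_measurable_slice_sum_borel[of i z l]
  have V: "?V > 0" using l by simp
  define q where "q t = indicat_real ?Q t * slice_sum_borel i z l t" for t
  have int: "integrable (perp_borel i) q" unfolding q_def by (rule integrable_slice_sum[OF l])
  have intQ: "integrable (perp_borel i) (indicat_real ?Q)"
    by (simp add: integrable_indicator_iff emeasure_perp_cube[OF l])
  have mQ: "(LINT t|perp_borel i. indicat_real ?Q t) = ?V"
    using sets.sets_into_space[OF perp_cube_in_sets[OF l, of i z]] V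
    by (simp add: measure_def emeasure_perp_cube[OF l] Int_absorb2)
  have nonneg: "AE t in perp_borel i. 0 \<le> q t + C * indicat_real ?Q t"
    using AE_good[of i]
  proof eventually_elim
    case (elim t)
    then show ?case using lower[of t] slice_sum_eq_borel[of i t z l] by (auto simp: q_def indicator_def)
  qed
  have "(\<integral>\<^sup>+t. ennreal (q t + C * indicat_real ?Q t) \<partial>perp_borel i) = ennreal (LINT t|perp_borel i. q t + C * indicat_real ?Q t)"
    using int intQ nonneg by (intro nn_integral_eq_integral) auto
  also have "(LINT t|perp_borel i. q t + C * indicat_real ?Q t) = (LINT t|perp_borel i. q t) + C * ?V"
    using int intQ by (simp add: mQ[simplified])
  also have "\<dots> \<le> K * ?V / 4" using T unfolding q_def .
  finally have 1: "(\<integral>\<^sup>+t. ennreal (q t + C * indicat_real ?Q t) \<partial>perp_borel i) \<le> ennreal (K * ?V / 4)"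
    by (simp add: ennreal_leI)
  have pt: "AE t in perp_borel i. indicator ?Q t \<le> ennreal (1 / K) * ennreal (q t + C * indicat_real ?Q t) + ennreal (1 / \<theta>) * (slice_dist i B z l t * indicator ?Q t)"
    using AE_good[of i]
  proof eventually_elim
    case (elim t)
    show ?case
    proof (cases "t \<in> ?Q")
      case True
      have "K \<le> slice_sum i z l t + C \<or> ennreal \<theta> < slice_dist i B z l t"
        using contra that elim True by (meson not_le)
      then show ?thesis
      proof
        assume "K \<le> slice_sum i z l t + C"
        then have "1 \<le> 1 / K * (q t + C * indicat_real ?Q t)"
          using True K slice_sum_eq_borel[OF elim True] by (simp add: q_def field_simps)
        then have "1 \<le> ennreal (1 / K * (q t + C * indicat_real ?Q t))"
          by (simp add: ennreal_leI[of 1, simplified])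
        also have "\<dots> = ennreal (1 / K) * ennreal (q t + C * indicat_real ?Q t)"
          using K by (intro ennreal_mult') simp
        finally show ?thesis using True by (auto intro: order_trans)
      next
        assume *: "ennreal \<theta> < slice_dist i B z l t"
        have "1 = ennreal (1 / \<theta>) * ennreal \<theta>" using \<theta> by (simp add: ennreal_mult[symmetric])
        also have "\<dots> \<le> ennreal (1 / \<theta>) * slice_dist i B z l t" using * by (intro mult_left_mono) auto
        finally show ?thesis using True by (auto intro: order_trans)
      qed
    qed simp
  qed
  have [measurable]: "q \<in> borel_measurable (perp_borel i)" unfolding q_def by measurable
  have "ennreal ?V = (\<integral>\<^sup>+t. indicator ?Q t \<partial>perp_borel i)" by (simp add: emeasure_perp_cube[OF l])
  also have "\<dots> \<le> (\<integral>\<^sup>+t. ennreal (1 / K) * ennreal (q t + C * indicat_real ?Q t) + ennreal (1 / \<theta>) * (slice_dist i B z l t * indicator ?Q t) \<partial>perp_borel i)"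
    by (rule nn_integral_mono_AE[OF pt])
  also have "\<dots> = ennreal (1 / K) * (\<integral>\<^sup>+t. ennreal (q t + C * indicat_real ?Q t) \<partial>perp_borel i) + ennreal (1 / \<theta>) * (\<integral>\<^sup>+t\<in>?Q. slice_dist i B z l t \<partial>perp_borel i)"
    by (simp add: nn_integral_add nn_integral_cmult)
  also have "\<dots> \<le> ennreal (1 / K) * ennreal (K * ?V / 4) + ennreal (1 / \<theta>) * ennreal (\<theta> * ?V / 4)"
    by (intro add_mono mult_left_mono 1 D) auto
  also have "\<dots> = ennreal (?V / 4 + ?V / 4)"
    using K \<theta> V by (simp add: ennreal_mult[symmetric] ennreal_plus[symmetric] del: ennreal_plus)
  finally have "?V \<le> ?V / 4 + ?V / 4" using V by (simp add: ennreal_le_iff del: ennreal_plus)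
  with V show False by simp
qed

end

theorem proposition5p3:
  fixes M l :: real
  assumes "M > 1" and "l > 0"
  shows "\<exists>\<eta>\<^sub>0>0. \<forall>\<delta>>0. \<exists>\<alpha>\<^sub>1 \<tau>\<^sub>1. 0 < \<alpha>\<^sub>1 \<and> \<alpha>\<^sub>1 < 1 \<and> 0 < \<tau>\<^sub>1 \<and>
    (\<forall>\<alpha> \<tau> L. \<forall>E :: (real ^ 'n::finite) set. \<forall>z.
       0 \<le> \<alpha> \<and> \<alpha> < \<alpha>\<^sub>1 \<and> 0 < \<tau> \<and> \<tau> < \<tau>\<^sub>1 \<and> l < L \<and>
       cube_periodic L E \<and> locally_finite_perimeter E \<and>
       (\<forall>j. 0 \<le> z $ j \<and> z $ j < L) \<and>
       Fbar \<alpha> \<tau> E z l < M \<longrightarrow>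
       (\<forall>\<eta>. 0 < \<eta> \<and> \<eta> < \<eta>\<^sub>0 \<longrightarrow> stripe_dist \<eta> E (cube z l) \<le> \<delta>))"
proof -
  note l = assms(2)
  define d where "d = CARD('n)"
  have d1: "real d \<ge> 1" by (simp add: d_def Suc_leI)
  define c where "c = 1 / (64 * real CARD('n) ^ (CARD('n) + 2))"
  have c0: "0 < c" by (simp add: c_def)
  \<comment> \<open>Half the threshold of \<open>powr_small_ge\<close> for \<open>X = 1\<close>,
    since the estimate is used up to \<open>2 * \<eta>\<^sub>1\<close>. \<open>C\<close> is then the
    lower bound of \<open>slice_sum_lower\<close>, with opposite sign.\<close>
  define \<eta>\<^sub>1 where "\<eta>\<^sub>1 = min 1 ((c / 1)\<^sup>2) / 2"
  have \<eta>1: "0 < \<eta>\<^sub>1" using c0 by (simp add: \<eta>\<^sub>1_def)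
  define C where "C = l / \<eta>\<^sub>1 + 1"
  have C0: "0 < C" using l \<eta>1 by (simp add: C_def add_pos_pos)
  define V where "V = l ^ (d - 1)"
  have V0: "0 < V" using l by (simp add: V_def)
  have lV: "l ^ d = l * V" using d1 by (cases d) (simp_all add: V_def)
  \<comment> \<open>Bounds the share of a single direction: the total is at most
    \<open>M * l ^ d\<close>, and each of the other directions, whose number is rounded up to
    \<open>d\<close>, may be as low as \<open>- (C * V)\<close>.\<close>
  define Z where "Z = M * l ^ d + real d * C * V"
  have Z0: "0 < Z" using assms C0 V0 d1 by (simp add: Z_def add_pos_nonneg)
  \<comment> \<open>Chosen so that \<open>Z + C * V = K * V / 4\<close>, the quarter required by
    \<open>ex_good_slice\<close>. It depends on \<open>M\<close>, \<open>l\<close> and the dimension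
    only.\<close>
  define K where "K = 4 * (Z + C * V) / V"
  have K0: "0 < K" using Z0 C0 V0 by (simp add: K_def add_pos_pos)
  \<comment> \<open>Half the threshold for \<open>X = K + 1\<close>, where the 1 compensates the -1
    in \<open>r_term\<close>. Since \<open>K\<close> does not involve \<open>\<delta>\<close>,
    neither does this bound for the spacing.\<close>
  define \<eta>\<^sub>0 where "\<eta>\<^sub>0 = min 1 ((c / (K + 1))\<^sup>2) / 2"
  have \<eta>0: "0 < \<eta>\<^sub>0" using c0 K0 by (simp add: \<eta>\<^sub>0_def)
  define A where "A = max 1 (real (CARD('n) + 1) * l)"
  have A1: "A \<ge> 1" by (simp add: A_def)
  show ?thesis
  proof (rule exI[of _ \<eta>\<^sub>0], intro conjI allI impI \<eta>0)
    fix \<delta> :: real assume \<delta>: "0 < \<delta>"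
    \<comment> \<open>Solves \<open>d * s * l ^ d = l * (\<delta> * l ^ d * V / 4)\<close>: the left
      side is the bound for the oscillation, the right side the quarter allowed for slice distances
      with \<open>\<theta> = \<delta> * l ^ d\<close>. Next, \<open>\<sigma>\<close> is chosen so
      that \<open>sqrt (3 * \<sigma>) = s\<close>.\<close>
    define s where "s = \<delta> * l ^ d / (4 * real d)"
    have s0: "0 < s" using \<delta> l d1 by (simp add: s_def)
    define \<sigma> where "\<sigma> = s\<^sup>2 / 3"
    have \<sigma>0: "0 < \<sigma>" using s0 by (simp add: \<sigma>_def)
    \<comment> \<open>The bound for \<open>N * mixed_total\<close>: the constant of
      \<open>mixed_total_log_bound\<close> times the bound for the cross terms. The number
      \<open>N\<close> of scales is then taken so large that
      \<open>Y / N \<le> \<sigma>\<close>.\<close>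
    define Y where "Y = 16 * A ^ (CARD('n) + 2) * (real d * (Z + C * V))"
    obtain N :: nat where N: "max 1 (Y / \<sigma>) < real N" using reals_Archimedean2 by blast
    have N1: "1 < real N" and NY: "Y \<le> \<sigma> * real N" using N \<sigma>0 by (auto simp: field_simps)
    \<comment> \<open>The bound \<open>1 / N\<close> limits the loss over \<open>N\<close> scales;
      \<open>1 / 2\<close> is for \<open>powr_small_ge\<close>.\<close>
    define \<alpha>\<^sub>1 where "\<alpha>\<^sub>1 = min (1 / 2) (1 / real N)"
    \<comment> \<open>For \<open>\<tau> \<le> 1\<close> the quantity
      \<open>\<tau> powr (1 / (1 - \<alpha>))\<close> is at most \<open>\<tau>\<close>, so the other
      three bounds pass on to it.\<close>
    define \<tau>\<^sub>1 where "\<tau>\<^sub>1 = min (min 1 (l / 2 ^ N)) (min \<eta>\<^sub>0 \<eta>\<^sub>1)"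
    show "\<exists>\<alpha>\<^sub>1 \<tau>\<^sub>1. 0 < \<alpha>\<^sub>1 \<and> \<alpha>\<^sub>1 < 1 \<and> 0 < \<tau>\<^sub>1 \<and>
    (\<forall>\<alpha> \<tau> L. \<forall>E :: (real ^ 'n::finite) set. \<forall>z.
       0 \<le> \<alpha> \<and> \<alpha> < \<alpha>\<^sub>1 \<and> 0 < \<tau> \<and> \<tau> < \<tau>\<^sub>1 \<and> l < L \<and>
       cube_periodic L E \<and> locally_finite_perimeter E \<and>
       (\<forall>j. 0 \<le> z $ j \<and> z $ j < L) \<and>
       Fbar \<alpha> \<tau> E z l < M \<longrightarrow>
       (\<forall>\<eta>. 0 < \<eta> \<and> \<eta> < \<eta>\<^sub>0 \<longrightarrow> stripe_dist \<eta> E (cube z l) \<le> \<delta>))"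
    proof (rule exI[of _ \<alpha>\<^sub>1], rule exI[of _ \<tau>\<^sub>1], intro conjI allI impI)
      show "0 < \<alpha>\<^sub>1" "\<alpha>\<^sub>1 < 1" "0 < \<tau>\<^sub>1" using N1 l \<eta>0 \<eta>1 by (auto simp: \<alpha>\<^sub>1_def \<tau>\<^sub>1_def)
      fix \<alpha> \<tau> L :: real and E :: "(real ^ 'n) set" and z :: "real ^ 'n" and \<eta> :: real
      assume *: "0 \<le> \<alpha> \<and> \<alpha> < \<alpha>\<^sub>1 \<and> 0 < \<tau> \<and> \<tau> < \<tau>\<^sub>1 \<and> l < L \<and>
       cube_periodic L E \<and> locally_finite_perimeter E \<and>
       (\<forall>j. 0 \<le> z $ j \<and> z $ j < L) \<and>
       Fbar \<alpha> \<tau> E z l < M" and eta: "0 < \<eta> \<and> \<eta> < \<eta>\<^sub>0"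
      have "\<alpha> < 1 / 2" "\<alpha> < 1 / real N" using * by (auto simp: \<alpha>\<^sub>1_def)
      then have \<alpha>: "0 \<le> \<alpha>" "\<alpha> \<le> 1 / 2" "\<alpha> < 1" "\<alpha> * real N \<le> 1"
        using * N1 by (simp_all add: field_simps)
      have \<tau>: "0 < \<tau>" "\<tau> \<le> 1" "\<tau> \<le> l / 2 ^ N" "\<tau> \<le> \<eta>\<^sub>0" "\<tau> \<le> \<eta>\<^sub>1" using * by (auto simp: \<tau>\<^sub>1_def)
      have "1 \<le> 1 / (1 - \<alpha>)" using \<alpha> by (simp add: field_simps)
      then have "\<tau> powr (1 / (1 - \<alpha>)) \<le> \<tau> powr 1" using \<tau> by (intro powr_mono') auto
      then have eps: "\<tau> powr (1 / (1 - \<alpha>)) \<le> l / 2 ^ N" "\<tau> powr (1 / (1 - \<alpha>)) \<le> \<eta>\<^sub>0" "\<tau> powr (1 / (1 - \<alpha>)) \<le> \<eta>\<^sub>1"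
        using \<tau> by auto
      have EL: "E \<in> sets lebesgue" using * by (auto simp: locally_finite_perimeter_def gauss_green_def)
      obtain B N0 where BN: "B \<in> sets borel" "negligible N0" "B \<union> N0 = E"
        by (rule sets_lebesgue_almost_borel[OF EL])
      have EB: "AE x in lborel. x \<in> E \<longleftrightarrow> x \<in> B"
      proof -
        have "AE x in lborel. x \<notin> N0"
          using AE_not_in[OF BN(2)[unfolded negligible_iff_null_sets]] by (simp only: AE_completion_iff)
        then show ?thesis by eventually_elim (use BN(3) in auto)
      qed
      have per: "cube_periodic L E" "locally_finite_perimeter E" "0 < L" using * l by auto
      interpret perimeter_energy \<alpha> \<tau> L E B
        by unfold_locales (fact per \<alpha> \<tau> BN(1) EB)+
      define I where "I i = (LINT t|perp_borel i. indicator (perp_cube i z l) t * slice_sum_borel i z l t)" for i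
      define w where "w i = 1 / real d * enn2real (\<integral>\<^sup>+x\<in>cube z l. cross_energy i \<alpha> \<tau> B x \<partial>lborel)" for i
      have w0: "0 \<le> w i" for i by (simp add: w_def)
      have F: "Fbar \<alpha> \<tau> E z l * l ^ d = (\<Sum>i\<in>UNIV. I i + w i)"
        unfolding Fbar_def Fbar_dir_def integral_slice_sum[OF l] integral_w_term I_def[symmetric] d_def[symmetric] w_def[symmetric]
        using l by (simp add: sum_distrib_right)
      have one: "1 \<le> c * h powr (- (1 - \<alpha>))" if "0 < h" "h \<le> 2 * \<eta>\<^sub>1" for h
        by (rule powr_small_ge[OF c0 _ _ _ \<alpha>(1,2)]) (use that in \<open>auto simp: \<eta>\<^sub>1_def\<close>)
      have K1: "K + 1 \<le> c * h powr (- (1 - \<alpha>))" if "0 < h" "h \<le> 2 * \<eta>\<^sub>0" for h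
        by (rule powr_small_ge[OF c0 _ _ _ \<alpha>(1,2)]) (use that K0 in \<open>auto simp: \<eta>\<^sub>0_def\<close>)
      have lower: "- C \<le> slice_sum i z l t" if "good i t" "t \<in> perp_cube i z l" for i t
        unfolding C_def by (rule slice_sum_lower(1)[OF that l \<eta>1 one[unfolded c_def] eps(3)])
      have Ilow: "- (C * V) \<le> I i" for i
      proof -
        note [measurable] = perp_cube_in_sets[OF l, of i z]
        have sp: "perp_cube i z l \<inter> space (perp_borel i) = perp_cube i z l"
          using sets.sets_into_space[OF perp_cube_in_sets[OF l, of i z]] by auto
        have "(LINT t|perp_borel i. - C * indicat_real (perp_cube i z l) t) \<le> I i"
          unfolding I_def
        proof (rule integral_mono_AE)
          show "integrable (perp_borel i) (\<lambda>t. - C * indicat_real (perp_cube i z l) t)"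
            by (intro integrable_mult_right) (simp add: integrable_indicator_iff emeasure_perp_cube[OF l] sp)
          show "AE t in perp_borel i. - C * indicat_real (perp_cube i z l) t \<le> indicat_real (perp_cube i z l) t * slice_sum_borel i z l t"
            using AE_good[of i]
          proof eventually_elim
            case (elim t)
            then show ?case using lower[OF elim] slice_sum_eq_borel[OF elim, of z l] by (auto simp: indicator_def)
          qed
        qed (rule integrable_slice_sum[OF l])
        moreover have "l ^ (CARD('n) - Suc 0) = V" by (simp add: V_def d_def)
        ultimately show ?thesis using V0 by (simp add: sp measure_def emeasure_perp_cube[OF l])
      qed
      have Iw: "I i + w i \<le> Z" for i
      proof -
        have "(\<Sum>j\<in>UNIV. I j + w j) = (I i + w i) + (\<Sum>j\<in>UNIV - {i}. I j + w j)" by (rule sum.remove) auto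
        moreover have "(\<Sum>j\<in>UNIV - {i}. - (C * V)) \<le> (\<Sum>j\<in>UNIV - {i}. I j + w j)"
          using Ilow w0 by (intro sum_mono) (simp add: add_increasing2)
        moreover have "real (card (UNIV - {i})) * (C * V) \<le> real d * (C * V)"
          using C0 V0 by (intro mult_right_mono) (auto simp: d_def intro!: card_mono)
        moreover have "Fbar \<alpha> \<tau> E z l * l ^ d \<le> M * l ^ d" using * l by (intro mult_right_mono) auto
        ultimately show ?thesis using F by (simp add: Z_def mult.assoc)
      qed
      \<comment> \<open>The bound on the share of a direction becomes one on its cross terms alone,
        because the slice part \<open>I i\<close> cannot fall below
        \<open>- (C * V)\<close>.\<close>
      have cross: "(\<integral>\<^sup>+x\<in>cube z l. (\<integral>\<^sup>+\<zeta>. ennreal (f_cross i B x \<zeta> * kernel \<alpha> \<tau> \<zeta>) \<partial>lborel) \<partial>lborel) \<le> ennreal (real d * (Z + C * V))" for i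
      proof -
        have "w i \<le> Z + C * V" using Iw[of i] Ilow[of i] by linarith
        then have "enn2real (\<integral>\<^sup>+x\<in>cube z l. cross_energy i \<alpha> \<tau> B x \<partial>lborel) \<le> real d * (Z + C * V)"
          unfolding w_def using d1 by (simp add: field_simps)
        then have "ennreal (enn2real (\<integral>\<^sup>+x\<in>cube z l. cross_energy i \<alpha> \<tau> B x \<partial>lborel)) \<le> ennreal (real d * (Z + C * V))"
          by (rule ennreal_leI)
        then show ?thesis using cross_total_finite[OF l, of i z] unfolding cross_energy_def by simp
      qed
      have mixed: "mixed_total i B (cube z l) \<le> ennreal \<sigma>" for i
      proof -
        have "ennreal (real N) * mixed_total i B (cube z l) \<le> ennreal (16 * A ^ (CARD('n) + 2)) * ennreal (real d * (Z + C * V))"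
          using mixed_total_log_bound[OF BN(1) \<alpha>(1,3) \<tau>(1) l eps(1) \<alpha>(4), of i z, folded A_def] cross[of i]
          by (meson mult_left_mono order_trans zero_le)
        also have "\<dots> = ennreal Y" using A1 d1 Z0 C0 V0 by (simp add: Y_def ennreal_mult)
        also have "\<dots> \<le> ennreal (real N * \<sigma>)" using NY by (intro ennreal_leI) (simp add: mult.commute)
        also have "\<dots> = ennreal (real N) * ennreal \<sigma>" using \<sigma>0 by (simp add: ennreal_mult)
        finally show ?thesis using N1 by (subst (asm) ennreal_mult_le_mult_iff) auto
      qed
      obtain i where i: "osc (- {i}) B z l \<le> ennreal (real CARD('n) * (sqrt (3 * \<sigma>) * l ^ CARD('n)))"
        using almost_one_dimensional[OF BN(1) l less_imp_le[OF \<sigma>0] mixed] by blast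
      have "sqrt (3 * \<sigma>) = s" using s0 by (simp add: \<sigma>_def)
      then have "real CARD('n) * (sqrt (3 * \<sigma>) * l ^ CARD('n)) = l * (\<delta> * l ^ d * V / 4)"
        using d1 by (simp add: s_def lV[unfolded d_def] d_def[symmetric] lV)
      with i have "ennreal l * (\<integral>\<^sup>+t\<in>perp_cube i z l. slice_dist i B z l t \<partial>perp_borel i) \<le> ennreal l * ennreal (\<delta> * l ^ d * V / 4)"
        unfolding osc_eq_slice_dist[OF BN(1) l] using l \<delta> V0 by (simp add: ennreal_mult'[symmetric])
      then have D: "(\<integral>\<^sup>+t\<in>perp_cube i z l. slice_dist i B z l t \<partial>perp_borel i) \<le> ennreal (\<delta> * l ^ d * l ^ (CARD('n) - 1) / 4)"
        using l by (subst (asm) ennreal_mult_le_mult_iff) (auto simp: V_def d_def)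
      have T: "(LINT t|perp_borel i. indicator (perp_cube i z l) t * slice_sum_borel i z l t) + C * l ^ (CARD('n) - 1) \<le> K * l ^ (CARD('n) - 1) / 4"
      proof -
        have "I i \<le> Z" using Iw[of i] w0[of i] by linarith
        then have "I i + C * V \<le> K * V / 4" using V0 by (simp add: K_def)
        then show ?thesis by (simp add: I_def V_def d_def)
      qed
      have \<theta>: "0 < \<delta> * l ^ d" using \<delta> l by simp
      obtain t where t: "good i t" "t \<in> perp_cube i z l" "slice_sum i z l t + C < K" "slice_dist i B z l t \<le> ennreal (\<delta> * l ^ d)"
        using ex_good_slice[OF l K0 \<theta> lower T D] by blast
      have "stripe_dist \<eta> E (cube z l) \<le> enn2real (slice_dist i B z l t) / l ^ CARD('n)"
      proof (rule stripe_dist_le_slice_dist[OF l _ t(1,2)])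
        show "0 < \<eta>" using eta by simp
        fix s s' assume ss: "s \<in> crossings i z l t" "s' \<in> crossings i z l t" "s < s'"
        \<comment> \<open>Two crossings closer than \<open>\<eta>\<^sub>0\<close> would raise the
          energy of the selected slice to at least \<open>K - C\<close>.\<close>
        show "\<eta> \<le> s' - s"
        proof (rule ccontr)
          assume "\<not> \<eta> \<le> s' - s"
          then have small: "s' - s < \<eta>\<^sub>0" using eta by simp
          have "K - C \<le> slice_sum i z l t"
            unfolding C_def
            by (rule slice_sum_lower(2)[OF t(1,2) l \<eta>1 one[unfolded c_def] eps(3) less_imp_le[OF K0] K1[unfolded c_def] eps(2) ss small])
          with t(3) show False by simp
        qed
      qed
      also have "\<dots> \<le> (\<delta> * l ^ d) / l ^ CARD('n)"
        using t(4) \<theta> l by (intro divide_right_mono) (auto simp: enn2real_leI)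
      also have "\<dots> = \<delta>" using l by (simp add: d_def)
      finally show "stripe_dist \<eta> E (cube z l) \<le> \<delta>" .
    qed
  qed
qed

end
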